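(* Let $B$ be a standard Brownian motion on $[0,1]$ with $B(0)=0$, let $h=\max_{0\le u\le1}B(u)$, let $\theta$ be the smallest $u$ with $B(u)=h$, and let $c=B(1)$; assume $0<\theta<1$, $h>0$ (and $h>c$ where $c$ is given). Let $M_1$, $Vr$, $G_{11}$ be as defined in the context. For $\theta<t\le1$, with $s=\frac{t-\theta}{1-\theta}$, $$E[B(t)\mid\theta,h]=h-\sqrt{1-\theta}\int_0^\infty x\,M_1(s,x)\,e^{-x^2/2}\,dx=h-\sqrt{1-\theta}\,G_{11}(s).$$ Thus $E[B(t)\mid\theta,h]-h$ is independent of $h$ for $t\ge\theta$. For $0\le t\le\theta$, $E[B(t)\mid c,\theta,h]$ is independent of $c$ and $$E[B(t)\mid\theta,h]=E[B(t)\mid c,\theta,h]=h-\sqrt\theta\,M_1\Big(1-\frac t\theta,\frac h{\sqrt\theta}\Big)$$ $$=h-\sqrt\theta\Big[\frac{t}{h\sqrt\theta}+\frac{h(\theta-t)}{\theta^{3/2}}\Big]\mathrm{erf}\Big(\frac{h\sqrt{\theta-t}}{\sqrt{2t\theta}}\Big)-\frac{\sqrt{2t(\theta-t)}}{\sqrt{\pi\theta}}\exp\Big(-\frac{(\theta-t)h^2}{2t\theta}\Big).$$ For $0\le t\le\theta$ the conditional variance is independent of the final value $c$ and is given by $$\mathrm{Var}[B(t)\mid\theta,h]=\theta\,Vr\Big(1-\frac t\theta,\frac h{\sqrt\theta}\Big).$$ For $\theta\le t\le1$, with $s=\frac{t-\theta}{1-\theta}$, $$\mathrm{Var}[B(t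)\mid\theta,h]=(1-\theta)\,[3s-s^2]-(1-\theta)\,G_{11}(s)^2.$$
   Context: For $0\le s\le1$ and $y>0$ define $$M_1(s,y)=\frac1y\big[1-s+sy^2\big]\,\mathrm{erf}\Big(\frac{y\sqrt s}{\sqrt{2(1-s)}}\Big)+\sqrt{\frac{2s(1-s)}{\pi}}\exp\Big(-\frac{sy^2}{2(1-s)}\Big),$$ $$Vr(s,y)=3s(1-s)+y^2s^2-M_1(s,y)^2,$$ $$G_{11}(s)=\sqrt{\frac2\pi}\Big[\tan^{-1}\Big(\sqrt{\frac{s}{1-s}}\Big)+\sqrt{s(1-s)}\Big],$$ where expressions singular at an endpoint are read as their limits ($M_1(1,y)=y$, $G_{11}(1)=\sqrt{\pi/2}$; likewise the explicit formula at $t=0$). Here $\mathrm{erf}(z)=\frac2{\sqrt\pi}\int_0^ze^{-u^2}du$. The letters $c,\theta,h$ denote both the random variables $B(1)$, first argmax and maximum of $B$ on $[0,1]$, and their values. Conditional expectations and variances given $(\theta,h)$ or $(c,\theta,h)$ are with respect to the regular conditional distributions given those values, the formulas giving a version (valid for Lebesgue-almost every value of the conditioning variables). *)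

theory Defs
  imports "HOL-Probability.Probability" "HOL-Real_Asymp.Real_Asymp"
begin

section \<open>The special functions\<close>

definition erf :: "real \<Rightarrow> real" where
  "erf z = 2 / sqrt pi * (LBINT u=ereal 0..ereal z. exp (- u\<^sup>2))"

text \<open>The formulas for \<open>M1\<close>, \<open>G11\<close> and \<open>pre_max_mean\<close> contain a division by zero at an endpoint
  of their range, where the limiting value is meant. That the values chosen are the limits is
  proved in \<open>M1_tendsto\<close>, \<open>G11_tendsto\<close> and \<open>pre_max_mean_tendsto\<close> below.\<close>

definition M1 :: "real \<Rightarrow> real \<Rightarrow> real" where
  "M1 s y = (if s = 1 then y else
     1 / y * (1 - s + s * y\<^sup>2) * erf (y * sqrt s / sqrt (2 * (1 - s)))
     + sqrt (2 * s * (1 - s) / pi) * exp (- (s * y\<^sup>2 / (2 * (1 - s)))))"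

definition Vr :: "real \<Rightarrow> real \<Rightarrow> real" where
  "Vr s y = 3 * s * (1 - s) + y\<^sup>2 * s\<^sup>2 - (M1 s y)\<^sup>2"

definition G11 :: "real \<Rightarrow> real" where
  "G11 s = (if s = 1 then sqrt (pi / 2) else
     sqrt (2 / pi) * (arctan (sqrt (s / (1 - s))) + sqrt (s * (1 - s))))"

definition pre_max_mean :: "real \<Rightarrow> real \<Rightarrow> real \<Rightarrow> real" where
  "pre_max_mean \<theta> h t = (if t = 0 then 0 else
     h - sqrt \<theta> * (t / (h * sqrt \<theta>) + h * (\<theta> - t) / \<theta> powr (3 / 2))
           * erf (h * sqrt (\<theta> - t) / sqrt (2 * t * \<theta>))
       - sqrt (2 * t * (\<theta> - t)) / sqrt (pi * \<theta>) * exp (- ((\<theta> - t) * h\<^sup>2 / (2 * t * \<theta>))))"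

lemma erf_at_top: "(erf \<longlongrightarrow> 1) at_top"
proof -
  have i: "integrable lborel (\<lambda>x::real. indicator {0..} x *\<^sub>R exp (- x\<^sup>2))"
    and v: "(LBINT x:{0..}. exp (- x\<^sup>2)) = sqrt pi / 2"
    using gaussian_moment_0 unfolding has_bochner_integral_iff set_lebesgue_integral_def by auto
  have "((\<lambda>z. LBINT x:{0..z}. exp (- x\<^sup>2)) \<longlongrightarrow> (LBINT x:{0..}. exp (- (x::real)\<^sup>2))) at_top"
    by (rule tendsto_set_lebesgue_integral_at_top)
       (use i in \<open>auto simp: set_integrable_def\<close>)
  then have "((\<lambda>z. 2 / sqrt pi * (LBINT x:{0..z}. exp (- x\<^sup>2))) \<longlongrightarrow> 2 / sqrt pi * (sqrt pi / 2)) at_top"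
    unfolding v by (intro tendsto_intros)
  moreover have "\<forall>\<^sub>F z in at_top. 2 / sqrt pi * (LBINT x:{0..z}. exp (- x\<^sup>2)) = erf z"
    using eventually_ge_at_top[of 0] by eventually_elim (simp add: erf_def interval_integral_Icc)
  ultimately show ?thesis
    by (auto intro: Lim_transform_eventually)
qed

lemma tendsto_mult_exp_zero:
  fixes a b :: "real \<Rightarrow> real"
  assumes a: "(a \<longlongrightarrow> 0) F" and ev: "\<forall>\<^sub>F x in F. 0 \<le> a x \<and> 0 \<le> b x"
  shows "((\<lambda>x. a x * exp (- b x)) \<longlongrightarrow> 0) F"
proof (rule Lim_null_comparison[OF _ a])
  show "\<forall>\<^sub>F x in F. norm (a x * exp (- b x)) \<le> a x"
    using ev by eventually_elim (simp add: abs_mult mult_left_le)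
qed

lemma M1_tendsto:
  assumes "y > 0" shows "((\<lambda>s. M1 s y) \<longlongrightarrow> M1 1 y) (at_left 1)"
proof -
  have ev: "\<forall>\<^sub>F s::real in at_left 1. s \<in> {0<..<1}"
    by (rule eventually_at_left_real) simp
  have "((\<lambda>s. y * sqrt s) \<longlongrightarrow> y * sqrt 1) (at_left 1)"
    by (intro tendsto_intros)
  moreover have "0 < y * sqrt 1"
    using assms by simp
  moreover have "filterlim (\<lambda>s::real. inverse (sqrt (2 * (1 - s)))) at_top (at_left 1)"
    by real_asymp
  ultimately have "filterlim (\<lambda>s. y * sqrt s * inverse (sqrt (2 * (1 - s)))) at_top (at_left 1)"
    by (rule filterlim_tendsto_pos_mult_at_top)
  then have f: "filterlim (\<lambda>s. y * sqrt s / sqrt (2 * (1 - s))) at_top (at_left 1)"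
    unfolding divide_inverse .
  have e: "((\<lambda>s. erf (y * sqrt s / sqrt (2 * (1 - s)))) \<longlongrightarrow> 1) (at_left 1)"
    using filterlim_compose[OF erf_at_top f] .
  have a: "((\<lambda>s. 1 / y * (1 - s + s * y\<^sup>2)) \<longlongrightarrow> 1 / y * (1 - 1 + 1 * y\<^sup>2)) (at_left 1)"
    by (intro tendsto_intros)
  have y: "1 / y * (1 - 1 + 1 * y\<^sup>2) * 1 + 0 = M1 1 y"
    using assms by (simp add: M1_def power2_eq_square)
  have b: "((\<lambda>s. sqrt (2 * s * (1 - s) / pi) * exp (- (s * y\<^sup>2 / (2 * (1 - s))))) \<longlongrightarrow> 0) (at_left 1)"
  proof (rule tendsto_mult_exp_zero)
    have "((\<lambda>s. sqrt (2 * s * (1 - s) / pi)) \<longlongrightarrow> sqrt (2 * 1 * (1 - 1) / pi)) (at_left 1)"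
      by (intro tendsto_intros) simp
    then show "((\<lambda>s. sqrt (2 * s * (1 - s) / pi)) \<longlongrightarrow> 0) (at_left 1)"
      by simp
    show "\<forall>\<^sub>F s in at_left 1. 0 \<le> sqrt (2 * s * (1 - s) / pi) \<and> 0 \<le> s * y\<^sup>2 / (2 * (1 - s))"
      using ev by eventually_elim simp
  qed
  have "\<forall>\<^sub>F s in at_left 1. 1 / y * (1 - s + s * y\<^sup>2) * erf (y * sqrt s / sqrt (2 * (1 - s)))
     + sqrt (2 * s * (1 - s) / pi) * exp (- (s * y\<^sup>2 / (2 * (1 - s)))) = M1 s y"
    using ev by eventually_elim (simp only: M1_def, simp)
  with tendsto_add[OF tendsto_mult[OF a e] b] show ?thesis
    unfolding y by (rule Lim_transform_eventually)
qed

lemma G11_tendsto: "(G11 \<longlongrightarrow> G11 1) (at_left 1)"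
proof -
  have "filterlim (\<lambda>s::real. sqrt (s / (1 - s))) at_top (at_left 1)"
    by real_asymp
  then have "((\<lambda>s. arctan (sqrt (s / (1 - s)))) \<longlongrightarrow> pi / 2) (at_left 1)"
    by (rule filterlim_compose[OF tendsto_arctan_at_top])
  moreover have "((\<lambda>s::real. sqrt (s * (1 - s))) \<longlongrightarrow> sqrt (1 * (1 - 1))) (at_left 1)"
    by (intro tendsto_intros)
  ultimately have "((\<lambda>s. sqrt (2 / pi) * (arctan (sqrt (s / (1 - s))) + sqrt (s * (1 - s))))
          \<longlongrightarrow> sqrt (2 / pi) * (pi / 2 + sqrt (1 * (1 - 1)))) (at_left 1)"
    by (intro tendsto_intros)
  then have "((\<lambda>s. sqrt (2 / pi) * (arctan (sqrt (s / (1 - s))) + sqrt (s * (1 - s))))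
          \<longlongrightarrow> sqrt (2 / pi) * (pi / 2)) (at_left 1)"
    by simp
  moreover have "sqrt (2 / pi) * (pi / 2) = sqrt (pi / 2)"
    by (simp add: real_sqrt_divide field_simps)
  moreover have "\<forall>\<^sub>F s in at_left 1.
      sqrt (2 / pi) * (arctan (sqrt (s / (1 - s))) + sqrt (s * (1 - s))) = G11 s"
    by (auto simp: G11_def eventually_at_filter)
  ultimately show ?thesis
    by (auto intro: Lim_transform_eventually simp: G11_def)
qed

lemma pre_max_mean_tendsto:
  assumes "\<theta> > 0" "h > 0"
  shows "(pre_max_mean \<theta> h \<longlongrightarrow> pre_max_mean \<theta> h 0) (at_right 0)"
proof -
  have f: "filterlim (\<lambda>t. h * sqrt (\<theta> - t) / sqrt (2 * t * \<theta>)) at_top (at_right 0)"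
  proof -
    have "((\<lambda>t. h * sqrt (\<theta> - t) / sqrt (2 * \<theta>)) \<longlongrightarrow> h * sqrt (\<theta> - 0) / sqrt (2 * \<theta>)) (at_right 0)"
      using assms by (intro tendsto_intros) auto
    moreover have "0 < h * sqrt (\<theta> - 0) / sqrt (2 * \<theta>)"
      using assms by simp
    moreover have "filterlim (\<lambda>t::real. inverse (sqrt t)) at_top (at_right 0)"
      by real_asymp
    ultimately have "filterlim (\<lambda>t. h * sqrt (\<theta> - t) / sqrt (2 * \<theta>) * inverse (sqrt t)) at_top (at_right 0)"
      by (rule filterlim_tendsto_pos_mult_at_top)
    moreover have "h * sqrt (\<theta> - t) / sqrt (2 * \<theta>) * inverse (sqrt t)
        = h * sqrt (\<theta> - t) / sqrt (2 * t * \<theta>)" for t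
      by (simp add: real_sqrt_mult divide_inverse)
    ultimately show ?thesis
      by simp
  qed
  have e: "((\<lambda>t. erf (h * sqrt (\<theta> - t) / sqrt (2 * t * \<theta>))) \<longlongrightarrow> 1) (at_right 0)"
    using filterlim_compose[OF erf_at_top f] .
  have p: "\<theta> powr (3 / 2) = \<theta> * sqrt \<theta>"
    using assms powr_add[of \<theta> 1 "1/2"] by (simp add: powr_half_sqrt)
  have a: "((\<lambda>t. sqrt \<theta> * (t / (h * sqrt \<theta>) + h * (\<theta> - t) / \<theta> powr (3 / 2)))
      \<longlongrightarrow> sqrt \<theta> * (0 / (h * sqrt \<theta>) + h * (\<theta> - 0) / \<theta> powr (3 / 2))) (at_right 0)"
    using assms by (intro tendsto_intros) auto
  have z: "h - sqrt \<theta> * (0 / (h * sqrt \<theta>) + h * (\<theta> - 0) / \<theta> powr (3 / 2)) * 1 - 0 = pre_max_mean \<theta> h 0"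
    using assms by (simp add: pre_max_mean_def p)
  have b: "((\<lambda>t. sqrt (2 * t * (\<theta> - t)) / sqrt (pi * \<theta>) * exp (- ((\<theta> - t) * h\<^sup>2 / (2 * t * \<theta>)))) \<longlongrightarrow> 0) (at_right 0)"
  proof (rule tendsto_mult_exp_zero)
    have "((\<lambda>t. sqrt (2 * t * (\<theta> - t)) / sqrt (pi * \<theta>))
        \<longlongrightarrow> sqrt (2 * 0 * (\<theta> - 0)) / sqrt (pi * \<theta>)) (at_right 0)"
      using assms by (intro tendsto_intros) auto
    then show "((\<lambda>t. sqrt (2 * t * (\<theta> - t)) / sqrt (pi * \<theta>)) \<longlongrightarrow> 0) (at_right 0)"
      by simp
    have "\<forall>\<^sub>F t in at_right 0. t \<in> {0<..<\<theta>}"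
      using assms by (intro eventually_at_right_real)
    then show "\<forall>\<^sub>F t in at_right 0. 0 \<le> sqrt (2 * t * (\<theta> - t)) / sqrt (pi * \<theta>)
        \<and> 0 \<le> (\<theta> - t) * h\<^sup>2 / (2 * t * \<theta>)"
    proof eventually_elim
      case (elim t)
      then have "0 \<le> t" "0 \<le> \<theta> - t" "0 \<le> \<theta>"
        by auto
      then show ?case
        by (intro conjI divide_nonneg_nonneg mult_nonneg_nonneg real_sqrt_ge_zero) auto
    qed
  qed
  have "\<forall>\<^sub>F t in at_right 0. h - sqrt \<theta> * (t / (h * sqrt \<theta>) + h * (\<theta> - t) / \<theta> powr (3 / 2))
           * erf (h * sqrt (\<theta> - t) / sqrt (2 * t * \<theta>))
       - sqrt (2 * t * (\<theta> - t)) / sqrt (pi * \<theta>) * exp (- ((\<theta> - t) * h\<^sup>2 / (2 * t * \<theta>)))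
     = pre_max_mean \<theta> h t"
    using eventually_at_right_less[of 0] by eventually_elim (simp only: pre_max_mean_def, simp)
  with tendsto_diff[OF tendsto_diff[OF tendsto_const[of h] tendsto_mult[OF a e]] b] show ?thesis
    unfolding z by (rule Lim_transform_eventually)
qed

section \<open>Brownian motion, its maximum and first argmax\<close>

definition std_brownian_motion :: "'a measure \<Rightarrow> (real \<Rightarrow> 'a \<Rightarrow> real) \<Rightarrow> bool" where
  "std_brownian_motion M B \<longleftrightarrow>
     prob_space M \<and>
     (\<forall>t\<in>{0..1}. B t \<in> borel_measurable M) \<and>
     (\<forall>\<omega>\<in>space M. B 0 \<omega> = 0) \<and>
     (\<forall>\<omega>\<in>space M. continuous_on {0..1} (\<lambda>t. B t \<omega>)) \<and>
     (\<forall>s t. 0 \<le> s \<and> s < t \<and> t \<le> 1 \<longrightarrow>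
        distributed M lborel (\<lambda>\<omega>. B t \<omega> - B s \<omega>) (\<lambda>x. ennreal (normal_density 0 (sqrt (t - s)) x))) \<and>
     (\<forall>(n::nat) (\<tau>::nat \<Rightarrow> real).
        0 \<le> \<tau> 0 \<and> (\<forall>i<n. \<tau> i \<le> \<tau> (Suc i)) \<and> \<tau> n \<le> 1 \<longrightarrow>
        prob_space.indep_vars M (\<lambda>_. borel) (\<lambda>i \<omega>. B (\<tau> (Suc i)) \<omega> - B (\<tau> i) \<omega>) {..<n})"

definition path_max :: "(real \<Rightarrow> real) \<Rightarrow> real" where
  "path_max f = (SUP u\<in>{0..1}. f u)"

definition first_argmax :: "(real \<Rightarrow> real) \<Rightarrow> real" where
  "first_argmax f = (LEAST u. u \<in> {0..1} \<and> f u = path_max f)"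

definition sample_path :: "(real \<Rightarrow> 'a \<Rightarrow> real) \<Rightarrow> 'a \<Rightarrow> real \<Rightarrow> real" where
  "sample_path B \<omega> = (\<lambda>u\<in>{0..1}. B u \<omega>)"

section \<open>Regular conditional distributions\<close>

text \<open>\<open>C[0,1]\<close> with the sigma-algebra generated by the evaluations, which is its Borel
  sigma-algebra for the uniform norm. As usual for product spaces, its elements are the functions
  that are \<open>undefined\<close> outside \<open>{0..1}\<close>. Only the underlying measurable space is used.\<close>

definition path_space :: "(real \<Rightarrow> real) measure" where
  "path_space = restrict_space (\<Pi>\<^sub>M t\<in>{0..1}. borel) {f. continuous_on {0..1} f}"

text \<open>\<open>\<kappa>\<close> is a regular conditional distribution of \<open>Y\<close> given \<open>X\<close>: a probability kernel with
  \<open>P(X \<in> A, Y \<in> C) = E[\<kappa>(X, C); X \<in> A]\<close>.\<close>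

definition regular_cond_distr ::
  "'a measure \<Rightarrow> 'b measure \<Rightarrow> ('a \<Rightarrow> 'b) \<Rightarrow> 'c measure \<Rightarrow> ('a \<Rightarrow> 'c) \<Rightarrow> ('b \<Rightarrow> 'c measure) \<Rightarrow> bool" where
  "regular_cond_distr M S X T Y \<kappa> \<longleftrightarrow>
     \<kappa> \<in> S \<rightarrow>\<^sub>M prob_algebra T \<and>
     (\<forall>A\<in>sets S. \<forall>C\<in>sets T.
        emeasure M {\<omega>\<in>space M. X \<omega> \<in> A \<and> Y \<omega> \<in> C}
        = (\<integral>\<^sup>+\<omega>. emeasure (\<kappa> (X \<omega>)) C * indicator A (X \<omega>) \<partial>M))"

definition cond_mean :: "('b \<Rightarrow> (real \<Rightarrow> real) measure) \<Rightarrow> 'b \<Rightarrow> real \<Rightarrow> real" where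
  "cond_mean \<kappa> v t = (\<integral>f. f t \<partial>\<kappa> v)"

definition cond_var :: "('b \<Rightarrow> (real \<Rightarrow> real) measure) \<Rightarrow> 'b \<Rightarrow> real \<Rightarrow> real" where
  "cond_var \<kappa> v t = prob_space.variance (\<kappa> v) (\<lambda>f. f t)"

definition cond_square_integrable :: "('b \<Rightarrow> (real \<Rightarrow> real) measure) \<Rightarrow> 'b \<Rightarrow> real \<Rightarrow> bool" where
  "cond_square_integrable \<kappa> v t \<longleftrightarrow>
     integrable (\<kappa> v) (\<lambda>f. f t) \<and> integrable (\<kappa> v) (\<lambda>f. (f t)\<^sup>2)"

end

theory Submission
  imports Defs
begin

text \<open>The reflection principle gives the joint density of the maximum and its distance to the
  endpoint. By independence of past and future, both the joint law of argmax, maximum and endpoint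
  and its refinement by \<open>B(t)\<close> follow from splitting the path: at time \<open>t\<close>, the argmax lies on the
  side on which the maximum is larger. For \<open>t < \<theta>\<close> the conditional law of \<open>h - B(t)\<close> is that of a
  three-dimensional Bessel bridge, with a density that does not involve \<open>c\<close>; for \<open>t > \<theta>\<close> it is that
  of a Brownian meander of length \<open>1 - \<theta>\<close> at time \<open>t - \<theta>\<close>, with a density that does not involve
  \<open>h\<close>. The moments are Gaussian and error function integrals. The formulas hold for all rational \<open>t\<close>
  outside one null set, and both sides are continuous in \<open>t\<close>, by dominated convergence with
  \<open>max B\<^sup>2 + min B\<^sup>2\<close> as bound.\<close>

section \<open>Integrals of derivatives\<close>

text \<open>Every law is an identity of nonnegative integrals against an arbitrary measurable test
  function, so all exchanges of integrals are free and no moment has to be finite in advance. The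
  endpoint enters as \<open>x = h - c\<close>: in \<open>h\<close> and \<open>x\<close> the density
  \<open>maxd\<close> is symmetric, and \<open>argd\<close> splits at \<open>\<theta>\<close> into a
  factor in \<open>h\<close> and a factor in \<open>x\<close>. This product form is why the endpoint
  drops out before the maximum and the height after it. The obstacle is that \<open>\<theta>\<close>
  is not a stopping time, so the path cannot be restarted there. Only deterministic times are used
  for splitting: \<open>u\<close> to find the law of the argmax, \<open>t\<close> to add
  \<open>B(t)\<close>; what remains are convolutions of Gaussian densities with their mirror images.
  The reflection principle does need a stopping time, and takes the first passage on a dyadic grid,
  which has finitely many values, so that independence of increments replaces the strong Markov
  property. A given kernel is tied to these laws only by its integrals over Borel sets of
  conditioning values; comparing those with the densities determines its moments almost
  everywhere.\<close>

lemma nn_integral_FTC_einterval: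
  fixes f F :: "real \<Rightarrow> real" and a b :: ereal
  assumes "a < b"
    and F: "\<And>x. a < ereal x \<Longrightarrow> ereal x < b \<Longrightarrow> (F has_real_derivative f x) (at x)"
    and f: "\<And>x. a < ereal x \<Longrightarrow> ereal x < b \<Longrightarrow> isCont f x"
    and nn: "\<And>x. a < ereal x \<Longrightarrow> ereal x < b \<Longrightarrow> 0 \<le> f x"
    and A: "((F \<circ> real_of_ereal) \<longlongrightarrow> A) (at_right a)"
    and B: "((F \<circ> real_of_ereal) \<longlongrightarrow> B) (at_left b)"
  shows "(\<integral>\<^sup>+x. ennreal (f x) * indicator (einterval a b) x \<partial>lborel) = ennreal (B - A)"
proof -
  have nn': "AE x in lborel. a < ereal x \<longrightarrow> ereal x < b \<longrightarrow> 0 \<le> f x"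
    using nn by simp
  note ftc = interval_integral_FTC_nonneg[OF \<open>a < b\<close> F f nn' A B]
  have "(\<integral>\<^sup>+x. ennreal (f x) * indicator (einterval a b) x \<partial>lborel)
      = (\<integral>\<^sup>+x. ennreal (indicator (einterval a b) x *\<^sub>R f x) \<partial>lborel)"
    by (intro nn_integral_cong) (auto split: split_indicator)
  also have "\<dots> = ennreal (LINT x|lborel. indicator (einterval a b) x *\<^sub>R f x)"
    using ftc(1) nn unfolding set_integrable_def
    by (intro nn_integral_eq_integral) (auto split: split_indicator simp: einterval_def)
  also have "(LINT x|lborel. indicator (einterval a b) x *\<^sub>R f x) = B - A"
    using ftc(2) \<open>a < b\<close>
    unfolding interval_lebesgue_integral_def set_lebesgue_integral_def
    by (simp split: if_splits)
  finally show ?thesis .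
qed

lemma nn_integral_FTC_Ioo:
  fixes f F :: "real \<Rightarrow> real" and a b :: real
  assumes "a < b"
    and F: "\<And>x. a < x \<Longrightarrow> x < b \<Longrightarrow> (F has_real_derivative f x) (at x)"
    and f: "\<And>x. a < x \<Longrightarrow> x < b \<Longrightarrow> isCont f x"
    and nn: "\<And>x. a < x \<Longrightarrow> x < b \<Longrightarrow> 0 \<le> f x"
    and A: "(F \<longlongrightarrow> A) (at_right a)"
    and B: "(F \<longlongrightarrow> B) (at_left b)"
  shows "(\<integral>\<^sup>+x. ennreal (f x) * indicator {a<..<b} x \<partial>lborel) = ennreal (B - A)"
  using nn_integral_FTC_einterval[of "ereal a" "ereal b" F f A B] assms
  by (simp add: ereal_tendsto_simps)

lemma nn_integral_FTC_Ioi: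
  fixes f F :: "real \<Rightarrow> real" and a :: real
  assumes F: "\<And>x. a < x \<Longrightarrow> (F has_real_derivative f x) (at x)"
    and f: "\<And>x. a < x \<Longrightarrow> isCont f x"
    and nn: "\<And>x. a < x \<Longrightarrow> 0 \<le> f x"
    and A: "(F \<longlongrightarrow> A) (at_right a)"
    and B: "(F \<longlongrightarrow> B) at_top"
  shows "(\<integral>\<^sup>+x. ennreal (f x) * indicator {a<..} x \<partial>lborel) = ennreal (B - A)"
  using nn_integral_FTC_einterval[of "ereal a" \<infinity> F f A B] assms
  by (simp add: ereal_tendsto_simps)

lemma DERIV_tendsto_at_right:
  "(F has_real_derivative D) (at a) \<Longrightarrow> (F \<longlongrightarrow> F a) (at_right a)"
  using DERIV_isCont[of F D a] by (auto simp: isCont_def intro: tendsto_within_subset[OF _ subset_UNIV])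

lemma DERIV_tendsto_at_left:
  "(F has_real_derivative D) (at a) \<Longrightarrow> (F \<longlongrightarrow> F a) (at_left a)"
  using DERIV_isCont[of F D a] by (auto simp: isCont_def intro: tendsto_within_subset[OF _ subset_UNIV])

section \<open>The error function and Gaussian integrals\<close>

lemma erf_0 [simp]: "erf 0 = 0"
  unfolding erf_def by (simp add: zero_ereal_def[symmetric])

lemma erf_has_real_derivative: "(erf has_real_derivative 2 / sqrt pi * exp (- z\<^sup>2)) (at z)"
proof -
  \<comment> \<open>The bounds put both the base point 0 and \<open>z\<close> strictly inside the
    interval, so the derivative within the interval is a two-sided one.\<close>
  define a where "a = - \<bar>z\<bar> - 1"
  define b where "b = \<bar>z\<bar> + 1"
  have cont: "continuous_on {a..b} (\<lambda>u::real. exp (- u\<^sup>2))"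
    by (intro continuous_intros)
  have "((\<lambda>u. LBINT y=ereal 0..ereal u. exp (- y\<^sup>2)) has_real_derivative exp (- z\<^sup>2)) (at z within {a..b})"
    using interval_integral_FTC2[of a 0 b "\<lambda>u. exp (- u\<^sup>2)" z] cont
    by (auto simp: a_def b_def has_real_derivative_iff_has_vector_derivative)
  moreover have "z \<in> interior {a..b}"
    unfolding interior_atLeastAtMost_real by (auto simp: a_def b_def)
  ultimately have "((\<lambda>u. LBINT y=ereal 0..ereal u. exp (- y\<^sup>2)) has_real_derivative exp (- z\<^sup>2)) (at z)"
    using at_within_interior by metis
  from DERIV_cmult[OF this, of "2 / sqrt pi"] show ?thesis
    unfolding erf_def .
qed

lemmas erf_has_real_derivative' [derivative_intros] =
  DERIV_chain2[OF erf_has_real_derivative]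

lemma isCont_erf: "isCont erf z"
  using erf_has_real_derivative DERIV_isCont by blast

lemma tendsto_erf [tendsto_intros]: "(f \<longlongrightarrow> c) F \<Longrightarrow> ((\<lambda>x. erf (f x)) \<longlongrightarrow> erf c) F"
  using isCont_tendsto_compose[OF isCont_erf] .

lemma continuous_erf [continuous_intros]: "continuous F f \<Longrightarrow> continuous F (\<lambda>x. erf (f x))"
  unfolding continuous_def by (rule tendsto_erf)

lemma continuous_on_erf [continuous_intros]: "continuous_on A f \<Longrightarrow> continuous_on A (\<lambda>x. erf (f x))"
  unfolding continuous_on_def by (auto intro: tendsto_erf)

lemma borel_measurable_erf [measurable]: "erf \<in> borel_measurable borel"
  by (intro borel_measurable_continuous_onI continuous_on_erf continuous_on_id)

lemma erf_minus [simp]: "erf (- z) = - erf z"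
proof -
  have "((\<lambda>z. erf z + erf (- z)) has_real_derivative 0) (at w)" for w
    by (auto intro!: derivative_eq_intros)
  from DERIV_isconst_all[of "\<lambda>z. erf z + erf (- z)" z 0] this show ?thesis by simp
qed

lemma erf_nonneg: "0 \<le> z \<Longrightarrow> 0 \<le> erf z"
proof -
  assume "0 \<le> z"
  have "erf 0 \<le> erf z"
    using \<open>0 \<le> z\<close> erf_has_real_derivative
    by (intro DERIV_nonneg_imp_nondecreasing[of 0 z erf]) (auto intro!: exI)
  then show ?thesis by simp
qed

lemma erf_at_bot: "(erf \<longlongrightarrow> - 1) at_bot"
proof -
  have "((\<lambda>z. - erf (- z)) \<longlongrightarrow> - 1) at_bot"
    by (intro tendsto_minus filterlim_compose[OF erf_at_top] filterlim_uminus_at_top_at_bot)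
  then show ?thesis by simp
qed

text \<open>Parametrised by the variance and not by its root, because \<open>T\<close> is a length
  of time and such lengths add up under convolution.\<close>

definition gauss :: "real \<Rightarrow> real \<Rightarrow> real" where
  "gauss T z = exp (- (z\<^sup>2 / (2 * T))) / sqrt (2 * pi * T)"

lemma gauss_nonneg: "T \<ge> 0 \<Longrightarrow> 0 \<le> gauss T z" by (simp add: gauss_def)

lemma gauss_pos: "T > 0 \<Longrightarrow> 0 < gauss T z" by (simp add: gauss_def)

lemma gauss_minus [simp]: "gauss T (- z) = gauss T z" by (simp add: gauss_def)

lemma gauss_mono: "T > 0 \<Longrightarrow> \<bar>a\<bar> \<le> \<bar>b\<bar> \<Longrightarrow> gauss T b \<le> gauss T a"
  by (auto simp: gauss_def abs_le_square_iff intro!: divide_right_mono)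

lemma normal_density_eq_gauss: "T \<ge> 0 \<Longrightarrow> normal_density m (sqrt T) z = gauss T (z - m)"
  by (simp add: normal_density_def gauss_def)

lemma gauss_has_real_derivative [derivative_intros]:
  assumes "(f has_real_derivative D) (at x within S)" "T > 0"
  shows "((\<lambda>x. gauss T (f x)) has_real_derivative - (f x / T) * gauss T (f x) * D) (at x within S)"
  unfolding gauss_def using assms by (auto intro!: derivative_eq_intros simp: field_simps)

lemma erf_scaled_has_real_derivative:
  assumes "T > 0"
  shows "((\<lambda>x. erf ((x - m) / sqrt (2 * T)) / 2) has_real_derivative gauss T (x - m)) (at x)"
  using assms
  by (auto intro!: derivative_eq_intros simp: gauss_def real_sqrt_mult power_divide field_simps)

text \<open>Polynomial times Gaussian: a polynomial multiple \<open>P\<close> of the density absorbs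
  all but a constant multiple of the Gaussian, and \<open>erf\<close> absorbs that. Each Gaussian
  moment below reduces to solving the third assumption for \<open>P\<close> and
  \<open>c\<close>.\<close>

lemma gauss_erf_antiderivative:
  assumes "T > 0" "(P has_real_derivative P') (at x)" "(P' - P x * (x - m) / T + c) = D"
  shows "((\<lambda>x. P x * gauss T (x - m) + c * (erf ((x - m) / sqrt (2 * T)) / 2))
    has_real_derivative D * gauss T (x - m)) (at x)"
proof -
  have "((\<lambda>x. gauss T (x - m)) has_real_derivative - ((x - m) / T) * gauss T (x - m)) (at x)"
    using assms(1) by (auto intro!: derivative_eq_intros)
  from DERIV_add[OF DERIV_mult[OF assms(2) this] DERIV_cmult[OF erf_scaled_has_real_derivative[OF assms(1)], of c m]]
  show ?thesis
    unfolding assms(3)[symmetric] by (rule DERIV_cong) (simp add: algebra_simps)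
qed

lemma tendsto_gauss [tendsto_intros]:
  "(f \<longlongrightarrow> c) F \<Longrightarrow> ((\<lambda>x. gauss T (f x)) \<longlongrightarrow> gauss T c) F"
  unfolding gauss_def divide_inverse by (intro tendsto_intros)

lemma isCont_gauss [continuous_intros]: "isCont f x \<Longrightarrow> isCont (\<lambda>x. gauss T (f x)) x"
  unfolding continuous_def by (rule tendsto_gauss)

lemma borel_measurable_gauss [measurable]: "gauss T \<in> borel_measurable borel"
  unfolding gauss_def[abs_def] by measurable

lemma power_gauss_tendsto_0:
  assumes "T > 0"
  shows "((\<lambda>x. x ^ k * gauss T (x - m)) \<longlongrightarrow> 0) at_top"
proof -
  show ?thesis using assms unfolding gauss_def by real_asymp
qed

lemma erf_scaled_tendsto:
  assumes "T > 0"
  shows "((\<lambda>x. erf ((x - m) / sqrt (2 * T))) \<longlongrightarrow> 1) at_top"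
proof -
  have "filterlim (\<lambda>x. (x - m) / sqrt (2 * T)) at_top at_top"
    using assms by real_asymp
  then show ?thesis by (rule filterlim_compose[OF erf_at_top])
qed


text \<open>Completing the square. Read as a path from \<open>- h\<close> through \<open>y\<close>
  at time \<open>u\<close> to \<open>x\<close> at time \<open>u + v\<close>, the second factor is
  the law of the Brownian bridge at time \<open>u\<close>, with its mean and variance.\<close>

lemma gauss_mult_gauss:
  assumes "u > 0" "v > 0"
  shows "gauss u (h + y) * gauss v (x - y)
    = gauss (u + v) (h + x) * gauss (u * v / (u + v)) (y - (u * x - v * h) / (u + v))"
proof -
  have s: "sqrt (2 * pi * u) * sqrt (2 * pi * v) = sqrt (2 * pi * (u + v)) * sqrt (2 * pi * (u * v / (u + v)))"
    using assms by (simp add: real_sqrt_mult[symmetric] del: real_sqrt_mult)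
  have e: "(h + y)\<^sup>2 / (2 * u) + (x - y)\<^sup>2 / (2 * v)
    = (h + x)\<^sup>2 / (2 * (u + v)) + (y - (u * x - v * h) / (u + v))\<^sup>2 / (2 * (u * v / (u + v)))"
    using assms add_pos_pos[OF assms]
    by (simp add: divide_simps power2_eq_square) algebra
  have "gauss u (h + y) * gauss v (x - y)
    = exp (- ((h + y)\<^sup>2 / (2 * u) + (x - y)\<^sup>2 / (2 * v))) / (sqrt (2 * pi * u) * sqrt (2 * pi * v))"
    by (simp add: gauss_def exp_add[symmetric] del: real_sqrt_mult)
  also have "\<dots> = gauss (u + v) (h + x) * gauss (u * v / (u + v)) (y - (u * x - v * h) / (u + v))"
    unfolding e s by (simp add: gauss_def exp_add[symmetric])
  finally show ?thesis .
qed

section \<open>Densities of maximum, argmax and endpoint\<close>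

text \<open>On \<open>[0,T]\<close>, \<open>maxd T\<close> is the joint density of \<open>h\<close> and \<open>x = h - c\<close>, and \<open>argd T\<close> that of
  \<open>\<theta>\<close>, \<open>h\<close> and \<open>x\<close>.\<close>

definition maxd :: "real \<Rightarrow> real \<Rightarrow> real \<Rightarrow> real" where
  "maxd T h x = (if 0 < h \<and> 0 < x then 2 * (h + x) / T * gauss T (h + x) else 0)"

definition argd :: "real \<Rightarrow> real \<Rightarrow> real \<Rightarrow> real \<Rightarrow> real" where
  "argd T \<theta> h x = (if 0 < \<theta> \<and> \<theta> < T \<and> 0 < h \<and> 0 < x
     then 2 * h * x / (\<theta> * (T - \<theta>)) * gauss \<theta> h * gauss (T - \<theta>) x else 0)"

lemma maxd_nonneg: "T > 0 \<Longrightarrow> 0 \<le> maxd T h x"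
  by (simp add: maxd_def gauss_nonneg)

lemma maxd_commute: "maxd T h x = maxd T x h"
  by (simp add: maxd_def add.commute)

lemma argd_nonneg: "0 \<le> argd T \<theta> h x"
  by (simp add: argd_def gauss_nonneg)

lemma borel_measurable_gauss_compose [measurable (raw)]:
  assumes [measurable]: "f \<in> borel_measurable N" "g \<in> borel_measurable N"
  shows "(\<lambda>x. gauss (f x) (g x)) \<in> borel_measurable N"
  unfolding gauss_def by measurable

lemma borel_measurable_maxd [measurable (raw)]:
  assumes [measurable]: "f \<in> borel_measurable N" "g \<in> borel_measurable N"
  shows "(\<lambda>x. maxd T (f x) (g x)) \<in> borel_measurable N"
  unfolding maxd_def by measurable

lemma borel_measurable_argd [measurable (raw)]:
  assumes [measurable]: "f \<in> borel_measurable N" "g \<in> borel_measurable N" "k \<in> borel_measurable N"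
  shows "(\<lambda>x. argd T (f x) (g x) (k x)) \<in> borel_measurable N"
  unfolding argd_def by measurable

lemma gauss_tendsto_0: "T > 0 \<Longrightarrow> ((\<lambda>x. gauss T (a + x)) \<longlongrightarrow> 0) at_top"
  using power_gauss_tendsto_0[of T 0 "- a"] by (simp add: add.commute)

text \<open>The integrand is a derivative in \<open>x\<close>. The result is the half-normal
  density: the maximum has the law of the absolute value of the endpoint.\<close>

lemma nn_integral_maxd:
  assumes "T > 0" "h > 0"
  shows "(\<integral>\<^sup>+x. ennreal (maxd T h x) \<partial>lborel) = ennreal (2 * gauss T h)"
proof -
  have "(\<integral>\<^sup>+x. ennreal (maxd T h x) \<partial>lborel)
      = (\<integral>\<^sup>+x. ennreal (2 * (h + x) / T * gauss T (h + x)) * indicator {0<..} x \<partial>lborel)"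
    using assms by (intro nn_integral_cong) (auto simp: maxd_def split: split_indicator)
  also have "\<dots> = ennreal (0 - (- (2 * gauss T (h + 0))))"
  proof (rule nn_integral_FTC_Ioi)
    show "((\<lambda>x. - (2 * gauss T (h + x))) has_real_derivative 2 * (h + x) / T * gauss T (h + x)) (at x)" for x
      using assms by (auto intro!: derivative_eq_intros)
    show "isCont (\<lambda>x. 2 * (h + x) / T * gauss T (h + x)) x" for x
      by (intro continuous_intros) (use assms in auto)
    show "0 < x \<Longrightarrow> 0 \<le> 2 * (h + x) / T * gauss T (h + x)" for x
      using assms by (simp add: gauss_nonneg)
    show "((\<lambda>x. - (2 * gauss T (h + x))) \<longlongrightarrow> - (2 * gauss T (h + 0))) (at_right 0)"
      by (intro tendsto_intros)
    show "((\<lambda>x. - (2 * gauss T (h + x))) \<longlongrightarrow> 0) at_top"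
      using tendsto_minus[OF tendsto_mult_right_zero[OF gauss_tendsto_0[OF \<open>T > 0\<close>]], of 2] by simp
  qed
  finally show ?thesis by simp
qed

text \<open>By the half-normal law this is the probability that a path of length \<open>T\<close>
  stays below \<open>x\<close>; it is the source of the error function in
  \<open>post_density\<close>.\<close>

lemma nn_integral_gauss_erf:
  assumes "T > 0" "x \<ge> 0"
  shows "(\<integral>\<^sup>+h. ennreal (2 * gauss T h) * indicator {0..x} h \<partial>lborel) = ennreal (erf (x / sqrt (2 * T)))"
proof -
  have "(\<integral>\<^sup>+h. ennreal (2 * gauss T h) * indicator {0..x} h \<partial>lborel)
     = ennreal (2 * (erf ((x - 0) / sqrt (2 * T)) / 2) - 2 * (erf ((0 - 0) / sqrt (2 * T)) / 2))"
    using assms DERIV_cmult[OF erf_scaled_has_real_derivative[OF \<open>T > 0\<close>, of 0], of 2]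
    by (intro nn_integral_FTC_Icc) (auto simp: gauss_nonneg intro: has_field_derivative_at_within)
  then show ?thesis by simp
qed

text \<open>The right-hand side is the transition density of Brownian motion killed at \<open>0\<close>.\<close>

lemma nn_integral_maxd_diagonal:
  assumes T: "T > 0" and "a > 0" "b > 0"
  shows "(\<integral>\<^sup>+z. ennreal (maxd T (a - b + z) z) * indicator {..<b} z \<partial>lborel)
    = ennreal (gauss T (a - b) - gauss T (a + b))"
proof -
  \<comment> \<open>Both arguments of \<open>maxd\<close> are positive exactly for
    \<open>z > l\<close>.\<close>
  define l where "l = max 0 (b - a)"
  have lb: "l < b" using assms by (auto simp: l_def)
  let ?f = "\<lambda>z. 2 * (a - b + 2 * z) / T * gauss T (a - b + 2 * z)"
  have "(\<integral>\<^sup>+z. ennreal (maxd T (a - b + z) z) * indicator {..<b} z \<partial>lborel)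
      = (\<integral>\<^sup>+z. ennreal (?f z) * indicator {l<..<b} z \<partial>lborel)"
    by (intro nn_integral_cong) (auto simp: maxd_def l_def algebra_simps split: split_indicator)
  also have "\<dots> = ennreal (- gauss T (a - b + 2 * b) - (- gauss T (a - b + 2 * l)))"
  proof (rule nn_integral_FTC_Ioo[OF lb])
    show "((\<lambda>z. - gauss T (a - b + 2 * z)) has_real_derivative ?f z) (at z)" for z
      using assms by (auto intro!: derivative_eq_intros)
    show "isCont ?f z" for z
      by (intro continuous_intros) (use assms in auto)
    show "l < z \<Longrightarrow> 0 \<le> ?f z" for z
      using assms by (simp add: gauss_nonneg l_def)
  qed (intro tendsto_intros)+
  \<comment> \<open>Here \<open>a - b + 2 * l\<close> is the absolute value of \<open>a - b\<close>,
    and the Gaussian is even.\<close>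
  also have "gauss T (a - b + 2 * l) = gauss T (a - b)"
    using gauss_minus[of T "a - b"] by (auto simp: l_def max_def)
  finally show ?thesis by (simp add: algebra_simps)
qed

text \<open>The density at \<open>h\<close> and \<open>x\<close> of paths of length
  \<open>u + v\<close> whose maximum is reached by time \<open>u\<close>: \<open>y\<close> is the
  depth below the maximum at time \<open>u\<close>, and a killed path leads from \<open>y\<close> to
  \<open>x\<close>. The mirror term is the direct one with \<open>- x\<close> for \<open>x\<close>,
  so a single antiderivative serves both.\<close>

lemma nn_integral_maxd_killed:
  assumes u: "u > 0" and v: "v > 0" and "h > 0" "x > 0"
  defines "J \<equiv> \<lambda>x. (h + x) / (u + v) * gauss (u + v) (h + x)
             * (1 + erf ((u * x - v * h) / sqrt (2 * (u * v * (u + v)))))"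
  shows "(\<integral>\<^sup>+y. ennreal (maxd u h y * (gauss v (x - y) - gauss v (x + y))) \<partial>lborel)
     = ennreal (J x - J (- x))"
proof -
  \<comment> \<open>\<open>s\<close> and \<open>m x\<close> are the variance and the mean of the
    bridge from \<open>gauss_mult_gauss\<close>.\<close>
  define s where "s = u * v / (u + v)"
  have s: "s > 0" using u v by (simp add: s_def)
  define m where "m = (\<lambda>x. (u * x - v * h) / (u + v))"
  define G where "G = (\<lambda>x y. 2 / u * gauss (u + v) (h + x)
     * (- s * gauss s (y - m x) + (h + m x) * (erf ((y - m x) / sqrt (2 * s)) / 2)))"
  have hm: "h + m x = u * (h + x) / (u + v)" for x
    using u v by (simp add: m_def field_simps)
  have dG: "(G x has_real_derivative 2 * (h + y) / u * (gauss u (h + y) * gauss v (x - y))) (at y)" for x y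
  proof -
    have "((\<lambda>y. - s * gauss s (y - m x) + (h + m x) * (erf ((y - m x) / sqrt (2 * s)) / 2))
        has_real_derivative (h + y) * gauss s (y - m x)) (at y)"
      using s by (intro gauss_erf_antiderivative) (auto intro!: derivative_eq_intros)
    from DERIV_cmult[OF this, of "2 / u * gauss (u + v) (h + x)"] show ?thesis
      unfolding gauss_mult_gauss[OF u v] s_def[symmetric] G_def
      by (rule DERIV_cong) (simp add: m_def)
  qed
  have Gtop: "(G x \<longlongrightarrow> (h + x) / (u + v) * gauss (u + v) (h + x)) at_top" for x
  proof -
    have "(G x \<longlongrightarrow> 2 / u * gauss (u + v) (h + x) * (- s * 0 + (h + m x) * (1 / 2))) at_top"
      unfolding G_def
      by (intro tendsto_intros erf_scaled_tendsto[OF s] power_gauss_tendsto_0[OF s, of 0, simplified]) simp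
    moreover have "2 / u * g * (- s * 0 + u * (h + x) / (u + v) * (1 / 2)) = (h + x) / (u + v) * g" for g
      using u v by (simp add: divide_simps)
    ultimately show ?thesis unfolding hm by simp
  qed
  have w: "m x / sqrt (2 * s) = (u * x - v * h) / sqrt (2 * (u * v * (u + v)))" for x
  proof -
    have "sqrt (2 * (u * v * (u + v))) = sqrt (2 * s * (u + v)\<^sup>2)"
      using u v by (simp add: s_def power2_eq_square)
    also have "\<dots> = sqrt (2 * s) * (u + v)"
      using u v by (simp add: real_sqrt_mult)
    finally show ?thesis by (simp add: m_def)
  qed
  \<comment> \<open>The first summand is even in \<open>x\<close> and cancels in
    \<open>G x 0 - G (- x) 0\<close>.\<close>
  have G0: "G x 0 = - 2 * v / (u + v) * gauss u h * gauss v x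
      - (h + x) / (u + v) * gauss (u + v) (h + x) * erf ((u * x - v * h) / sqrt (2 * (u * v * (u + v))))" for x
  proof -
    have "G x 0 = - (2 / u * s) * (gauss (u + v) (h + x) * gauss s (0 - m x))
       - 2 / u * ((h + m x) * (erf (m x / sqrt (2 * s)) / 2)) * gauss (u + v) (h + x)"
      using u by (simp add: G_def divide_simps) (simp add: algebra_simps)
    also have "gauss (u + v) (h + x) * gauss s (0 - m x) = gauss u h * gauss v x"
      using gauss_mult_gauss[OF u v, of h 0 x] by (simp add: s_def m_def)
    finally have G: "G x 0 = - (2 / u * s) * (gauss u h * gauss v x) - 2 / u * ((h + m x) * (erf (m x / sqrt (2 * s)) / 2)) * gauss (u + v) (h + x)" .
    have "- (2 / u * (u * v / w)) * A - 2 / u * (u * z / w * (e / 2)) * g = - 2 * v / w * A - z / w * g * e"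
      if "w \<noteq> 0" for w A z e g :: real
      using u that by (simp add: field_simps)
    from this[of "u + v"] show ?thesis unfolding G hm w unfolding s_def using u v by (simp add: mult.assoc)
  qed
  let ?f = "\<lambda>y. 2 * (h + y) / u * (gauss u (h + y) * gauss v (x - y)) - 2 * (h + y) / u * (gauss u (h + y) * gauss v (- x - y))"
  have feq: "?f y = 2 * (h + y) / u * gauss u (h + y) * (gauss v (x - y) - gauss v (x + y))" for y
  proof -
    have "gauss v (- x - y) = gauss v (x + y)" using gauss_minus[of v "x + y"] by simp
    then show ?thesis by (simp only: right_diff_distrib mult.assoc)
  qed
  have "(\<integral>\<^sup>+y. ennreal (maxd u h y * (gauss v (x - y) - gauss v (x + y))) \<partial>lborel)
      = (\<integral>\<^sup>+y. ennreal (?f y) * indicator {0<..} y \<partial>lborel)"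
    unfolding feq using assms
    by (intro nn_integral_cong) (auto simp: maxd_def split: split_indicator)
  also have "\<dots> = ennreal ((h + x) / (u + v) * gauss (u + v) (h + x) - (h + - x) / (u + v) * gauss (u + v) (h + - x)
     - (G x 0 - G (- x) 0))"
  proof (rule nn_integral_FTC_Ioi)
    show "((\<lambda>y. G x y - G (- x) y) has_real_derivative ?f y) (at y)" for y
      by (intro DERIV_diff dG)
    show "isCont ?f y" for y
      by (intro continuous_intros) (use u in auto)
    show "0 \<le> ?f y" if "0 < y" for y
      unfolding feq using assms that by (intro mult_nonneg_nonneg) (auto simp: gauss_nonneg intro!: gauss_mono)
    show "((\<lambda>y. G x y - G (- x) y) \<longlongrightarrow> G x 0 - G (- x) 0) (at_right 0)"
      by (intro tendsto_diff DERIV_tendsto_at_right[OF dG])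
  qed (intro tendsto_diff Gtop)
  also have "(h + x) / (u + v) * gauss (u + v) (h + x) - (h + - x) / (u + v) * gauss (u + v) (h + - x)
     - (G x 0 - G (- x) 0) = J x - J (- x)"
    unfolding G0 J_def by (simp add: algebra_simps)
  finally show ?thesis .
qed


text \<open>The preceding integral, as a function of \<open>u\<close>, is the distribution function
  of the argmax, so its derivative must be the density of the argmax. The exponential from
  \<open>erf\<close> and \<open>gauss T (h + x)\<close> combine, by completing the square backwards
  at the point 0, into one Gaussian for \<open>[0, u]\<close> and one for
  \<open>[u, T]\<close>.\<close>

lemma argd_antiderivative:
  fixes T h :: real
  defines "J \<equiv> \<lambda>x u. (h + x) / T * gauss T (h + x)
             * (1 + erf ((u * x - (T - u) * h) / sqrt (2 * (u * (T - u) * T))))"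
  assumes u: "0 < u" "u < T"
  shows "(J x has_real_derivative
     (h + x) * (u * x + (T - u) * h) / (T * u * (T - u)) * gauss u h * gauss (T - u) x) (at u)"
proof -
  define r where "r = (\<lambda>u. 2 * (u * (T - u) * T))"
  define w where "w = (\<lambda>u. (u * x - (T - u) * h) / sqrt (r u))"
  have T: "T > 0" and v: "T - u > 0" using u by auto
  have r: "r u > 0" using u T by (simp add: r_def)
  have dr: "(r has_real_derivative 2 * T * (T - 2 * u)) (at u)"
    unfolding r_def by (auto intro!: derivative_eq_intros simp: algebra_simps)
  have dw: "(w has_real_derivative T * (u * x + (T - u) * h) / (sqrt (r u) * (2 * (u * (T - u))))) (at u)"
  proof -
    have "(w has_real_derivative
        ((x + h) * sqrt (r u) - (u * x - (T - u) * h) * (2 * T * (T - 2 * u) / (2 * sqrt (r u)))) / (sqrt (r u))\<^sup>2) (at u)"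
      unfolding w_def using r dr
      by (auto intro!: derivative_eq_intros simp: power2_eq_square field_simps)
    moreover have "((x + h) * sqrt (r u) - (u * x - (T - u) * h) * (2 * T * (T - 2 * u) / (2 * sqrt (r u)))) / (sqrt (r u))\<^sup>2
       = ((x + h) * (sqrt (r u))\<^sup>2 - (u * x - (T - u) * h) * (T * (T - 2 * u))) / (sqrt (r u) * (sqrt (r u))\<^sup>2)"
    proof -
      have "((x + h) * q - A * (2 * T * B / (2 * q))) / q\<^sup>2 = ((x + h) * q\<^sup>2 - A * (T * B)) / (q * q\<^sup>2)"
        if "q \<noteq> 0" for q A B :: real
        using that by (simp add: field_simps power2_eq_square)
      from this[of "sqrt (r u)"] show ?thesis using r by simp
    qed
    also have "(sqrt (r u))\<^sup>2 = 2 * (u * (T - u) * T)" using r by (simp add: r_def)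
    also have "((x + h) * (2 * (u * (T - u) * T)) - (u * x - (T - u) * h) * (T * (T - 2 * u))) / (sqrt (r u) * (2 * (u * (T - u) * T)))
       = T * (u * x + (T - u) * h) / (sqrt (r u) * (2 * (u * (T - u))))"
    proof -
      have "((x + h) * (2 * (u * (T - u) * T)) - (u * x - (T - u) * h) * (T * (T - 2 * u)))
         = T * (T * (u * x + (T - u) * h))" by algebra
      then show ?thesis using T by simp
    qed
    ultimately show ?thesis by simp
  qed
  \<comment> \<open>The square of the argument of \<open>erf\<close> is the exponent of the bridge
    Gaussian at 0.\<close>
  have w2: "(w u)\<^sup>2 = (0 - (u * x - (T - u) * h) / T)\<^sup>2 / (2 * (u * (T - u) / T))"
    using u T r by (simp add: w_def r_def power_divide field_simps power2_eq_square)
  have s: "sqrt (r u) = T * sqrt (2 * (u * (T - u) / T))"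
  proof -
    have "r u = T\<^sup>2 * (2 * (u * (T - u) / T))" using T by (simp add: r_def power2_eq_square)
    then show ?thesis using T by (simp only: real_sqrt_mult[of "T\<^sup>2"]) simp
  qed
  have "exp (- (w u)\<^sup>2) / (sqrt pi * sqrt (r u)) = gauss (u * (T - u) / T) (0 - (u * x - (T - u) * h) / T) / T"
    unfolding w2 s gauss_def by (simp add: real_sqrt_mult real_sqrt_divide)
  moreover have "gauss T (h + x) * gauss (u * (T - u) / T) (0 - (u * x - (T - u) * h) / T) = gauss u h * gauss (T - u) x"
    using gauss_mult_gauss[OF u(1) v, of h 0 x] by simp
  ultimately have e: "gauss T (h + x) * (exp (- (w u)\<^sup>2) / (sqrt pi * sqrt (r u))) = gauss u h * gauss (T - u) x / T"
    by simp
  have "(J x has_real_derivative (h + x) / T * gauss T (h + x) * (2 / sqrt pi * exp (- (w u)\<^sup>2) * (T * (u * x + (T - u) * h) / (sqrt (r u) * (2 * (u * (T - u))))))) (at u)"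
  proof -
    have J: "J x = (\<lambda>u. (h + x) / T * gauss T (h + x) * (1 + erf (w u)))"
      by (simp add: J_def w_def r_def fun_eq_iff)
    have "((\<lambda>u. 1 + erf (w u)) has_real_derivative 2 / sqrt pi * exp (- (w u)\<^sup>2) * (T * (u * x + (T - u) * h) / (sqrt (r u) * (2 * (u * (T - u)))))) (at u)"
      using DERIV_add[OF DERIV_const DERIV_chain2[OF erf_has_real_derivative dw]] by simp
    from DERIV_cmult[OF this] show ?thesis unfolding J .
  qed
  moreover have "(h + x) / T * gauss T (h + x) * (2 / sqrt pi * exp (- (w u)\<^sup>2) * (T * (u * x + (T - u) * h) / (sqrt (r u) * (2 * (u * (T - u))))))
    = (h + x) * (u * x + (T - u) * h) / (u * (T - u)) * (gauss T (h + x) * (exp (- (w u)\<^sup>2) / (sqrt pi * sqrt (r u))))"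
  proof -
    have "z / T * g * (2 / p * E * (T * n / (q * (2 * k)))) = z * n / k * (g * (E / (p * q)))" for z g p E n q k
      using T by (simp add: mult_ac)
    then show ?thesis .
  qed
  ultimately show ?thesis unfolding e by (simp add: mult_ac)
qed

text \<open>\<open>argJ T h x u - argJ T h (- x) u\<close> is an antiderivative of \<open>argd T u h x\<close> in \<open>u\<close>.\<close>

definition argJ :: "real \<Rightarrow> real \<Rightarrow> real \<Rightarrow> real \<Rightarrow> real" where
  "argJ T h x u = (h + x) / T * gauss T (h + x)
             * (1 + erf ((u * x - (T - u) * h) / sqrt (2 * (u * (T - u) * T))))"

lemma argJ_tendsto_0:
  assumes "T > 0" "h > 0"
  shows "(argJ T h x \<longlongrightarrow> 0) (at_right 0)"
proof -
  have "filterlim (\<lambda>u. (u * x - (T - u) * h) / sqrt (2 * (u * (T - u) * T))) at_bot (at_right 0)"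
    using assms by real_asymp
  from filterlim_compose[OF erf_at_bot this]
  have "(argJ T h x \<longlongrightarrow> (h + x) / T * gauss T (h + x) * (1 + - 1)) (at_right 0)"
    unfolding argJ_def[abs_def] by (intro tendsto_intros)
  then show ?thesis by simp
qed

text \<open>Near \<open>T\<close> the numerator tends to \<open>T * x\<close> and the root to 0, so
  the sign of \<open>x\<close> selects the limit of \<open>erf\<close>: the direct term survives and
  the mirror term vanishes.\<close>

lemma argJ_tendsto_T:
  assumes "T > 0" "x \<noteq> 0"
  shows "(argJ T h x \<longlongrightarrow> (if x > 0 then 2 * (h + x) / T * gauss T (h + x) else 0)) (at_left T)"
proof -
  let ?w = "\<lambda>u. (u * x - (T - u) * h) / sqrt (2 * (u * (T - u) * T))"
  have num: "((\<lambda>u. u * x - (T - u) * h) \<longlongrightarrow> T * x - (T - T) * h) (at_left T)"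
    by (intro tendsto_intros)
  have r: "filterlim (\<lambda>u. inverse (sqrt (2 * (u * (T - u) * T)))) at_top (at_left T)"
  proof (rule filterlim_inverse_at_top)
    have "((\<lambda>u. sqrt (2 * (u * (T - u) * T))) \<longlongrightarrow> sqrt (2 * (T * (T - T) * T))) (at_left T)"
      by (intro tendsto_intros)
    then show "((\<lambda>u. sqrt (2 * (u * (T - u) * T))) \<longlongrightarrow> 0) (at_left T)" by simp
    show "\<forall>\<^sub>F u in at_left T. 0 < sqrt (2 * (u * (T - u) * T))"
      using eventually_at_left_real[OF assms(1)] by eventually_elim (use assms in simp)
  qed
  have erf: "((\<lambda>u. erf (?w u)) \<longlongrightarrow> (if x > 0 then 1 else - 1)) (at_left T)"
  proof (cases "x > 0")
    case True
    then have "filterlim ?w at_top (at_left T)"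
      unfolding divide_inverse using assms
      by (intro filterlim_tendsto_pos_mult_at_top[OF num _ r]) simp
    then show ?thesis using True filterlim_compose[OF erf_at_top] by simp
  next
    case False
    then have "filterlim ?w at_bot (at_left T)"
      unfolding divide_inverse using assms
      by (intro filterlim_tendsto_neg_mult_at_bot[OF num _ r]) (simp add: mult_pos_neg)
    then show ?thesis using False filterlim_compose[OF erf_at_bot] by simp
  qed
  have "(argJ T h x \<longlongrightarrow> (h + x) / T * gauss T (h + x) * (1 + (if x > 0 then 1 else - 1))) (at_left T)"
    unfolding argJ_def[abs_def] by (intro tendsto_intros erf)
  then show ?thesis by (simp add: algebra_simps split: if_splits)
qed

lemma argJ_diff_has_real_derivative:
  assumes "0 < h" "0 < x" "0 < u" "u < T"
  shows "((\<lambda>u. argJ T h x u - argJ T h (- x) u) has_real_derivative argd T u h x) (at u)"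
proof -
  have "((\<lambda>u. argJ T h x u - argJ T h (- x) u) has_real_derivative
     (h + x) * (u * x + (T - u) * h) / (T * u * (T - u)) * gauss u h * gauss (T - u) x
     - (h + - x) * (u * - x + (T - u) * h) / (T * u * (T - u)) * gauss u h * gauss (T - u) (- x)) (at u)"
    unfolding argJ_def[abs_def] using assms by (intro DERIV_diff argd_antiderivative) auto
  moreover have "(h + x) * (u * x + (T - u) * h) / (T * u * (T - u)) * gauss u h * gauss (T - u) x
     - (h + - x) * (u * - x + (T - u) * h) / (T * u * (T - u)) * gauss u h * gauss (T - u) (- x)
     = ((h + x) * (u * x + (T - u) * h) - (h + - x) * (u * - x + (T - u) * h)) / (T * u * (T - u)) * gauss u h * gauss (T - u) x"
    by (simp add: diff_divide_distrib left_diff_distrib)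
  \<comment> \<open>The part even in \<open>x\<close> cancels and the odd part is doubled; the
    factor \<open>T\<close> then cancels the one in the denominator.\<close>
  also have "(h + x) * (u * x + (T - u) * h) - (h + - x) * (u * - x + (T - u) * h) = T * (2 * h * x)"
    by algebra
  ultimately show ?thesis using assms by (simp add: argd_def mult_ac)
qed

lemma isCont_argd: 
  assumes "0 < h" "0 < x" "0 < u" "u < T"
  shows "isCont (\<lambda>u. argd T u h x) u"
proof -
  have "isCont (\<lambda>u. 2 * h * x / (u * (T - u)) * gauss u h * gauss (T - u) x) u"
    unfolding gauss_def using assms by (intro continuous_intros) auto
  moreover have "\<forall>\<^sub>F u in nhds u. argd T u h x = 2 * h * x / (u * (T - u)) * gauss u h * gauss (T - u) x"
    using eventually_nhds_in_open[of "{0<..<T}" u] assms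
    by (auto elim!: eventually_mono simp: argd_def)
  ultimately show ?thesis using isCont_cong by fastforce
qed

lemma nn_integral_argd_less:
  assumes "0 < h" "0 < x" "0 < u" "u < T"
  shows "(\<integral>\<^sup>+\<theta>. ennreal (argd T \<theta> h x) * indicator {..u} \<theta> \<partial>lborel) = ennreal (argJ T h x u - argJ T h (- x) u)"
proof -
  have "(\<integral>\<^sup>+\<theta>. ennreal (argd T \<theta> h x) * indicator {..u} \<theta> \<partial>lborel)
     = (\<integral>\<^sup>+\<theta>. ennreal (argd T \<theta> h x) * indicator {0<..<u} \<theta> \<partial>lborel)"
    by (intro nn_integral_cong_AE) (use AE_lborel_singleton[of u] in eventually_elim, auto simp: argd_def split: split_indicator)
  also have "\<dots> = ennreal (argJ T h x u - argJ T h (- x) u - (0 - 0))"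
  proof (rule nn_integral_FTC_Ioo)
    show "((\<lambda>u. argJ T h x u - argJ T h (- x) u) \<longlongrightarrow> 0 - 0) (at_right 0)"
      using assms by (intro tendsto_diff argJ_tendsto_0) auto
    show "((\<lambda>u. argJ T h x u - argJ T h (- x) u) \<longlongrightarrow> argJ T h x u - argJ T h (- x) u) (at_left u)"
      by (rule DERIV_tendsto_at_left[OF argJ_diff_has_real_derivative[OF assms]])
  qed (use assms in \<open>auto intro!: argJ_diff_has_real_derivative isCont_argd argd_nonneg\<close>)
  finally show ?thesis by simp
qed

text \<open>Total mass over all argmaxes; it settles the case where the bound on the argmax is
  void.\<close>

lemma nn_integral_argd:
  assumes "0 < T"
  shows "(\<integral>\<^sup>+\<theta>. ennreal (argd T \<theta> h x) \<partial>lborel) = ennreal (maxd T h x)"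
proof (cases "0 < h \<and> 0 < x")
  case True
  have "(\<integral>\<^sup>+\<theta>. ennreal (argd T \<theta> h x) \<partial>lborel)
     = (\<integral>\<^sup>+\<theta>. ennreal (argd T \<theta> h x) * indicator {0<..<T} \<theta> \<partial>lborel)"
    by (intro nn_integral_cong) (auto simp: argd_def split: split_indicator)
  also have "\<dots> = ennreal (((if x > 0 then 2 * (h + x) / T * gauss T (h + x) else 0)
       - (if - x > 0 then 2 * (h + - x) / T * gauss T (h + - x) else 0)) - (0 - 0))"
  proof (rule nn_integral_FTC_Ioo)
    show "((\<lambda>u. argJ T h x u - argJ T h (- x) u) \<longlongrightarrow> 0 - 0) (at_right 0)"
      using assms True by (intro tendsto_diff argJ_tendsto_0) auto
  next
    show "((\<lambda>u. argJ T h x u - argJ T h (- x) u) \<longlongrightarrow> (if x > 0 then 2 * (h + x) / T * gauss T (h + x) else 0)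
       - (if - x > 0 then 2 * (h + - x) / T * gauss T (h + - x) else 0)) (at_left T)"
      using assms True by (intro tendsto_diff argJ_tendsto_T) auto
  qed (use assms True in \<open>auto intro!: argJ_diff_has_real_derivative isCont_argd argd_nonneg\<close>)
  finally show ?thesis using True by (simp add: maxd_def)
next
  case False
  then have "argd T \<theta> h x = 0" "maxd T h x = 0" for \<theta>
    by (auto simp: argd_def maxd_def)
  then show ?thesis by simp
qed

text \<open>This identifies \<open>argd\<close>: both sides measure the event that the argmax is at
  most \<open>u\<close>, the left one by splitting the path at \<open>u\<close>, the right one by
  integrating the density.\<close>

lemma nn_integral_maxd_killed':
  assumes "0 < h" "0 < x" "0 < u" "u < T"
  shows "(\<integral>\<^sup>+y. ennreal (maxd u h y * (gauss (T - u) (x - y) - gauss (T - u) (x + y))) \<partial>lborel)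
     = (\<integral>\<^sup>+\<theta>. ennreal (argd T \<theta> h x) * indicator {..u} \<theta> \<partial>lborel)"
  unfolding nn_integral_argd_less[OF assms]
  using nn_integral_maxd_killed[of u "T - u" h x] assms by (simp add: argJ_def)

lemma nn_integral_FTC_Ioi':
  fixes f F :: "real \<Rightarrow> real"
  assumes F: "\<And>x. 0 \<le> x \<Longrightarrow> (F has_real_derivative f x) (at x)"
    and f: "\<And>x. 0 < x \<Longrightarrow> isCont f x"
    and nn: "\<And>x. 0 < x \<Longrightarrow> 0 \<le> f x"
    and B: "(F \<longlongrightarrow> B) at_top"
  shows "(\<integral>\<^sup>+x. ennreal (f x) * indicator {0<..} x \<partial>lborel) = ennreal (B - F 0)"
  by (rule nn_integral_FTC_Ioi) (use assms in \<open>auto intro: DERIV_tendsto_at_right\<close>)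

section \<open>The Bessel bridge\<close>

text \<open>For \<open>v = t (\<theta> - t) / \<theta>\<close> and \<open>m = h (\<theta> - t) / \<theta>\<close>, the density of \<open>h - B(t)\<close> given \<open>\<theta>\<close> and
  \<open>h\<close> when \<open>t < \<theta>\<close>.\<close>

definition bessel_bridge :: "real \<Rightarrow> real \<Rightarrow> real \<Rightarrow> real" where
  "bessel_bridge v m y = (if 0 < y then y / m * (gauss v (y - m) - gauss v (y + m)) else 0)"

definition bessel_mean :: "real \<Rightarrow> real \<Rightarrow> real" where
  "bessel_mean v m = (m + v / m) * erf (m / sqrt (2 * v)) + 2 * v * gauss v m"

lemma bessel_bridge_nonneg:
  assumes "v > 0" "m > 0" shows "0 \<le> bessel_bridge v m y"
  using assms by (auto simp: bessel_bridge_def intro!: mult_nonneg_nonneg divide_nonneg_nonneg gauss_mono)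

lemma gauss_antiderivative_tendsto:
  assumes "v > 0" "\<And>y. P y = a * y ^ 2 + b * y + d"
  shows "((\<lambda>y. P y * gauss v (y - m) + c * (erf ((y - m) / sqrt (2 * v)) / 2)) \<longlongrightarrow> c / 2) at_top"
proof -
  have eq: "P y * gauss v (y - m) + c * (erf ((y - m) / sqrt (2 * v)) / 2)
    = a * (y ^ 2 * gauss v (y - m)) + b * (y ^ 1 * gauss v (y - m)) + d * (y ^ 0 * gauss v (y - m))
       + c * (erf ((y - m) / sqrt (2 * v)) / 2)" for y
    by (simp add: assms(2) algebra_simps)
  have "((\<lambda>y. P y * gauss v (y - m) + c * (erf ((y - m) / sqrt (2 * v)) / 2)) \<longlongrightarrow> a * 0 + b * 0 + d * 0 + c * (1 / 2)) at_top"
    unfolding eq by (intro tendsto_intros power_gauss_tendsto_0 erf_scaled_tendsto assms) simp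
  then show ?thesis by simp
qed

text \<open>The density is \<open>y / m\<close> times a difference of Gaussians centred at
  \<open>m\<close> and \<open>- m\<close>, so \<open>eq\<close> is required for both signs and one
  antiderivative is used twice. The constant \<open>c m\<close> is the integral of
  \<open>y * q y\<close> over the whole line against the Gaussian centred at \<open>m\<close>; the
  rest of the result is the contribution of the boundary point 0.\<close>

lemma bessel_bridge_moment:
  assumes v: "v > 0" and m: "m > 0"
    and P: "\<And>m y. ((\<lambda>y. P m y) has_real_derivative P' m y) (at y)"
    and eq: "\<And>m y. P' m y - P m y * (y - m) / v + c m = y * q y"
    and quad: "\<And>m y. P m y = a * y ^ 2 + b m * y + d m"
    and q: "\<And>y. y > 0 \<Longrightarrow> 0 \<le> q y" "\<And>y. isCont q y"
  shows "(\<integral>\<^sup>+y. ennreal (q y) * ennreal (bessel_bridge v m y) \<partial>lborel)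
    = ennreal (((c m - c (- m)) / 2 - ((d m - d (- m)) * gauss v m - (c m + c (- m)) / 2 * erf (m / sqrt (2 * v)))) / m)"
proof -
  define G where "G = (\<lambda>m y. P m y * gauss v (y - m) + c m * (erf ((y - m) / sqrt (2 * v)) / 2))"
  have dG: "(G m has_real_derivative (y * q y) * gauss v (y - m)) (at y)" for m y
    unfolding G_def by (rule gauss_erf_antiderivative[OF v P eq])
  let ?f = "\<lambda>y. (y * q y * gauss v (y - m) - y * q y * gauss v (y - - m)) / m"
  have "(\<integral>\<^sup>+y. ennreal (q y) * ennreal (bessel_bridge v m y) \<partial>lborel)
     = (\<integral>\<^sup>+y. ennreal (?f y) * indicator {0<..} y \<partial>lborel)"
    using q m bessel_bridge_nonneg[OF v m]
    by (intro nn_integral_cong)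
      (auto simp: bessel_bridge_def ennreal_mult'[symmetric] algebra_simps diff_divide_distrib split: split_indicator)
  also have "\<dots> = ennreal ((c m / 2 - c (- m) / 2) / m - (G m 0 - G (- m) 0) / m)"
  proof (rule nn_integral_FTC_Ioi')
    show "((\<lambda>y. (G m y - G (- m) y) / m) has_real_derivative ?f y) (at y)" for y
      by (intro DERIV_cdivide DERIV_diff dG)
    show "isCont ?f y" for y
      by (intro continuous_intros q) (use m in auto)
    show "0 \<le> ?f y" if "0 < y" for y
    proof -
      have "gauss v (y + m) \<le> gauss v (y - m)" using that m v by (intro gauss_mono) auto
      then have "y * q y * gauss v (y + m) \<le> y * q y * gauss v (y - m)"
        using q that by (intro mult_left_mono) auto
      then show ?thesis using m by simp
    qed
    show "((\<lambda>y. (G m y - G (- m) y) / m) \<longlongrightarrow> (c m / 2 - c (- m) / 2) / m) at_top"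
      unfolding G_def using m by (intro tendsto_intros gauss_antiderivative_tendsto[OF v quad]) auto
  qed
  also have "G m 0 - G (- m) 0 = (d m - d (- m)) * gauss v m - (c m + c (- m)) / 2 * erf (m / sqrt (2 * v))"
    by (simp add: G_def quad algebra_simps add_divide_distrib)
  also have "(c m / 2 - c (- m) / 2) / m - ((d m - d (- m)) * gauss v m - (c m + c (- m)) / 2 * erf (m / sqrt (2 * v))) / m
     = ((c m - c (- m)) / 2 - ((d m - d (- m)) * gauss v m - (c m + c (- m)) / 2 * erf (m / sqrt (2 * v)))) / m"
    by (simp add: diff_divide_distrib)
  finally show ?thesis .
qed

text \<open>As \<open>c\<close> serve the raw normal moments \<open>m\<close>,
  \<open>m^2 + v\<close> and \<open>m^3 + 3 * m * v\<close>. For the mass and the second moment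
  \<open>c\<close> is odd and \<open>d\<close> even, so all boundary terms cancel and the results
  are polynomial; for the mean the parities are exchanged and both \<open>erf\<close> and
  \<open>gauss\<close> remain.\<close>

lemma nn_integral_bessel_bridge:
  assumes v: "v > 0" and m: "m > 0"
  shows "(\<integral>\<^sup>+y. ennreal (bessel_bridge v m y) \<partial>lborel) = 1"
    and "(\<integral>\<^sup>+y. ennreal y * ennreal (bessel_bridge v m y) \<partial>lborel) = ennreal (bessel_mean v m)"
    and "(\<integral>\<^sup>+y. ennreal (y\<^sup>2) * ennreal (bessel_bridge v m y) \<partial>lborel) = ennreal (m\<^sup>2 + 3 * v)"
proof -
  have "(\<integral>\<^sup>+y. ennreal 1 * ennreal (bessel_bridge v m y) \<partial>lborel)
    = ennreal (((m - (- m)) / 2 - (((- v) - (- v)) * gauss v m - (m + (- m)) / 2 * erf (m / sqrt (2 * v)))) / m)"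
    by (rule bessel_bridge_moment[OF v m, where P = "\<lambda>m y. - v" and P' = "\<lambda>m y. 0" and a = 0 and b = "\<lambda>m. 0" and d = "\<lambda>m. - v"
          and c = "\<lambda>m. m"]) (use v in \<open>auto intro!: derivative_eq_intros\<close>)
  then show "(\<integral>\<^sup>+y. ennreal (bessel_bridge v m y) \<partial>lborel) = 1"
    using m by simp
  have "(\<integral>\<^sup>+y. ennreal y * ennreal (bessel_bridge v m y) \<partial>lborel)
    = ennreal ((((m\<^sup>2 + v) - ((- m)\<^sup>2 + v)) / 2 - (((- v * m) - (- v * - m)) * gauss v m - ((m\<^sup>2 + v) + ((- m)\<^sup>2 + v)) / 2 * erf (m / sqrt (2 * v)))) / m)"
    by (rule bessel_bridge_moment[OF v m, where P = "\<lambda>m y. - v * (y + m)" and P' = "\<lambda>m y. - v" and a = 0 and b = "\<lambda>m. - v" and d = "\<lambda>m. - v * m"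
          and c = "\<lambda>m. m\<^sup>2 + v"]) (use v in \<open>auto intro!: derivative_eq_intros simp: field_simps power2_eq_square\<close>)
  moreover have "((m\<^sup>2 + v - ((- m)\<^sup>2 + v)) / 2 - (((- v * m) - (- v * - m)) * g - ((m\<^sup>2 + v) + ((- m)\<^sup>2 + v)) / 2 * e)) / m = (m + v / m) * e + 2 * v * g" for g e
    using m by (simp add: field_simps power2_eq_square)
  ultimately show "(\<integral>\<^sup>+y. ennreal y * ennreal (bessel_bridge v m y) \<partial>lborel) = ennreal (bessel_mean v m)"
    unfolding bessel_mean_def by simp
  have "(\<integral>\<^sup>+y. ennreal (y\<^sup>2) * ennreal (bessel_bridge v m y) \<partial>lborel)
    = ennreal (((m * (m\<^sup>2 + 3 * v) - - m * ((- m)\<^sup>2 + 3 * v)) / 2 - (((- v * (m\<^sup>2 + 2 * v)) - (- v * ((- m)\<^sup>2 + 2 * v))) * gauss v m - (m * (m\<^sup>2 + 3 * v) + - m * ((- m)\<^sup>2 + 3 * v)) / 2 * erf (m / sqrt (2 * v)))) / m)"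
    by (rule bessel_bridge_moment[OF v m, where P = "\<lambda>m y. - v * (y\<^sup>2 + m * y + m\<^sup>2 + 2 * v)" and P' = "\<lambda>m y. - v * (2 * y + m)" and a = "- v" and b = "\<lambda>m. - v * m" and d = "\<lambda>m. - v * (m\<^sup>2 + 2 * v)"
          and c = "\<lambda>m. m * (m\<^sup>2 + 3 * v)"]) (use v in \<open>auto intro!: derivative_eq_intros continuous_intros simp: field_simps power2_eq_square\<close>)
  then show "(\<integral>\<^sup>+y. ennreal (y\<^sup>2) * ennreal (bessel_bridge v m y) \<partial>lborel) = ennreal (m\<^sup>2 + 3 * v)"
    using m by simp
qed

text \<open>Brownian scaling by \<open>sqrt \<theta>\<close>, with time measured backwards from the
  maximum. In terms of the roots \<open>r\<close>, \<open>q\<close>, \<open>p\<close> of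
  \<open>\<theta>\<close>, \<open>\<theta> - t\<close>, \<open>t\<close> everything is rational
  except for \<open>sqrt 2\<close> and \<open>sqrt pi\<close>.\<close>

lemma bessel_mean_eq_M1:
  assumes "0 < t" "t < \<theta>" "0 < h"
  shows "bessel_mean (t * (\<theta> - t) / \<theta>) (h * (\<theta> - t) / \<theta>) = sqrt \<theta> * M1 (1 - t / \<theta>) (h / sqrt \<theta>)"
proof -
  define r where "r = sqrt \<theta>"
  have r: "r > 0" "\<theta> = r\<^sup>2" using assms by (auto simp: r_def)
  define q where "q = sqrt (\<theta> - t)"
  have q: "q > 0" "\<theta> - t = q\<^sup>2" using assms by (auto simp: q_def)
  define p where "p = sqrt t"
  have p: "p > 0" "t = p\<^sup>2" using assms by (auto simp: p_def)
  have s: "1 - t / \<theta> = q\<^sup>2 / r\<^sup>2" "1 - (1 - t / \<theta>) = p\<^sup>2 / r\<^sup>2"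
    using r q p by (simp_all add: field_simps)
  have v: "t * (\<theta> - t) / \<theta> = (p * q / r)\<^sup>2" "h * (\<theta> - t) / \<theta> = h * q\<^sup>2 / r\<^sup>2"
    unfolding q using r p by (simp_all add: power_divide power_mult_distrib)
  have rt: "sqrt (2 * x\<^sup>2) = sqrt 2 * x" "sqrt (2 * pi * x\<^sup>2) = sqrt 2 * sqrt pi * x" if "x > 0" for x
    using that by (simp_all add: real_sqrt_mult)
  have pq: "p * q / r > 0" using p q r by simp
  have a: "h * q\<^sup>2 / r\<^sup>2 / sqrt (2 * (p * q / r)\<^sup>2) = h / r * sqrt (q\<^sup>2 / r\<^sup>2) / sqrt (2 * (p\<^sup>2 / r\<^sup>2))"
    unfolding rt(1)[OF pq] using p(1) q(1) r(1)
    by (simp add: real_sqrt_mult real_sqrt_divide field_simps power2_eq_square)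
  have e: "(h * q\<^sup>2 / r\<^sup>2)\<^sup>2 / (2 * (p * q / r)\<^sup>2) = q\<^sup>2 / r\<^sup>2 * (h / r)\<^sup>2 / (2 * (p\<^sup>2 / r\<^sup>2))"
    using p(1) q(1) r(1) by (simp add: field_simps power2_eq_square)
  have g: "2 * (p * q / r)\<^sup>2 * gauss ((p * q / r)\<^sup>2) (h * q\<^sup>2 / r\<^sup>2)
    = r * (sqrt (2 * (q\<^sup>2 / r\<^sup>2) * (p\<^sup>2 / r\<^sup>2) / pi) * exp (- (q\<^sup>2 / r\<^sup>2 * (h / r)\<^sup>2 / (2 * (p\<^sup>2 / r\<^sup>2)))))"
  proof -
    have "sqrt (2 * (q\<^sup>2 / r\<^sup>2) * (p\<^sup>2 / r\<^sup>2) / pi) = sqrt (2 * (q / r)\<^sup>2 * (p / r)\<^sup>2 / pi)"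
      by (simp add: power_divide)
    also have "\<dots> = sqrt 2 * (q / r) * (p / r) / sqrt pi"
      unfolding real_sqrt_mult real_sqrt_divide using p(1) q(1) r(1) by simp
    finally have "sqrt (2 * (q\<^sup>2 / r\<^sup>2) * (p\<^sup>2 / r\<^sup>2) / pi) = sqrt 2 * (q / r) * (p / r) / sqrt pi" .
    moreover have "2 * (p * q / r)\<^sup>2 / (sqrt 2 * sqrt pi * (p * q / r)) = r * (sqrt 2 * (q / r) * (p / r) / sqrt pi)"
    proof -
      have "2 = sqrt 2 * sqrt (2::real)" by simp
      then have "2 * X\<^sup>2 / (sqrt 2 * sqrt pi * X) = sqrt 2 * X / sqrt pi" if "X > 0" for X
        using that by (simp add: field_simps power2_eq_square)
      from this[OF pq] show ?thesis using r by simp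
    qed
    moreover have "2 * Y\<^sup>2 * (E / (sqrt 2 * sqrt pi * Y)) = 2 * Y\<^sup>2 / (sqrt 2 * sqrt pi * Y) * E" for Y E :: real
      by (simp only: times_divide_eq_right times_divide_eq_left)
    ultimately show ?thesis unfolding gauss_def rt(2)[OF pq] e by (simp only: mult.assoc)
  qed
  have c: "h * q\<^sup>2 / r\<^sup>2 + (p * q / r)\<^sup>2 / (h * q\<^sup>2 / r\<^sup>2) = r * (1 / (h / r) * (p\<^sup>2 / r\<^sup>2 + q\<^sup>2 / r\<^sup>2 * (h / r)\<^sup>2))"
    using p(1) q(1) r(1) assms(3) by (simp add: field_simps power2_eq_square)
  define z where "z = 1 - t / \<theta>"
  have "M1 z (h / r) = 1 / (h / r) * (1 - z + z * (h / r)\<^sup>2) * erf (h / r * sqrt z / sqrt (2 * (1 - z)))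
     + sqrt (2 * z * (1 - z) / pi) * exp (- (z * (h / r)\<^sup>2 / (2 * (1 - z))))"
    using assms by (simp add: M1_def z_def)
  also have "1 - z = p\<^sup>2 / r\<^sup>2" using s by (simp add: z_def)
  also have "z = q\<^sup>2 / r\<^sup>2" using s by (simp add: z_def)
  finally have "M1 (1 - t / \<theta>) (h / sqrt \<theta>) = 1 / (h / r) * (p\<^sup>2 / r\<^sup>2 + q\<^sup>2 / r\<^sup>2 * (h / r)\<^sup>2) * erf (h / r * sqrt (q\<^sup>2 / r\<^sup>2) / sqrt (2 * (p\<^sup>2 / r\<^sup>2)))
     + sqrt (2 * (q\<^sup>2 / r\<^sup>2) * (p\<^sup>2 / r\<^sup>2) / pi) * exp (- (q\<^sup>2 / r\<^sup>2 * (h / r)\<^sup>2 / (2 * (p\<^sup>2 / r\<^sup>2))))"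
    using s(1) by (simp only: z_def r_def[symmetric])
  then show ?thesis
    unfolding bessel_mean_def v g a c r_def[symmetric] by (simp only: distrib_left distrib_right mult.assoc)
qed

text \<open>The bracket is \<open>Vr\<close> before the square of \<open>M1\<close> is
  subtracted.\<close>

lemma bessel_second_moment_eq:
  assumes "0 < \<theta>" "0 < h"
  shows "(h * (\<theta> - t) / \<theta>)\<^sup>2 + 3 * (t * (\<theta> - t) / \<theta>)
    = \<theta> * (3 * (1 - t / \<theta>) * (1 - (1 - t / \<theta>)) + (h / sqrt \<theta>)\<^sup>2 * (1 - t / \<theta>)\<^sup>2)"
  using assms by (simp add: power_divide divide_simps)

section \<open>After the maximum\<close>

text \<open>For \<open>a = t - \<theta>\<close> and \<open>b = 1 - t\<close>, the density of \<open>h - B(t)\<close> given \<open>\<theta>\<close> and \<open>h\<close> when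
  \<open>t > \<theta>\<close>.\<close>

definition post_density :: "real \<Rightarrow> real \<Rightarrow> real \<Rightarrow> real" where
  "post_density a b x = (if 0 < x then sqrt (2 * pi * (a + b)) / a * x * gauss a x * erf (x / sqrt (2 * b)) else 0)"

text \<open>Integration by parts: \<open>P * gauss a\<close> integrates \<open>q * gauss a\<close>,
  and the derivative of the \<open>erf\<close> factor is a Gaussian of variance \<open>b\<close>,
  which merges with \<open>gauss a\<close> into one of variance \<open>a * b / (a + b)\<close>.
  \<open>Q\<close> and \<open>k\<close> integrate what is left.\<close>

lemma gauss_erf_product_antiderivative:
  assumes a: "a > 0" and b: "b > 0"
    and P: "(P has_real_derivative P') (at x)" "P' - P x * x / a = q"
    and Q: "(Q has_real_derivative Q') (at x)" "Q' - Q x * (x * (a + b) / (a * b)) + k = - (2 * gauss (a + b) 0 * P x)"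
  shows "((\<lambda>x. P x * gauss a x * erf (x / sqrt (2 * b)) + (Q x * gauss (a * b / (a + b)) x + k * (erf (x / sqrt (2 * (a * b / (a + b)))) / 2)))
     has_real_derivative q * gauss a x * erf (x / sqrt (2 * b))) (at x)"
proof -
  define c where "c = a * b / (a + b)"
  have c: "c > 0" using a b by (simp add: c_def)
  have 1: "((\<lambda>x. P x * gauss a x) has_real_derivative q * gauss a x) (at x)"
    using DERIV_mult[OF P(1) gauss_has_real_derivative[OF DERIV_ident a]]
    by (rule DERIV_cong) (simp add: P(2)[symmetric] algebra_simps)
  have 2: "((\<lambda>x. erf (x / sqrt (2 * b))) has_real_derivative 2 * gauss b x) (at x)"
    using DERIV_cmult[OF erf_scaled_has_real_derivative[OF b, of 0], of 2] by simp
  have xc: "x / c = x * (a + b) / (a * b)" using a b by (simp add: c_def)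
  have QQ: "Q' - Q x * (x - 0) / c + k = - (2 * gauss (a + b) 0 * P x)"
    using Q(2) unfolding xc[symmetric] by simp
  have 3: "((\<lambda>x. Q x * gauss c x + k * (erf (x / sqrt (2 * c)) / 2)) has_real_derivative - (2 * gauss (a + b) 0 * P x) * gauss c x) (at x)"
    using gauss_erf_antiderivative[OF c Q(1), of 0 k "- (2 * gauss (a + b) 0 * P x)"] QQ by simp
  have prod: "gauss a x * gauss b x = gauss (a + b) 0 * gauss c x"
    using gauss_mult_gauss[OF a b, of 0 x 0] by (simp add: c_def)
  from DERIV_add[OF DERIV_mult[OF 1 2] 3] show ?thesis
    unfolding c_def[symmetric]
  proof (rule DERIV_cong)
    have "P x * (gauss a x * gauss b x) = P x * (gauss (a + b) 0 * gauss c x)" unfolding prod ..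
    then show "q * gauss a x * erf (x / sqrt (2 * b)) + 2 * gauss b x * (P x * gauss a x) + - (2 * gauss (a + b) 0 * P x) * gauss c x
       = q * gauss a x * erf (x / sqrt (2 * b))"
      by (simp add: algebra_simps)
  qed
qed

text \<open>For even \<open>q\<close> the factor \<open>x * q x\<close> is odd, so its Gaussian
  antiderivative contains no \<open>erf\<close> and the integration by parts closes. For the mean it
  would leave a product of an error function and a Gaussian, which is why that case is treated
  separately.\<close>

lemma post_density_even_moment:
  assumes a: "a > 0" and b: "b > 0"
    and P: "\<And>x. (P has_real_derivative P' x) (at x)" "\<And>x. P' x - P x * x / a = x * q x"
    and Q: "\<And>x. Q' x - Q x * (x * (a + b) / (a * b)) + k = - (2 * gauss (a + b) 0 * P x)" "\<And>x. (Q has_real_derivative Q' x) (at x)"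
    and quad: "\<And>y. P y = pa * y ^ 2 + pd" "\<And>y. Q y = qa * y"
    and q: "\<And>x. x > 0 \<Longrightarrow> 0 \<le> q x" "\<And>x. isCont q x"
  shows "(\<integral>\<^sup>+x. ennreal (q x) * ennreal (post_density a b x) \<partial>lborel) = ennreal (sqrt (2 * pi * (a + b)) / a * (k / 2))"
proof -
  define c where "c = a * b / (a + b)"
  have c: "c > 0" using a b by (simp add: c_def)
  let ?K = "sqrt (2 * pi * (a + b)) / a"
  let ?F = "\<lambda>x. ?K * (P x * gauss a x * erf (x / sqrt (2 * b)) + (Q x * gauss c x + k * (erf (x / sqrt (2 * c)) / 2)))"
  have "(\<integral>\<^sup>+x. ennreal (q x) * ennreal (post_density a b x) \<partial>lborel)
     = (\<integral>\<^sup>+x. ennreal (?K * (x * q x * gauss a x * erf (x / sqrt (2 * b)))) * indicator {0<..} x \<partial>lborel)"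
    using q by (intro nn_integral_cong) (auto simp: post_density_def ennreal_mult'[symmetric] algebra_simps split: split_indicator)
  also have "\<dots> = ennreal (?K * (0 * 1 + k / 2) - ?F 0)"
  proof (rule nn_integral_FTC_Ioi')
    show "(?F has_real_derivative ?K * (x * q x * gauss a x * erf (x / sqrt (2 * b)))) (at x)" for x
      unfolding c_def by (rule DERIV_cmult[OF gauss_erf_product_antiderivative[OF a b P(1) P(2) Q(2) Q(1)]])
    show "isCont (\<lambda>x. ?K * (x * q x * gauss a x * erf (x / sqrt (2 * b)))) x" for x
      by (intro continuous_intros q) (use b in auto)
    show "0 \<le> ?K * (x * q x * gauss a x * erf (x / sqrt (2 * b)))" if "0 < x" for x
      using a b q(1)[OF that] that by (auto intro!: mult_nonneg_nonneg divide_nonneg_nonneg gauss_nonneg erf_nonneg)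
    have "((\<lambda>x. P x * gauss a (x - 0) + 0 * (erf ((x - 0) / sqrt (2 * a)) / 2)) \<longlongrightarrow> 0 / 2) at_top"
      by (rule gauss_antiderivative_tendsto[OF a, where a = pa and b = 0 and d = pd]) (simp add: quad)
    then have 1: "((\<lambda>x. P x * gauss a x) \<longlongrightarrow> 0) at_top" by simp
    have "((\<lambda>x. Q x * gauss c (x - 0) + k * (erf ((x - 0) / sqrt (2 * c)) / 2)) \<longlongrightarrow> k / 2) at_top"
      by (rule gauss_antiderivative_tendsto[OF c, where a = 0 and b = qa and d = 0]) (simp add: quad)
    then have 2: "((\<lambda>x. Q x * gauss c x + k * (erf (x / sqrt (2 * c)) / 2)) \<longlongrightarrow> k / 2) at_top" by simp
    have 3: "((\<lambda>x. erf (x / sqrt (2 * b))) \<longlongrightarrow> 1) at_top"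
      using erf_scaled_tendsto[OF b, of 0] by simp
    show "(?F \<longlongrightarrow> ?K * (0 * 1 + k / 2)) at_top"
      by (intro tendsto_intros 1 2 3)
  qed
  also have "?F 0 = 0" by (simp add: quad)
  finally show ?thesis by simp
qed

lemma nn_integral_post_density:
  assumes a: "a > 0" and b: "b > 0"
  shows "(\<integral>\<^sup>+x. ennreal (post_density a b x) \<partial>lborel) = 1"
    and "(\<integral>\<^sup>+x. ennreal (x\<^sup>2) * ennreal (post_density a b x) \<partial>lborel) = ennreal (a * b / (a + b) + 2 * a)"
proof -
  have g: "gauss (a + b) 0 * sqrt (2 * pi * (a + b)) = 1"
    using a b by (simp add: gauss_def)
  have "(\<integral>\<^sup>+x. ennreal 1 * ennreal (post_density a b x) \<partial>lborel) = ennreal (sqrt (2 * pi * (a + b)) / a * (2 * a * gauss (a + b) 0 / 2))"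
    by (rule post_density_even_moment[OF a b, where P = "\<lambda>x. - a" and P' = "\<lambda>x. 0" and Q = "\<lambda>x. 0" and Q' = "\<lambda>x. 0" and qa = 0 and pa = 0 and pd = "- a"])
      (use a in \<open>auto intro!: derivative_eq_intros\<close>)
  also have "sqrt (2 * pi * (a + b)) / a * (2 * a * gauss (a + b) 0 / 2) = gauss (a + b) 0 * sqrt (2 * pi * (a + b))"
    using a by simp
  finally show "(\<integral>\<^sup>+x. ennreal (post_density a b x) \<partial>lborel) = 1"
    unfolding g by simp
  define c where "c = a * b / (a + b)"
  have c: "c > 0" using a b by (simp add: c_def)
  have xc: "x * (a + b) / (a * b) = x / c" for x using a b by (simp add: c_def)
  \<comment> \<open>The linear \<open>Q\<close> and the constant
    \<open>k = 2 * a * g * (c + 2 * a)\<close> come from comparing the coefficients of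
    \<open>x\<^sup>2\<close> and 1 in the condition on \<open>Q\<close>.\<close>
  have Qc: "- (2 * a * g * c) - - (2 * a * g * c * x) * (x * (a + b) / (a * b)) + 2 * a * g * (c + 2 * a) = - (2 * g * (- a * (x\<^sup>2 + 2 * a)))" for x g
    unfolding xc using c by (simp add: field_simps power2_eq_square)
  have "(\<integral>\<^sup>+x. ennreal (x\<^sup>2) * ennreal (post_density a b x) \<partial>lborel) = ennreal (sqrt (2 * pi * (a + b)) / a * (2 * a * gauss (a + b) 0 * (c + 2 * a) / 2))"
  proof (rule post_density_even_moment[OF a b])
    show "((\<lambda>x. - a * (x\<^sup>2 + 2 * a)) has_real_derivative - a * (2 * x)) (at x)" for x
      by (auto intro!: derivative_eq_intros)
    show "- a * (2 * x) - - a * (x\<^sup>2 + 2 * a) * x / a = x * x\<^sup>2" for x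
      using a by (simp add: field_simps power2_eq_square)
    show "((\<lambda>x. - (2 * a * gauss (a + b) 0 * c * x)) has_real_derivative - (2 * a * gauss (a + b) 0 * c)) (at x)" for x
      by (auto intro!: derivative_eq_intros)
    show "- a * (x\<^sup>2 + 2 * a) = - a * x ^ 2 + - 2 * a\<^sup>2" for x
      by (simp add: algebra_simps power2_eq_square)
    show "- (2 * a * gauss (a + b) 0 * c * x) = - (2 * a * gauss (a + b) 0 * c) * x" for x
      by simp
    show "isCont (\<lambda>x. x\<^sup>2) x" for x :: real
      by (intro continuous_intros)
  qed (use Qc in auto)
  also have "sqrt (2 * pi * (a + b)) / a * (2 * a * gauss (a + b) 0 * (c + 2 * a) / 2) = gauss (a + b) 0 * sqrt (2 * pi * (a + b)) * (c + 2 * a)"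
    using a by simp
  finally show "(\<integral>\<^sup>+x. ennreal (x\<^sup>2) * ennreal (post_density a b x) \<partial>lborel) = ennreal (a * b / (a + b) + 2 * a)"
    unfolding g c_def by simp
qed


section \<open>The mean after the maximum and the integral of \<open>M1\<close>\<close>

text \<open>The error function is written as an integral of Gaussians over a range of
  \<open>z\<close> that does not depend on \<open>x\<close>. After the exchange the inner integral
  is elementary for odd powers of \<open>x\<close> and leaves a rational function of
  \<open>z\<close>; this is where the arctangent of \<open>G11\<close> comes from.\<close>

lemma nn_integral_erf_fubini:
  assumes b: "b > 0" and [measurable]: "f \<in> borel_measurable borel" and f: "\<And>x. x > 0 \<Longrightarrow> 0 \<le> f x"
  shows "(\<integral>\<^sup>+x. ennreal (f x * erf (x / sqrt (2 * b))) * indicator {0<..} x \<partial>lborel)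
     = (\<integral>\<^sup>+z. (\<integral>\<^sup>+x. ennreal (2 * x * f x * gauss 1 (x * z)) * indicator {0<..} x \<partial>lborel) * indicator {0..1 / sqrt b} z \<partial>lborel)"
proof -
  have 1: "ennreal (f x * erf (x / sqrt (2 * b))) * indicator {0<..} x
    = (\<integral>\<^sup>+z. ennreal (2 * x * f x * gauss 1 (x * z)) * indicator {0<..} x * indicator {0..1 / sqrt b} z \<partial>lborel)" for x
  proof (cases "x > 0")
    case True
    have "(\<integral>\<^sup>+z. ennreal (2 * x * f x * gauss 1 (x * z)) * indicator {0..1 / sqrt b} z \<partial>lborel)
       = ennreal (f x * erf (x * (1 / sqrt b) / sqrt 2) - f x * erf (x * 0 / sqrt 2))"
    proof (rule nn_integral_FTC_Icc[where F = "\<lambda>z. f x * erf (x * z / sqrt 2)"])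
      show "((\<lambda>z. f x * erf (x * z / sqrt 2)) has_real_derivative 2 * x * f x * gauss 1 (x * z)) (at z)" for z
        unfolding gauss_def
        by (auto intro!: derivative_eq_intros simp: power_divide real_sqrt_mult field_simps)
    qed (use True f[OF True] b in \<open>auto simp: gauss_nonneg\<close>)
    then show ?thesis using True by (simp add: real_sqrt_mult mult.commute)
  qed simp
  have "(\<integral>\<^sup>+x. ennreal (f x * erf (x / sqrt (2 * b))) * indicator {0<..} x \<partial>lborel)
     = (\<integral>\<^sup>+z. \<integral>\<^sup>+x. ennreal (2 * x * f x * gauss 1 (x * z)) * indicator {0<..} x * indicator {0..1 / sqrt b} z \<partial>lborel \<partial>lborel)"
    unfolding 1 by (rule lborel_pair.Fubini') measurable
  also have "\<dots> = (\<integral>\<^sup>+z. (\<integral>\<^sup>+x. ennreal (2 * x * f x * gauss 1 (x * z)) * indicator {0<..} x \<partial>lborel) * indicator {0..1 / sqrt b} z \<partial>lborel)"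
    by (intro nn_integral_cong nn_integral_multc) measurable
  finally show ?thesis .
qed

lemma nn_integral_x_exp:
  assumes "A > 0"
  shows "(\<integral>\<^sup>+x. ennreal (x * exp (- (A * x\<^sup>2 / 2))) * indicator {0<..} x \<partial>lborel) = ennreal (1 / A)"
    and "(\<integral>\<^sup>+x. ennreal (x ^ 3 * exp (- (A * x\<^sup>2 / 2))) * indicator {0<..} x \<partial>lborel) = ennreal (2 / A\<^sup>2)"
proof -
  have "(\<integral>\<^sup>+x. ennreal (x * exp (- (A * x\<^sup>2 / 2))) * indicator {0<..} x \<partial>lborel) = ennreal (0 - (- (exp (- (A * 0\<^sup>2 / 2)) / A)))"
  proof (rule nn_integral_FTC_Ioi')
    show "((\<lambda>x. - (exp (- (A * x\<^sup>2 / 2)) / A)) has_real_derivative x * exp (- (A * x\<^sup>2 / 2))) (at x)" for x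
      using assms by (auto intro!: derivative_eq_intros simp: field_simps)
    show "((\<lambda>x. - (exp (- (A * x\<^sup>2 / 2)) / A)) \<longlongrightarrow> 0) at_top"
      using assms by real_asymp
  qed (auto intro!: continuous_intros)
  then show "(\<integral>\<^sup>+x. ennreal (x * exp (- (A * x\<^sup>2 / 2))) * indicator {0<..} x \<partial>lborel) = ennreal (1 / A)" by simp
  have "(\<integral>\<^sup>+x. ennreal (x ^ 3 * exp (- (A * x\<^sup>2 / 2))) * indicator {0<..} x \<partial>lborel) = ennreal (0 - (- ((0\<^sup>2 / A + 2 / A\<^sup>2) * exp (- (A * 0\<^sup>2 / 2)))))"
  proof (rule nn_integral_FTC_Ioi')
    show "((\<lambda>x. - ((x\<^sup>2 / A + 2 / A\<^sup>2) * exp (- (A * x\<^sup>2 / 2)))) has_real_derivative x ^ 3 * exp (- (A * x\<^sup>2 / 2))) (at x)" for x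
      using assms by (auto intro!: derivative_eq_intros simp: field_simps power2_eq_square power3_eq_cube)
    show "((\<lambda>x. - ((x\<^sup>2 / A + 2 / A\<^sup>2) * exp (- (A * x\<^sup>2 / 2)))) \<longlongrightarrow> 0) at_top"
      using assms by real_asymp
  qed (auto intro!: continuous_intros)
  then show "(\<integral>\<^sup>+x. ennreal (x ^ 3 * exp (- (A * x\<^sup>2 / 2))) * indicator {0<..} x \<partial>lborel) = ennreal (2 / A\<^sup>2)" by simp
qed

lemma gauss_mult_gauss_one:
  assumes "a > 0"
  shows "gauss a x * gauss 1 (x * z) = exp (- ((1 / a + z\<^sup>2) * x\<^sup>2 / 2)) / (2 * pi * sqrt a)"
proof -
  have "sqrt (2 * pi * a) * sqrt (2 * pi * 1) = sqrt ((2 * pi)\<^sup>2 * a)"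
    unfolding real_sqrt_mult[symmetric] by (simp add: power2_eq_square)
  also have "\<dots> = 2 * pi * sqrt a"
    by (simp add: real_sqrt_mult del: real_sqrt_mult_self)
  finally have "sqrt (2 * pi * a) * sqrt (2 * pi * 1) = 2 * pi * sqrt a" .
  moreover have "x\<^sup>2 / (2 * a) + (x * z)\<^sup>2 / (2 * 1) = (1 / a + z\<^sup>2) * x\<^sup>2 / 2"
    using assms by (simp add: field_simps)
  ultimately show ?thesis
    by (simp only: gauss_def times_divide_times_eq exp_add[symmetric] minus_add_distrib[symmetric])
qed

lemma nn_integral_gauss_erf_0:
  assumes a: "a > 0" and b: "b > 0"
  shows "(\<integral>\<^sup>+x. ennreal (gauss a x * erf (x / sqrt (2 * b))) * indicator {0<..} x \<partial>lborel)
    = ennreal (arctan (sqrt (a / b)) / pi)"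
proof -
  define r where "r = sqrt a"
  have r: "r > 0" "a = r\<^sup>2" using a by (auto simp: r_def)
  have inner: "(\<integral>\<^sup>+x. ennreal (2 * x * gauss a x * gauss 1 (x * z)) * indicator {0<..} x \<partial>lborel)
     = ennreal (r / (pi * (1 + (r * z)\<^sup>2)))" for z
  proof -
    have A: "1 / a + z\<^sup>2 > 0" using a by (simp add: add_pos_nonneg)
    have "(\<integral>\<^sup>+x. ennreal (2 * x * gauss a x * gauss 1 (x * z)) * indicator {0<..} x \<partial>lborel)
      = (\<integral>\<^sup>+x. ennreal (1 / (pi * r)) * (ennreal (x * exp (- ((1 / a + z\<^sup>2) * x\<^sup>2 / 2))) * indicator {0<..} x) \<partial>lborel)"
      unfolding mult.assoc gauss_mult_gauss_one[OF a] r_def[symmetric] using r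
      by (intro nn_integral_cong) (auto simp: ennreal_mult'[symmetric] split: split_indicator)
    also have "\<dots> = ennreal (1 / (pi * r) * (1 / (1 / a + z\<^sup>2)))"
      using A r(1) by (subst nn_integral_cmult) (simp_all add: nn_integral_x_exp[OF A] ennreal_mult'[symmetric])
    also have "1 / a + z\<^sup>2 = (1 + (r * z)\<^sup>2) / r\<^sup>2"
      using r(1) unfolding r(2) by (simp add: field_simps)
    also have "1 / (pi * r) * (1 / ((1 + (r * z)\<^sup>2) / r\<^sup>2)) = r / (pi * (1 + (r * z)\<^sup>2))"
    proof -
      have "1 / (pi * r) * (1 / (W / r\<^sup>2)) = r / (pi * W)" for W
        using r(1) by (simp add: power2_eq_square)
      then show ?thesis .
    qed
    finally show ?thesis .
  qed
  have "(\<integral>\<^sup>+x. ennreal (gauss a x * erf (x / sqrt (2 * b))) * indicator {0<..} x \<partial>lborel)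
     = (\<integral>\<^sup>+z. ennreal (r / (pi * (1 + (r * z)\<^sup>2))) * indicator {0..1 / sqrt b} z \<partial>lborel)"
    unfolding inner[symmetric] using b by (intro nn_integral_erf_fubini) (auto simp: gauss_nonneg a less_imp_le)
  also have "\<dots> = ennreal (arctan (r * (1 / sqrt b)) / pi - arctan (r * 0) / pi)"
  proof (rule nn_integral_FTC_Icc[where F = "\<lambda>z. arctan (r * z) / pi"])
    show "((\<lambda>z. arctan (r * z) / pi) has_real_derivative r / (pi * (1 + (r * z)\<^sup>2))) (at z)" for z
    proof -
      have "((\<lambda>z. arctan (r * z)) has_real_derivative inverse (1 + (r * z)\<^sup>2) * r) (at z)"
        by (rule DERIV_chain2[OF DERIV_arctan DERIV_cmult_Id])
      moreover have "inverse W * r / pi = r / (pi * W)" for W by (simp add: divide_inverse)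
      ultimately show ?thesis using DERIV_cdivide[of "\<lambda>z. arctan (r * z)"] by metis
    qed
  qed (use r b in \<open>auto intro!: divide_nonneg_nonneg\<close>)
  finally show ?thesis using a by (simp add: r_def real_sqrt_divide)
qed

lemma nn_integral_gauss_erf_2:
  assumes a: "a > 0" and b: "b > 0"
  shows "(\<integral>\<^sup>+x. ennreal (x\<^sup>2 * gauss a x * erf (x / sqrt (2 * b))) * indicator {0<..} x \<partial>lborel)
    = ennreal (a / pi * (arctan (sqrt (a / b)) + sqrt (a * b) / (a + b)))"
proof -
  define r where "r = sqrt a"
  have r: "r > 0" "a = r\<^sup>2" using a by (auto simp: r_def)
  have pos: "1 + (r * z)\<^sup>2 > 0" for z by (simp add: add_pos_nonneg)
  have inner: "(\<integral>\<^sup>+x. ennreal (2 * x * (x\<^sup>2 * gauss a x) * gauss 1 (x * z)) * indicator {0<..} x \<partial>lborel)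
     = ennreal (2 * r ^ 3 / (pi * (1 + (r * z)\<^sup>2)\<^sup>2))" for z
  proof -
    have A: "1 / a + z\<^sup>2 > 0" using a by (simp add: add_pos_nonneg)
    have "2 * x * (x\<^sup>2 * gauss a x) * gauss 1 (x * z) = 1 / (pi * r) * (x ^ 3 * exp (- ((1 / a + z\<^sup>2) * x\<^sup>2 / 2)))" for x
    proof -
      have "2 * x * (x\<^sup>2 * gauss a x) * gauss 1 (x * z) = 2 * x ^ 3 * (gauss a x * gauss 1 (x * z))"
        by (simp add: power2_eq_square power3_eq_cube)
      then show ?thesis unfolding gauss_mult_gauss_one[OF a] r_def[symmetric] by simp
    qed
    then have "(\<integral>\<^sup>+x. ennreal (2 * x * (x\<^sup>2 * gauss a x) * gauss 1 (x * z)) * indicator {0<..} x \<partial>lborel)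
      = (\<integral>\<^sup>+x. ennreal (1 / (pi * r)) * (ennreal (x ^ 3 * exp (- ((1 / a + z\<^sup>2) * x\<^sup>2 / 2))) * indicator {0<..} x) \<partial>lborel)"
      using r by (intro nn_integral_cong) (auto simp: ennreal_mult'[symmetric] split: split_indicator)
    also have "\<dots> = ennreal (1 / (pi * r) * (2 / (1 / a + z\<^sup>2)\<^sup>2))"
      using A r(1) by (subst nn_integral_cmult) (simp_all add: nn_integral_x_exp[OF A] ennreal_mult'[symmetric])
    also have "1 / a + z\<^sup>2 = (1 + (r * z)\<^sup>2) / r\<^sup>2"
      using r(1) unfolding r(2) by (simp add: field_simps)
    also have "1 / (pi * r) * (2 / ((1 + (r * z)\<^sup>2) / r\<^sup>2)\<^sup>2) = 2 * r ^ 3 / (pi * (1 + (r * z)\<^sup>2)\<^sup>2)"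
      using r(1) pos[of z] by (simp add: power_divide) (simp add: eval_nat_numeral)
    finally show ?thesis .
  qed
  have "(\<integral>\<^sup>+x. ennreal (x\<^sup>2 * gauss a x * erf (x / sqrt (2 * b))) * indicator {0<..} x \<partial>lborel)
     = (\<integral>\<^sup>+z. ennreal (2 * r ^ 3 / (pi * (1 + (r * z)\<^sup>2)\<^sup>2)) * indicator {0..1 / sqrt b} z \<partial>lborel)"
    unfolding inner[symmetric] using b by (intro nn_integral_erf_fubini) (auto simp: gauss_nonneg a less_imp_le)
  also have "\<dots> = ennreal (r\<^sup>2 / pi * (arctan (r * (1 / sqrt b)) + r * (1 / sqrt b) / (1 + (r * (1 / sqrt b))\<^sup>2))
       - r\<^sup>2 / pi * (arctan (r * 0) + r * 0 / (1 + (r * 0)\<^sup>2)))"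
  proof (rule nn_integral_FTC_Icc[where F = "\<lambda>z. r\<^sup>2 / pi * (arctan (r * z) + r * z / (1 + (r * z)\<^sup>2))"])
    show "((\<lambda>z. r\<^sup>2 / pi * (arctan (r * z) + r * z / (1 + (r * z)\<^sup>2))) has_real_derivative 2 * r ^ 3 / (pi * (1 + (r * z)\<^sup>2)\<^sup>2)) (at z)" for z
    proof -
      have "((\<lambda>z. r\<^sup>2 / pi * (arctan (r * z) + r * z / (1 + (r * z)\<^sup>2))) has_real_derivative
         r\<^sup>2 / pi * (r / (1 + (r * z)\<^sup>2) + (r * (1 + (r * z)\<^sup>2) - r * z * (2 * (r * z) * r)) / (1 + (r * z)\<^sup>2)\<^sup>2)) (at z)"
        using pos[of z] by (auto intro!: derivative_eq_intros simp: power2_eq_square inverse_eq_divide)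
      moreover have "r\<^sup>2 / pi * (r / (1 + (r * z)\<^sup>2) + (r * (1 + (r * z)\<^sup>2) - r * z * (2 * (r * z) * r)) / (1 + (r * z)\<^sup>2)\<^sup>2)
         = 2 * r ^ 3 / (pi * (1 + (r * z)\<^sup>2)\<^sup>2)"
      proof -
        define w where "w = 1 + (r * z)\<^sup>2"
        have "(r * z)\<^sup>2 = w - 1" by (simp add: w_def)
        moreover have "r * z * (2 * (r * z) * r) = 2 * (r * z)\<^sup>2 * r" by (simp add: power2_eq_square)
        ultimately have rz: "r * z * (2 * (r * z) * r) = 2 * (w - 1) * r" by simp
        have w: "w > 0" using pos[of z] by (simp add: w_def)
        then have "r / w = r * w / w\<^sup>2" by (simp add: power2_eq_square)
        moreover have "r * w / w\<^sup>2 + (r * w - 2 * (w - 1) * r) / w\<^sup>2 = 2 * r / w\<^sup>2"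
          unfolding add_divide_distrib[symmetric] by (simp add: algebra_simps)
        ultimately show ?thesis
          unfolding w_def[symmetric] rz by (simp add: power2_eq_square power3_eq_cube)
      qed
      ultimately show ?thesis by simp
    qed
  qed (use r b in \<open>auto intro!: divide_nonneg_nonneg\<close>)
  also have "r * (1 / sqrt b) / (1 + (r * (1 / sqrt b))\<^sup>2) = sqrt (a * b) / (a + b)"
  proof -
    define p where "p = sqrt b"
    have p: "p > 0" "b = p\<^sup>2" using b by (auto simp: p_def)
    show ?thesis unfolding real_sqrt_mult r_def[symmetric] p_def[symmetric] r(2) p(2)
      using r(1) p(1) by (simp add: field_simps power2_eq_square)
  qed
  finally show ?thesis using a by (simp add: r_def real_sqrt_divide)
qed

lemma nn_integral_post_density_1:
  assumes a: "a > 0" and b: "b > 0"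
  shows "(\<integral>\<^sup>+x. ennreal x * ennreal (post_density a b x) \<partial>lborel)
    = ennreal (sqrt (a + b) * (sqrt (2 / pi) * (arctan (sqrt (a / b)) + sqrt (a * b) / (a + b))))"
proof -
  have "(\<integral>\<^sup>+x. ennreal x * ennreal (post_density a b x) \<partial>lborel)
     = (\<integral>\<^sup>+x. ennreal (sqrt (2 * pi * (a + b)) / a) * (ennreal (x\<^sup>2 * gauss a x * erf (x / sqrt (2 * b))) * indicator {0<..} x) \<partial>lborel)"
  proof (intro nn_integral_cong)
    fix x :: real
    define K where "K = sqrt (2 * pi * (a + b)) / a"
    have K: "0 \<le> K" using a b by (simp add: K_def)
    show "ennreal x * ennreal (post_density a b x)
      = ennreal K * (ennreal (x\<^sup>2 * gauss a x * erf (x / sqrt (2 * b))) * indicator {0<..} x)"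
    proof (cases "x > 0")
      case True
      then have "x * post_density a b x = K * (x\<^sup>2 * gauss a x * erf (x / sqrt (2 * b)))"
        by (simp add: post_density_def K_def[symmetric] power2_eq_square)
      with True show ?thesis
        using K by (simp add: ennreal_mult'[symmetric])
    qed (simp add: post_density_def)
  qed
  also have "\<dots> = ennreal (sqrt (2 * pi * (a + b)) / a * (a / pi * (arctan (sqrt (a / b)) + sqrt (a * b) / (a + b))))"
    using a b by (subst nn_integral_cmult) (simp_all add: nn_integral_gauss_erf_2 ennreal_mult'[symmetric])
  also have "sqrt (2 * pi * (a + b)) / a * (a / pi * X) = sqrt (a + b) * (sqrt (2 / pi) * X)" for X
  proof -
    define k where "k = sqrt pi"
    have k: "k > 0" "pi = k\<^sup>2" by (auto simp: k_def)
    have "sqrt (2 * pi * (a + b)) = sqrt 2 * k * sqrt (a + b)" "sqrt (2 / pi) = sqrt 2 / k"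
      by (simp_all only: real_sqrt_mult real_sqrt_divide k_def)
    then show ?thesis unfolding k(2) using a k(1) by (simp add: power2_eq_square)
  qed
  finally show ?thesis .
qed

lemma ennreal_linear_combination3:
  assumes "0 \<le> u" "0 \<le> v" "0 \<le> w" "0 \<le> X" "0 \<le> Y" "0 \<le> Z"
  shows "ennreal u * ennreal X + ennreal v * ennreal Y + ennreal w * ennreal Z = ennreal (u * X + v * Y + w * Z)"
  using assms by (simp add: ennreal_mult')

text \<open>The weight \<open>x * exp (- x\<^sup>2 / 2)\<close> is the Rayleigh density, the law of
  the distance from the maximum to the endpoint divided by \<open>sqrt (1 - \<theta>)\<close>. So
  the integral averages the mean of a Bessel bridge, run from the maximum to the endpoint, over that
  endpoint. The proof evaluates it directly.\<close>

lemma nn_integral_M1: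
  assumes s: "0 < s" "s < 1"
  shows "(\<integral>\<^sup>+x. ennreal (x * M1 s x * exp (- x\<^sup>2 / 2)) * indicator {0<..} x \<partial>lborel) = ennreal (G11 s)"
proof -
  \<comment> \<open>With this \<open>b\<close> the argument of \<open>erf\<close> in
    \<open>M1\<close> becomes \<open>x / sqrt (2 * b)\<close>, and the integrals above apply with
    \<open>a = 1\<close>.\<close>
  define b where "b = (1 - s) / s"
  have b: "b > 0" using s by (simp add: b_def)
  define C where "C = sqrt (2 * s * (1 - s) / pi)"
  have C: "C \<ge> 0" using s by (simp add: C_def)
  have arg: "x * sqrt s / sqrt (2 * (1 - s)) = x / sqrt (2 * b)" for x
    using s by (simp add: b_def real_sqrt_mult real_sqrt_divide)
  have ex: "exp (- (s * x\<^sup>2 / (2 * (1 - s)))) * exp (- x\<^sup>2 / 2) = exp (- (1 / (1 - s) * x\<^sup>2 / 2))" for x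
    unfolding exp_add[symmetric] using s by (simp add: field_simps)
  have g1: "exp (- x\<^sup>2 / 2) = sqrt (2 * pi) * gauss 1 x" for x by (simp add: gauss_def)
  have M1: "x * M1 s x * exp (- x\<^sup>2 / 2) = sqrt (2 * pi) * ((1 - s) * (gauss 1 x * erf (x / sqrt (2 * b)))
     + s * (x\<^sup>2 * gauss 1 x * erf (x / sqrt (2 * b)))) + C * (x * exp (- (1 / (1 - s) * x\<^sup>2 / 2)))" if "x > 0" for x
  proof -
    have "x * M1 s x * exp (- x\<^sup>2 / 2) = (1 - s + s * x\<^sup>2) * erf (x / sqrt (2 * b)) * exp (- x\<^sup>2 / 2)
      + C * (x * (exp (- (s * x\<^sup>2 / (2 * (1 - s)))) * exp (- x\<^sup>2 / 2)))"
    proof -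
      have "M1 s x = 1 / x * (1 - s + s * x\<^sup>2) * erf (x / sqrt (2 * b)) + C * exp (- (s * x\<^sup>2 / (2 * (1 - s))))"
        unfolding M1_def arg C_def using s by simp
      moreover have "x * (1 / x * A * e + C * E) * F = A * e * F + C * (x * (E * F))" for A e E F
        using that by (simp add: field_simps)
      ultimately show ?thesis by simp
    qed
    then show ?thesis unfolding ex unfolding g1 by (simp add: algebra_simps)
  qed
  let ?E = "\<lambda>x. erf (x / sqrt (2 * b))"
  have e: "?E x \<ge> 0" if "x > 0" for x using that b by (intro erf_nonneg) simp
  have "(\<integral>\<^sup>+x. ennreal (x * M1 s x * exp (- x\<^sup>2 / 2)) * indicator {0<..} x \<partial>lborel)
     = (\<integral>\<^sup>+x. ennreal (sqrt (2 * pi) * (1 - s)) * (ennreal (gauss 1 x * ?E x) * indicator {0<..} x)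
       + ennreal (sqrt (2 * pi) * s) * (ennreal (x\<^sup>2 * gauss 1 x * ?E x) * indicator {0<..} x)
       + ennreal C * (ennreal (x * exp (- (1 / (1 - s) * x\<^sup>2 / 2))) * indicator {0<..} x) \<partial>lborel)"
  proof (intro nn_integral_cong)
    fix x :: real
    show "ennreal (x * M1 s x * exp (- x\<^sup>2 / 2)) * indicator {0<..} x = ennreal (sqrt (2 * pi) * (1 - s)) * (ennreal (gauss 1 x * ?E x) * indicator {0<..} x)
       + ennreal (sqrt (2 * pi) * s) * (ennreal (x\<^sup>2 * gauss 1 x * ?E x) * indicator {0<..} x)
       + ennreal C * (ennreal (x * exp (- (1 / (1 - s) * x\<^sup>2 / 2))) * indicator {0<..} x)"
    proof (cases "x > 0")
      case True
      have eqr: "K * ((1 - s) * X + s * Y) + C * Z = K * (1 - s) * X + K * s * Y + C * Z" for K X Y Z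
        by (simp add: algebra_simps)
      have "ennreal (x * M1 s x * exp (- x\<^sup>2 / 2)) = ennreal (sqrt (2 * pi) * (1 - s)) * ennreal (gauss 1 x * ?E x)
         + ennreal (sqrt (2 * pi) * s) * ennreal (x\<^sup>2 * gauss 1 x * ?E x)
         + ennreal C * ennreal (x * exp (- (1 / (1 - s) * x\<^sup>2 / 2)))"
        unfolding M1[OF True] eqr using s C e[OF True] True
        by (intro ennreal_linear_combination3[symmetric]) (auto intro!: mult_nonneg_nonneg gauss_nonneg)
      then show ?thesis using True by (simp only: indicator_simps greaterThan_iff mult_1_right)
    qed simp
  qed
  also have "\<dots> = ennreal (sqrt (2 * pi) * (1 - s)) * ennreal (arctan (sqrt (1 / b)) / pi)
       + ennreal (sqrt (2 * pi) * s) * ennreal (1 / pi * (arctan (sqrt (1 / b)) + sqrt (1 * b) / (1 + b)))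
       + ennreal C * ennreal (1 / (1 / (1 - s)))"
    using b s nn_integral_gauss_erf_0[of 1 b] nn_integral_gauss_erf_2[of 1 b] nn_integral_x_exp(1)[of "1 / (1 - s)"]
    by (simp add: nn_integral_add nn_integral_cmult)
  \<comment> \<open>The arctangent occurs with the weights \<open>1 - s\<close> and
    \<open>s\<close>, which add up to 1.\<close>
  also have "\<dots> = ennreal (sqrt (2 * pi) / pi * arctan (sqrt (1 / b)) + (sqrt (2 * pi) * s / pi * (sqrt (1 * b) / (1 + b)) + C * (1 - s)))"
  proof -
    have "K * (1 - s) * (A / pi) + K * s * (1 / pi * (A + B)) + C * (1 / (1 / (1 - s))) = K / pi * A + (K * s / pi * B + C * (1 - s))" for K A B
      by (simp add: field_simps)
    then show ?thesis using b s C by (subst ennreal_linear_combination3) auto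
  qed
  also have "sqrt (2 * pi) / pi * arctan (sqrt (1 / b)) + (sqrt (2 * pi) * s / pi * (sqrt (1 * b) / (1 + b)) + C * (1 - s)) = G11 s"
  proof -
    define p where "p = sqrt s"
    define q where "q = sqrt (1 - s)"
    have p: "p > 0" "s = p\<^sup>2" and q: "q > 0" "1 - s = q\<^sup>2" using s by (auto simp: p_def q_def)
    have pq: "p\<^sup>2 + q\<^sup>2 = 1" using p q by simp
    have k: "sqrt (2 * pi) / pi = sqrt (2 / pi)"
    proof -
      have "sqrt pi / pi = 1 / sqrt pi" by (simp add: field_simps)
      then show ?thesis by (simp add: real_sqrt_mult real_sqrt_divide field_simps)
    qed
    have "sqrt (1 * b) / (1 + b) = p * q"
    proof -
      have "sqrt b = q / p" by (simp add: b_def real_sqrt_divide p_def q_def)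
      moreover have "1 + b = 1 / p\<^sup>2" using s by (simp add: b_def p(2)[symmetric] field_simps)
      ultimately show ?thesis using p(1) by (simp add: power2_eq_square)
    qed
    moreover have "C = sqrt (2 / pi) * (p * q)"
      by (simp add: C_def p_def q_def real_sqrt_mult real_sqrt_divide)
    moreover have "sqrt (2 * pi) * s / pi = sqrt (2 / pi) * s" using k by (metis times_divide_eq_left)
    ultimately have "sqrt (2 * pi) / pi * arctan (sqrt (1 / b)) + (sqrt (2 * pi) * s / pi * (sqrt (1 * b) / (1 + b)) + C * (1 - s))
      = sqrt (2 / pi) * (arctan (sqrt (1 / b)) + p * q)"
      unfolding k by (simp add: algebra_simps)
    moreover have "p * q = sqrt (s * (1 - s))" by (simp add: p_def q_def real_sqrt_mult)
    moreover have "1 / b = s / (1 - s)" by (simp add: b_def)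
    ultimately show ?thesis using s by (simp add: G11_def)
  qed
  finally show ?thesis .
qed

text \<open>At \<open>s = 1\<close> the bridge has arrived at its endpoint, and the mean
  \<open>sqrt (pi / 2)\<close> of the Rayleigh law remains.\<close>

lemma nn_integral_M1_1:
  "(\<integral>\<^sup>+x. ennreal (x * M1 1 x * exp (- x\<^sup>2 / 2)) * indicator {0<..} x \<partial>lborel) = ennreal (G11 1)"
proof -
  have "x * M1 1 x * exp (- x\<^sup>2 / 2) = sqrt (2 * pi) * (x\<^sup>2 * gauss 1 (x - 0))" for x
    by (simp add: M1_def gauss_def power2_eq_square)
  then have "(\<integral>\<^sup>+x. ennreal (x * M1 1 x * exp (- x\<^sup>2 / 2)) * indicator {0<..} x \<partial>lborel)
    = (\<integral>\<^sup>+x. ennreal (sqrt (2 * pi) * (x\<^sup>2 * gauss 1 (x - 0))) * indicator {0<..} x \<partial>lborel)" by simp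
  also have "\<dots> = ennreal (sqrt (2 * pi) * (1 / 2) - sqrt (2 * pi) * (- 0 * gauss 1 (0 - 0) + 1 * (erf ((0 - 0) / sqrt (2 * 1)) / 2)))"
  proof (rule nn_integral_FTC_Ioi'[where F = "\<lambda>x. sqrt (2 * pi) * (- x * gauss 1 (x - 0) + 1 * (erf ((x - 0) / sqrt (2 * 1)) / 2))"])
    show "((\<lambda>x. sqrt (2 * pi) * (- x * gauss 1 (x - 0) + 1 * (erf ((x - 0) / sqrt (2 * 1)) / 2))) has_real_derivative sqrt (2 * pi) * (x\<^sup>2 * gauss 1 (x - 0))) (at x)" for x
      by (intro DERIV_cmult gauss_erf_antiderivative[where P' = "- 1"]) (auto intro!: derivative_eq_intros simp: power2_eq_square)
    show "((\<lambda>x. sqrt (2 * pi) * (- x * gauss 1 (x - 0) + 1 * (erf ((x - 0) / sqrt (2 * 1)) / 2))) \<longlongrightarrow> sqrt (2 * pi) * (1 / 2)) at_top"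
      by (intro tendsto_intros gauss_antiderivative_tendsto[where a = 0 and b = "- 1" and d = 0]) auto
  qed (auto intro!: continuous_intros simp: gauss_nonneg)
  also have "sqrt (2 * pi) * (1 / 2) - sqrt (2 * pi) * (- 0 * gauss 1 (0 - 0) + 1 * (erf ((0 - 0) / sqrt (2 * 1)) / 2)) = G11 1"
    by (simp add: G11_def real_sqrt_mult real_sqrt_divide field_simps)
  finally show ?thesis .
qed

section \<open>Maximum and first argmax of a path\<close>

text \<open>\<open>path_max\<close> and \<open>first_argmax\<close> for an interval of any length,
  because the pieces of a split path have other lengths than 1.\<close>

definition pmax :: "real \<Rightarrow> (real \<Rightarrow> real) \<Rightarrow> real" where
  "pmax T f = (SUP u\<in>{0..T}. f u)"

definition parg :: "real \<Rightarrow> (real \<Rightarrow> real) \<Rightarrow> real" where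
  "parg T f = (LEAST u. u \<in> {0..T} \<and> f u = pmax T f)"

lemma pmax_attained:
  assumes "0 \<le> T" "continuous_on {0..T} f"
  obtains s where "s \<in> {0..T}" "f s = pmax T f" "\<And>x. x \<in> {0..T} \<Longrightarrow> f x \<le> f s"
proof -
  obtain s where s: "s \<in> {0..T}" "\<forall>x\<in>{0..T}. f x \<le> f s"
    using continuous_attains_sup[of "{0..T}" f] assms by auto
  have "pmax T f = f s"
    unfolding pmax_def by (rule cSup_eq_maximum) (use s in auto)
  with s that show thesis by auto
qed

lemma pmax_upper:
  assumes "continuous_on {0..T} f" "x \<in> {0..T}"
  shows "f x \<le> pmax T f"
proof -
  have "0 \<le> T" using assms(2) by auto
  from pmax_attained[OF this assms(1)] assms(2) show ?thesis by metis
qed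

lemma pmax_le_iff:
  assumes "0 \<le> T" "continuous_on {0..T} f"
  shows "pmax T f \<le> c \<longleftrightarrow> (\<forall>x\<in>{0..T}. f x \<le> c)"
proof -
  obtain s where "s \<in> {0..T}" "f s = pmax T f"
    using pmax_attained[OF assms] by metis
  then show ?thesis using pmax_upper[OF assms(2)] by (metis order_trans)
qed

lemma parg_unique:
  assumes "s \<in> {0..T}" "f s = pmax T f" "\<And>r. 0 \<le> r \<Longrightarrow> r < s \<Longrightarrow> f r \<noteq> pmax T f"
  shows "parg T f = s"
  unfolding parg_def by (rule Least_equality) (use assms not_le in auto)

text \<open>\<open>LEAST\<close> over the reals says something only if a least element exists. The
  points where a continuous function attains its maximum form a closed set that is bounded below, so
  this set contains its infimum.\<close>

lemma parg_exists:
  assumes "0 \<le> T" "continuous_on {0..T} f"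
  shows "parg T f \<in> {0..T}" "f (parg T f) = pmax T f" "\<And>r. 0 \<le> r \<Longrightarrow> r < parg T f \<Longrightarrow> f r \<noteq> pmax T f"
proof -
  let ?A = "{0..T} \<inter> f -` {pmax T f}"
  have cl: "closed ?A"
    by (rule continuous_closed_preimage) (use assms in auto)
  have ne: "?A \<noteq> {}" using pmax_attained[OF assms] by (metis IntI empty_iff vimage_singleton_eq)
  have bd: "bdd_below ?A" by auto
  have In: "Inf ?A \<in> ?A" by (rule closed_contains_Inf[OF ne bd cl])
  have lt: "f r \<noteq> pmax T f" if "0 \<le> r" "r < Inf ?A" for r
  proof
    assume "f r = pmax T f"
    then have "r \<in> ?A" using that In by auto
    then show False using cInf_lower[OF _ bd] that by fastforce
  qed
  have eq: "parg T f = Inf ?A"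
    by (rule parg_unique) (use In lt in auto)
  show "parg T f \<in> {0..T}" "f (parg T f) = pmax T f" "\<And>r. 0 \<le> r \<Longrightarrow> r < parg T f \<Longrightarrow> f r \<noteq> pmax T f"
    unfolding eq using In lt by auto
qed

lemma continuous_on_shift:
  fixes f :: "real \<Rightarrow> real"
  assumes "continuous_on {0..T} f" "u \<ge> 0"
  shows "continuous_on {0..T - u} (\<lambda>s. f (u + s) - f u)"
proof (intro continuous_on_diff continuous_on_const)
  show "continuous_on {0..T - u} (\<lambda>s. f (u + s))"
    by (rule continuous_on_compose2[OF assms(1)]) (use assms(2) in \<open>auto intro!: continuous_intros\<close>)
qed

text \<open>A tie between the two pieces goes to the left one, since the first argmax is taken;
  hence the weak inequality in the second claim and the strict one in the third.\<close>

lemma pmax_split: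
  fixes f :: "real \<Rightarrow> real"
  assumes u: "0 \<le> u" "u \<le> T" and f: "continuous_on {0..T} f"
  defines "g \<equiv> \<lambda>s. f (u + s) - f u"
  shows "pmax T f = max (pmax u f) (f u + pmax (T - u) g)"
    and "f u + pmax (T - u) g \<le> pmax u f \<Longrightarrow> parg T f = parg u f"
    and "pmax u f < f u + pmax (T - u) g \<Longrightarrow> parg T f = u + parg (T - u) g \<and> u < parg T f"
proof -
  have fu: "continuous_on {0..u} f" using f by (rule continuous_on_subset) (use u in auto)
  have g: "continuous_on {0..T - u} g"
    unfolding g_def using f u by (intro continuous_on_shift) auto
  have T: "0 \<le> T" "0 \<le> T - u" using u by auto
  have shift: "f (u + s) = f u + g s" for s by (simp add: g_def)
  have shift': "f s = f u + g (s - u)" for s by (simp add: g_def)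
  show eq: "pmax T f = max (pmax u f) (f u + pmax (T - u) g)"
  proof (rule antisym)
    show "pmax T f \<le> max (pmax u f) (f u + pmax (T - u) g)"
      unfolding pmax_le_iff[OF T(1) f]
    proof
      fix x assume x: "x \<in> {0..T}"
      show "f x \<le> max (pmax u f) (f u + pmax (T - u) g)"
      proof (cases "x \<le> u")
        case True then show ?thesis using pmax_upper[OF fu, of x] x by auto
      next
        case False then show ?thesis using pmax_upper[OF g, of "x - u"] x shift'[of x] by auto
      qed
    qed
    have "pmax u f \<le> pmax T f"
      unfolding pmax_le_iff[OF u(1) fu] using pmax_upper[OF f] u by auto
    moreover have "pmax (T - u) g \<le> pmax T f - f u"
      unfolding pmax_le_iff[OF T(2) g] using pmax_upper[OF f, of "u + x" for x] u shift by (auto simp: algebra_simps)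
    ultimately show "max (pmax u f) (f u + pmax (T - u) g) \<le> pmax T f" by auto
  qed
  note a = parg_exists[OF u(1) fu] and b = parg_exists[OF T(2) g]
  show "parg T f = parg u f" if le: "f u + pmax (T - u) g \<le> pmax u f"
  proof (rule parg_unique)
    have "pmax T f = pmax u f" using eq le by simp
    then show "f (parg u f) = pmax T f" "\<And>r. 0 \<le> r \<Longrightarrow> r < parg u f \<Longrightarrow> f r \<noteq> pmax T f"
      using a by auto
  qed (use a(1) u in auto)
  show "parg T f = u + parg (T - u) g \<and> u < parg T f" if lt: "pmax u f < f u + pmax (T - u) g"
  proof -
    have m: "pmax T f = f u + pmax (T - u) g" using eq lt by simp
    have e: "parg T f = u + parg (T - u) g"
    proof (rule parg_unique)
      show "u + parg (T - u) g \<in> {0..T}" using b(1) u by auto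
      show "f (u + parg (T - u) g) = pmax T f" using shift b(2) m by simp
      show "f r \<noteq> pmax T f" if r: "0 \<le> r" "r < u + parg (T - u) g" for r
      proof (cases "r \<le> u")
        case True then show ?thesis using pmax_upper[OF fu, of r] r lt m by auto
      next
        case False then show ?thesis using b(3)[of "r - u"] r m shift'[of r] by auto
      qed
    qed
    \<comment> \<open>Otherwise the right piece would attain its maximum at its start
      \<open>u\<close>, which also belongs to the left piece.\<close>
    have "parg (T - u) g \<noteq> 0"
    proof
      assume "parg (T - u) g = 0"
      then have "pmax (T - u) g = 0" using b(2) by (simp add: g_def)
      then show False using lt pmax_upper[OF fu, of u] u by auto
    qed
    then show ?thesis using e b(1) by auto
  qed
qed

text \<open>This turns an event about the argmax into a comparison of two maxima, which yields its
  measurability and later its law.\<close>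

lemma parg_le_iff:
  fixes f :: "real \<Rightarrow> real"
  assumes u: "0 \<le> u" "u \<le> T" and f: "continuous_on {0..T} f"
  shows "parg T f \<le> u \<longleftrightarrow> f u + pmax (T - u) (\<lambda>s. f (u + s) - f u) \<le> pmax u f"
proof -
  have "continuous_on {0..u} f" using f by (rule continuous_on_subset) (use u in auto)
  from parg_exists(1)[OF u(1) this] pmax_split[OF assms] show ?thesis
    by (metis atLeastAtMost_iff leD leI)
qed

section \<open>Measurability of the maximum and of the argmax\<close>

text \<open>Dyadic points make the maximum a countable supremum.\<close>

lemma dyadic_approx:
  assumes "s \<in> {0..T}"
  obtains k :: "nat \<Rightarrow> nat" where "\<And>n. k n \<le> 2 ^ n" "(\<lambda>n. real (k n) * T / 2 ^ n) \<longlonglongrightarrow> s"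
proof -
  \<comment> \<open>For \<open>T = 0\<close> the quotient is 0, and \<open>s = r * T\<close> still
    holds because then \<open>s = 0\<close>.\<close>
  define r where "r = s / T"
  have r: "0 \<le> r" "r \<le> 1" "s = r * T" using assms by (auto simp: r_def divide_le_eq_1)
  define k where "k = (\<lambda>n. nat \<lfloor>r * 2 ^ n\<rfloor>)"
  have k: "real (k n) = of_int \<lfloor>r * 2 ^ n\<rfloor>" for n
    using r by (simp add: k_def)
  have k1: "real (k n) \<le> r * 2 ^ n" and k2: "r * 2 ^ n - 1 \<le> real (k n)" for n
    unfolding k by linarith+
  have le: "k n \<le> 2 ^ n" for n
  proof -
    have "real (k n) \<le> 1 * 2 ^ n"
      by (rule order_trans[OF k1 mult_right_mono[OF r(2)]]) simp
    then have "real (k n) \<le> real (2 ^ n)" by simp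
    then show ?thesis by (simp only: of_nat_le_iff)
  qed
  have bound: "s - T / 2 ^ n \<le> real (k n) * T / 2 ^ n" "real (k n) * T / 2 ^ n \<le> s" for n
  proof -
    have T: "0 \<le> T" using assms by simp
    have "real (k n) * T / 2 ^ n \<le> r * 2 ^ n * T / 2 ^ n"
      by (rule divide_right_mono[OF mult_right_mono[OF k1 T]]) simp
    also have "\<dots> = s" unfolding r(3) by simp
    finally show "real (k n) * T / 2 ^ n \<le> s" .
    have "s - T / 2 ^ n = (r * 2 ^ n - 1) * T / 2 ^ n"
      unfolding r(3) by (simp add: left_diff_distrib diff_divide_distrib)
    also have "\<dots> \<le> real (k n) * T / 2 ^ n"
      by (rule divide_right_mono[OF mult_right_mono[OF k2 T]]) simp
    finally show "s - T / 2 ^ n \<le> real (k n) * T / 2 ^ n" .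
  qed
  have "(\<lambda>n. T / 2 ^ n) \<longlonglongrightarrow> 0" by real_asymp
  from tendsto_diff[OF tendsto_const[of s] this]
  have lim: "(\<lambda>n. s - T / 2 ^ n) \<longlonglongrightarrow> s" by simp
  have "(\<lambda>n. real (k n) * T / 2 ^ n) \<longlonglongrightarrow> s"
    by (rule tendsto_sandwich[OF always_eventually always_eventually lim tendsto_const]) (intro allI bound)+
  with le that show thesis by blast
qed

lemma dyadic_in_interval: "0 \<le> T \<Longrightarrow> k \<le> 2 ^ n \<Longrightarrow> real k * T / 2 ^ n \<in> {0..T}"
proof -
  assume T: "0 \<le> T" and k: "k \<le> 2 ^ n"
  have "real k \<le> real (2 ^ n)" using k by (simp only: of_nat_le_iff)
  then have "real k * T \<le> 2 ^ n * T" using T by (intro mult_right_mono) simp_all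
  then have "real k * T / 2 ^ n \<le> T" by (simp add: pos_divide_le_eq mult.commute)
  then show ?thesis using T by simp
qed

lemma pmax_gt_iff_dyadic:
  assumes "0 \<le> T" "continuous_on {0..T} f"
  shows "a < pmax T f \<longleftrightarrow> (\<exists>n k. k \<le> 2 ^ n \<and> a < f (real k * T / 2 ^ n))"
proof
  assume a: "a < pmax T f"
  obtain s where s: "s \<in> {0..T}" "f s = pmax T f" using pmax_attained[OF assms] by metis
  obtain k :: "nat \<Rightarrow> nat" where k: "\<And>n. k n \<le> 2 ^ n" "(\<lambda>n. real (k n) * T / 2 ^ n) \<longlonglongrightarrow> s"
    using dyadic_approx[OF s(1)] by metis
  have "(\<lambda>n. f (real (k n) * T / 2 ^ n)) \<longlonglongrightarrow> f s"
    using dyadic_in_interval[OF assms(1) k(1)]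
    by (intro continuous_on_tendsto_compose[OF assms(2) k(2) s(1)] always_eventually allI)
  from order_tendstoD(1)[OF this, of a] a s(2) have "\<forall>\<^sub>F n in sequentially. a < f (real (k n) * T / 2 ^ n)" by simp
  from eventually_happens'[OF sequentially_bot this] obtain n where "a < f (real (k n) * T / 2 ^ n)" by blast
  then show "\<exists>n k. k \<le> 2 ^ n \<and> a < f (real k * T / 2 ^ n)" using k(1) by blast
next
  assume "\<exists>n k. k \<le> 2 ^ n \<and> a < f (real k * T / 2 ^ n)"
  then show "a < pmax T f"
    using pmax_upper[OF assms(2)] dyadic_in_interval[OF assms(1)] by (meson less_le_trans)
qed

lemma borel_measurable_pmax:
  fixes W :: "real \<Rightarrow> 'b \<Rightarrow> real"
  assumes "0 \<le> T" and [measurable]: "\<And>s. s \<in> {0..T} \<Longrightarrow> W s \<in> borel_measurable N"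
    and "\<And>\<omega>. \<omega> \<in> space N \<Longrightarrow> continuous_on {0..T} (\<lambda>s. W s \<omega>)"
  shows "(\<lambda>\<omega>. pmax T (\<lambda>s. W s \<omega>)) \<in> borel_measurable N"
proof (rule borel_measurable_iff_greater[THEN iffD2], rule allI)
  fix a
  have "{\<omega> \<in> space N. a < pmax T (\<lambda>s. W s \<omega>)}
    = (\<Union>n. \<Union>k\<in>{..2 ^ n}. {\<omega> \<in> space N. a < W (real k * T / 2 ^ n) \<omega>})"
  proof (rule set_eqI)
    fix \<omega>
    show "\<omega> \<in> {\<omega> \<in> space N. a < pmax T (\<lambda>s. W s \<omega>)}
      \<longleftrightarrow> \<omega> \<in> (\<Union>n. \<Union>k\<in>{..2 ^ n}. {\<omega> \<in> space N. a < W (real k * T / 2 ^ n) \<omega>})"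
    proof (cases "\<omega> \<in> space N")
      case True
      from pmax_gt_iff_dyadic[OF assms(1) assms(3)[OF True], of a] True show ?thesis by simp blast
    qed simp
  qed
  also have "\<dots> \<in> sets N"
  proof (intro sets.countable_UN sets.finite_UN image_subsetI)
    fix n k :: nat assume "k \<in> {..2 ^ n}"
    then have [measurable]: "W (real k * T / 2 ^ n) \<in> borel_measurable N"
      using dyadic_in_interval[OF assms(1)] assms(2) by blast
    show "{\<omega> \<in> space N. a < W (real k * T / 2 ^ n) \<omega>} \<in> sets N" by measurable
  qed
  finally show "{\<omega> \<in> space N. a < pmax T (\<lambda>s. W s \<omega>)} \<in> sets N" .
qed

lemma borel_measurable_parg:
  fixes W :: "real \<Rightarrow> 'b \<Rightarrow> real"
  assumes "0 \<le> T" and W: "\<And>s. s \<in> {0..T} \<Longrightarrow> W s \<in> borel_measurable N"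
    and cont: "\<And>\<omega>. \<omega> \<in> space N \<Longrightarrow> continuous_on {0..T} (\<lambda>s. W s \<omega>)"
  shows "(\<lambda>\<omega>. parg T (\<lambda>s. W s \<omega>)) \<in> borel_measurable N"
proof (rule borel_measurable_iff_le[THEN iffD2], rule allI)
  fix u
  have range: "0 \<le> parg T (\<lambda>s. W s \<omega>) \<and> parg T (\<lambda>s. W s \<omega>) \<le> T" if "\<omega> \<in> space N" for \<omega>
    using parg_exists(1)[OF assms(1) cont[OF that]] by simp
  consider "u < 0" | "T < u" | "0 \<le> u" "u \<le> T" by linarith
  then show "{\<omega> \<in> space N. parg T (\<lambda>s. W s \<omega>) \<le> u} \<in> sets N"
  proof cases
    case 1
    then have "{\<omega> \<in> space N. parg T (\<lambda>s. W s \<omega>) \<le> u} = {}"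
      using range by force
    then show ?thesis by (simp only: sets.empty_sets)
  next
    case 2
    then have "{\<omega> \<in> space N. parg T (\<lambda>s. W s \<omega>) \<le> u} = space N"
      using range by force
    then show ?thesis by (simp only: sets.top)
  next
    case 3
    have m1: "W u \<in> borel_measurable N" using 3 by (intro W) simp
    have m2: "(\<lambda>\<omega>. pmax u (\<lambda>s. W s \<omega>)) \<in> borel_measurable N"
    proof (rule borel_measurable_pmax)
      show "continuous_on {0..u} (\<lambda>s. W s \<omega>)" if "\<omega> \<in> space N" for \<omega>
        using continuous_on_subset[OF cont[OF that]] 3 by simp
    qed (use 3 W in simp_all)
    have m3: "(\<lambda>\<omega>. pmax (T - u) (\<lambda>s. W (u + s) \<omega> - W u \<omega>)) \<in> borel_measurable N"
    proof (rule borel_measurable_pmax)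
      show "continuous_on {0..T - u} (\<lambda>s. W (u + s) \<omega> - W u \<omega>)" if "\<omega> \<in> space N" for \<omega>
        using continuous_on_shift[OF cont[OF that]] 3 by simp
      show "(\<lambda>\<omega>. W (u + s) \<omega> - W u \<omega>) \<in> borel_measurable N" if "s \<in> {0..T - u}" for s
      proof (rule borel_measurable_diff)
        show "W (u + s) \<in> borel_measurable N" using that 3 by (intro W) simp
        show "W u \<in> borel_measurable N" using that 3 by (intro W) simp
      qed
    qed (use 3 in simp)
    have "{\<omega> \<in> space N. parg T (\<lambda>s. W s \<omega>) \<le> u}
      = {\<omega> \<in> space N. W u \<omega> + pmax (T - u) (\<lambda>s. W (u + s) \<omega> - W u \<omega>) \<le> pmax u (\<lambda>s. W s \<omega>)}"
    proof (rule Collect_cong, rule conj_cong[OF refl])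
      fix \<omega> assume \<omega>: "\<omega> \<in> space N"
      show "(parg T (\<lambda>s. W s \<omega>) \<le> u) = (W u \<omega> + pmax (T - u) (\<lambda>s. W (u + s) \<omega> - W u \<omega>) \<le> pmax u (\<lambda>s. W s \<omega>))"
        by (rule parg_le_iff[OF 3 cont[OF \<omega>]])
    qed
    also have "\<dots> \<in> sets N"
      by (intro borel_measurable_le borel_measurable_add m1 m2 m3)
    finally show ?thesis .
  qed
qed

section \<open>Independence of past and future\<close>

definition dyadic_sample :: "(real \<Rightarrow> 'b \<Rightarrow> real) \<Rightarrow> real \<Rightarrow> nat \<Rightarrow> 'b \<Rightarrow> nat \<Rightarrow> real" where
  "dyadic_sample V t n \<omega> = (\<lambda>i\<in>{..2 ^ n}. V (real i * t / 2 ^ n) \<omega>)"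

definition dyadic_events :: "'b set \<Rightarrow> (real \<Rightarrow> 'b \<Rightarrow> real) \<Rightarrow> real \<Rightarrow> nat \<Rightarrow> 'b set set" where
  "dyadic_events \<Omega> V t n = {dyadic_sample V t n -` A \<inter> \<Omega> | A. A \<in> sets (PiM {..2 ^ n} (\<lambda>_. borel))}"

text \<open>Generated by samples on grids only, so that independence can be checked on finitely many
  increments; by continuity of the paths it still makes the process measurable at every time up to
  \<open>t\<close>.\<close>

definition path_sigma :: "'b set \<Rightarrow> (real \<Rightarrow> 'b \<Rightarrow> real) \<Rightarrow> real \<Rightarrow> 'b measure" where
  "path_sigma \<Omega> V t = sigma \<Omega> (\<Union>n. dyadic_events \<Omega> V t n)"

lemma dyadic_sample_space: "dyadic_sample V t n \<omega> \<in> space (PiM {..2 ^ n} (\<lambda>_. borel))"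
  by (auto simp: dyadic_sample_def space_PiM)

text \<open>The grids are nested: index \<open>i\<close> of the coarse one is index
  \<open>i * 2 ^ d\<close> of the fine one. Hence two events have a common level, and the union over
  all levels is closed under intersection.\<close>

lemma dyadic_events_mono:
  assumes "n \<le> m"
  shows "dyadic_events \<Omega> V t n \<subseteq> dyadic_events \<Omega> V t m"
proof
  fix X assume "X \<in> dyadic_events \<Omega> V t n"
  then obtain A where A: "A \<in> sets (PiM {..2 ^ n} (\<lambda>_. borel))" "X = dyadic_sample V t n -` A \<inter> \<Omega>"
    by (auto simp: dyadic_events_def)
  obtain d where m: "m = n + d" using assms le_Suc_ex by blast
  define r :: "(nat \<Rightarrow> real) \<Rightarrow> nat \<Rightarrow> real" where "r = (\<lambda>x. \<lambda>i\<in>{..2 ^ n}. x (i * 2 ^ d))"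
  have le: "i * 2 ^ d \<le> 2 ^ m" if "i \<le> 2 ^ n" for i :: nat
    using that by (simp add: m power_add)
  have r: "r \<in> measurable (PiM {..2 ^ m} (\<lambda>_. borel)) (PiM {..2 ^ n} (\<lambda>_. borel))"
    unfolding r_def by (intro measurable_restrict measurable_component_singleton) (use le in simp)
  have "r (dyadic_sample V t m \<omega>) = dyadic_sample V t n \<omega>" for \<omega>
    using le by (auto simp: r_def dyadic_sample_def m power_add fun_eq_iff restrict_def)
  then have "X = dyadic_sample V t m -` (r -` A \<inter> space (PiM {..2 ^ m} (\<lambda>_. borel))) \<inter> \<Omega>"
    using dyadic_sample_space[of V t m] by (auto simp: A(2))
  moreover have "r -` A \<inter> space (PiM {..2 ^ m} (\<lambda>_. borel)) \<in> sets (PiM {..2 ^ m} (\<lambda>_. borel))"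
    using measurable_sets[OF r A(1)] .
  ultimately show "X \<in> dyadic_events \<Omega> V t m"
    unfolding dyadic_events_def by blast
qed

lemma Int_stable_dyadic_events: "Int_stable (\<Union>n. dyadic_events \<Omega> V t n)"
proof (rule Int_stableI)
  fix a b assume "a \<in> (\<Union>n. dyadic_events \<Omega> V t n)" "b \<in> (\<Union>n. dyadic_events \<Omega> V t n)"
  then obtain n m where "a \<in> dyadic_events \<Omega> V t n" "b \<in> dyadic_events \<Omega> V t m" by blast
  then have "a \<in> dyadic_events \<Omega> V t (max n m)" "b \<in> dyadic_events \<Omega> V t (max n m)"
    using dyadic_events_mono[of n "max n m" \<Omega> V t] dyadic_events_mono[of m "max n m" \<Omega> V t] by auto
  then obtain A B where
    A: "A \<in> sets (PiM {..2 ^ max n m} (\<lambda>_. borel))" "a = dyadic_sample V t (max n m) -` A \<inter> \<Omega>" and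
    B: "B \<in> sets (PiM {..2 ^ max n m} (\<lambda>_. borel))" "b = dyadic_sample V t (max n m) -` B \<inter> \<Omega>"
    unfolding dyadic_events_def by blast
  have "a \<inter> b = dyadic_sample V t (max n m) -` (A \<inter> B) \<inter> \<Omega>" using A B by auto
  then have "a \<inter> b \<in> dyadic_events \<Omega> V t (max n m)"
    unfolding dyadic_events_def using sets.Int[OF A(1) B(1)] by blast
  then show "a \<inter> b \<in> (\<Union>n. dyadic_events \<Omega> V t n)" by blast
qed

lemma dyadic_events_Pow: "(\<Union>n. dyadic_events \<Omega> V t n) \<subseteq> Pow \<Omega>"
  by (auto simp: dyadic_events_def)

lemma space_path_sigma [simp]: "space (path_sigma \<Omega> V t) = \<Omega>"
  unfolding path_sigma_def using dyadic_events_Pow by (rule space_measure_of)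

lemma sets_path_sigma: "sets (path_sigma \<Omega> V t) = sigma_sets \<Omega> (\<Union>n. dyadic_events \<Omega> V t n)"
  unfolding path_sigma_def using dyadic_events_Pow by (rule sets_measure_of)

text \<open>The value at any time is the limit of values at grid points, by continuity.\<close>

lemma measurable_path_sigma:
  assumes s: "s \<in> {0..t}" and cont: "\<And>\<omega>. \<omega> \<in> \<Omega> \<Longrightarrow> continuous_on {0..t} (\<lambda>s. V s \<omega>)"
  shows "V s \<in> borel_measurable (path_sigma \<Omega> V t)"
proof -
  have t: "0 \<le> t" using s by simp
  have grid: "V (real k * t / 2 ^ n) \<in> borel_measurable (path_sigma \<Omega> V t)" if k: "k \<le> 2 ^ n" for n k
  proof (rule measurableI)
    fix A :: "real set" assume A: "A \<in> sets borel"
    let ?P = "PiM {..2 ^ n} (\<lambda>_::nat. borel :: real measure)"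
    have "(\<lambda>x. x k) -` A \<inter> space ?P \<in> sets ?P"
      by (rule measurable_sets[OF _ A]) (use k in \<open>intro measurable_component_singleton; simp\<close>)
    moreover have "V (real k * t / 2 ^ n) -` A \<inter> \<Omega> = dyadic_sample V t n -` ((\<lambda>x. x k) -` A \<inter> space ?P) \<inter> \<Omega>"
      using k dyadic_sample_space[of V t n] by (auto simp: dyadic_sample_def)
    ultimately have "V (real k * t / 2 ^ n) -` A \<inter> \<Omega> \<in> dyadic_events \<Omega> V t n"
      unfolding dyadic_events_def by blast
    then show "V (real k * t / 2 ^ n) -` A \<inter> space (path_sigma \<Omega> V t) \<in> sets (path_sigma \<Omega> V t)"
      unfolding space_path_sigma sets_path_sigma by (intro sigma_sets.Basic) blast
  qed simp
  obtain k :: "nat \<Rightarrow> nat" where k: "\<And>n. k n \<le> 2 ^ n" "(\<lambda>n. real (k n) * t / 2 ^ n) \<longlonglongrightarrow> s"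
    using dyadic_approx[OF s] by metis
  show ?thesis
  proof (rule borel_measurable_LIMSEQ_real[where u = "\<lambda>n. V (real (k n) * t / 2 ^ n)"])
    fix \<omega> assume \<omega>: "\<omega> \<in> space (path_sigma \<Omega> V t)"
    then have \<omega>: "\<omega> \<in> \<Omega>" by simp
    show "(\<lambda>n. V (real (k n) * t / 2 ^ n) \<omega>) \<longlonglongrightarrow> V s \<omega>"
      using dyadic_in_interval[OF t k(1)]
      by (intro continuous_on_tendsto_compose[OF cont[OF \<omega>] k(2) s] always_eventually allI)
  qed (rule grid[OF k(1)])
qed

section \<open>Brownian motion on an interval of any length\<close>

locale brownian = prob_space M for M :: "'a measure" +
  fixes T :: real and W :: "real \<Rightarrow> 'a \<Rightarrow> real"
  assumes T_nonneg: "0 \<le> T"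
    and measurable_W: "s \<in> {0..T} \<Longrightarrow> W s \<in> borel_measurable M"
    and W_0: "\<omega> \<in> space M \<Longrightarrow> W 0 \<omega> = 0"
    and continuous_W: "\<omega> \<in> space M \<Longrightarrow> continuous_on {0..T} (\<lambda>s. W s \<omega>)"
    and increment_distributed: "0 \<le> s \<Longrightarrow> s < t \<Longrightarrow> t \<le> T \<Longrightarrow>
      distributed M lborel (\<lambda>\<omega>. W t \<omega> - W s \<omega>) (\<lambda>x. ennreal (normal_density 0 (sqrt (t - s)) x))"
    and increments_indep: "0 \<le> \<tau> 0 \<Longrightarrow> (\<And>i. i < n \<Longrightarrow> \<tau> i \<le> \<tau> (Suc i)) \<Longrightarrow> \<tau> n \<le> T \<Longrightarrow>
      indep_vars (\<lambda>_. borel) (\<lambda>i \<omega>. W (\<tau> (Suc i)) \<omega> - W (\<tau> i) \<omega>) {..<n}"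

lemma std_brownian_motion_brownian: "std_brownian_motion M B \<Longrightarrow> brownian M 1 B"
  unfolding std_brownian_motion_def brownian_def brownian_axioms_def by simp

context brownian
begin

lemma brownian_restrict:
  assumes "0 \<le> t" "t \<le> T"
  shows "brownian M t W"
proof
  show "continuous_on {0..t} (\<lambda>s. W s \<omega>)" if "\<omega> \<in> space M" for \<omega>
    using continuous_on_subset[OF continuous_W[OF that]] assms by simp
  show "distributed M lborel (\<lambda>\<omega>. W v \<omega> - W s \<omega>) (\<lambda>x. ennreal (normal_density 0 (sqrt (v - s)) x))"
    if "0 \<le> s" "s < v" "v \<le> t" for s v
    using increment_distributed that assms by simp
  show "indep_vars (\<lambda>_. borel) (\<lambda>i \<omega>. W (\<tau> (Suc i)) \<omega> - W (\<tau> i) \<omega>) {..<n}"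
    if "0 \<le> \<tau> 0" "\<And>i. i < n \<Longrightarrow> \<tau> i \<le> \<tau> (Suc i)" "\<tau> n \<le> t" for \<tau> and n :: nat
    using that assms by (intro increments_indep) auto
qed (use assms measurable_W W_0 in auto)

lemma brownian_shift:
  assumes t: "0 \<le> t" "t \<le> T"
  shows "brownian M (T - t) (\<lambda>s \<omega>. W (t + s) \<omega> - W t \<omega>)"
proof
  show "(\<lambda>\<omega>. W (t + s) \<omega> - W t \<omega>) \<in> borel_measurable M" if "s \<in> {0..T - t}" for s
    using that t by (intro borel_measurable_diff measurable_W) auto
  show "continuous_on {0..T - t} (\<lambda>s. W (t + s) \<omega> - W t \<omega>)" if "\<omega> \<in> space M" for \<omega>
    using continuous_on_shift[OF continuous_W[OF that]] t by simp
  show "distributed M lborel (\<lambda>\<omega>. W (t + v) \<omega> - W t \<omega> - (W (t + s) \<omega> - W t \<omega>)) (\<lambda>x. ennreal (normal_density 0 (sqrt (v - s)) x))"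
    if "0 \<le> s" "s < v" "v \<le> T - t" for s v
    using increment_distributed[of "t + s" "t + v"] that t by simp
  show "indep_vars (\<lambda>_. borel) (\<lambda>i \<omega>. W (t + \<tau> (Suc i)) \<omega> - W t \<omega> - (W (t + \<tau> i) \<omega> - W t \<omega>)) {..<n}"
    if "0 \<le> \<tau> 0" "\<And>i. i < n \<Longrightarrow> \<tau> i \<le> \<tau> (Suc i)" "\<tau> n \<le> T - t" for \<tau> and n :: nat
    using increments_indep[of "\<lambda>i. t + \<tau> i" n] that t by simp
qed (use t in auto)

text \<open>This controls the minimum of the path, which is minus the maximum of the negated
  path.\<close>

lemma brownian_uminus: "brownian M T (\<lambda>s \<omega>. - W s \<omega>)"
proof
  show "continuous_on {0..T} (\<lambda>s. - W s \<omega>)" if "\<omega> \<in> space M" for \<omega>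
    by (intro continuous_on_minus continuous_W that)
  show "distributed M lborel (\<lambda>\<omega>. - W v \<omega> - - W s \<omega>) (\<lambda>x. ennreal (normal_density 0 (sqrt (v - s)) x))"
    if "0 \<le> s" "s < v" "v \<le> T" for s v
    using normal_density_affine[OF increment_distributed[OF that], of "-1" 0] that by simp
  show "indep_vars (\<lambda>_. borel) (\<lambda>i \<omega>. - W (\<tau> (Suc i)) \<omega> - - W (\<tau> i) \<omega>) {..<n}"
    if "0 \<le> \<tau> 0" "\<And>i. i < n \<Longrightarrow> \<tau> i \<le> \<tau> (Suc i)" "\<tau> n \<le> T" for \<tau> and n :: nat
    using indep_vars_compose2[OF increments_indep[OF that], of "\<lambda>_ x. - x" "\<lambda>_. borel"] by simp
qed (use T_nonneg W_0 measurable_W in auto)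

definition "past t = path_sigma (space M) W t"
definition "future t = path_sigma (space M) (\<lambda>s \<omega>. W (t + s) \<omega> - W t \<omega>) (T - t)"

lemma measurable_past:
  assumes "s \<in> {0..t}" "t \<le> T"
  shows "W s \<in> borel_measurable (past t)"
  unfolding past_def using assms brownian.continuous_W[OF brownian_restrict[of t]]
  by (intro measurable_path_sigma) auto

lemma measurable_future:
  assumes "s \<in> {0..T - t}" "0 \<le> t"
  shows "(\<lambda>\<omega>. W (t + s) \<omega> - W t \<omega>) \<in> borel_measurable (future t)"
  unfolding future_def using assms brownian.continuous_W[OF brownian_shift[of t]]
  by (intro measurable_path_sigma[where V = "\<lambda>s \<omega>. W (t + s) \<omega> - W t \<omega>"]) auto

text \<open>Both samples are partial sums of the increments along one grid of \<open>2 * N\<close>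
  steps, the first \<open>N\<close> of them before \<open>t\<close> and the others after it, so they
  depend on disjoint blocks of independent increments.\<close>

lemma dyadic_indep:
  assumes t: "0 \<le> t" "t \<le> T"
    and A: "A \<in> sets (PiM {..2 ^ n} (\<lambda>_. borel))" and B: "B \<in> sets (PiM {..2 ^ n} (\<lambda>_. borel))"
  defines "X \<equiv> dyadic_sample W t n" and "Y \<equiv> dyadic_sample (\<lambda>s \<omega>. W (t + s) \<omega> - W t \<omega>) (T - t) n"
  shows "prob ((X -` A \<inter> space M) \<inter> (Y -` B \<inter> space M)) = prob (X -` A \<inter> space M) * prob (Y -` B \<inter> space M)"
    and "X -` A \<inter> space M \<in> events" and "Y -` B \<inter> space M \<in> events"
proof -
  define N :: nat where "N = 2 ^ n"
  have N: "N > 0" by (simp add: N_def)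
  \<comment> \<open>The grid of \<open>[0, t]\<close> followed by that of \<open>[t, T]\<close>;
    both branches would give \<open>t\<close> at index \<open>N\<close>, where they meet.\<close>
  define \<tau> where "\<tau> = (\<lambda>i. if i \<le> N then real i * t / N else t + (real i - N) * (T - t) / N)"
  have \<tau>1: "\<tau> i = real i * t / N" if "i \<le> N" for i using that by (simp add: \<tau>_def)
  have \<tau>2: "\<tau> (N + i) = t + real i * (T - t) / N" for i using N by (simp add: \<tau>_def)
  have mono: "\<tau> i \<le> \<tau> (Suc i)" for i
  proof (cases "Suc i \<le> N")
    case True
    then show ?thesis using t by (auto simp: \<tau>1 intro!: divide_right_mono mult_right_mono)
  next
    case False
    then obtain j where j: "i = N + j" by (metis le_Suc_ex not_less_eq_eq)
    have "\<tau> (Suc i) = \<tau> (N + Suc j)" using j by simp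
    then show ?thesis using t unfolding j \<tau>2 by (simp add: divide_right_mono mult_right_mono)
  qed
  define D where "D = (\<lambda>i \<omega>. W (\<tau> (Suc i)) \<omega> - W (\<tau> i) \<omega>)"
  have "\<tau> (2 * N) \<le> T" using N by (simp add: \<tau>_def)
  then have "indep_vars (\<lambda>_. borel) D {..<2 * N}"
    unfolding D_def using mono by (intro increments_indep) (auto simp: \<tau>_def)
  then have ind: "indep_var (PiM {..<N} (\<lambda>_. borel)) (\<lambda>\<omega>. \<lambda>i\<in>{..<N}. D i \<omega>) (PiM {N..<2 * N} (\<lambda>_. borel)) (\<lambda>\<omega>. \<lambda>i\<in>{N..<2 * N}. D i \<omega>)"
    by (rule indep_var_restrict) auto
  \<comment> \<open>Partial sums recover the samples from the increments; for the first block this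
    uses that the path starts at 0.\<close>
  define P1 :: "(nat \<Rightarrow> real) \<Rightarrow> nat \<Rightarrow> real" where "P1 = (\<lambda>x. \<lambda>i\<in>{..N}. \<Sum>j\<in>{0..<i}. x j)"
  define P2 :: "(nat \<Rightarrow> real) \<Rightarrow> nat \<Rightarrow> real" where "P2 = (\<lambda>x. \<lambda>i\<in>{..N}. \<Sum>j\<in>{N..<N + i}. x j)"
  have P1: "P1 \<in> measurable (PiM {..<N} (\<lambda>_. borel)) (PiM {..N} (\<lambda>_. borel))"
    unfolding P1_def by (intro measurable_restrict borel_measurable_sum measurable_component_singleton) auto
  have P2: "P2 \<in> measurable (PiM {N..<2 * N} (\<lambda>_. borel)) (PiM {..N} (\<lambda>_. borel))"
    unfolding P2_def by (intro measurable_restrict borel_measurable_sum measurable_component_singleton) auto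
  note ind' = indep_var_compose[OF ind P1 P2]
  have tele: "(\<Sum>j\<in>{a..<b}. D j \<omega>) = W (\<tau> b) \<omega> - W (\<tau> a) \<omega>" if "a \<le> b" for a b \<omega>
    unfolding D_def using sum_Suc_diff'[OF that, of "\<lambda>i. W (\<tau> i) \<omega>"] .
  have X: "P1 (\<lambda>i\<in>{..<N}. D i \<omega>) = X \<omega>" if "\<omega> \<in> space M" for \<omega>
  proof
    fix i
    have "(\<Sum>j\<in>{0..<i}. if j \<in> {..<N} then D j \<omega> else undefined) = (\<Sum>j\<in>{0..<i}. D j \<omega>)" if "i \<le> N"
      using that by (intro sum.cong) auto
    then show "P1 (\<lambda>i\<in>{..<N}. D i \<omega>) i = X \<omega> i"
      using tele[of 0 i \<omega>] that W_0[of \<omega>] \<tau>1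
      by (auto simp: P1_def X_def dyadic_sample_def N_def restrict_def)
  qed
  have Y: "P2 (\<lambda>i\<in>{N..<2 * N}. D i \<omega>) = Y \<omega>" for \<omega>
  proof
    fix i
    have "(\<Sum>j\<in>{N..<N + i}. if j \<in> {N..<2 * N} then D j \<omega> else undefined) = (\<Sum>j\<in>{N..<N + i}. D j \<omega>)" if "i \<le> N"
      using that by (intro sum.cong) auto
    moreover have "(\<Sum>j\<in>{N..<N + i}. D j \<omega>) = W (t + real i * (T - t) / N) \<omega> - W t \<omega>"
      using tele[of N "N + i" \<omega>] \<tau>2[of i] \<tau>2[of 0] by simp
    ultimately show "P2 (\<lambda>i\<in>{N..<2 * N}. D i \<omega>) i = Y \<omega> i"
      by (auto simp: P2_def Y_def dyadic_sample_def N_def restrict_def)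
  qed
  have eqX: "(P1 \<circ> (\<lambda>\<omega>. \<lambda>i\<in>{..<N}. D i \<omega>)) -` A \<inter> space M = X -` A \<inter> space M"
    using X by auto
  have eqY: "(P2 \<circ> (\<lambda>\<omega>. \<lambda>i\<in>{N..<2 * N}. D i \<omega>)) -` B \<inter> space M = Y -` B \<inter> space M"
    using Y by auto
  note AB = A[folded N_def] B[folded N_def]
  show "X -` A \<inter> space M \<in> events" "Y -` B \<inter> space M \<in> events"
    using measurable_sets[OF indep_var_rv1[OF ind'] AB(1)] measurable_sets[OF indep_var_rv2[OF ind'] AB(2)]
    unfolding eqX eqY by auto
  have "prob ((\<lambda>x. ((P1 \<circ> (\<lambda>\<omega>. \<lambda>i\<in>{..<N}. D i \<omega>)) x, (P2 \<circ> (\<lambda>\<omega>. \<lambda>i\<in>{N..<2 * N}. D i \<omega>)) x)) -` (A \<times> B) \<inter> space M)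
    = prob (X -` A \<inter> space M) * prob (Y -` B \<inter> space M)"
    using indep_varD[OF ind' AB] unfolding eqX eqY .
  moreover have "(\<lambda>x. ((P1 \<circ> (\<lambda>\<omega>. \<lambda>i\<in>{..<N}. D i \<omega>)) x, (P2 \<circ> (\<lambda>\<omega>. \<lambda>i\<in>{N..<2 * N}. D i \<omega>)) x)) -` (A \<times> B) \<inter> space M
     = (X -` A \<inter> space M) \<inter> (Y -` B \<inter> space M)"
    using X Y by auto
  ultimately show "prob ((X -` A \<inter> space M) \<inter> (Y -` B \<inter> space M)) = prob (X -` A \<inter> space M) * prob (Y -` B \<inter> space M)"
    by simp
qed

text \<open>Independence passes from generators that are closed under intersection to the generated
  sigma-algebras. Generators of different levels are first raised to a common one.\<close>

lemma indep_past_future: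
  assumes t: "0 \<le> t" "t \<le> T"
  shows "indep_set (sets (past t)) (sets (future t))"
  unfolding past_def future_def sets_path_sigma
proof (intro indep_set_sigma_sets Int_stable_dyadic_events indep_setI)
  let ?F = "\<lambda>s \<omega>. W (t + s) \<omega> - W t \<omega>"
  show "(\<Union>n. dyadic_events (space M) W t n) \<subseteq> events"
    "(\<Union>n. dyadic_events (space M) ?F (T - t) n) \<subseteq> events"
    using dyadic_indep(2,3)[OF t] by (auto simp: dyadic_events_def)
  fix a b assume "a \<in> (\<Union>n. dyadic_events (space M) W t n)" "b \<in> (\<Union>n. dyadic_events (space M) ?F (T - t) n)"
  then obtain n m where "a \<in> dyadic_events (space M) W t n" "b \<in> dyadic_events (space M) ?F (T - t) m" by blast
  then have "a \<in> dyadic_events (space M) W t (max n m)" "b \<in> dyadic_events (space M) ?F (T - t) (max n m)"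
    using dyadic_events_mono[of n "max n m" "space M" W t] dyadic_events_mono[of m "max n m" "space M" ?F "T - t"] by auto
  then show "prob (a \<inter> b) = prob a * prob b"
    using dyadic_indep(1)[OF t] unfolding dyadic_events_def by blast
qed

text \<open>The form in which independence is used: the joint law is a product, so the future may be
  replaced by that of an independent copy \<open>\<omega>'\<close>.\<close>

lemma nn_integral_indep:
  fixes S R :: "'c measure"
  assumes t: "0 \<le> t" "t \<le> T"
    and X: "X \<in> measurable (past t) S" and Y: "Y \<in> measurable (future t) R"
    and G: "G \<in> borel_measurable (S \<Otimes>\<^sub>M R)"
  shows "(\<integral>\<^sup>+\<omega>. G (X \<omega>, Y \<omega>) \<partial>M) = (\<integral>\<^sup>+\<omega>. \<integral>\<^sup>+\<omega>'. G (X \<omega>, Y \<omega>') \<partial>M \<partial>M)"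
proof -
  note ind = indep_past_future[OF t]
  have sp: "space (past t) = space M" "space (future t) = space M"
    by (simp_all add: past_def future_def)
  have sub: "sets (past t) \<subseteq> events" "sets (future t) \<subseteq> events"
    using indep_setD_ev1[OF ind] indep_setD_ev2[OF ind] by auto
  have XM: "X \<in> measurable M S" and YM: "Y \<in> measurable M R"
    using X Y sub sp by (auto simp: measurable_def)
  have "indep_set (sigma_sets (space M) {X -` A \<inter> space M |A. A \<in> sets S}) (sigma_sets (space M) {Y -` A \<inter> space M |A. A \<in> sets R})"
    unfolding indep_set_def
  proof (rule indep_sets_mono_sets[OF ind[unfolded indep_set_def]])
    fix i :: bool
    have 1: "sigma_sets (space M) {X -` A \<inter> space M |A. A \<in> sets S} \<subseteq> sets (past t)"
      unfolding sp(1)[symmetric] by (rule sets.sigma_sets_subset) (use X in \<open>auto intro: measurable_sets\<close>)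
    have 2: "sigma_sets (space M) {Y -` A \<inter> space M |A. A \<in> sets R} \<subseteq> sets (future t)"
      unfolding sp(2)[symmetric] by (rule sets.sigma_sets_subset) (use Y in \<open>auto intro: measurable_sets\<close>)
    show "case_bool (sigma_sets (space M) {X -` A \<inter> space M |A. A \<in> sets S}) (sigma_sets (space M) {Y -` A \<inter> space M |A. A \<in> sets R}) i
       \<subseteq> case_bool (sets (past t)) (sets (future t)) i"
      using 1 2 by (cases i) auto
  qed
  then have "indep_var S X R Y" using XM YM by (simp add: indep_var_eq)
  then have dist: "distr M (S \<Otimes>\<^sub>M R) (\<lambda>x. (X x, Y x)) = distr M S X \<Otimes>\<^sub>M distr M R Y"
    by (simp add: indep_var_distribution_eq)
  interpret Y: prob_space "distr M R Y" using YM by (rule prob_space_distr)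
  have pair: "(\<lambda>x. (X x, Y x)) \<in> measurable M (S \<Otimes>\<^sub>M R)" using XM YM by (rule measurable_Pair)
  have "(\<integral>\<^sup>+\<omega>. G (X \<omega>, Y \<omega>) \<partial>M) = (\<integral>\<^sup>+z. G z \<partial>distr M (S \<Otimes>\<^sub>M R) (\<lambda>x. (X x, Y x)))"
    using pair G by (simp add: nn_integral_distr)
  also have "\<dots> = (\<integral>\<^sup>+x. \<integral>\<^sup>+y. G (x, y) \<partial>distr M R Y \<partial>distr M S X)"
    unfolding dist using G by (intro Y.nn_integral_fst[symmetric]) (simp add: measurable_cong_sets[OF sets_pair_measure_cong[OF sets_distr sets_distr] refl])
  also have "\<dots> = (\<integral>\<^sup>+\<omega>. \<integral>\<^sup>+y. G (X \<omega>, y) \<partial>distr M R Y \<partial>M)"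
  proof -
    have "G \<in> borel_measurable (S \<Otimes>\<^sub>M distr M R Y)"
      using G by (simp add: measurable_cong_sets[OF sets_pair_measure_cong[OF refl sets_distr] refl])
    then have "(\<lambda>x. \<integral>\<^sup>+y. G (x, y) \<partial>distr M R Y) \<in> borel_measurable S"
      by (rule Y.borel_measurable_nn_integral_fst)
    then show ?thesis using XM by (simp add: nn_integral_distr)
  qed
  also have "\<dots> = (\<integral>\<^sup>+\<omega>. \<integral>\<^sup>+\<omega>'. G (X \<omega>, Y \<omega>') \<partial>M \<partial>M)"
  proof (rule nn_integral_cong)
    fix \<omega> assume "\<omega> \<in> space M"
    then have "X \<omega> \<in> space S" by (rule measurable_space[OF XM])
    from measurable_compose[OF measurable_Pair1'[OF this] G] have "(\<lambda>y. G (X \<omega>, y)) \<in> borel_measurable R" .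
    then show "(\<integral>\<^sup>+y. G (X \<omega>, y) \<partial>distr M R Y) = (\<integral>\<^sup>+\<omega>'. G (X \<omega>, Y \<omega>') \<partial>M)"
      using YM by (simp add: nn_integral_distr)
  qed
  finally show ?thesis .
qed

end

text \<open>Lower orthants are closed under intersection, generate the Borel sets and exhaust the
  space, so distribution functions determine the joint laws in two and three variables.\<close>

lemma measure_eqI_atMost:
  fixes \<mu> \<nu> :: "'b::ordered_euclidean_space measure"
  assumes sets: "sets \<mu> = sets borel" "sets \<nu> = sets borel"
    and eq: "\<And>x. emeasure \<mu> {..x} = emeasure \<nu> {..x}" and fin: "\<And>x. emeasure \<mu> {..x} \<noteq> \<infinity>"
  shows "\<mu> = \<nu>"
proof (rule measure_eqI_generator_eq[where E = "range atMost" and \<Omega> = UNIV and A = "\<lambda>i. {..real i *\<^sub>R One}"])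
  show "Int_stable (range atMost :: 'b set set)"
  proof (rule Int_stableI)
    fix a b :: "'b set" assume "a \<in> range atMost" "b \<in> range atMost"
    then obtain x y where "a = {..x}" "b = {..y}" by auto
    then have "a \<inter> b = {..inf x y}" by auto
    then show "a \<inter> b \<in> range atMost" by blast
  qed
  show "sets \<mu> = sigma_sets UNIV (range atMost)" "sets \<nu> = sigma_sets UNIV (range atMost)"
    unfolding sets by (simp_all add: borel_eq_atMost)
  show "(\<Union>i. {..real i *\<^sub>R One}) = (UNIV :: 'b set)"
  proof (rule set_eqI)
    fix x :: 'b
    obtain n where n: "norm x \<le> real n" using real_arch_simple by blast
    have "x \<le> real n *\<^sub>R One"
      unfolding eucl_le[of x]
    proof
      fix i :: 'b assume "i \<in> Basis"
      then have "x \<bullet> i \<le> norm x" using Basis_le_norm[of i x] by simp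
      then show "x \<bullet> i \<le> (real n *\<^sub>R One) \<bullet> i" using n \<open>i \<in> Basis\<close> by simp
    qed
    then have "x \<in> {..real n *\<^sub>R One}" by simp
    then show "x \<in> (\<Union>i. {..real i *\<^sub>R One}) \<longleftrightarrow> x \<in> UNIV" by blast
  qed
qed (use eq fin in auto)

context brownian
begin

lemma nn_integral_increment:
  assumes "0 \<le> s" "s < t" "t \<le> T" and [measurable]: "\<phi> \<in> borel_measurable borel"
  shows "(\<integral>\<^sup>+\<omega>. \<phi> (W t \<omega> - W s \<omega>) \<partial>M) = (\<integral>\<^sup>+x. ennreal (gauss (t - s) x) * \<phi> x \<partial>lborel)"
  using distributed_nn_integral[OF increment_distributed[OF assms(1-3)], of \<phi>] assms
  by (simp add: normal_density_eq_gauss)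

lemma nn_integral_W:
  assumes "0 < t" "t \<le> T" and [measurable]: "\<phi> \<in> borel_measurable borel"
  shows "(\<integral>\<^sup>+\<omega>. \<phi> (W t \<omega>) \<partial>M) = (\<integral>\<^sup>+x. ennreal (gauss t x) * \<phi> x \<partial>lborel)"
proof -
  have "(\<integral>\<^sup>+\<omega>. \<phi> (W t \<omega>) \<partial>M) = (\<integral>\<^sup>+\<omega>. \<phi> (W t \<omega> - W 0 \<omega>) \<partial>M)"
    using W_0 by (intro nn_integral_cong) simp
  then show ?thesis using nn_integral_increment[of 0 t \<phi>] assms by simp
qed

text \<open>The symmetry that is reflected. The degenerate case \<open>s = t\<close> is included
  because the first passage may occur at the last grid point.\<close>

lemma increment_symmetric:
  assumes "0 \<le> s" "s \<le> t" "t \<le> T"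
  shows "prob {\<omega> \<in> space M. W t \<omega> - W s \<omega> < a} = prob {\<omega> \<in> space M. W s \<omega> - W t \<omega> < a}"
proof (cases "s = t")
  case False
  have [measurable]: "W s \<in> borel_measurable M" "W t \<in> borel_measurable M"
    using assms by (auto intro: measurable_W)
  have m: "emeasure M {\<omega> \<in> space M. P (W t \<omega> - W s \<omega>)} = (\<integral>\<^sup>+x. ennreal (gauss (t - s) x) * indicator {x. P x} x \<partial>lborel)"
    if [measurable]: "Measurable.pred borel P" for P
  proof -
    have "emeasure M {\<omega> \<in> space M. P (W t \<omega> - W s \<omega>)} = (\<integral>\<^sup>+\<omega>. indicator {\<omega> \<in> space M. P (W t \<omega> - W s \<omega>)} \<omega> \<partial>M)"
      by (rule nn_integral_indicator[symmetric]) measurable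
    also have "\<dots> = (\<integral>\<^sup>+\<omega>. indicator {x. P x} (W t \<omega> - W s \<omega>) \<partial>M)"
      by (intro nn_integral_cong) (simp add: indicator_def)
    also have "\<dots> = (\<integral>\<^sup>+x. ennreal (gauss (t - s) x) * indicator {x. P x} x \<partial>lborel)"
      using assms False by (intro nn_integral_increment) auto
    finally show ?thesis .
  qed
  have "emeasure M {\<omega> \<in> space M. W t \<omega> - W s \<omega> < a} = (\<integral>\<^sup>+x. ennreal (gauss (t - s) x) * indicator {x. x < a} x \<partial>lborel)"
    by (rule m) measurable
  also have "\<dots> = (\<integral>\<^sup>+x. ennreal (gauss (t - s) x) * indicator {x. - x < a} x \<partial>lborel)"
    using nn_integral_real_affine[of "\<lambda>x. ennreal (gauss (t - s) x) * indicator {x. x < a} x" "-1" 0]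
    by (simp add: indicator_def)
  also have "\<dots> = emeasure M {\<omega> \<in> space M. - (W t \<omega> - W s \<omega>) < a}"
    by (rule m[symmetric]) measurable
  finally show ?thesis by (simp add: measure_def)
qed simp

section \<open>The reflection principle\<close>

definition "Mx \<omega> = pmax T (\<lambda>s. W s \<omega>)"

lemma borel_measurable_Mx [measurable]: "Mx \<in> borel_measurable M"
  unfolding Mx_def using T_nonneg measurable_W continuous_W by (rule borel_measurable_pmax)

lemma Mx_upper: "\<omega> \<in> space M \<Longrightarrow> s \<in> {0..T} \<Longrightarrow> W s \<omega> \<le> Mx \<omega>"
  unfolding Mx_def by (rule pmax_upper[OF continuous_W])

lemma Mx_nonneg: "\<omega> \<in> space M \<Longrightarrow> 0 \<le> Mx \<omega>"
  using Mx_upper[of \<omega> 0] W_0[of \<omega>] T_nonneg by simp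

lemma measurable_W_T [measurable]: "W T \<in> borel_measurable M"
  using measurable_W[of T] T_nonneg by simp

text \<open>The path first exceeds \<open>m\<close> on the \<open>n\<close>-th dyadic grid at index \<open>k\<close>. The path is
  reflected at its value there, which differs from \<open>m\<close> by an overshoot.\<close>

definition "passage m n k = {\<omega> \<in> space M. m < W (real k * T / 2 ^ n) \<omega> \<and> (\<forall>j<k. W (real j * T / 2 ^ n) \<omega> \<le> m)}"

lemma passage_past:
  assumes "k \<le> 2 ^ n"
  shows "passage m n k \<in> sets (past (real k * T / 2 ^ n))"
proof -
  let ?t = "real k * T / 2 ^ n"
  have sp: "space (past ?t) = space M" by (simp add: past_def)
  have t: "?t \<le> T" using dyadic_in_interval[OF T_nonneg assms] by simp
  have m: "W (real j * T / 2 ^ n) \<in> borel_measurable (past ?t)" if "j \<le> k" for j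
    using that T_nonneg by (intro measurable_past t) (auto intro!: divide_right_mono mult_right_mono)
  have "passage m n k = {\<omega> \<in> space (past ?t). m < W ?t \<omega>} \<inter> {\<omega> \<in> space (past ?t). \<forall>j\<in>{..<k}. W (real j * T / 2 ^ n) \<omega> \<le> m}"
    unfolding sp by (auto simp: passage_def)
  also have "\<dots> \<in> sets (past ?t)"
    using m by (intro sets.Int sets.sets_Collect_finite_All borel_measurable_less borel_measurable_le) auto
  finally show ?thesis .
qed

text \<open>Whether the first passage occurs at index \<open>k\<close> is decided by the path up to
  that grid time; the increment from there to \<open>T\<close> is independent of it and
  symmetric.\<close>

lemma passage_indep:
  assumes "k \<le> 2 ^ n"
  defines "t \<equiv> real k * T / 2 ^ n"
  shows "prob (passage m n k \<inter> {\<omega> \<in> space M. W T \<omega> - W t \<omega> < a}) = prob (passage m n k \<inter> {\<omega> \<in> space M. W t \<omega> - W T \<omega> < a})"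
proof -
  have t: "0 \<le> t" "t \<le> T" using dyadic_in_interval[OF T_nonneg assms(1)] by (auto simp: t_def)
  have sp: "space (future t) = space M" by (simp add: future_def)
  have "(\<lambda>\<omega>. W (t + (T - t)) \<omega> - W t \<omega>) \<in> borel_measurable (future t)"
    using t by (intro measurable_future) auto
  then have m: "(\<lambda>\<omega>. W T \<omega> - W t \<omega>) \<in> borel_measurable (future t)" by simp
  have "{\<omega> \<in> space (future t). W T \<omega> - W t \<omega> < a} \<in> sets (future t)"
    "{\<omega> \<in> space (future t). - a < W T \<omega> - W t \<omega>} \<in> sets (future t)"
    using m by (auto intro!: borel_measurable_less)
  moreover have "{\<omega> \<in> space M. - a < W T \<omega> - W t \<omega>} = {\<omega> \<in> space M. W t \<omega> - W T \<omega> < a}" by auto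
  ultimately have "{\<omega> \<in> space M. W T \<omega> - W t \<omega> < a} \<in> sets (future t)"
    "{\<omega> \<in> space M. W t \<omega> - W T \<omega> < a} \<in> sets (future t)" unfolding sp by auto
  then show ?thesis
    using indep_setD[OF indep_past_future[OF t] passage_past[OF assms(1), of m, folded t_def]] increment_symmetric[OF t order_refl, of a]
    by simp
qed

text \<open>\<open>V\<close> relates the value at the passage to the endpoint. It is kept general so
  that the event and its mirror image are two instances with a common limit theorem.\<close>

definition "crossing m n V = (\<Union>k\<in>{..2 ^ n}. passage m n k \<inter> {\<omega> \<in> space M. V (W (real k * T / 2 ^ n) \<omega>) (W T \<omega>)})"

text \<open>On the grid the reflection is exact: the first passage events for different indices are
  disjoint, and the increment is reflected separately on each of them.\<close>

lemma crossing_symmetric: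
  "prob (crossing m n (\<lambda>w e. e - w < a)) = prob (crossing m n (\<lambda>w e. w - e < a))"
  "crossing m n (\<lambda>w e. e - w < a) \<in> events" "crossing m n (\<lambda>w e. w - e < a) \<in> events"
proof -
  have grid: "W (real k * T / 2 ^ n) \<in> borel_measurable M" if "k \<le> 2 ^ n" for k
    using dyadic_in_interval[OF T_nonneg that] by (rule measurable_W)
  have ev: "passage m n k \<in> events" if "k \<le> 2 ^ n" for k
    using passage_past[OF that, of m] indep_setD_ev1[OF indep_past_future] dyadic_in_interval[OF T_nonneg that] by auto
  have ev1: "passage m n k \<inter> {\<omega> \<in> space M. W T \<omega> - W (real k * T / 2 ^ n) \<omega> < a} \<in> events" if "k \<le> 2 ^ n" for k
    using grid[OF that] by (intro sets.Int ev that borel_measurable_less borel_measurable_diff) auto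
  have ev2: "passage m n k \<inter> {\<omega> \<in> space M. W (real k * T / 2 ^ n) \<omega> - W T \<omega> < a} \<in> events" if "k \<le> 2 ^ n" for k
    using grid[OF that] by (intro sets.Int ev that borel_measurable_less borel_measurable_diff) auto
  have disj: "disjoint_family_on (\<lambda>k. passage m n k \<inter> X k) {..2 ^ n}" for X
    unfolding disjoint_family_on_def
  proof (intro ballI impI)
    fix i j :: nat assume "i \<noteq> j"
    then consider "i < j" | "j < i" by linarith
    then show "passage m n i \<inter> X i \<inter> (passage m n j \<inter> X j) = {}"
      by cases (auto simp: passage_def not_le[symmetric])
  qed
  show "crossing m n (\<lambda>w e. e - w < a) \<in> events" "crossing m n (\<lambda>w e. w - e < a) \<in> events"
    unfolding crossing_def using ev1 ev2 by auto
  have "prob (crossing m n (\<lambda>w e. e - w < a)) = (\<Sum>k\<in>{..2 ^ n}. prob (passage m n k \<inter> {\<omega> \<in> space M. W T \<omega> - W (real k * T / 2 ^ n) \<omega> < a}))"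
    unfolding crossing_def using ev1 disj by (intro finite_measure_finite_Union) auto
  also have "\<dots> = (\<Sum>k\<in>{..2 ^ n}. prob (passage m n k \<inter> {\<omega> \<in> space M. W (real k * T / 2 ^ n) \<omega> - W T \<omega> < a}))"
    by (intro sum.cong refl passage_indep) simp
  also have "\<dots> = prob (crossing m n (\<lambda>w e. w - e < a))"
    unfolding crossing_def using ev2 disj by (intro finite_measure_finite_Union[symmetric]) auto
  finally show "prob (crossing m n (\<lambda>w e. e - w < a)) = prob (crossing m n (\<lambda>w e. w - e < a))" .
qed

text \<open>By continuity the overshoot at the first dyadic passage time tends to \<open>0\<close>.\<close>

lemma passage_close:
  assumes \<omega>: "\<omega> \<in> space M" and m: "0 \<le> m" and e: "0 < e"
  shows "\<forall>\<^sub>F n in sequentially. \<forall>k\<le>2 ^ n. \<omega> \<in> passage m n k \<longrightarrow> W (real k * T / 2 ^ n) \<omega> < m + e"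
proof -
  have "uniformly_continuous_on {0..T} (\<lambda>s. W s \<omega>)"
    by (rule compact_uniformly_continuous[OF continuous_W[OF \<omega>]]) simp
  then obtain d where d: "d > 0" "\<And>x y. x \<in> {0..T} \<Longrightarrow> y \<in> {0..T} \<Longrightarrow> dist y x < d \<Longrightarrow> dist (W y \<omega>) (W x \<omega>) < e"
    unfolding uniformly_continuous_on_def using e by metis
  have "(\<lambda>n. T / 2 ^ n) \<longlonglongrightarrow> 0" by real_asymp
  then have "\<forall>\<^sub>F n in sequentially. T / 2 ^ n < d" using d(1) by (rule order_tendstoD(2))
  then show ?thesis
  proof eventually_elim
    case (elim n)
    show ?case
    proof (intro allI impI)
      fix k :: nat assume k: "k \<le> 2 ^ n" and p: "\<omega> \<in> passage m n k"
      \<comment> \<open>The path starts at 0, which is not above \<open>m\<close>, so the passage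
        has a predecessor on the grid, where the path is still at most \<open>m\<close>.\<close>
      have "k \<noteq> 0"
      proof
        assume "k = 0"
        then show False using p W_0[OF \<omega>] m by (simp add: passage_def)
      qed
      then obtain j where j: "k = Suc j" by (cases k) auto
      have in': "real j * T / 2 ^ n \<in> {0..T}" "real k * T / 2 ^ n \<in> {0..T}"
        using k j by (auto intro!: dyadic_in_interval[OF T_nonneg] simp del: atLeastAtMost_iff of_nat_Suc)
      have "real k * T / 2 ^ n - real j * T / 2 ^ n = T / 2 ^ n"
        using j by (simp add: diff_divide_distrib[symmetric] algebra_simps)
      then have "dist (real k * T / 2 ^ n) (real j * T / 2 ^ n) < d"
        using elim T_nonneg by (simp add: dist_real_def)
      then have "dist (W (real k * T / 2 ^ n) \<omega>) (W (real j * T / 2 ^ n) \<omega>) < e"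
        by (intro d(2) in')
      moreover have "W (real j * T / 2 ^ n) \<omega> \<le> m" using p j by (auto simp: passage_def)
      ultimately show "W (real k * T / 2 ^ n) \<omega> < m + e" by (simp add: dist_real_def)
    qed
  qed
qed

text \<open>Some grid point lies above \<open>m\<close>, and it stays a grid point on all finer
  levels because the grids are nested.\<close>

lemma passage_exists:
  assumes \<omega>: "\<omega> \<in> space M" and "m < Mx \<omega>"
  shows "\<forall>\<^sub>F n in sequentially. \<exists>k\<le>2 ^ n. \<omega> \<in> passage m n k"
proof -
  obtain n0 k0 where k0: "k0 \<le> 2 ^ n0" "m < W (real k0 * T / 2 ^ n0) \<omega>"
    using assms pmax_gt_iff_dyadic[OF T_nonneg continuous_W[OF \<omega>]] unfolding Mx_def by blast
  show ?thesis unfolding eventually_sequentially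
  proof (rule exI[of _ n0], intro allI impI)
    fix n assume "n0 \<le> n"
    then obtain d where d: "n = n0 + d" using le_Suc_ex by blast
    have ex: "m < W (real (k0 * 2 ^ d) * T / 2 ^ n) \<omega>" using k0 by (simp add: d power_add)
    define k where "k = (LEAST k. m < W (real k * T / 2 ^ n) \<omega>)"
    have "m < W (real k * T / 2 ^ n) \<omega>" unfolding k_def by (rule LeastI[of _ "k0 * 2 ^ d"]) (rule ex)
    moreover have "W (real j * T / 2 ^ n) \<omega> \<le> m" if "j < k" for j
      using not_less_Least[of j "\<lambda>k. m < W (real k * T / 2 ^ n) \<omega>"] that unfolding k_def by auto
    moreover have "k \<le> k0 * 2 ^ d" unfolding k_def by (rule Least_le) (rule ex)
    moreover have "k0 * 2 ^ d \<le> 2 ^ n" using k0 by (simp add: d power_add)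
    ultimately show "\<exists>k\<le>2 ^ n. \<omega> \<in> passage m n k" using \<omega> unfolding passage_def
      by (intro exI[of _ k] conjI) auto
  qed
qed

lemma passage_Mx: "\<omega> \<in> passage m n k \<Longrightarrow> k \<le> 2 ^ n \<Longrightarrow> m < Mx \<omega>"
  using Mx_upper[of \<omega> "real k * T / 2 ^ n"] dyadic_in_interval[OF T_nonneg, of k n] by (auto simp: passage_def)

text \<open>The last assumption says that for almost every path a small overshoot does not change
  \<open>V\<close>. Since the overshoot tends to 0, the indicators are eventually constant along
  almost every path, and dominated convergence applies.\<close>

lemma prob_crossing_tendsto:
  assumes m: "0 \<le> m" and ev: "\<And>n. crossing m n V \<in> events" "{\<omega> \<in> space M. m < Mx \<omega> \<and> V m (W T \<omega>)} \<in> events"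
    and V: "AE \<omega> in M. \<exists>e>0. \<forall>w. m < w \<longrightarrow> w < m + e \<longrightarrow> V w (W T \<omega>) = V m (W T \<omega>)"
  shows "(\<lambda>n. prob (crossing m n V)) \<longlonglongrightarrow> prob {\<omega> \<in> space M. m < Mx \<omega> \<and> V m (W T \<omega>)}"
proof -
  let ?E = "{\<omega> \<in> space M. m < Mx \<omega> \<and> V m (W T \<omega>)}"
  have "(\<lambda>n. integral\<^sup>L M (indicator (crossing m n V) :: 'a \<Rightarrow> real)) \<longlonglongrightarrow> integral\<^sup>L M (indicator ?E :: 'a \<Rightarrow> real)"
  proof (rule integral_dominated_convergence[where w = "\<lambda>_. 1"])
    show "AE \<omega> in M. (\<lambda>n. indicator (crossing m n V) \<omega> :: real) \<longlonglongrightarrow> indicator ?E \<omega>"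
      using V
    proof (rule AE_mp, intro AE_I2 impI)
      fix \<omega> assume \<omega>: "\<omega> \<in> space M" and "\<exists>e>0. \<forall>w. m < w \<longrightarrow> w < m + e \<longrightarrow> V w (W T \<omega>) = V m (W T \<omega>)"
      then obtain e where e: "e > 0" "\<And>w. m < w \<Longrightarrow> w < m + e \<Longrightarrow> V w (W T \<omega>) = V m (W T \<omega>)" by blast
      have "\<forall>\<^sub>F n in sequentially. (indicator ?E \<omega> :: real) = indicator (crossing m n V) \<omega>"
      proof (cases "m < Mx \<omega>")
        case True
        from passage_exists[OF \<omega> True] passage_close[OF \<omega> m e(1)]
        show ?thesis
        proof eventually_elim
          case (elim n)
          have eq: "V (W (real k * T / 2 ^ n) \<omega>) (W T \<omega>) = V m (W T \<omega>)" if "k \<le> 2 ^ n" "\<omega> \<in> passage m n k" for k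
            using elim(2) that by (intro e(2)) (auto simp: passage_def)
          have "\<omega> \<in> crossing m n V \<longleftrightarrow> \<omega> \<in> ?E"
            unfolding crossing_def using eq elim(1) True \<omega> by auto
          then show ?case by (simp add: indicator_def)
        qed
      next
        case False
        then have "\<omega> \<notin> crossing m n V" for n unfolding crossing_def using passage_Mx[of \<omega> m n] by auto
        then show ?thesis using False by simp
      qed
      then show "(\<lambda>n. indicator (crossing m n V) \<omega> :: real) \<longlonglongrightarrow> indicator ?E \<omega>"
        by (rule Lim_transform_eventually[OF tendsto_const])
    qed
  qed (use ev in \<open>auto simp: indicator_def\<close>)
  then show ?thesis using ev by simp
qed

lemma AE_W_T_neq:
  assumes T: "0 < T"
  shows "AE \<omega> in M. W T \<omega> \<noteq> c"
proof -
  have "emeasure M {\<omega> \<in> space M. W T \<omega> = c} = (\<integral>\<^sup>+\<omega>. indicator {c} (W T \<omega>) \<partial>M)"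
  proof -
    have "emeasure M {\<omega> \<in> space M. W T \<omega> = c} = (\<integral>\<^sup>+\<omega>. indicator {\<omega> \<in> space M. W T \<omega> = c} \<omega> \<partial>M)"
      by (rule nn_integral_indicator[symmetric]) measurable
    also have "\<dots> = (\<integral>\<^sup>+\<omega>. indicator {c} (W T \<omega>) \<partial>M)"
      by (intro nn_integral_cong) (simp add: indicator_def)
    finally show ?thesis .
  qed
  also have "\<dots> = (\<integral>\<^sup>+x. ennreal (gauss T x) * indicator {c} x \<partial>lborel)"
    using T by (intro nn_integral_W) auto
  also have "\<dots> = 0"
    by (simp add: nn_integral_0_iff_AE AE_lborel_singleton[of c] indicator_def)
      (use AE_lborel_singleton[of c] in eventually_elim, simp)
  finally show ?thesis by (subst AE_iff_measurable[OF _ refl]) auto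
qed

theorem reflection_principle:
  assumes T: "0 < T" and m: "0 \<le> m" and b: "b \<le> m"
  shows "prob {\<omega> \<in> space M. m < Mx \<omega> \<and> W T \<omega> < b} = prob {\<omega> \<in> space M. 2 * m - b < W T \<omega>}"
proof -
  \<comment> \<open>At level \<open>w = m\<close> the relation \<open>e - w < a\<close> says
    \<open>e < b\<close>, and its reflection \<open>w - e < a\<close> says
    \<open>2 * m - b < e\<close>.\<close>
  define a where "a = b - m"
  have "(\<lambda>n. prob (crossing m n (\<lambda>w e. e - w < a))) \<longlonglongrightarrow> prob {\<omega> \<in> space M. m < Mx \<omega> \<and> W T \<omega> - m < a}"
  proof (rule prob_crossing_tendsto[OF m crossing_symmetric(2)])
    show "AE \<omega> in M. \<exists>e>0. \<forall>w. m < w \<longrightarrow> w < m + e \<longrightarrow> (W T \<omega> - w < a) = (W T \<omega> - m < a)"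
      using AE_W_T_neq[OF T, of "m + a"]
    proof (rule AE_mp, intro AE_I2 impI)
      fix \<omega> assume "W T \<omega> \<noteq> m + a"
      then show "\<exists>e>0. \<forall>w. m < w \<longrightarrow> w < m + e \<longrightarrow> (W T \<omega> - w < a) = (W T \<omega> - m < a)"
        \<comment> \<open>The admissible overshoot is the distance of the endpoint from the tie,
          positive outside a null event.\<close>
        by (intro exI[of _ "\<bar>W T \<omega> - m - a\<bar>"]) auto
    qed
  qed measurable
  moreover have "(\<lambda>n. prob (crossing m n (\<lambda>w e. w - e < a))) \<longlonglongrightarrow> prob {\<omega> \<in> space M. m < Mx \<omega> \<and> m - W T \<omega> < a}"
  proof (rule prob_crossing_tendsto[OF m crossing_symmetric(3)])
    show "AE \<omega> in M. \<exists>e>0. \<forall>w. m < w \<longrightarrow> w < m + e \<longrightarrow> (w - W T \<omega> < a) = (m - W T \<omega> < a)"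
      using AE_W_T_neq[OF T, of "m - a"]
    proof (rule AE_mp, intro AE_I2 impI)
      fix \<omega> assume "W T \<omega> \<noteq> m - a"
      then show "\<exists>e>0. \<forall>w. m < w \<longrightarrow> w < m + e \<longrightarrow> (w - W T \<omega> < a) = (m - W T \<omega> < a)"
        by (intro exI[of _ "\<bar>m - W T \<omega> - a\<bar>"]) auto
    qed
  qed measurable
  ultimately have "prob {\<omega> \<in> space M. m < Mx \<omega> \<and> W T \<omega> - m < a} = prob {\<omega> \<in> space M. m < Mx \<omega> \<and> m - W T \<omega> < a}"
    unfolding crossing_symmetric(1) by (rule LIMSEQ_unique)
  moreover have "{\<omega> \<in> space M. m < Mx \<omega> \<and> W T \<omega> - m < a} = {\<omega> \<in> space M. m < Mx \<omega> \<and> W T \<omega> < b}"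
    by (auto simp: a_def)
  \<comment> \<open>As \<open>b \<le> m\<close>, an endpoint above \<open>2 * m - b\<close> is above
    \<open>m\<close>, so the condition on the maximum is automatic.\<close>
  moreover have "{\<omega> \<in> space M. m < Mx \<omega> \<and> m - W T \<omega> < a} = {\<omega> \<in> space M. 2 * m - b < W T \<omega>}"
    using b Mx_upper[of _ T] T by (force simp: a_def)
  ultimately show ?thesis by simp
qed

end

section \<open>Joint law of the maximum and the endpoint\<close>

text \<open>The product borel algebra is not syntactically a product measure, so projections need their
  own rules.\<close>

lemma borel_measurable_fst_snd [measurable (raw)]:
  fixes f :: "'c \<Rightarrow> 'a::second_countable_topology \<times> 'b::second_countable_topology"
  assumes "f \<in> borel_measurable N"
  shows "(\<lambda>x. fst (f x)) \<in> borel_measurable N" "(\<lambda>x. snd (f x)) \<in> borel_measurable N"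
proof -
  have "fst \<in> borel_measurable (borel :: ('a \<times> 'b) measure)" "snd \<in> borel_measurable (borel :: ('a \<times> 'b) measure)"
    by (auto intro!: borel_measurable_continuous_onI continuous_intros)
  then show "(\<lambda>x. fst (f x)) \<in> borel_measurable N" "(\<lambda>x. snd (f x)) \<in> borel_measurable N"
    using measurable_compose[OF assms] by auto
qed

text \<open>Integrating the density over \<open>h \<le> m\<close> gives the method of images: the
  free density at the endpoint \<open>b\<close> minus that at its mirror image
  \<open>2 * m - b\<close>. The integrand is a derivative in \<open>h\<close>.\<close>

lemma nn_integral_maxd_atMost:
  assumes T: "T > 0" and m: "m \<ge> 0"
  shows "(\<integral>\<^sup>+h. ennreal (maxd T h (h - b)) * indicator {..m} h \<partial>lborel)
    = ennreal (gauss T b - gauss T (2 * m - b)) * indicator {..m} b"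
proof (cases "b < m \<and> 0 < m")
  case True
  define l where "l = max 0 b"
  have lm: "l < m" using True by (auto simp: l_def)
  let ?f = "\<lambda>h. 2 * (2 * h - b) / T * gauss T (2 * h - b)"
  have "(\<integral>\<^sup>+h. ennreal (maxd T h (h - b)) * indicator {..m} h \<partial>lborel)
     = (\<integral>\<^sup>+h. ennreal (?f h) * indicator {l<..<m} h \<partial>lborel)"
  proof (rule nn_integral_cong_AE)
    show "AE h in lborel. ennreal (maxd T h (h - b)) * indicator {..m} h = ennreal (?f h) * indicator {l<..<m} h"
      using AE_lborel_singleton[of m]
      by eventually_elim (auto simp: maxd_def l_def indicator_def algebra_simps)
  qed
  also have "\<dots> = ennreal (- gauss T (2 * m - b) - (- gauss T (2 * l - b)))"
  proof (rule nn_integral_FTC_Ioo[OF lm])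
    show "((\<lambda>h. - gauss T (2 * h - b)) has_real_derivative ?f h) (at h)" for h
      using T by (auto intro!: derivative_eq_intros)
    show "isCont ?f h" for h
      by (intro continuous_intros) (use T in auto)
    show "l < h \<Longrightarrow> 0 \<le> ?f h" for h
      using T by (simp add: gauss_nonneg l_def)
  qed (intro tendsto_intros)+
  also have "gauss T (2 * l - b) = gauss T b"
    by (auto simp: l_def max_def)
  finally show ?thesis using True by simp
next
  case False
  then have "maxd T h (h - b) = 0" if "h \<le> m" for h
    using that by (auto simp: maxd_def)
  then have "(\<integral>\<^sup>+h. ennreal (maxd T h (h - b)) * indicator {..m} h \<partial>lborel) = (\<integral>\<^sup>+h. 0 \<partial>(lborel :: real measure))"
    by (intro nn_integral_cong) (auto simp: indicator_def)
  moreover have "ennreal (gauss T b - gauss T (2 * m - b)) * indicator {..m} b = 0"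
    using False m by (auto simp: indicator_def)
  ultimately show ?thesis by simp
qed

context brownian
begin

lemma Mx_W_T_cdf:
  assumes T: "0 < T" and m: "0 \<le> m"
  shows "emeasure M {\<omega> \<in> space M. Mx \<omega> \<le> m \<and> W T \<omega> \<le> b}
    = (\<integral>\<^sup>+x. ennreal (gauss T x - gauss T (2 * m - x)) * indicator {..min b m} x \<partial>lborel)"
proof -
  \<comment> \<open>On \<open>Mx \<le> m\<close> the endpoint is at most \<open>m\<close>, so
    \<open>b\<close> may be lowered to \<open>min b m\<close>, which meets the assumption of the
    reflection principle.\<close>
  define c where "c = min b m"
  have c: "c \<le> m" by (simp add: c_def)
  have law: "emeasure M {\<omega> \<in> space M. P (W T \<omega>)} = (\<integral>\<^sup>+x. ennreal (gauss T x) * indicator {x. P x} x \<partial>lborel)"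
    if [measurable]: "Measurable.pred borel P" for P
  proof -
    have "emeasure M {\<omega> \<in> space M. P (W T \<omega>)} = (\<integral>\<^sup>+\<omega>. indicator {\<omega> \<in> space M. P (W T \<omega>)} \<omega> \<partial>M)"
      by (rule nn_integral_indicator[symmetric]) measurable
    also have "\<dots> = (\<integral>\<^sup>+\<omega>. indicator {x. P x} (W T \<omega>) \<partial>M)"
      by (intro nn_integral_cong) (simp add: indicator_def)
    also have "\<dots> = (\<integral>\<^sup>+x. ennreal (gauss T x) * indicator {x. P x} x \<partial>lborel)"
      using T by (intro nn_integral_W) auto
    finally show ?thesis .
  qed
  let ?R = "\<integral>\<^sup>+x. ennreal (gauss T (2 * m - x)) * indicator {..c} x \<partial>lborel"
  have high: "emeasure M {\<omega> \<in> space M. m < Mx \<omega> \<and> W T \<omega> \<le> c} = ?R"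
  proof -
    have "emeasure M {\<omega> \<in> space M. m < Mx \<omega> \<and> W T \<omega> \<le> c} = emeasure M {\<omega> \<in> space M. m < Mx \<omega> \<and> W T \<omega> < c}"
    proof (rule emeasure_eq_AE)
      show "AE \<omega> in M. (\<omega> \<in> {\<omega> \<in> space M. m < Mx \<omega> \<and> W T \<omega> \<le> c}) = (\<omega> \<in> {\<omega> \<in> space M. m < Mx \<omega> \<and> W T \<omega> < c})"
        using AE_W_T_neq[OF T, of c] by eventually_elim auto
    qed measurable
    also have "\<dots> = emeasure M {\<omega> \<in> space M. 2 * m - c < W T \<omega>}"
      using reflection_principle[OF T m c] by (simp add: emeasure_eq_measure)
    also have "\<dots> = (\<integral>\<^sup>+x. ennreal (gauss T x) * indicator {x. 2 * m - c < x} x \<partial>lborel)"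
      by (rule law) measurable
    also have "\<dots> = (\<integral>\<^sup>+x. ennreal (gauss T (2 * m - x)) * indicator {x. 2 * m - c < 2 * m - x} x \<partial>lborel)"
      using nn_integral_real_affine[of "\<lambda>x. ennreal (gauss T x) * indicator {x. 2 * m - c < x} x" "-1" "2 * m"]
      by (simp add: indicator_def)
    also have "\<dots> = ?R"
    proof (rule nn_integral_cong_AE)
      show "AE x in lborel. ennreal (gauss T (2 * m - x)) * indicator {x. 2 * m - c < 2 * m - x} x = ennreal (gauss T (2 * m - x)) * indicator {..c} x"
        using AE_lborel_singleton[of c] by eventually_elim (auto simp: indicator_def)
    qed
    finally show ?thesis .
  qed
  have fin: "?R \<noteq> \<infinity>" unfolding high[symmetric] by simp
  have le: "gauss T (2 * m - x) \<le> gauss T x" if "x \<le> c" for x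
    using that c T m by (intro gauss_mono) auto
  \<comment> \<open>The complementary event is added on both sides and cancelled at the end, where
    finiteness of \<open>?R\<close> is used; this avoids subtraction of extended reals.\<close>
  have "emeasure M {\<omega> \<in> space M. Mx \<omega> \<le> m \<and> W T \<omega> \<le> c} + ?R = emeasure M {\<omega> \<in> space M. W T \<omega> \<le> c}"
    unfolding high[symmetric] by (subst plus_emeasure) (auto intro!: arg_cong[where f = "emeasure M"])
  also have "\<dots> = (\<integral>\<^sup>+x. ennreal (gauss T x) * indicator {x. x \<le> c} x \<partial>lborel)"
    by (rule law) measurable
  also have "\<dots> = (\<integral>\<^sup>+x. ennreal (gauss T x - gauss T (2 * m - x)) * indicator {..c} x + ennreal (gauss T (2 * m - x)) * indicator {..c} x \<partial>lborel)"
    using le T by (intro nn_integral_cong) (auto simp: indicator_def ennreal_plus[symmetric] gauss_nonneg simp del: ennreal_plus)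
  also have "\<dots> = (\<integral>\<^sup>+x. ennreal (gauss T x - gauss T (2 * m - x)) * indicator {..c} x \<partial>lborel) + ?R"
    by (rule nn_integral_add) measurable
  finally have "emeasure M {\<omega> \<in> space M. Mx \<omega> \<le> m \<and> W T \<omega> \<le> c} = (\<integral>\<^sup>+x. ennreal (gauss T x - gauss T (2 * m - x)) * indicator {..c} x \<partial>lborel)"
    using fin by (simp add: ennreal_add_left_cancel add.commute)
  moreover have "{\<omega> \<in> space M. Mx \<omega> \<le> m \<and> W T \<omega> \<le> c} = {\<omega> \<in> space M. Mx \<omega> \<le> m \<and> W T \<omega> \<le> b}"
    using Mx_upper[of _ T] T by (force simp: c_def)
  ultimately show ?thesis by (simp add: c_def)
qed

lemma distr_Mx_W_T:
  assumes T: "0 < T"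
  shows "distr M borel (\<lambda>\<omega>. (Mx \<omega>, W T \<omega>)) = density lborel (\<lambda>(h, b). ennreal (maxd T h (h - b)))"
proof (rule measure_eqI_atMost)
  fix z :: "real \<times> real"
  obtain m b where z: "z = (m, b)" by (cases z)
  have [measurable]: "(\<lambda>(h, b). ennreal (maxd T h (h - b))) \<in> borel_measurable (borel :: (real \<times> real) measure)"
    unfolding borel_prod[symmetric] by measurable
  have sub: "{..(m, b)} = {..m} \<times> {..b}" by (auto simp: less_eq_prod_def)
  have L: "emeasure (distr M borel (\<lambda>\<omega>. (Mx \<omega>, W T \<omega>))) {..z} = emeasure M {\<omega> \<in> space M. Mx \<omega> \<le> m \<and> W T \<omega> \<le> b}"
    unfolding z sub by (subst emeasure_distr) (auto intro!: arg_cong[where f = "emeasure M"] simp: sub[symmetric])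
  have "emeasure (density lborel (\<lambda>(h, b). ennreal (maxd T h (h - b)))) {..z}
     = (\<integral>\<^sup>+p. (\<lambda>(h, b). ennreal (maxd T h (h - b))) p * indicator {..z} p \<partial>lborel)"
    by (intro emeasure_density) simp_all
  also have "\<dots> = (\<integral>\<^sup>+p. ennreal (maxd T (fst p) (fst p - snd p)) * indicator {..m} (fst p) * indicator {..b} (snd p) \<partial>(lborel \<Otimes>\<^sub>M lborel))"
    unfolding lborel_prod z sub by (intro nn_integral_cong) (auto simp: indicator_def)
  also have "\<dots> = (\<integral>\<^sup>+x. \<integral>\<^sup>+h. ennreal (maxd T h (h - x)) * indicator {..m} h * indicator {..b} x \<partial>lborel \<partial>lborel)"
    by (subst lborel_pair.nn_integral_snd[symmetric]) simp_all
  also have "\<dots> = (\<integral>\<^sup>+x. (\<integral>\<^sup>+h. ennreal (maxd T h (h - x)) * indicator {..m} h \<partial>lborel) * indicator {..b} x \<partial>lborel)"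
    by (intro nn_integral_cong nn_integral_multc) measurable
  finally have R: "emeasure (density lborel (\<lambda>(h, b). ennreal (maxd T h (h - b)))) {..z}
     = (\<integral>\<^sup>+x. (\<integral>\<^sup>+h. ennreal (maxd T h (h - x)) * indicator {..m} h \<partial>lborel) * indicator {..b} x \<partial>lborel)" .
  show "emeasure (distr M borel (\<lambda>\<omega>. (Mx \<omega>, W T \<omega>))) {..z} = emeasure (density lborel (\<lambda>(h, b). ennreal (maxd T h (h - b)))) {..z}"
  proof (cases "0 \<le> m")
    case True
    show ?thesis
      unfolding L R nn_integral_maxd_atMost[OF T True] Mx_W_T_cdf[OF T True]
      by (intro nn_integral_cong) (auto simp: indicator_def)
  next
    case False
    have empty: "{\<omega> \<in> space M. Mx \<omega> \<le> m \<and> W T \<omega> \<le> b} = {}" using Mx_nonneg False by force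
    have "emeasure M {\<omega> \<in> space M. Mx \<omega> \<le> m \<and> W T \<omega> \<le> b} = 0" unfolding empty by simp
    moreover have "(\<integral>\<^sup>+h. ennreal (maxd T h (h - x)) * indicator {..m} h \<partial>lborel) = (\<integral>\<^sup>+h. 0 \<partial>(lborel :: real measure))" for x
      using False by (intro nn_integral_cong) (auto simp: maxd_def indicator_def)
    ultimately show ?thesis unfolding L R by simp
  qed
next
  fix x :: "real \<times> real"
  interpret D: prob_space "distr M borel (\<lambda>\<omega>. (Mx \<omega>, W T \<omega>))" by (rule prob_space_distr) measurable
  show "emeasure (distr M borel (\<lambda>\<omega>. (Mx \<omega>, W T \<omega>))) {..x} \<noteq> \<infinity>" by simp
qed simp_all

lemma nn_integral_Mx_W_T:
  assumes T: "0 < T" and [measurable]: "\<phi> \<in> borel_measurable (borel :: (real \<times> real) measure)"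
  shows "(\<integral>\<^sup>+\<omega>. \<phi> (Mx \<omega>, Mx \<omega> - W T \<omega>) \<partial>M) = (\<integral>\<^sup>+p. ennreal (maxd T (fst p) (snd p)) * \<phi> p \<partial>lborel)"
proof -
  have [measurable]: "(\<lambda>(h, b). ennreal (maxd T h (h - b))) \<in> borel_measurable (borel :: (real \<times> real) measure)"
    unfolding borel_prod[symmetric] by measurable
  have [measurable]: "\<phi> \<in> borel_measurable (lborel \<Otimes>\<^sub>M lborel)"
    by (simp add: lborel_prod)
  have "(\<lambda>p. \<phi> (fst p, fst p - snd p)) \<in> borel_measurable (borel \<Otimes>\<^sub>M borel)"
    by measurable
  then have [measurable]: "(\<lambda>p. \<phi> (fst p, fst p - snd p)) \<in> borel_measurable (borel :: (real \<times> real) measure)"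
    by (simp only: borel_prod)
  have "(\<integral>\<^sup>+\<omega>. \<phi> (Mx \<omega>, Mx \<omega> - W T \<omega>) \<partial>M) = (\<integral>\<^sup>+p. \<phi> (fst p, fst p - snd p) \<partial>distr M borel (\<lambda>\<omega>. (Mx \<omega>, W T \<omega>)))"
    by (subst nn_integral_distr) simp_all
  also have "\<dots> = (\<integral>\<^sup>+p. (\<lambda>(h, b). ennreal (maxd T h (h - b))) p * \<phi> (fst p, fst p - snd p) \<partial>lborel)"
    unfolding distr_Mx_W_T[OF T] by (rule nn_integral_density) simp_all
  also have "\<dots> = (\<integral>\<^sup>+p. ennreal (maxd T (fst p) (fst p - snd p)) * \<phi> (fst p, fst p - snd p) \<partial>(lborel \<Otimes>\<^sub>M lborel))"
    unfolding lborel_prod by (intro nn_integral_cong) (auto split: prod.split)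
  also have "\<dots> = (\<integral>\<^sup>+h. \<integral>\<^sup>+b. ennreal (maxd T h (h - b)) * \<phi> (h, h - b) \<partial>lborel \<partial>lborel)"
    by (subst lborel.nn_integral_fst[symmetric]) simp_all
  also have "\<dots> = (\<integral>\<^sup>+h. \<integral>\<^sup>+x. ennreal (maxd T h x) * \<phi> (h, x) \<partial>lborel \<partial>lborel)"
  proof (rule nn_integral_cong)
    fix h :: real
    show "(\<integral>\<^sup>+b. ennreal (maxd T h (h - b)) * \<phi> (h, h - b) \<partial>lborel) = (\<integral>\<^sup>+x. ennreal (maxd T h x) * \<phi> (h, x) \<partial>lborel)"
      using nn_integral_real_affine[of "\<lambda>x. ennreal (maxd T h x) * \<phi> (h, x)" "-1" h] by simp
  qed
  also have "\<dots> = (\<integral>\<^sup>+p. ennreal (maxd T (fst p) (snd p)) * \<phi> p \<partial>(lborel \<Otimes>\<^sub>M lborel))"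
    by (subst lborel.nn_integral_fst[symmetric]) simp_all
  finally show ?thesis unfolding lborel_prod .
qed

section \<open>Splitting at a fixed time, and the law of the argmax\<close>

definition "argM \<omega> = parg T (\<lambda>s. W s \<omega>)"

lemma borel_measurable_argM [measurable]: "argM \<in> borel_measurable M"
  unfolding argM_def using T_nonneg measurable_W continuous_W by (rule borel_measurable_parg)

lemma argM_range: "\<omega> \<in> space M \<Longrightarrow> 0 \<le> argM \<omega> \<and> argM \<omega> \<le> T"
  using parg_exists(1)[OF T_nonneg continuous_W] by (simp add: argM_def)

text \<open>The maximum, its distance to the endpoint, and the argmax split at time \<open>u\<close> into the
  corresponding quantities for the independent past and future.\<close>

definition "past3 u \<omega> = (parg u (\<lambda>s. W s \<omega>), pmax u (\<lambda>s. W s \<omega>), pmax u (\<lambda>s. W s \<omega>) - W u \<omega>)"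
definition "future3 u \<omega> = (let V = (\<lambda>s. W (u + s) \<omega> - W u \<omega>) in
   (parg (T - u) V, pmax (T - u) V, pmax (T - u) V - V (T - u)))"

lemma measurable_past3:
  assumes "0 \<le> u" "u \<le> T"
  shows "past3 u \<in> measurable (past u) borel"
proof -
  have sp: "space (past u) = space M" by (simp add: past_def)
  have W: "W s \<in> borel_measurable (past u)" if "s \<in> {0..u}" for s
    using that assms by (intro measurable_past) auto
  have c: "continuous_on {0..u} (\<lambda>s. W s \<omega>)" if "\<omega> \<in> space (past u)" for \<omega>
    using brownian.continuous_W[OF brownian_restrict[OF assms]] that sp by simp
  have V: "W u \<in> borel_measurable (past u)" using assms by (intro W) simp
  note m = borel_measurable_pmax[OF assms(1) W c]
  show ?thesis
    unfolding past3_def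
    by (intro borel_measurable_Pair borel_measurable_parg[OF assms(1) W c] m borel_measurable_diff[OF m V])
qed

lemma measurable_future3:
  assumes "0 \<le> u" "u \<le> T"
  shows "future3 u \<in> measurable (future u) borel"
proof -
  let ?V = "\<lambda>s \<omega>. W (u + s) \<omega> - W u \<omega>"
  have sp: "space (future u) = space M" by (simp add: future_def)
  have W: "?V s \<in> borel_measurable (future u)" if "s \<in> {0..T - u}" for s
    using that assms by (intro measurable_future) auto
  have c: "continuous_on {0..T - u} (\<lambda>s. ?V s \<omega>)" if "\<omega> \<in> space (future u)" for \<omega>
    using brownian.continuous_W[OF brownian_shift[OF assms]] that sp by simp
  have u: "0 \<le> T - u" using assms by simp
  have V: "?V (T - u) \<in> borel_measurable (future u)" using assms by (intro W) simp
  note m = borel_measurable_pmax[OF u W c]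
  show ?thesis
    unfolding future3_def Let_def
    by (intro borel_measurable_Pair borel_measurable_parg[OF u W c] m borel_measurable_diff[OF m V])
qed

lemma nn_integral_past3_future3:
  assumes u: "0 \<le> u" "u \<le> T" and G: "G \<in> borel_measurable (borel :: ((real \<times> real \<times> real) \<times> (real \<times> real \<times> real)) measure)"
  shows "(\<integral>\<^sup>+\<omega>. G (past3 u \<omega>, future3 u \<omega>) \<partial>M) = (\<integral>\<^sup>+\<omega>. \<integral>\<^sup>+\<omega>'. G (past3 u \<omega>, future3 u \<omega>') \<partial>M \<partial>M)"
  using nn_integral_indep[OF u measurable_past3[OF u] measurable_future3[OF u], of G] G
  by (simp add: borel_prod)

text \<open>\<open>m\<close> is the maximum up to \<open>u\<close> and \<open>y\<close> its height
  above the path at \<open>u\<close>; \<open>n\<close> is the maximum of the later increments and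
  \<open>z\<close> the distance from it to the end. The future reaches a new maximum exactly if
  \<open>n > y\<close>, and that maximum is \<open>m - y + n\<close>.\<close>

lemma split_at:
  assumes u: "0 \<le> u" "u \<le> T" and \<omega>: "\<omega> \<in> space M"
    and p: "past3 u \<omega> = (p1, m, y)" and f: "future3 u \<omega> = (f1, n, z)"
  shows "argM \<omega> \<le> u \<longleftrightarrow> n \<le> y"
    and "n \<le> y \<Longrightarrow> argM \<omega> = p1 \<and> Mx \<omega> = m \<and> Mx \<omega> - W T \<omega> = z + y - n \<and> Mx \<omega> - W u \<omega> = y"
    and "y < n \<Longrightarrow> argM \<omega> = u + f1 \<and> Mx \<omega> = m - y + n \<and> Mx \<omega> - W T \<omega> = z \<and> Mx \<omega> - W u \<omega> = n"
  using pmax_split[OF u continuous_W[OF \<omega>]] parg_le_iff[OF u continuous_W[OF \<omega>]] p f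
  unfolding past3_def future3_def argM_def Mx_def Let_def by auto

end

lemma nn_integral_lborel_pair:
  fixes f :: "'a::euclidean_space \<times> 'b::euclidean_space \<Rightarrow> ennreal"
  assumes [measurable]: "f \<in> borel_measurable borel"
  shows "(\<integral>\<^sup>+p. f p \<partial>lborel) = (\<integral>\<^sup>+x. \<integral>\<^sup>+y. f (x, y) \<partial>lborel \<partial>lborel)"
    and "(\<integral>\<^sup>+p. f p \<partial>lborel) = (\<integral>\<^sup>+y. \<integral>\<^sup>+x. f (x, y) \<partial>lborel \<partial>lborel)"
proof -
  have [measurable]: "f \<in> borel_measurable (lborel \<Otimes>\<^sub>M lborel)"
    by (simp add: lborel_prod)
  show "(\<integral>\<^sup>+p. f p \<partial>lborel) = (\<integral>\<^sup>+x. \<integral>\<^sup>+y. f (x, y) \<partial>lborel \<partial>lborel)"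
    unfolding lborel_prod[symmetric] by (rule lborel.nn_integral_fst[symmetric]) measurable
  show "(\<integral>\<^sup>+p. f p \<partial>lborel) = (\<integral>\<^sup>+y. \<integral>\<^sup>+x. f (x, y) \<partial>lborel \<partial>lborel)"
    unfolding lborel_prod[symmetric] by (rule lborel_pair.nn_integral_snd[symmetric]) measurable
qed

lemma nn_integral_lborel_shift:
  fixes f :: "real \<Rightarrow> ennreal"
  assumes [measurable]: "f \<in> borel_measurable borel"
  shows "(\<integral>\<^sup>+x. f (x + c) \<partial>lborel) = (\<integral>\<^sup>+x. f x \<partial>lborel)"
  using nn_integral_real_affine[of f 1 c] by (simp add: add.commute)

text \<open>The killed transition density, set to 0 for \<open>a \<le> 0\<close> so that the
  diagonal integral holds for every real \<open>a\<close> and no case distinction enters the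
  convolutions.\<close>

definition killed :: "real \<Rightarrow> real \<Rightarrow> real \<Rightarrow> real" where
  "killed T a b = (if 0 < a then gauss T (a - b) - gauss T (a + b) else 0)"

lemma borel_measurable_killed [measurable (raw)]:
  assumes [measurable]: "f \<in> borel_measurable N" "g \<in> borel_measurable N"
  shows "(\<lambda>x. killed T (f x) (g x)) \<in> borel_measurable N"
  unfolding killed_def by measurable

lemma nn_integral_maxd_diagonal':
  assumes T: "T > 0" and b: "b > 0"
  shows "(\<integral>\<^sup>+z. ennreal (maxd T (a - b + z) z) * indicator {..<b} z \<partial>lborel) = ennreal (killed T a b)"
proof (cases "a > 0")
  case True
  then show ?thesis using nn_integral_maxd_diagonal[OF T True b] by (simp add: killed_def)
next
  case False
  then have "(\<integral>\<^sup>+z. ennreal (maxd T (a - b + z) z) * indicator {..<b} z \<partial>lborel) = (\<integral>\<^sup>+z. 0 \<partial>(lborel :: real measure))"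
    by (intro nn_integral_cong) (auto simp: maxd_def indicator_def)
  then show ?thesis using False by (simp add: killed_def)
qed

context brownian
begin

lemma nn_integral_past_max:
  assumes u: "0 < u" "u \<le> T" and [measurable]: "\<phi> \<in> borel_measurable (borel :: (real \<times> real) measure)"
  shows "(\<integral>\<^sup>+\<omega>. \<phi> (snd (past3 u \<omega>)) \<partial>M) = (\<integral>\<^sup>+p. ennreal (maxd u (fst p) (snd p)) * \<phi> p \<partial>lborel)"
proof -
  interpret P: brownian M u W using u by (intro brownian_restrict) auto
  show ?thesis using P.nn_integral_Mx_W_T[OF u(1), of \<phi>] by (simp add: P.Mx_def past3_def)
qed

lemma nn_integral_future_max:
  assumes u: "0 \<le> u" "u < T" and [measurable]: "\<phi> \<in> borel_measurable (borel :: (real \<times> real) measure)"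
  shows "(\<integral>\<^sup>+\<omega>. \<phi> (snd (future3 u \<omega>)) \<partial>M) = (\<integral>\<^sup>+p. ennreal (maxd (T - u) (fst p) (snd p)) * \<phi> p \<partial>lborel)"
proof -
  interpret F: brownian M "T - u" "\<lambda>s \<omega>. W (u + s) \<omega> - W u \<omega>" using u by (intro brownian_shift) auto
  have "0 < T - u" using u by simp
  from F.nn_integral_Mx_W_T[OF this, of \<phi>] show ?thesis by (simp add: F.Mx_def future3_def Let_def)
qed

text \<open>If the argmax is at most \<open>u\<close>, the maximum belongs to the past and the
  future contributes only the way from depth \<open>y\<close> to depth \<open>x\<close>. Integrating
  out \<open>n\<close> gives the killed density, and integrating out \<open>y\<close> gives the mass
  of \<open>argd\<close> below \<open>u\<close>.\<close>

lemma nn_integral_argM_le: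
  assumes u: "0 < u" "u < T" and [measurable]: "\<psi> \<in> borel_measurable (borel :: (real \<times> real) measure)"
  shows "(\<integral>\<^sup>+\<omega>. indicator {..u} (argM \<omega>) * \<psi> (Mx \<omega>, Mx \<omega> - W T \<omega>) \<partial>M)
    = (\<integral>\<^sup>+h. \<integral>\<^sup>+x. (\<integral>\<^sup>+\<theta>. ennreal (argd T \<theta> h x) * indicator {..u} \<theta> \<partial>lborel) * \<psi> (h, x) \<partial>lborel \<partial>lborel)"
proof -
  have u': "0 \<le> u" "u \<le> T" and v: "0 < T - u" using u by auto
  define K where "K = (\<lambda>(m :: real, y) (n, z). if n \<le> y then \<psi> (m, z + y - n) else 0)"
  have K: "K (m, y) (n, z) = (if n \<le> y then \<psi> (m, z + y - n) else 0)" for m y n z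
    by (simp add: K_def)
  have Kalt: "(\<lambda>x. K (f x) (g x)) = (\<lambda>x. if fst (g x) \<le> snd (f x) then \<psi> (fst (f x), snd (g x) + snd (f x) - fst (g x)) else 0)" for f :: "'z \<Rightarrow> _" and g
    by (auto simp: K_def split: prod.split)
  have [measurable (raw)]: "(\<lambda>x. K (f x) (g x)) \<in> borel_measurable N"
    if [measurable]: "f \<in> borel_measurable N" "g \<in> borel_measurable N" for f g and N :: "'z measure"
    unfolding Kalt by measurable
  have "(\<integral>\<^sup>+\<omega>. indicator {..u} (argM \<omega>) * \<psi> (Mx \<omega>, Mx \<omega> - W T \<omega>) \<partial>M)
     = (\<integral>\<^sup>+\<omega>. (\<lambda>(p, f). K (snd p) (snd f)) (past3 u \<omega>, future3 u \<omega>) \<partial>M)"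
  proof (rule nn_integral_cong)
    fix \<omega> assume \<omega>: "\<omega> \<in> space M"
    obtain p1 m y f1 n z where p: "past3 u \<omega> = (p1, m, y)" and f: "future3 u \<omega> = (f1, n, z)"
      by (metis prod_cases3)
    show "indicator {..u} (argM \<omega>) * \<psi> (Mx \<omega>, Mx \<omega> - W T \<omega>) = (\<lambda>(p, f). K (snd p) (snd f)) (past3 u \<omega>, future3 u \<omega>)"
    proof (cases "n \<le> y")
      case True
      then have "argM \<omega> \<le> u" "Mx \<omega> = m" "Mx \<omega> - W T \<omega> = z + y - n"
        using split_at(1)[OF u' \<omega> p f] split_at(2)[OF u' \<omega> p f] by auto
      then show ?thesis using True by (simp only: p f) (simp add: K)
    next
      case False
      then show ?thesis using split_at(1)[OF u' \<omega> p f] by (simp add: p f K)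
    qed
  qed
  also have "\<dots> = (\<integral>\<^sup>+\<omega>. \<integral>\<^sup>+\<omega>'. K (snd (past3 u \<omega>)) (snd (future3 u \<omega>')) \<partial>M \<partial>M)"
    by (subst nn_integral_past3_future3[OF u']) (simp_all add: case_prod_beta)
  also have "\<dots> = (\<integral>\<^sup>+\<omega>. (\<lambda>p. \<integral>\<^sup>+q. ennreal (maxd (T - u) (fst q) (snd q)) * K p q \<partial>lborel) (snd (past3 u \<omega>)) \<partial>M)"
    using u by (intro nn_integral_cong nn_integral_future_max) auto
  also have "\<dots> = (\<integral>\<^sup>+p. ennreal (maxd u (fst p) (snd p)) * (\<integral>\<^sup>+q. ennreal (maxd (T - u) (fst q) (snd q)) * K p q \<partial>lborel) \<partial>lborel)"
    using u by (intro nn_integral_past_max) auto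
  also have "\<dots> = (\<integral>\<^sup>+m. \<integral>\<^sup>+y. ennreal (maxd u m y) * (\<integral>\<^sup>+q. ennreal (maxd (T - u) (fst q) (snd q)) * K (m, y) q \<partial>lborel) \<partial>lborel \<partial>lborel)"
    by (subst nn_integral_lborel_pair(1)) simp_all
  also have "\<dots> = (\<integral>\<^sup>+m. \<integral>\<^sup>+y. ennreal (maxd u m y) * (\<integral>\<^sup>+x. ennreal (killed (T - u) x y) * \<psi> (m, x) \<partial>lborel) \<partial>lborel \<partial>lborel)"
  proof (intro nn_integral_cong)
    fix m y :: real
    show "ennreal (maxd u m y) * (\<integral>\<^sup>+q. ennreal (maxd (T - u) (fst q) (snd q)) * K (m, y) q \<partial>lborel)
       = ennreal (maxd u m y) * (\<integral>\<^sup>+x. ennreal (killed (T - u) x y) * \<psi> (m, x) \<partial>lborel)"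
    proof (cases "y > 0")
      case True
      have "(\<integral>\<^sup>+q. ennreal (maxd (T - u) (fst q) (snd q)) * K (m, y) q \<partial>lborel)
         = (\<integral>\<^sup>+n. \<integral>\<^sup>+z. ennreal (maxd (T - u) n z) * (indicator {..y} n * \<psi> (m, z + y - n)) \<partial>lborel \<partial>lborel)"
        by (subst nn_integral_lborel_pair(1)) (auto simp: K indicator_def intro!: nn_integral_cong)
      \<comment> \<open>The substitution \<open>x = z + y - n\<close>, the final depth below the
        overall maximum, brings the arguments of \<open>maxd\<close> into the diagonal form.\<close>
      also have "\<dots> = (\<integral>\<^sup>+n. \<integral>\<^sup>+x. ennreal (maxd (T - u) n (x - y + n)) * (indicator {..y} n * \<psi> (m, x)) \<partial>lborel \<partial>lborel)"
      proof (rule nn_integral_cong)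
        fix n :: real
        show "(\<integral>\<^sup>+z. ennreal (maxd (T - u) n z) * (indicator {..y} n * \<psi> (m, z + y - n)) \<partial>lborel)
           = (\<integral>\<^sup>+x. ennreal (maxd (T - u) n (x - y + n)) * (indicator {..y} n * \<psi> (m, x)) \<partial>lborel)"
          using nn_integral_lborel_shift[of "\<lambda>z. ennreal (maxd (T - u) n z) * (indicator {..y} n * \<psi> (m, z + y - n))" "n - y"]
          by (simp add: algebra_simps)
      qed
      also have "\<dots> = (\<integral>\<^sup>+x. \<integral>\<^sup>+n. ennreal (maxd (T - u) n (x - y + n)) * (indicator {..y} n * \<psi> (m, x)) \<partial>lborel \<partial>lborel)"
        by (rule lborel_pair.Fubini') measurable
      also have "\<dots> = (\<integral>\<^sup>+x. ennreal (killed (T - u) x y) * \<psi> (m, x) \<partial>lborel)"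
      proof (rule nn_integral_cong)
        fix x :: real
        have "(\<integral>\<^sup>+n. ennreal (maxd (T - u) n (x - y + n)) * (indicator {..y} n * \<psi> (m, x)) \<partial>lborel)
           = (\<integral>\<^sup>+n. ennreal (maxd (T - u) (x - y + n) n) * indicator {..<y} n * \<psi> (m, x) \<partial>lborel)"
        \<comment> \<open>The tie \<open>n = y\<close> is a null set; removing it yields the open
          half line of the diagonal integral.\<close>
        proof (rule nn_integral_cong_AE)
          show "AE n in lborel. ennreal (maxd (T - u) n (x - y + n)) * (indicator {..y} n * \<psi> (m, x))
             = ennreal (maxd (T - u) (x - y + n) n) * indicator {..<y} n * \<psi> (m, x)"
            using AE_lborel_singleton[of y] by eventually_elim (auto simp: maxd_commute[of "T - u"] indicator_def)
        qed
        also have "\<dots> = (\<integral>\<^sup>+n. ennreal (maxd (T - u) (x - y + n) n) * indicator {..<y} n \<partial>lborel) * \<psi> (m, x)"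
          by (rule nn_integral_multc) measurable
        finally show "(\<integral>\<^sup>+n. ennreal (maxd (T - u) n (x - y + n)) * (indicator {..y} n * \<psi> (m, x)) \<partial>lborel) = ennreal (killed (T - u) x y) * \<psi> (m, x)"
          using nn_integral_maxd_diagonal'[OF v True, of x] by simp
      qed
      finally show ?thesis by simp
    qed (simp add: maxd_def)
  qed
  also have "\<dots> = (\<integral>\<^sup>+m. \<integral>\<^sup>+x. (\<integral>\<^sup>+\<theta>. ennreal (argd T \<theta> m x) * indicator {..u} \<theta> \<partial>lborel) * \<psi> (m, x) \<partial>lborel \<partial>lborel)"
  proof (rule nn_integral_cong)
    fix m :: real
    have "(\<integral>\<^sup>+y. ennreal (maxd u m y) * (\<integral>\<^sup>+x. ennreal (killed (T - u) x y) * \<psi> (m, x) \<partial>lborel) \<partial>lborel)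
       = (\<integral>\<^sup>+y. \<integral>\<^sup>+x. ennreal (maxd u m y) * ennreal (killed (T - u) x y) * \<psi> (m, x) \<partial>lborel \<partial>lborel)"
      by (intro nn_integral_cong) (simp add: nn_integral_cmult[symmetric] mult.assoc)
    also have "\<dots> = (\<integral>\<^sup>+x. \<integral>\<^sup>+y. ennreal (maxd u m y) * ennreal (killed (T - u) x y) * \<psi> (m, x) \<partial>lborel \<partial>lborel)"
      by (rule lborel_pair.Fubini') measurable
    also have "\<dots> = (\<integral>\<^sup>+x. (\<integral>\<^sup>+\<theta>. ennreal (argd T \<theta> m x) * indicator {..u} \<theta> \<partial>lborel) * \<psi> (m, x) \<partial>lborel)"
    proof (rule nn_integral_cong)
      fix x :: real
      have "(\<integral>\<^sup>+y. ennreal (maxd u m y) * ennreal (killed (T - u) x y) \<partial>lborel) = (\<integral>\<^sup>+\<theta>. ennreal (argd T \<theta> m x) * indicator {..u} \<theta> \<partial>lborel)"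
      proof (cases "0 < m \<and> 0 < x")
        case True
        have "(\<integral>\<^sup>+y. ennreal (maxd u m y) * ennreal (killed (T - u) x y) \<partial>lborel)
           = (\<integral>\<^sup>+y. ennreal (maxd u m y * (gauss (T - u) (x - y) - gauss (T - u) (x + y))) \<partial>lborel)"
          using True maxd_nonneg[OF u(1)] by (intro nn_integral_cong) (simp add: ennreal_mult'[symmetric] killed_def)
        then show ?thesis using nn_integral_maxd_killed'[OF _ _ u, of m x] True by simp
      next
        case False
        then have "(\<integral>\<^sup>+y. ennreal (maxd u m y) * ennreal (killed (T - u) x y) \<partial>lborel) = (\<integral>\<^sup>+y. 0 \<partial>(lborel :: real measure))"
          by (intro nn_integral_cong) (auto simp: killed_def maxd_def)
        moreover have "(\<integral>\<^sup>+\<theta>. ennreal (argd T \<theta> m x) * indicator {..u} \<theta> \<partial>lborel) = (\<integral>\<^sup>+y. 0 \<partial>(lborel :: real measure))"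
          using False by (intro nn_integral_cong) (auto simp: argd_def)
        ultimately show ?thesis by simp
      qed
      then show "(\<integral>\<^sup>+y. ennreal (maxd u m y) * ennreal (killed (T - u) x y) * \<psi> (m, x) \<partial>lborel)
         = (\<integral>\<^sup>+\<theta>. ennreal (argd T \<theta> m x) * indicator {..u} \<theta> \<partial>lborel) * \<psi> (m, x)"
        by (simp add: nn_integral_multc)
    qed
    finally show "(\<integral>\<^sup>+y. ennreal (maxd u m y) * (\<integral>\<^sup>+x. ennreal (killed (T - u) x y) * \<psi> (m, x) \<partial>lborel) \<partial>lborel)
      = (\<integral>\<^sup>+x. (\<integral>\<^sup>+\<theta>. ennreal (argd T \<theta> m x) * indicator {..u} \<theta> \<partial>lborel) * \<psi> (m, x) \<partial>lborel)" .
  qed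
  finally show ?thesis .
qed

lemma AE_Mx_pos:
  assumes T: "0 < T"
  shows "AE \<omega> in M. 0 < Mx \<omega>"
proof -
  have "(\<integral>\<^sup>+\<omega>. indicator {..0} (Mx \<omega>) \<partial>M) = (\<integral>\<^sup>+p. ennreal (maxd T (fst p) (snd p)) * indicator {..0} (fst p) \<partial>lborel)"
    using nn_integral_Mx_W_T[OF T, of "\<lambda>p. indicator {..0} (fst p)"] by simp
  also have "\<dots> = (\<integral>\<^sup>+p. 0 \<partial>(lborel :: (real \<times> real) measure))"
    by (intro nn_integral_cong) (auto simp: maxd_def indicator_def)
  finally have "AE \<omega> in M. indicator {..0} (Mx \<omega>) = (0 :: ennreal)"
    by (simp add: nn_integral_0_iff_AE)
  then show ?thesis by eventually_elim (auto simp: indicator_def split: if_splits)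
qed

lemma distr_argM:
  assumes T: "0 < T"
  shows "distr M borel (\<lambda>\<omega>. (argM \<omega>, Mx \<omega>, Mx \<omega> - W T \<omega>))
    = density lborel (\<lambda>q. ennreal (argd T (fst q) (fst (snd q)) (snd (snd q))))"
proof (rule measure_eqI_atMost)
  fix z :: "real \<times> real \<times> real"
  obtain u a c where z: "z = (u, a, c)" by (metis prod_cases3)
  define \<psi> :: "real \<times> real \<Rightarrow> ennreal" where "\<psi> = (\<lambda>p. indicator {..a} (fst p) * indicator {..c} (snd p))"
  have [measurable]: "\<psi> \<in> borel_measurable borel" unfolding \<psi>_def by measurable
  have ind: "indicator {..z} q = indicator {..u} (fst q) * \<psi> (snd q)" for q
    by (cases q) (auto simp: z \<psi>_def indicator_def less_eq_prod_def)
  have L: "emeasure (distr M borel (\<lambda>\<omega>. (argM \<omega>, Mx \<omega>, Mx \<omega> - W T \<omega>))) {..z}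
    = (\<integral>\<^sup>+\<omega>. indicator {..u} (argM \<omega>) * \<psi> (Mx \<omega>, Mx \<omega> - W T \<omega>) \<partial>M)"
  proof -
    have "emeasure (distr M borel (\<lambda>\<omega>. (argM \<omega>, Mx \<omega>, Mx \<omega> - W T \<omega>))) {..z}
      = (\<integral>\<^sup>+q. indicator {..z} q \<partial>distr M borel (\<lambda>\<omega>. (argM \<omega>, Mx \<omega>, Mx \<omega> - W T \<omega>)))"
      by (rule nn_integral_indicator[symmetric]) simp
    also have "\<dots> = (\<integral>\<^sup>+\<omega>. indicator {..z} (argM \<omega>, Mx \<omega>, Mx \<omega> - W T \<omega>) \<partial>M)"
      by (subst nn_integral_distr) simp_all
    finally show ?thesis unfolding ind by simp
  qed
  have R: "emeasure (density lborel (\<lambda>q. ennreal (argd T (fst q) (fst (snd q)) (snd (snd q))))) {..z}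
    = (\<integral>\<^sup>+h. \<integral>\<^sup>+x. (\<integral>\<^sup>+\<theta>. ennreal (argd T \<theta> h x) * indicator {..u} \<theta> \<partial>lborel) * \<psi> (h, x) \<partial>lborel \<partial>lborel)"
  proof -
    have "emeasure (density lborel (\<lambda>q. ennreal (argd T (fst q) (fst (snd q)) (snd (snd q))))) {..z}
      = (\<integral>\<^sup>+q. ennreal (argd T (fst q) (fst (snd q)) (snd (snd q))) * (indicator {..u} (fst q) * \<psi> (snd q)) \<partial>lborel)"
      unfolding ind[symmetric] by (rule emeasure_density) simp_all
    also have "\<dots> = (\<integral>\<^sup>+p. \<integral>\<^sup>+\<theta>. ennreal (argd T \<theta> (fst p) (snd p)) * indicator {..u} \<theta> * \<psi> p \<partial>lborel \<partial>lborel)"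
      by (subst nn_integral_lborel_pair(2)) (simp_all add: mult.assoc)
    also have "\<dots> = (\<integral>\<^sup>+p. (\<integral>\<^sup>+\<theta>. ennreal (argd T \<theta> (fst p) (snd p)) * indicator {..u} \<theta> \<partial>lborel) * \<psi> p \<partial>lborel)"
      by (intro nn_integral_cong nn_integral_multc) measurable
    also have "\<dots> = (\<integral>\<^sup>+h. \<integral>\<^sup>+x. (\<integral>\<^sup>+\<theta>. ennreal (argd T \<theta> h x) * indicator {..u} \<theta> \<partial>lborel) * \<psi> (h, x) \<partial>lborel \<partial>lborel)"
      by (subst nn_integral_lborel_pair(1)) simp_all
    finally show ?thesis .
  qed
  \<comment> \<open>The split needs \<open>u\<close> strictly inside. For \<open>T \<le> u\<close>
    the bound on the argmax is void; for \<open>u \<le> 0\<close> it would place the argmax at 0,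
    where the path vanishes, although the maximum is almost surely positive.\<close>
  consider "0 < u" "u < T" | "T \<le> u" | "u \<le> 0" by linarith
  then show "emeasure (distr M borel (\<lambda>\<omega>. (argM \<omega>, Mx \<omega>, Mx \<omega> - W T \<omega>))) {..z}
     = emeasure (density lborel (\<lambda>q. ennreal (argd T (fst q) (fst (snd q)) (snd (snd q))))) {..z}"
  proof cases
    case 1
    then show ?thesis unfolding L R by (intro nn_integral_argM_le) auto
  next
    case 2
    have "(\<integral>\<^sup>+\<omega>. indicator {..u} (argM \<omega>) * \<psi> (Mx \<omega>, Mx \<omega> - W T \<omega>) \<partial>M) = (\<integral>\<^sup>+\<omega>. \<psi> (Mx \<omega>, Mx \<omega> - W T \<omega>) \<partial>M)"
    proof (rule nn_integral_cong)
      fix \<omega> assume "\<omega> \<in> space M"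
      then have "argM \<omega> \<le> u" using argM_range[of \<omega>] 2 by simp
      then show "indicator {..u} (argM \<omega>) * \<psi> (Mx \<omega>, Mx \<omega> - W T \<omega>) = \<psi> (Mx \<omega>, Mx \<omega> - W T \<omega>)" by simp
    qed
    also have "\<dots> = (\<integral>\<^sup>+h. \<integral>\<^sup>+x. ennreal (maxd T h x) * \<psi> (h, x) \<partial>lborel \<partial>lborel)"
      by (subst nn_integral_Mx_W_T[OF T]) (simp_all add: nn_integral_lborel_pair(1))
    also have "\<dots> = (\<integral>\<^sup>+h. \<integral>\<^sup>+x. (\<integral>\<^sup>+\<theta>. ennreal (argd T \<theta> h x) * indicator {..u} \<theta> \<partial>lborel) * \<psi> (h, x) \<partial>lborel \<partial>lborel)"
    proof -
      have "(\<integral>\<^sup>+\<theta>. ennreal (argd T \<theta> h x) * indicator {..u} \<theta> \<partial>lborel) = ennreal (maxd T h x)" for h x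
        unfolding nn_integral_argd[OF T, symmetric] using 2
        by (intro nn_integral_cong) (auto simp: argd_def indicator_def)
      then show ?thesis by simp
    qed
    finally show ?thesis unfolding L R .
  next
    case 3
    have "(\<integral>\<^sup>+\<omega>. indicator {..u} (argM \<omega>) * \<psi> (Mx \<omega>, Mx \<omega> - W T \<omega>) \<partial>M) = (\<integral>\<^sup>+\<omega>. 0 \<partial>M)"
    proof (rule nn_integral_cong_AE)
      show "AE \<omega> in M. indicator {..u} (argM \<omega>) * \<psi> (Mx \<omega>, Mx \<omega> - W T \<omega>) = 0"
        using AE_Mx_pos[OF T] AE_space
      proof eventually_elim
        case (elim \<omega>)
        have "argM \<omega> \<noteq> 0"
          using parg_exists(2)[OF T_nonneg continuous_W[OF elim(2)]] W_0[OF elim(2)] elim(1)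
          by (auto simp: argM_def Mx_def)
        then have "\<not> argM \<omega> \<le> u" using argM_range[OF elim(2)] 3 by simp
        then show ?case by simp
      qed
    qed
    moreover have "(\<integral>\<^sup>+\<theta>. ennreal (argd T \<theta> h x) * indicator {..u} \<theta> \<partial>lborel) = (\<integral>\<^sup>+\<theta>. 0 \<partial>(lborel :: real measure))" for h x
      using 3 by (intro nn_integral_cong) (auto simp: argd_def indicator_def)
    ultimately show ?thesis unfolding L R by simp
  qed
next
  fix x :: "real \<times> real \<times> real"
  interpret D: prob_space "distr M borel (\<lambda>\<omega>. (argM \<omega>, Mx \<omega>, Mx \<omega> - W T \<omega>))" by (rule prob_space_distr) measurable
  show "emeasure (distr M borel (\<lambda>\<omega>. (argM \<omega>, Mx \<omega>, Mx \<omega> - W T \<omega>))) {..x} \<noteq> \<infinity>" by simp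
qed simp_all

lemma nn_integral_argM:
  assumes T: "0 < T" and [measurable]: "\<phi> \<in> borel_measurable (borel :: (real \<times> real \<times> real) measure)"
  shows "(\<integral>\<^sup>+\<omega>. \<phi> (argM \<omega>, Mx \<omega>, Mx \<omega> - W T \<omega>) \<partial>M)
    = (\<integral>\<^sup>+q. ennreal (argd T (fst q) (fst (snd q)) (snd (snd q))) * \<phi> q \<partial>lborel)"
proof -
  have "(\<integral>\<^sup>+\<omega>. \<phi> (argM \<omega>, Mx \<omega>, Mx \<omega> - W T \<omega>) \<partial>M) = (\<integral>\<^sup>+q. \<phi> q \<partial>distr M borel (\<lambda>\<omega>. (argM \<omega>, Mx \<omega>, Mx \<omega> - W T \<omega>)))"
    by (subst nn_integral_distr) simp_all
  then show ?thesis unfolding distr_argM[OF T] by (subst (asm) nn_integral_density) simp_all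
qed

end

section \<open>The path at time \<open>t\<close> jointly with argmax and maximum\<close>

lemma borel_measurable_bessel_bridge [measurable (raw)]:
  assumes [measurable]: "v \<in> borel_measurable N" "m \<in> borel_measurable N" "y \<in> borel_measurable N"
  shows "(\<lambda>x. bessel_bridge (v x) (m x) (y x)) \<in> borel_measurable N"
  unfolding bessel_bridge_def by measurable

lemma borel_measurable_post_density [measurable (raw)]:
  assumes [measurable]: "a \<in> borel_measurable N" "b \<in> borel_measurable N" "y \<in> borel_measurable N"
  shows "(\<lambda>x. post_density (a x) (b x) (y x)) \<in> borel_measurable N"
  unfolding post_density_def by measurable

text \<open>The joint density of \<open>\<theta>\<close> and \<open>h\<close>.\<close>

definition argm :: "real \<Rightarrow> real \<Rightarrow> real \<Rightarrow> real" where
  "argm T \<theta> h = (if 0 < \<theta> \<and> \<theta> < T \<and> 0 < h then 2 * h / \<theta> * gauss \<theta> h * gauss (T - \<theta>) 0 else 0)"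

lemma argm_nonneg: "0 \<le> argm T \<theta> h"
  by (simp add: argm_def gauss_nonneg)

lemma borel_measurable_argm [measurable (raw)]:
  assumes [measurable]: "f \<in> borel_measurable N" "g \<in> borel_measurable N"
  shows "(\<lambda>x. argm T (f x) (g x)) \<in> borel_measurable N"
  unfolding argm_def by measurable

text \<open>The endpoint enters \<open>argd\<close> only through
  \<open>x * gauss (T - \<theta>) x\<close>, a multiple of a Rayleigh density and a derivative in
  \<open>x\<close>.\<close>

lemma nn_integral_argd_end:
  "(\<integral>\<^sup>+x. ennreal (argd T \<theta> h x) \<partial>lborel) = ennreal (argm T \<theta> h)"
proof (cases "0 < \<theta> \<and> \<theta> < T \<and> 0 < h")
  case True
  then have v: "T - \<theta> > 0" by simp
  let ?C = "2 * h / \<theta> * gauss \<theta> h"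
  have C: "?C \<ge> 0" using True by (simp add: gauss_nonneg)
  let ?f = "\<lambda>x. ?C * (x / (T - \<theta>) * gauss (T - \<theta>) x)"
  have "(\<integral>\<^sup>+x. ennreal (argd T \<theta> h x) \<partial>lborel) = (\<integral>\<^sup>+x. ennreal (?f x) * indicator {0<..} x \<partial>lborel)"
    using True by (intro nn_integral_cong) (auto simp: argd_def indicator_def mult_ac)
  also have "\<dots> = ennreal (0 - ?C * - gauss (T - \<theta>) 0)"
  proof (rule nn_integral_FTC_Ioi'[where F = "\<lambda>x. ?C * - gauss (T - \<theta>) x"])
    have "((\<lambda>x. - gauss (T - \<theta>) x) has_real_derivative x / (T - \<theta>) * gauss (T - \<theta>) x) (at x)" for x
      using v by (auto intro!: derivative_eq_intros)
    then show "((\<lambda>x. ?C * - gauss (T - \<theta>) x) has_real_derivative ?f x) (at x)" for x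
      by (rule DERIV_cmult)
    show "isCont ?f x" for x
      by (intro continuous_intros) (use v in auto)
    show "0 \<le> ?f x" if "0 < x" for x
      by (intro mult_nonneg_nonneg[OF C] mult_nonneg_nonneg divide_nonneg_nonneg gauss_nonneg) (use v that in auto)
    have "(gauss (T - \<theta>) \<longlongrightarrow> 0) at_top"
      using gauss_tendsto_0[OF v, of 0] by simp
    then have "((\<lambda>x. ?C * - gauss (T - \<theta>) x) \<longlongrightarrow> ?C * - 0) at_top"
      by (intro tendsto_mult tendsto_const tendsto_minus)
    then show "((\<lambda>x. ?C * - gauss (T - \<theta>) x) \<longlongrightarrow> 0) at_top"
      by (simp only: minus_zero mult_zero_right)
  qed
  finally show ?thesis using True by (simp add: argm_def)
next
  case False
  then have "(\<integral>\<^sup>+x. ennreal (argd T \<theta> h x) \<partial>lborel) = (\<integral>\<^sup>+x. 0 \<partial>(lborel :: real measure))"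
    by (intro nn_integral_cong) (auto simp: argd_def)
  moreover have "argm T \<theta> h = 0" using False by (auto simp: argm_def)
  ultimately show ?thesis by simp
qed

text \<open>The reason why the endpoint is irrelevant before the maximum: \<open>z\<close> occurs on
  both sides only in a factor of \<open>argd\<close>. Completing the square merges the two Gaussians
  on \<open>[0, t]\<close> with the one on \<open>[t, \<theta>]\<close>, which produces the mean and
  variance of the bridge.\<close>

lemma argd_killed:
  assumes t: "0 < t"
  shows "ennreal (argd (T - t) (\<theta> - t) n z) * ennreal (killed t h n)
    = indicator {t<..} \<theta> * ennreal (argd T \<theta> h z) * ennreal (bessel_bridge (t * (\<theta> - t) / \<theta>) (h * (\<theta> - t) / \<theta>) n)"
proof (cases "t < \<theta> \<and> \<theta> < T \<and> 0 < n \<and> 0 < z \<and> 0 < h")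
  case True
  define u where "u = \<theta> - t"
  have u: "u > 0" "\<theta> = u + t" "\<theta> > 0" using True t by (auto simp: u_def)
  have g: "gauss t (h - n) * gauss u n = gauss \<theta> h * gauss (t * u / \<theta>) (n - h * u / \<theta>)"
    using gauss_mult_gauss[OF u(1) t, of 0 n h] u(2) by (simp add: mult.commute)
  have g': "gauss t (h + n) * gauss u n = gauss \<theta> h * gauss (t * u / \<theta>) (n + h * u / \<theta>)"
    using gauss_mult_gauss[OF u(1) t, of 0 n "- h"] gauss_minus[of t "h + n"] u(2) by (simp add: mult.commute)
  have "argd (T - t) u n z * killed t h n
     = 2 * n * z / (u * (T - \<theta>)) * gauss (T - \<theta>) z * (gauss t (h - n) * gauss u n - gauss t (h + n) * gauss u n)"
    using True u by (simp add: argd_def killed_def algebra_simps)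
  also have "\<dots> = argd T \<theta> h z * bessel_bridge (t * u / \<theta>) (h * u / \<theta>) n"
    unfolding g g' using True u(1,3) by (simp add: argd_def bessel_bridge_def field_simps)
  finally have eq: "argd (T - t) u n z * killed t h n = argd T \<theta> h z * bessel_bridge (t * u / \<theta>) (h * u / \<theta>) n" .
  show ?thesis using True eq unfolding u_def[symmetric]
    by (simp add: ennreal_mult'[symmetric] argd_nonneg)
next
  case False
  have z: "argd (T - t) (\<theta> - t) n z = 0 \<or> killed t h n = 0" using False t by (auto simp: argd_def killed_def)
  have "\<not> t < \<theta> \<or> argd T \<theta> h z = 0 \<or> bessel_bridge (t * (\<theta> - t) / \<theta>) (h * (\<theta> - t) / \<theta>) n = 0"
    using False t by (auto simp: argd_def bessel_bridge_def)
  then show ?thesis using z by (auto simp: indicator_def)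
qed

text \<open>The left side is the density of argmax, maximum and depth \<open>y\<close> at time
  \<open>t\<close>, times the probability that the future stays below \<open>y\<close>. The height
  \<open>h\<close> occurs only in the factor for \<open>[0, \<theta>]\<close>, so it separates into
  \<open>argm\<close>.\<close>

lemma argd_erf:
  assumes t: "t < T"
  shows "ennreal (argd t \<theta> h y) * ennreal (erf (y / sqrt (2 * (T - t))))
    = ennreal (argm T \<theta> h) * indicator {..<t} \<theta> * ennreal (post_density (t - \<theta>) (T - t) y)"
proof (cases "0 < \<theta> \<and> \<theta> < t \<and> 0 < h \<and> 0 < y")
  case True
  have "gauss (T - \<theta>) 0 * sqrt (2 * pi * (T - \<theta>)) = 1" using True t by (simp add: gauss_def)
  then have "argm T \<theta> h * post_density (t - \<theta>) (T - t) y
    = 2 * h / \<theta> * gauss \<theta> h * (y / (t - \<theta>) * gauss (t - \<theta>) y * erf (y / sqrt (2 * (T - t)))) * 1"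
    using True t by (simp add: argm_def post_density_def mult_ac)
  then have "argd t \<theta> h y * erf (y / sqrt (2 * (T - t))) = argm T \<theta> h * post_density (t - \<theta>) (T - t) y"
    using True by (simp add: argd_def)
  then show ?thesis using True argd_nonneg argm_nonneg by (simp add: ennreal_mult'[symmetric])
next
  case False
  have "argd t \<theta> h y = 0" using False by (auto simp: argd_def)
  moreover have "argm T \<theta> h = 0 \<or> \<not> \<theta> < t \<or> post_density (t - \<theta>) (T - t) y = 0"
    using False by (auto simp: argm_def post_density_def)
  ultimately show ?thesis by (auto simp: indicator_def)
qed

context brownian
begin

lemma nn_integral_future_arg:
  assumes u: "0 \<le> u" "u < T" and [measurable]: "\<phi> \<in> borel_measurable (borel :: (real \<times> real \<times> real) measure)"
  shows "(\<integral>\<^sup>+\<omega>. \<phi> (future3 u \<omega>) \<partial>M) = (\<integral>\<^sup>+q. ennreal (argd (T - u) (fst q) (fst (snd q)) (snd (snd q))) * \<phi> q \<partial>lborel)"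
proof -
  interpret F: brownian M "T - u" "\<lambda>s \<omega>. W (u + s) \<omega> - W u \<omega>" using u by (intro brownian_shift) auto
  have "0 < T - u" using u by simp
  from F.nn_integral_argM[OF this, of \<phi>] show ?thesis by (simp add: F.argM_def F.Mx_def future3_def Let_def)
qed

lemma nn_integral_past_arg:
  assumes u: "0 < u" "u \<le> T" and [measurable]: "\<phi> \<in> borel_measurable (borel :: (real \<times> real \<times> real) measure)"
  shows "(\<integral>\<^sup>+\<omega>. \<phi> (past3 u \<omega>) \<partial>M) = (\<integral>\<^sup>+q. ennreal (argd u (fst q) (fst (snd q)) (snd (snd q))) * \<phi> q \<partial>lborel)"
proof -
  interpret P: brownian M u W using u by (intro brownian_restrict) auto
  show ?thesis using P.nn_integral_argM[OF u(1), of \<phi>] by (simp add: P.argM_def P.Mx_def past3_def)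
qed

text \<open>For \<open>t\<close> before the argmax the maximum is that of the future piece: its
  height \<open>n\<close> above the path at \<open>t\<close> is the depth sought, and the past
  enters only through its maximum and its final depth, which are integrated out.\<close>

theorem law_before_max:
  assumes t: "0 < t" "t < T" and [measurable]: "\<Phi> \<in> borel_measurable (borel :: (real \<times> real \<times> real \<times> real) measure)"
  shows "(\<integral>\<^sup>+\<omega>. indicator {t<..} (argM \<omega>) * \<Phi> (Mx \<omega> - W t \<omega>, argM \<omega>, Mx \<omega>, Mx \<omega> - W T \<omega>) \<partial>M)
    = (\<integral>\<^sup>+q. ennreal (argd T (fst q) (fst (snd q)) (snd (snd q))) * (indicator {t<..} (fst q) *
        (\<integral>\<^sup>+y. ennreal (bessel_bridge (t * (fst q - t) / fst q) (fst (snd q) * (fst q - t) / fst q) y) * \<Phi> (y, q) \<partial>lborel)) \<partial>lborel)"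
proof -
  have t': "0 \<le> t" "t \<le> T" using t by auto
  define K where "K = (\<lambda>p q. if snd p < fst (snd q) then \<Phi> (fst (snd q), t + fst q, fst p - snd p + fst (snd q), snd (snd q)) else 0)"
  have [measurable (raw)]: "(\<lambda>x. K (f x) (g x)) \<in> borel_measurable N"
    if [measurable]: "f \<in> borel_measurable N" "g \<in> borel_measurable N" for f g and N :: "'z measure"
    unfolding K_def by measurable
  have "(\<integral>\<^sup>+\<omega>. indicator {t<..} (argM \<omega>) * \<Phi> (Mx \<omega> - W t \<omega>, argM \<omega>, Mx \<omega>, Mx \<omega> - W T \<omega>) \<partial>M)
     = (\<integral>\<^sup>+\<omega>. (\<lambda>(p, f). K (snd p) f) (past3 t \<omega>, future3 t \<omega>) \<partial>M)"
  proof (rule nn_integral_cong)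
    fix \<omega> assume \<omega>: "\<omega> \<in> space M"
    obtain p1 m y f1 n z where p: "past3 t \<omega> = (p1, m, y)" and f: "future3 t \<omega> = (f1, n, z)"
      by (metis prod_cases3)
    show "indicator {t<..} (argM \<omega>) * \<Phi> (Mx \<omega> - W t \<omega>, argM \<omega>, Mx \<omega>, Mx \<omega> - W T \<omega>) = (\<lambda>(p, f). K (snd p) f) (past3 t \<omega>, future3 t \<omega>)"
    proof (cases "n \<le> y")
      case True
      then show ?thesis using split_at(1)[OF t' \<omega> p f] by (simp add: p f K_def)
    next
      case False
      then have e: "argM \<omega> = t + f1" "Mx \<omega> = m - y + n" "Mx \<omega> - W T \<omega> = z" "Mx \<omega> - W t \<omega> = n" and l: "t < argM \<omega>"
        using split_at(1)[OF t' \<omega> p f] split_at(3)[OF t' \<omega> p f] by auto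
      have "indicator {t<..} (argM \<omega>) = (1 :: ennreal)" using l by simp
      moreover have "K (m, y) (f1, n, z) = \<Phi> (n, t + f1, m - y + n, z)" using False by (simp add: K_def)
      ultimately show ?thesis by (simp only: p f e(3,4) prod.case snd_conv mult_1_left) (simp only: e(1,2))
    qed
  qed
  also have "\<dots> = (\<integral>\<^sup>+\<omega>. \<integral>\<^sup>+\<omega>'. K (snd (past3 t \<omega>)) (future3 t \<omega>') \<partial>M \<partial>M)"
    by (subst nn_integral_past3_future3[OF t']) (simp_all add: case_prod_beta)
  also have "\<dots> = (\<integral>\<^sup>+\<omega>. (\<lambda>p. \<integral>\<^sup>+q. ennreal (argd (T - t) (fst q) (fst (snd q)) (snd (snd q))) * K p q \<partial>lborel) (snd (past3 t \<omega>)) \<partial>M)"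
    using t by (intro nn_integral_cong nn_integral_future_arg) auto
  also have "\<dots> = (\<integral>\<^sup>+p. ennreal (maxd t (fst p) (snd p)) * (\<integral>\<^sup>+q. ennreal (argd (T - t) (fst q) (fst (snd q)) (snd (snd q))) * K p q \<partial>lborel) \<partial>lborel)"
    using t by (intro nn_integral_past_max) auto
  also have "\<dots> = (\<integral>\<^sup>+p. \<integral>\<^sup>+q. ennreal (maxd t (fst p) (snd p)) * (ennreal (argd (T - t) (fst q) (fst (snd q)) (snd (snd q))) * K p q) \<partial>lborel \<partial>lborel)"
    by (simp add: nn_integral_cmult)
  also have "\<dots> = (\<integral>\<^sup>+q. \<integral>\<^sup>+p. ennreal (maxd t (fst p) (snd p)) * (ennreal (argd (T - t) (fst q) (fst (snd q)) (snd (snd q))) * K p q) \<partial>lborel \<partial>lborel)"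
    by (rule lborel_pair.Fubini') measurable
  also have "\<dots> = (\<integral>\<^sup>+q. \<integral>\<^sup>+h. ennreal (argd (T - t) (fst q) (fst (snd q)) (snd (snd q))) * (ennreal (killed t h (fst (snd q))) * \<Phi> (fst (snd q), t + fst q, h, snd (snd q))) \<partial>lborel \<partial>lborel)"
  proof (rule nn_integral_cong)
    fix q :: "real \<times> real \<times> real"
    obtain f1 n z where q: "q = (f1, n, z)" by (metis prod_cases3)
    show "(\<integral>\<^sup>+p. ennreal (maxd t (fst p) (snd p)) * (ennreal (argd (T - t) (fst q) (fst (snd q)) (snd (snd q))) * K p q) \<partial>lborel)
      = (\<integral>\<^sup>+h. ennreal (argd (T - t) (fst q) (fst (snd q)) (snd (snd q))) * (ennreal (killed t h (fst (snd q))) * \<Phi> (fst (snd q), t + fst q, h, snd (snd q))) \<partial>lborel)"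
    proof (cases "n > 0")
      case True
      let ?A = "ennreal (argd (T - t) f1 n z)"
      let ?g = "\<lambda>h. ?A * \<Phi> (n, t + f1, h, z)"
      have "(\<integral>\<^sup>+p. ennreal (maxd t (fst p) (snd p)) * (?A * K p q) \<partial>lborel)
         = (\<integral>\<^sup>+y. \<integral>\<^sup>+m. ennreal (maxd t m y) * (?A * K (m, y) q) \<partial>lborel \<partial>lborel)"
        by (subst nn_integral_lborel_pair(2)) simp_all
      \<comment> \<open>Replacing \<open>m\<close> by the overall maximum
        \<open>h = m - y + n\<close> leaves \<open>y\<close> free, and the integral over
        \<open>y\<close> is then the diagonal one.\<close>
      also have "\<dots> = (\<integral>\<^sup>+y. \<integral>\<^sup>+h. ennreal (maxd t (h - n + y) y) * indicator {..<n} y * ?g h \<partial>lborel \<partial>lborel)"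
      proof (rule nn_integral_cong)
        fix y :: real
        have "(\<integral>\<^sup>+m. ennreal (maxd t m y) * (?A * K (m, y) q) \<partial>lborel) = (\<integral>\<^sup>+m. ennreal (maxd t m y) * indicator {..<n} y * ?g (m - y + n) \<partial>lborel)"
          by (intro nn_integral_cong) (auto simp: q K_def indicator_def mult.assoc)
        also have "\<dots> = (\<integral>\<^sup>+h. ennreal (maxd t (h - n + y) y) * indicator {..<n} y * ?g h \<partial>lborel)"
          using nn_integral_lborel_shift[of "\<lambda>m. ennreal (maxd t m y) * indicator {..<n} y * ?g (m - y + n)" "y - n"]
          by (simp add: algebra_simps)
        finally show "(\<integral>\<^sup>+m. ennreal (maxd t m y) * (?A * K (m, y) q) \<partial>lborel) = (\<integral>\<^sup>+h. ennreal (maxd t (h - n + y) y) * indicator {..<n} y * ?g h \<partial>lborel)" .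
      qed
      also have "\<dots> = (\<integral>\<^sup>+h. \<integral>\<^sup>+y. ennreal (maxd t (h - n + y) y) * indicator {..<n} y * ?g h \<partial>lborel \<partial>lborel)"
        by (rule lborel_pair.Fubini') measurable
      also have "\<dots> = (\<integral>\<^sup>+h. ennreal (killed t h n) * ?g h \<partial>lborel)"
        by (simp add: nn_integral_multc nn_integral_maxd_diagonal'[OF t(1) True])
      finally show ?thesis by (simp add: q mult_ac)
    qed (simp add: q argd_def)
  qed
  also have "\<dots> = (\<integral>\<^sup>+f. \<integral>\<^sup>+n. \<integral>\<^sup>+z. \<integral>\<^sup>+h. ennreal (argd (T - t) f n z) * (ennreal (killed t h n) * \<Phi> (n, t + f, h, z)) \<partial>lborel \<partial>lborel \<partial>lborel \<partial>lborel)"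
    by (simp add: nn_integral_lborel_pair(1))
  also have "\<dots> = (\<integral>\<^sup>+\<theta>. \<integral>\<^sup>+n. \<integral>\<^sup>+z. \<integral>\<^sup>+h. ennreal (argd (T - t) (\<theta> - t) n z) * (ennreal (killed t h n) * \<Phi> (n, \<theta>, h, z)) \<partial>lborel \<partial>lborel \<partial>lborel \<partial>lborel)"
    using nn_integral_lborel_shift[of "\<lambda>f. \<integral>\<^sup>+n. \<integral>\<^sup>+z. \<integral>\<^sup>+h. ennreal (argd (T - t) f n z) * (ennreal (killed t h n) * \<Phi> (n, t + f, h, z)) \<partial>lborel \<partial>lborel \<partial>lborel" "- t"]
    by simp
  also have "\<dots> = (\<integral>\<^sup>+\<theta>. \<integral>\<^sup>+n. \<integral>\<^sup>+z. \<integral>\<^sup>+h. ennreal (argd T \<theta> h z) * (indicator {t<..} \<theta> * (ennreal (bessel_bridge (t * (\<theta> - t) / \<theta>) (h * (\<theta> - t) / \<theta>) n) * \<Phi> (n, \<theta>, h, z))) \<partial>lborel \<partial>lborel \<partial>lborel \<partial>lborel)"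
    unfolding mult.assoc[symmetric] argd_killed[OF t(1)] by (simp add: mult.commute[of "indicator {t<..} _"])
  also have "\<dots> = (\<integral>\<^sup>+\<theta>. \<integral>\<^sup>+h. \<integral>\<^sup>+z. \<integral>\<^sup>+n. ennreal (argd T \<theta> h z) * (indicator {t<..} \<theta> * (ennreal (bessel_bridge (t * (\<theta> - t) / \<theta>) (h * (\<theta> - t) / \<theta>) n) * \<Phi> (n, \<theta>, h, z))) \<partial>lborel \<partial>lborel \<partial>lborel \<partial>lborel)"
  proof (rule nn_integral_cong)
    fix \<theta> :: real
    let ?F = "\<lambda>n z h. ennreal (argd T \<theta> h z) * (indicator {t<..} \<theta> * (ennreal (bessel_bridge (t * (\<theta> - t) / \<theta>) (h * (\<theta> - t) / \<theta>) n) * \<Phi> (n, \<theta>, h, z)))"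
    have "(\<integral>\<^sup>+n. \<integral>\<^sup>+z. \<integral>\<^sup>+h. ?F n z h \<partial>lborel \<partial>lborel \<partial>lborel) = (\<integral>\<^sup>+z. \<integral>\<^sup>+n. \<integral>\<^sup>+h. ?F n z h \<partial>lborel \<partial>lborel \<partial>lborel)"
      by (rule lborel_pair.Fubini') measurable
    also have "\<dots> = (\<integral>\<^sup>+z. \<integral>\<^sup>+h. \<integral>\<^sup>+n. ?F n z h \<partial>lborel \<partial>lborel \<partial>lborel)"
      by (rule nn_integral_cong, rule lborel_pair.Fubini') measurable
    also have "\<dots> = (\<integral>\<^sup>+h. \<integral>\<^sup>+z. \<integral>\<^sup>+n. ?F n z h \<partial>lborel \<partial>lborel \<partial>lborel)"
      by (rule lborel_pair.Fubini') measurable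
    finally show "(\<integral>\<^sup>+n. \<integral>\<^sup>+z. \<integral>\<^sup>+h. ?F n z h \<partial>lborel \<partial>lborel \<partial>lborel) = (\<integral>\<^sup>+h. \<integral>\<^sup>+z. \<integral>\<^sup>+n. ?F n z h \<partial>lborel \<partial>lborel \<partial>lborel)" .
  qed
  also have "\<dots> = (\<integral>\<^sup>+q. ennreal (argd T (fst q) (fst (snd q)) (snd (snd q))) * (indicator {t<..} (fst q) *
        (\<integral>\<^sup>+y. ennreal (bessel_bridge (t * (fst q - t) / fst q) (fst (snd q) * (fst q - t) / fst q) y) * \<Phi> (y, q) \<partial>lborel)) \<partial>lborel)"
    by (simp add: nn_integral_lborel_pair(1) nn_integral_cmult)
  finally show ?thesis .
qed

text \<open>For \<open>t\<close> after the argmax the maximum and the depth \<open>y\<close> come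
  from the past piece, and the future matters only through its maximum being at most
  \<open>y\<close>, which has probability \<open>erf (y / sqrt (2 * (T - t)))\<close>. The test
  function does not see the endpoint.\<close>

theorem law_after_max:
  assumes t: "0 < t" "t < T" and [measurable]: "\<Phi> \<in> borel_measurable (borel :: (real \<times> real \<times> real) measure)"
  shows "(\<integral>\<^sup>+\<omega>. indicator {..t} (argM \<omega>) * \<Phi> (Mx \<omega> - W t \<omega>, argM \<omega>, Mx \<omega>) \<partial>M)
    = (\<integral>\<^sup>+q. ennreal (argm T (fst q) (snd q)) * (indicator {..<t} (fst q) *
        (\<integral>\<^sup>+y. ennreal (post_density (t - fst q) (T - t) y) * \<Phi> (y, q) \<partial>lborel)) \<partial>lborel)"
proof -
  have t': "0 \<le> t" "t \<le> T" and v: "0 < T - t" using t by auto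
  define K where "K = (\<lambda>p (q :: real \<times> real). if fst q \<le> snd (snd p) then \<Phi> (snd (snd p), fst p, fst (snd p)) else 0)"
  have [measurable (raw)]: "(\<lambda>x. K (f x) (g x)) \<in> borel_measurable N"
    if [measurable]: "f \<in> borel_measurable N" "g \<in> borel_measurable N" for f and g :: "'z \<Rightarrow> real \<times> real" and N :: "'z measure"
    unfolding K_def by measurable
  have "(\<integral>\<^sup>+\<omega>. indicator {..t} (argM \<omega>) * \<Phi> (Mx \<omega> - W t \<omega>, argM \<omega>, Mx \<omega>) \<partial>M)
     = (\<integral>\<^sup>+\<omega>. (\<lambda>(p, f). K p (snd f)) (past3 t \<omega>, future3 t \<omega>) \<partial>M)"
  proof (rule nn_integral_cong)
    fix \<omega> assume \<omega>: "\<omega> \<in> space M"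
    obtain p1 m y f1 n z where p: "past3 t \<omega> = (p1, m, y)" and f: "future3 t \<omega> = (f1, n, z)"
      by (metis prod_cases3)
    show "indicator {..t} (argM \<omega>) * \<Phi> (Mx \<omega> - W t \<omega>, argM \<omega>, Mx \<omega>) = (\<lambda>(p, f). K p (snd f)) (past3 t \<omega>, future3 t \<omega>)"
    proof (cases "n \<le> y")
      case False
      then show ?thesis using split_at(1)[OF t' \<omega> p f] by (simp add: p f K_def)
    next
      case True
      then have e: "argM \<omega> = p1" "Mx \<omega> = m" "Mx \<omega> - W t \<omega> = y" and l: "argM \<omega> \<le> t"
        using split_at(1)[OF t' \<omega> p f] split_at(2)[OF t' \<omega> p f] by auto
      have "indicator {..t} (argM \<omega>) = (1 :: ennreal)" using l by simp
      moreover have "K (p1, m, y) (n, z) = \<Phi> (y, p1, m)" using True by (simp add: K_def)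
      ultimately show ?thesis by (simp only: p f e(3) prod.case snd_conv mult_1_left) (simp only: e(1,2))
    qed
  qed
  also have "\<dots> = (\<integral>\<^sup>+\<omega>. \<integral>\<^sup>+\<omega>'. K (past3 t \<omega>) (snd (future3 t \<omega>')) \<partial>M \<partial>M)"
    by (subst nn_integral_past3_future3[OF t']) (simp_all add: case_prod_beta)
  also have "\<dots> = (\<integral>\<^sup>+\<omega>. (\<lambda>p. \<integral>\<^sup>+q. ennreal (maxd (T - t) (fst q) (snd q)) * K p q \<partial>lborel) (past3 t \<omega>) \<partial>M)"
    using t by (intro nn_integral_cong nn_integral_future_max) auto
  also have "\<dots> = (\<integral>\<^sup>+p. ennreal (argd t (fst p) (fst (snd p)) (snd (snd p))) * (\<integral>\<^sup>+q. ennreal (maxd (T - t) (fst q) (snd q)) * K p q \<partial>lborel) \<partial>lborel)"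
    using t by (intro nn_integral_past_arg) auto
  also have "\<dots> = (\<integral>\<^sup>+p. ennreal (argd t (fst p) (fst (snd p)) (snd (snd p))) * (ennreal (erf (snd (snd p) / sqrt (2 * (T - t)))) * \<Phi> (snd (snd p), fst p, fst (snd p))) \<partial>lborel)"
  proof (rule nn_integral_cong)
    fix p :: "real \<times> real \<times> real"
    obtain \<theta> m y where p: "p = (\<theta>, m, y)" by (metis prod_cases3)
    show "ennreal (argd t (fst p) (fst (snd p)) (snd (snd p))) * (\<integral>\<^sup>+q. ennreal (maxd (T - t) (fst q) (snd q)) * K p q \<partial>lborel)
      = ennreal (argd t (fst p) (fst (snd p)) (snd (snd p))) * (ennreal (erf (snd (snd p) / sqrt (2 * (T - t)))) * \<Phi> (snd (snd p), fst p, fst (snd p)))"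
    proof (cases "y > 0")
      case True
      have "(\<integral>\<^sup>+q. ennreal (maxd (T - t) (fst q) (snd q)) * K p q \<partial>lborel)
         = (\<integral>\<^sup>+n. \<integral>\<^sup>+z. ennreal (maxd (T - t) n z) * (indicator {..y} n * \<Phi> (y, \<theta>, m)) \<partial>lborel \<partial>lborel)"
        by (subst nn_integral_lborel_pair(1)) (auto simp: p K_def indicator_def intro!: nn_integral_cong)
      also have "\<dots> = (\<integral>\<^sup>+n. ennreal (2 * gauss (T - t) n) * indicator {0..y} n * \<Phi> (y, \<theta>, m) \<partial>lborel)"
      proof (rule nn_integral_cong_AE)
        show "AE n in lborel. (\<integral>\<^sup>+z. ennreal (maxd (T - t) n z) * (indicator {..y} n * \<Phi> (y, \<theta>, m)) \<partial>lborel)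
            = ennreal (2 * gauss (T - t) n) * indicator {0..y} n * \<Phi> (y, \<theta>, m)"
          using AE_lborel_singleton[of 0]
        proof eventually_elim
          case (elim n)
          show ?case
          proof (cases "0 < n")
            case True
            then show ?thesis by (simp add: nn_integral_multc nn_integral_maxd[OF v True] indicator_def)
          next
            case False
            then show ?thesis using elim by (simp add: maxd_def)
          qed
        qed
      qed
      also have "\<dots> = ennreal (erf (y / sqrt (2 * (T - t)))) * \<Phi> (y, \<theta>, m)"
        using True by (simp add: nn_integral_multc nn_integral_gauss_erf[OF v])
      finally show ?thesis by (simp add: p)
    qed (simp add: p argd_def)
  qed
  also have "\<dots> = (\<integral>\<^sup>+p. ennreal (argm T (fst p) (fst (snd p))) * indicator {..<t} (fst p) * ennreal (post_density (t - fst p) (T - t) (snd (snd p))) * \<Phi> (snd (snd p), fst p, fst (snd p)) \<partial>lborel)"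
    unfolding mult.assoc[symmetric] argd_erf[OF t(2)] ..
  also have "\<dots> = (\<integral>\<^sup>+q. ennreal (argm T (fst q) (snd q)) * (indicator {..<t} (fst q) *
        (\<integral>\<^sup>+y. ennreal (post_density (t - fst q) (T - t) y) * \<Phi> (y, q) \<partial>lborel)) \<partial>lborel)"
    by (simp add: nn_integral_lborel_pair(1) nn_integral_cmult[symmetric] mult.assoc)
  finally show ?thesis .
qed

lemma nn_integral_end_argM_Mx:
  assumes T: "0 < T" and [measurable]: "\<phi> \<in> borel_measurable (borel :: (real \<times> real \<times> real) measure)"
  shows "(\<integral>\<^sup>+q. ennreal (argd T (fst q) (fst (snd q)) (snd (snd q))) * \<phi> (fst (snd q) - snd (snd q), fst q, fst (snd q)) \<partial>lborel)
    = (\<integral>\<^sup>+x. ennreal (argd T (fst (snd x)) (snd (snd x)) (snd (snd x) - fst x)) * \<phi> x \<partial>lborel)"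
proof -
  let ?F = "\<lambda>\<theta> h c. ennreal (argd T \<theta> h (h - c)) * \<phi> (c, \<theta>, h)"
  have "(\<integral>\<^sup>+q. ennreal (argd T (fst q) (fst (snd q)) (snd (snd q))) * \<phi> (fst (snd q) - snd (snd q), fst q, fst (snd q)) \<partial>lborel)
     = (\<integral>\<^sup>+\<theta>. \<integral>\<^sup>+h. \<integral>\<^sup>+x. ennreal (argd T \<theta> h x) * \<phi> (h - x, \<theta>, h) \<partial>lborel \<partial>lborel \<partial>lborel)"
    by (simp add: nn_integral_lborel_pair(1))
  also have "\<dots> = (\<integral>\<^sup>+\<theta>. \<integral>\<^sup>+h. \<integral>\<^sup>+c. ?F \<theta> h c \<partial>lborel \<partial>lborel \<partial>lborel)"
  proof (rule nn_integral_cong, rule nn_integral_cong)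
    fix \<theta> h :: real
    show "(\<integral>\<^sup>+x. ennreal (argd T \<theta> h x) * \<phi> (h - x, \<theta>, h) \<partial>lborel) = (\<integral>\<^sup>+c. ?F \<theta> h c \<partial>lborel)"
      using nn_integral_real_affine[of "\<lambda>x. ennreal (argd T \<theta> h x) * \<phi> (h - x, \<theta>, h)" "-1" h] by simp
  qed
  also have "\<dots> = (\<integral>\<^sup>+\<theta>. \<integral>\<^sup>+c. \<integral>\<^sup>+h. ?F \<theta> h c \<partial>lborel \<partial>lborel \<partial>lborel)"
    by (rule nn_integral_cong, rule lborel_pair.Fubini') measurable
  also have "\<dots> = (\<integral>\<^sup>+c. \<integral>\<^sup>+\<theta>. \<integral>\<^sup>+h. ?F \<theta> h c \<partial>lborel \<partial>lborel \<partial>lborel)"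
    by (rule lborel_pair.Fubini') measurable
  also have "\<dots> = (\<integral>\<^sup>+x. ennreal (argd T (fst (snd x)) (snd (snd x)) (snd (snd x) - fst x)) * \<phi> x \<partial>lborel)"
    by (simp add: nn_integral_lborel_pair(1))
  finally show ?thesis .
qed

lemma nn_integral_argM_Mx:
  assumes T: "0 < T" and [measurable]: "\<phi> \<in> borel_measurable (borel :: (real \<times> real) measure)"
  shows "(\<integral>\<^sup>+q. ennreal (argd T (fst q) (fst (snd q)) (snd (snd q))) * \<phi> (fst q, fst (snd q)) \<partial>lborel)
    = (\<integral>\<^sup>+x. ennreal (argm T (fst x) (snd x)) * \<phi> x \<partial>lborel)"
  by (simp add: nn_integral_lborel_pair(1) nn_integral_multc nn_integral_argd_end)

end

section \<open>Regular conditional distributions\<close>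

text \<open>The definition of a kernel speaks of rectangles, which are closed under intersection and
  generate the product sigma-algebra. Hence the joint law is the mixture of the measures
  \<open>N \<omega>\<close>, the law \<open>\<kappa> (X \<omega>)\<close> placed on the fibre over
  \<open>X \<omega>\<close>.\<close>

lemma regular_cond_distr_nn_integral:
  assumes M: "prob_space M" and rcd: "regular_cond_distr M S X R Y \<kappa>"
    and X: "X \<in> measurable M S" and Y: "Y \<in> measurable M R" and g: "g \<in> borel_measurable (S \<Otimes>\<^sub>M R)"
  shows "(\<integral>\<^sup>+\<omega>. g (X \<omega>, Y \<omega>) \<partial>M) = (\<integral>\<^sup>+\<omega>. \<integral>\<^sup>+y. g (X \<omega>, y) \<partial>\<kappa> (X \<omega>) \<partial>M)"
proof -
  interpret prob_space M by fact
  have \<kappa>: "\<kappa> \<in> measurable S (prob_algebra R)"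
    and eq: "\<And>A C. A \<in> sets S \<Longrightarrow> C \<in> sets R \<Longrightarrow> emeasure M {\<omega> \<in> space M. X \<omega> \<in> A \<and> Y \<omega> \<in> C}
        = (\<integral>\<^sup>+\<omega>. emeasure (\<kappa> (X \<omega>)) C * indicator A (X \<omega>) \<partial>M)"
    using rcd unfolding regular_cond_distr_def by auto
  have \<kappa>X: "(\<lambda>\<omega>. \<kappa> (X \<omega>)) \<in> measurable M (subprob_algebra R)"
    using measurable_compose[OF X measurable_prob_algebraD[OF \<kappa>]] .
  have sets_\<kappa>: "sets (\<kappa> (X \<omega>)) = sets R" if "\<omega> \<in> space M" for \<omega>
    using measurable_space[OF \<kappa> measurable_space[OF X that]] by (simp add: space_prob_algebra)
  define N where "N = (\<lambda>\<omega>. distr (\<kappa> (X \<omega>)) (S \<Otimes>\<^sub>M R) (Pair (X \<omega>)))"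
  have N: "N \<in> measurable M (subprob_algebra (S \<Otimes>\<^sub>M R))"
    unfolding N_def
  proof (rule measurable_distr2[OF _ \<kappa>X])
    show "case_prod (\<lambda>\<omega>. Pair (X \<omega>)) \<in> measurable (M \<Otimes>\<^sub>M R) (S \<Otimes>\<^sub>M R)"
      unfolding case_prod_beta' by (intro measurable_Pair measurable_compose[OF measurable_fst X] measurable_snd)
  qed
  have P: "Pair (X \<omega>) \<in> measurable (\<kappa> (X \<omega>)) (S \<Otimes>\<^sub>M R)" if "\<omega> \<in> space M" for \<omega>
    unfolding measurable_cong_sets[OF sets_\<kappa>[OF that] refl] by (rule measurable_Pair1'[OF measurable_space[OF X that]])
  have XY: "(\<lambda>\<omega>. (X \<omega>, Y \<omega>)) \<in> measurable M (S \<Otimes>\<^sub>M R)" using X Y by (rule measurable_Pair)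
  have "distr M (S \<Otimes>\<^sub>M R) (\<lambda>\<omega>. (X \<omega>, Y \<omega>)) = M \<bind> N"
  proof (rule measure_eqI_generator_eq[OF Int_stable_pair_measure_generator[of S R], of "space S \<times> space R" _ _ "\<lambda>_. space S \<times> space R"])
    show "{a \<times> b |a b. a \<in> sets S \<and> b \<in> sets R} \<subseteq> Pow (space S \<times> space R)"
      by (rule pair_measure_closed)
    show "sets (distr M (S \<Otimes>\<^sub>M R) (\<lambda>\<omega>. (X \<omega>, Y \<omega>))) = sigma_sets (space S \<times> space R) {a \<times> b |a b. a \<in> sets S \<and> b \<in> sets R}"
      by (simp add: sets_pair_measure)
    show "sets (M \<bind> N) = sigma_sets (space S \<times> space R) {a \<times> b |a b. a \<in> sets S \<and> b \<in> sets R}"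
      using sets_bind[of M N "S \<Otimes>\<^sub>M R"] not_empty by (simp add: N_def sets_pair_measure)
    show "emeasure (distr M (S \<Otimes>\<^sub>M R) (\<lambda>\<omega>. (X \<omega>, Y \<omega>))) (space S \<times> space R) \<noteq> \<infinity>" for i :: nat
    proof -
      interpret D: prob_space "distr M (S \<Otimes>\<^sub>M R) (\<lambda>\<omega>. (X \<omega>, Y \<omega>))" using XY by (rule prob_space_distr)
      show ?thesis by simp
    qed
    fix Z assume "Z \<in> {a \<times> b |a b. a \<in> sets S \<and> b \<in> sets R}"
    then obtain A C where AC: "A \<in> sets S" "C \<in> sets R" "Z = A \<times> C" by auto
    then have Z: "Z \<in> sets (S \<Otimes>\<^sub>M R)" by simp
    have "emeasure (distr M (S \<Otimes>\<^sub>M R) (\<lambda>\<omega>. (X \<omega>, Y \<omega>))) Z = emeasure M {\<omega> \<in> space M. X \<omega> \<in> A \<and> Y \<omega> \<in> C}"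
      unfolding emeasure_distr[OF XY Z] by (rule arg_cong[where f = "emeasure M"]) (auto simp: AC(3))
    also have "\<dots> = (\<integral>\<^sup>+\<omega>. emeasure (\<kappa> (X \<omega>)) C * indicator A (X \<omega>) \<partial>M)"
      by (rule eq[OF AC(1,2)])
    also have "\<dots> = (\<integral>\<^sup>+\<omega>. emeasure (N \<omega>) Z \<partial>M)"
    proof (rule nn_integral_cong)
      fix \<omega> assume \<omega>: "\<omega> \<in> space M"
      have "Pair (X \<omega>) -` Z \<inter> space (\<kappa> (X \<omega>)) = (if X \<omega> \<in> A then C else {})"
        using sets.sets_into_space[OF AC(2)] sets_eq_imp_space_eq[OF sets_\<kappa>[OF \<omega>]] by (auto simp: AC(3))
      then show "emeasure (\<kappa> (X \<omega>)) C * indicator A (X \<omega>) = emeasure (N \<omega>) Z"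
        unfolding N_def emeasure_distr[OF P[OF \<omega>] Z] by simp
    qed
    also have "\<dots> = emeasure (M \<bind> N) Z"
      by (rule emeasure_bind[OF not_empty N Z, symmetric])
    finally show "emeasure (distr M (S \<Otimes>\<^sub>M R) (\<lambda>\<omega>. (X \<omega>, Y \<omega>))) Z = emeasure (M \<bind> N) Z" .
  qed auto
  then have "(\<integral>\<^sup>+z. g z \<partial>distr M (S \<Otimes>\<^sub>M R) (\<lambda>\<omega>. (X \<omega>, Y \<omega>))) = (\<integral>\<^sup>+\<omega>. \<integral>\<^sup>+z. g z \<partial>N \<omega> \<partial>M)"
    by (simp add: nn_integral_bind[OF g N])
  moreover have "(\<integral>\<^sup>+z. g z \<partial>N \<omega>) = (\<integral>\<^sup>+y. g (X \<omega>, y) \<partial>\<kappa> (X \<omega>))" if "\<omega> \<in> space M" for \<omega>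
    unfolding N_def using P[OF that] g by (simp add: nn_integral_distr)
  then have "(\<integral>\<^sup>+\<omega>. \<integral>\<^sup>+z. g z \<partial>N \<omega> \<partial>M) = (\<integral>\<^sup>+\<omega>. \<integral>\<^sup>+y. g (X \<omega>, y) \<partial>\<kappa> (X \<omega>) \<partial>M)"
    by (rule nn_integral_cong)
  ultimately show ?thesis using XY g by (simp add: nn_integral_distr)
qed

text \<open>Testing against every Borel set \<open>A\<close> makes the two sides densities of the
  same measure, and densities with respect to a sigma-finite measure are unique almost everywhere.
  Where \<open>p x\<close> is positive it can be cancelled, being finite. \<open>D\<close> confines
  the comparison to values for which a formula is available.\<close>

lemma regular_cond_distr_AE_eq:
  fixes X :: "'a \<Rightarrow> 'b::euclidean_space" and p :: "'b \<Rightarrow> real"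
  assumes M: "prob_space M" and rcd: "regular_cond_distr M borel X R Y \<kappa>"
    and X: "X \<in> borel_measurable M" and Y: "Y \<in> measurable M R" and g: "g \<in> borel_measurable (borel \<Otimes>\<^sub>M R)"
    and law: "distr M borel X = density lborel (\<lambda>x. ennreal (p x))"
    and [measurable]: "p \<in> borel_measurable borel" "w \<in> borel_measurable borel" "D \<in> sets borel"
    and eq: "\<And>A. A \<in> sets borel \<Longrightarrow> (\<integral>\<^sup>+\<omega>. indicator D (X \<omega>) * g (X \<omega>, Y \<omega>) * indicator A (X \<omega>) \<partial>M)
      = (\<integral>\<^sup>+x. ennreal (p x) * (indicator D x * w x * indicator A x) \<partial>lborel)"
  shows "AE x in lborel. 0 < p x \<longrightarrow> x \<in> D \<longrightarrow> (\<integral>\<^sup>+y. g (x, y) \<partial>\<kappa> x) = w x"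
proof -
  have \<kappa>: "\<kappa> \<in> measurable borel (subprob_algebra R)"
    using rcd unfolding regular_cond_distr_def by (auto intro: measurable_prob_algebraD)
  define K where "K = (\<lambda>x. \<integral>\<^sup>+y. g (x, y) \<partial>\<kappa> x)"
  have [measurable]: "K \<in> borel_measurable borel"
    unfolding K_def by (rule nn_integral_measurable_subprob_algebra2[OF _ \<kappa>]) (use g in simp)
  have sets_\<kappa>: "sets (\<kappa> x) = sets R" for x
    using measurable_space[OF \<kappa>, of x] by (simp add: space_subprob_algebra)
  have "density lborel (\<lambda>x. ennreal (p x) * (indicator D x * K x)) = density lborel (\<lambda>x. ennreal (p x) * (indicator D x * w x))"
  proof (rule measure_eqI)
    fix A :: "'b set" assume "A \<in> sets (density lborel (\<lambda>x. ennreal (p x) * (indicator D x * K x)))"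
    then have [measurable]: "A \<in> sets borel" by simp
    let ?g = "\<lambda>(x, y). indicator D x * g (x, y) * indicator A x :: ennreal"
    have g': "?g \<in> borel_measurable (borel \<Otimes>\<^sub>M R)"
      using g unfolding case_prod_beta' by measurable
    have "(\<integral>\<^sup>+x. ennreal (p x) * (indicator D x * w x * indicator A x) \<partial>lborel) = (\<integral>\<^sup>+\<omega>. ?g (X \<omega>, Y \<omega>) \<partial>M)"
      using eq[of A] by simp
    also have "\<dots> = (\<integral>\<^sup>+\<omega>. \<integral>\<^sup>+y. ?g (X \<omega>, y) \<partial>\<kappa> (X \<omega>) \<partial>M)"
      by (rule regular_cond_distr_nn_integral[OF M rcd X Y g'])
    also have "\<dots> = (\<integral>\<^sup>+\<omega>. indicator D (X \<omega>) * K (X \<omega>) * indicator A (X \<omega>) \<partial>M)"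
    proof (rule nn_integral_cong)
      fix \<omega> assume "\<omega> \<in> space M"
      have "(\<lambda>y. g (X \<omega>, y)) \<in> borel_measurable R"
        by (rule measurable_compose[OF measurable_Pair1' g]) simp
      then have gm: "(\<lambda>y. g (X \<omega>, y)) \<in> borel_measurable (\<kappa> (X \<omega>))"
        by (simp add: measurable_cong_sets[OF sets_\<kappa> refl])
      show "(\<integral>\<^sup>+y. ?g (X \<omega>, y) \<partial>\<kappa> (X \<omega>)) = indicator D (X \<omega>) * K (X \<omega>) * indicator A (X \<omega>)"
        using gm by (simp add: K_def nn_integral_cmult nn_integral_multc)
    qed
    also have "\<dots> = (\<integral>\<^sup>+x. indicator D x * K x * indicator A x \<partial>distr M borel X)"
      using X by (subst nn_integral_distr) simp_all
    also have "\<dots> = (\<integral>\<^sup>+x. ennreal (p x) * (indicator D x * K x * indicator A x) \<partial>lborel)"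
      unfolding law by (rule nn_integral_density) measurable
    finally show "emeasure (density lborel (\<lambda>x. ennreal (p x) * (indicator D x * K x))) A
       = emeasure (density lborel (\<lambda>x. ennreal (p x) * (indicator D x * w x))) A"
      by (simp add: emeasure_density mult.assoc)
  qed simp
  then have "AE x in lborel. ennreal (p x) * (indicator D x * K x) = ennreal (p x) * (indicator D x * w x)"
    by (intro sigma_finite_measure.density_unique[OF sigma_finite_lborel]) measurable
  then show ?thesis
  proof eventually_elim
    case (elim x)
    show ?case
    proof (intro impI)
      assume "0 < p x" "x \<in> D"
      then show "(\<integral>\<^sup>+y. g (x, y) \<partial>\<kappa> x) = w x"
        using elim by (simp add: K_def ennreal_mult_cancel_left)
    qed
  qed
qed

text \<open>For \<open>path_bound\<close>, whose conditional law is not computed: a finite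
  expectation already forces finite conditional integrals almost everywhere.\<close>

lemma regular_cond_distr_AE_finite:
  fixes X :: "'a \<Rightarrow> 'b::euclidean_space" and p :: "'b \<Rightarrow> real"
  assumes M: "prob_space M" and rcd: "regular_cond_distr M borel X R Y \<kappa>"
    and X: "X \<in> borel_measurable M" and Y: "Y \<in> measurable M R" and g: "g \<in> borel_measurable (borel \<Otimes>\<^sub>M R)"
    and law: "distr M borel X = density lborel (\<lambda>x. ennreal (p x))"
    and [measurable]: "p \<in> borel_measurable borel"
    and fin: "(\<integral>\<^sup>+\<omega>. g (X \<omega>, Y \<omega>) \<partial>M) \<noteq> \<infinity>"
  shows "AE x in lborel. 0 < p x \<longrightarrow> (\<integral>\<^sup>+y. g (x, y) \<partial>\<kappa> x) \<noteq> \<infinity>"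
proof -
  have \<kappa>: "\<kappa> \<in> measurable borel (subprob_algebra R)"
    using rcd unfolding regular_cond_distr_def by (auto intro: measurable_prob_algebraD)
  define K where "K = (\<lambda>x. \<integral>\<^sup>+y. g (x, y) \<partial>\<kappa> x)"
  have [measurable]: "K \<in> borel_measurable borel"
    unfolding K_def by (rule nn_integral_measurable_subprob_algebra2[OF _ \<kappa>]) (use g in simp)
  have "(\<integral>\<^sup>+\<omega>. g (X \<omega>, Y \<omega>) \<partial>M) = (\<integral>\<^sup>+\<omega>. K (X \<omega>) \<partial>M)"
    unfolding K_def by (rule regular_cond_distr_nn_integral[OF M rcd X Y g])
  also have "\<dots> = (\<integral>\<^sup>+x. K x \<partial>distr M borel X)"
    using X by (subst nn_integral_distr) simp_all
  also have "\<dots> = (\<integral>\<^sup>+x. ennreal (p x) * K x \<partial>lborel)"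
    unfolding law by (rule nn_integral_density) measurable
  finally have "AE x in lborel. ennreal (p x) * K x \<noteq> \<infinity>"
    using fin by (intro nn_integral_PInf_AE) simp_all
  then show ?thesis
    by eventually_elim (auto simp: K_def ennreal_mult_eq_top_iff)
qed

section \<open>Paths under a conditional distribution\<close>

lemma space_path_space: "f \<in> space path_space \<Longrightarrow> continuous_on {0..1} f"
  by (simp add: path_space_def space_restrict_space)

lemma measurable_path_eval: "t \<in> {0..1} \<Longrightarrow> (\<lambda>f. f t) \<in> borel_measurable path_space"
  unfolding path_space_def by (intro measurable_restrict_space1 measurable_component_singleton)

definition path_bound :: "(real \<Rightarrow> real) \<Rightarrow> real" where
  "path_bound f = (pmax 1 f)\<^sup>2 + (pmax 1 (\<lambda>s. - f s))\<^sup>2"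

lemma borel_measurable_path_bound [measurable]: "path_bound \<in> borel_measurable path_space"
proof -
  have "(\<lambda>f. pmax 1 (\<lambda>s. f s)) \<in> borel_measurable path_space"
    by (rule borel_measurable_pmax) (use measurable_path_eval space_path_space in auto)
  moreover have "(\<lambda>f. pmax 1 (\<lambda>s. - f s)) \<in> borel_measurable path_space"
  proof (rule borel_measurable_pmax)
    show "(\<lambda>f. - f s) \<in> borel_measurable path_space" if "s \<in> {0..1}" for s :: real
      by (intro borel_measurable_uminus measurable_path_eval that)
    show "continuous_on {0..1} (\<lambda>s. - f s)" if "f \<in> space path_space" for f
      by (intro continuous_on_minus space_path_space that)
  qed simp
  ultimately show ?thesis unfolding path_bound_def by measurable
qed

lemma path_bound_upper:
  assumes f: "continuous_on {0..1} f" and t: "t \<in> {0..1}"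
  shows "(f t)\<^sup>2 \<le> path_bound f"
proof -
  have 1: "f t \<le> pmax 1 f" "- f t \<le> pmax 1 (\<lambda>s. - f s)"
    using pmax_upper[OF f t] pmax_upper[OF continuous_on_minus[OF f] t] by auto
  show ?thesis
  proof (cases "0 \<le> f t")
    case True
    then have "(f t)\<^sup>2 \<le> (pmax 1 f)\<^sup>2" using 1 by (intro power_mono) auto
    then show ?thesis by (simp add: path_bound_def add_increasing2)
  next
    case False
    then have "(- f t)\<^sup>2 \<le> (pmax 1 (\<lambda>s. - f s))\<^sup>2" using 1 by (intro power_mono) auto
    then show ?thesis by (simp add: path_bound_def add_increasing)
  qed
qed

lemma path_moments:
  assumes Q: "Q \<in> space (prob_algebra path_space)" and fin: "(\<integral>\<^sup>+f. ennreal (path_bound f) \<partial>Q) \<noteq> \<infinity>"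
  shows "\<And>t. t \<in> {0..1} \<Longrightarrow> integrable Q (\<lambda>f. f t)"
    and "\<And>t. t \<in> {0..1} \<Longrightarrow> integrable Q (\<lambda>f. (f t)\<^sup>2)"
    and "continuous_on {0..1} (\<lambda>t. \<integral>f. h - f t \<partial>Q)"
    and "continuous_on {0..1} (\<lambda>t. \<integral>f. (h - f t)\<^sup>2 \<partial>Q)"
proof -
  interpret Q: prob_space Q using Q by (simp add: space_prob_algebra)
  have sets: "sets Q = sets path_space" using Q by (simp add: space_prob_algebra)
  have sp: "space Q = space path_space" using sets by (rule sets_eq_imp_space_eq)
  have ev: "(\<lambda>f. f t) \<in> borel_measurable Q" if "t \<in> {0..1}" for t
    unfolding measurable_cong_sets[OF sets refl] by (rule measurable_path_eval[OF that])
  have bm: "path_bound \<in> borel_measurable Q"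
    unfolding measurable_cong_sets[OF sets refl] by (rule borel_measurable_path_bound)
  have nn: "0 \<le> path_bound f" for f by (simp add: path_bound_def)
  have bi: "integrable Q path_bound"
    using fin bm nn by (intro integrableI_nonneg) (auto simp: top.not_eq_extremum)
  have ub: "(f t)\<^sup>2 \<le> path_bound f" if "f \<in> space Q" "t \<in> {0..1}" for f t
    using path_bound_upper[OF space_path_space that(2)] that(1) sp by simp
  have ub1: "\<bar>f t\<bar> \<le> 1 + path_bound f" if "f \<in> space Q" "t \<in> {0..1}" for f t
  proof -
    have "\<bar>f t\<bar> \<le> 1 + (f t)\<^sup>2"
      using zero_le_power2[of "\<bar>f t\<bar> - 1"] by (simp add: power2_diff)
    then show ?thesis using ub[OF that] by simp
  qed
  show i1: "integrable Q (\<lambda>f. f t)" if t: "t \<in> {0..1}" for t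
  proof (rule Bochner_Integration.integrable_bound)
    show "integrable Q (\<lambda>f. 1 + path_bound f)" using bi by simp
    show "AE f in Q. norm (f t) \<le> norm (1 + path_bound f)"
    proof (rule AE_I2)
      fix f assume "f \<in> space Q"
      from ub1[OF this t] nn[of f] show "norm (f t) \<le> norm (1 + path_bound f)" by simp
    qed
  qed (rule ev[OF t])
  show i2: "integrable Q (\<lambda>f. (f t)\<^sup>2)" if t: "t \<in> {0..1}" for t
  proof (rule Bochner_Integration.integrable_bound[OF bi])
    show "(\<lambda>f. (f t)\<^sup>2) \<in> borel_measurable Q" by (intro borel_measurable_power ev t)
    show "AE f in Q. norm ((f t)\<^sup>2) \<le> norm (path_bound f)"
    proof (rule AE_I2)
      fix f assume "f \<in> space Q"
      from ub[OF this t] nn[of f] show "norm ((f t)\<^sup>2) \<le> norm (path_bound f)" by simp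
    qed
  qed
  \<comment> \<open>Proved for a continuous function \<open>G\<close> of the value, so that the
    first and the second moment are both instances.\<close>
  have cont: "continuous_on {0..1} (\<lambda>t. \<integral>f. G (f t) \<partial>Q)"
    if G: "continuous_on UNIV G" and b: "integrable Q b" "\<And>f t. f \<in> space Q \<Longrightarrow> t \<in> {0..1} \<Longrightarrow> \<bar>G (f t)\<bar> \<le> b f"
    for G :: "real \<Rightarrow> real" and b
    unfolding continuous_on_sequentially comp_def
  proof (intro allI ballI impI, elim conjE)
    fix x :: "nat \<Rightarrow> real" and a assume a: "a \<in> {0..1}" and x: "\<forall>n. x n \<in> {0..1}" "x \<longlonglongrightarrow> a"
    have Gm: "G \<in> borel_measurable borel" using G by (rule borel_measurable_continuous_onI)
    show "(\<lambda>n. \<integral>f. G (f (x n)) \<partial>Q) \<longlonglongrightarrow> (\<integral>f. G (f a) \<partial>Q)"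
    proof (rule integral_dominated_convergence[where w = b])
      show "AE f in Q. (\<lambda>n. G (f (x n))) \<longlonglongrightarrow> G (f a)"
      proof (rule AE_I2)
        fix f assume "f \<in> space Q"
        then have "continuous_on {0..1} f" using sp space_path_space by simp
        then have "(\<lambda>n. f (x n)) \<longlonglongrightarrow> f a"
          using x(1) by (intro continuous_on_tendsto_compose[OF _ x(2) a] always_eventually)
        then show "(\<lambda>n. G (f (x n))) \<longlonglongrightarrow> G (f a)"
          using x(1) by (intro continuous_on_tendsto_compose[OF G]) auto
      qed
      show "(\<lambda>f. G (f a)) \<in> borel_measurable Q"
        by (rule measurable_compose[OF ev[OF a] Gm])
      show "(\<lambda>f. G (f (x n))) \<in> borel_measurable Q" for n
        using x(1) by (intro measurable_compose[OF ev Gm]) simp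
      show "AE f in Q. norm (G (f (x n))) \<le> b f" for n
        using x(1) b(2) by (intro AE_I2) simp
    qed (rule b(1))
  qed
  show "continuous_on {0..1} (\<lambda>t. \<integral>f. h - f t \<partial>Q)"
  proof (rule cont)
    show "\<bar>h - f t\<bar> \<le> \<bar>h\<bar> + (1 + path_bound f)" if "f \<in> space Q" "t \<in> {0..1}" for f t
      using ub1[OF that] abs_ge_self[of h] abs_ge_minus_self[of h] unfolding abs_le_iff by linarith
  qed (use bi in \<open>auto intro!: continuous_intros\<close>)
  show "continuous_on {0..1} (\<lambda>t. \<integral>f. (h - f t)\<^sup>2 \<partial>Q)"
  proof (rule cont)
    show "\<bar>(h - f t)\<^sup>2\<bar> \<le> 2 * h\<^sup>2 + 2 * path_bound f" if "f \<in> space Q" "t \<in> {0..1}" for f t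
    proof -
      have "(h - f t)\<^sup>2 \<le> 2 * h\<^sup>2 + 2 * (f t)\<^sup>2"
        using zero_le_power2[of "h + f t"] by (simp add: power2_eq_square algebra_simps)
      then show ?thesis using ub[OF that] by simp
    qed
  qed (use bi in \<open>auto intro!: continuous_intros\<close>)
qed

section \<open>Continuity in \<open>t\<close>\<close>

text \<open>The approximating rationals are taken strictly inside \<open>(a, b)\<close>. The
  equality thus extends also to the ends \<open>0\<close>, \<open>\<theta>\<close> and
  \<open>1\<close>, where the densities degenerate.\<close>

lemma continuous_eq_from_rationals:
  fixes f g :: "real \<Rightarrow> real"
  assumes "a < b" and f: "continuous_on {a..b} f" and g: "continuous_on {a..b} g"
    and eq: "\<And>r. r \<in> \<rat> \<Longrightarrow> a < r \<Longrightarrow> r < b \<Longrightarrow> f r = g r" and x: "x \<in> {a..b}"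
  shows "f x = g x"
proof -
  have ne: "max a (x - e) < min b (x + e)" if "e > 0" for e
    using assms(1) x that by auto
  have "\<forall>n. \<exists>r. r \<in> \<rat> \<and> max a (x - 1 / real (Suc n)) < r \<and> r < min b (x + 1 / real (Suc n))"
  proof
    fix n
    have "0 < 1 / real (Suc n)" by simp
    from Rats_dense_in_real[OF ne[OF this]]
    show "\<exists>r. r \<in> \<rat> \<and> max a (x - 1 / real (Suc n)) < r \<and> r < min b (x + 1 / real (Suc n))" by blast
  qed
  from choice[OF this] obtain r where
    r: "\<forall>n. r n \<in> \<rat> \<and> max a (x - 1 / real (Suc n)) < r n \<and> r n < min b (x + 1 / real (Suc n))" by blast
  have ab: "a < r n" "r n < b" "x - 1 / real (Suc n) \<le> r n" "r n \<le> x + 1 / real (Suc n)" "r n \<in> \<rat>" for n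
    using r[rule_format, of n] by (simp_all only: max_less_iff_conj min_less_iff_conj less_imp_le)
  have 0: "(\<lambda>n. 1 / real (Suc n)) \<longlonglongrightarrow> 0" using LIMSEQ_inverse_real_of_nat by (simp add: inverse_eq_divide)
  have lim: "r \<longlonglongrightarrow> x"
  proof (rule tendsto_sandwich)
    show "(\<lambda>n. x - 1 / real (Suc n)) \<longlonglongrightarrow> x" using tendsto_diff[OF tendsto_const[of x] 0] by simp
    show "(\<lambda>n. x + 1 / real (Suc n)) \<longlonglongrightarrow> x" using tendsto_add[OF tendsto_const[of x] 0] by simp
  qed (intro always_eventually allI ab)+
  have in': "\<forall>\<^sub>F n in sequentially. r n \<in> {a..b}"
    using ab by (intro always_eventually allI) (simp add: less_imp_le)
  have "(\<lambda>n. f (r n)) \<longlonglongrightarrow> f x" "(\<lambda>n. g (r n)) \<longlonglongrightarrow> g x"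
    by (rule continuous_on_tendsto_compose[OF f lim x in'], rule continuous_on_tendsto_compose[OF g lim x in'])
  moreover have "f (r n) = g (r n)" for n by (intro eq r ab)
  ultimately show ?thesis by (simp add: LIMSEQ_unique)
qed

lemma continuous_on_M1:
  assumes y: "y > 0"
  shows "continuous_on {0..1} (\<lambda>s. M1 s y)"
  unfolding continuous_on_def
proof
  fix s :: real assume s: "s \<in> {0..1}"
  show "((\<lambda>s. M1 s y) \<longlongrightarrow> M1 s y) (at s within {0..1})"
  proof (cases "s = 1")
    case True
    then show ?thesis using M1_tendsto[OF y] by (simp add: at_within_Icc_at_left)
  next
    case False
    let ?F = "\<lambda>s. 1 / y * (1 - s + s * y\<^sup>2) * erf (y * sqrt s / sqrt (2 * (1 - s)))
     + sqrt (2 * s * (1 - s) / pi) * exp (- (s * y\<^sup>2 / (2 * (1 - s))))"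
    have "(?F \<longlongrightarrow> ?F s) (at s within {0..1})"
      by (intro tendsto_intros) (use False in auto)
    moreover have "\<forall>\<^sub>F s in at s within {0..1}. ?F s = M1 s y"
    proof -
      have "\<forall>\<^sub>F s in at s within {0..1}. s \<noteq> 1"
        using False by (intro tendsto_imp_eventually_ne[OF tendsto_ident_at])
      then show ?thesis by eventually_elim (simp add: M1_def)
    qed
    ultimately have "((\<lambda>s. M1 s y) \<longlongrightarrow> ?F s) (at s within {0..1})"
      by (rule Lim_transform_eventually)
    then show ?thesis using False by (simp add: M1_def)
  qed
qed

lemma continuous_on_G11: "continuous_on {0..1} G11"
  unfolding continuous_on_def
proof
  fix s :: real assume s: "s \<in> {0..1}"
  show "(G11 \<longlongrightarrow> G11 s) (at s within {0..1})"
  proof (cases "s = 1")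
    case True
    then show ?thesis using G11_tendsto by (simp add: at_within_Icc_at_left)
  next
    case False
    let ?F = "\<lambda>s. sqrt (2 / pi) * (arctan (sqrt (s / (1 - s))) + sqrt (s * (1 - s)))"
    have "(?F \<longlongrightarrow> ?F s) (at s within {0..1})"
      by (intro tendsto_intros) (use False in auto)
    moreover have "\<forall>\<^sub>F s in at s within {0..1}. ?F s = G11 s"
    proof -
      have "\<forall>\<^sub>F s in at s within {0..1}. s \<noteq> 1"
        using False by (intro tendsto_imp_eventually_ne[OF tendsto_ident_at])
      then show ?thesis by eventually_elim (simp add: G11_def)
    qed
    ultimately have "(G11 \<longlongrightarrow> ?F s) (at s within {0..1})"
      by (rule Lim_transform_eventually)
    then show ?thesis using False by (simp add: G11_def)
  qed
qed

lemma pmax_cong: "(\<And>s. s \<in> {0..T} \<Longrightarrow> f s = g s) \<Longrightarrow> pmax T f = pmax T g"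
  unfolding pmax_def by (intro arg_cong[where f = Sup] image_cong refl)

lemma path_max_sample_path: "path_max (sample_path B \<omega>) = pmax 1 (\<lambda>s. B s \<omega>)"
proof -
  have "pmax 1 (sample_path B \<omega>) = pmax 1 (\<lambda>s. B s \<omega>)"
    by (rule pmax_cong) (simp add: sample_path_def)
  then show ?thesis by (simp add: path_max_def pmax_def)
qed

lemma first_argmax_sample_path: "first_argmax (sample_path B \<omega>) = parg 1 (\<lambda>s. B s \<omega>)"
proof -
  have "(u \<in> {0..1} \<and> sample_path B \<omega> u = pmax 1 (\<lambda>s. B s \<omega>)) \<longleftrightarrow> (u \<in> {0..1} \<and> B u \<omega> = pmax 1 (\<lambda>s. B s \<omega>))" for u
    by (auto simp: sample_path_def)
  then show ?thesis unfolding first_argmax_def parg_def path_max_sample_path by simp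
qed

lemma bessel_mean_nonneg: "v > 0 \<Longrightarrow> m > 0 \<Longrightarrow> 0 \<le> bessel_mean v m"
  by (simp add: bessel_mean_def gauss_nonneg erf_nonneg)

lemma (in brownian) Mx_square_integrable:
  assumes T: "0 < T"
  shows "(\<integral>\<^sup>+\<omega>. ennreal ((Mx \<omega>)\<^sup>2) \<partial>M) \<noteq> \<infinity>"
proof -
  have int: "integrable lborel (\<lambda>h. gauss T h * h\<^sup>2)"
    using integrable_normal_moment[of "sqrt T" 0 2] T by (simp add: normal_density_eq_gauss)
  have "(\<integral>\<^sup>+\<omega>. ennreal ((Mx \<omega>)\<^sup>2) \<partial>M) = (\<integral>\<^sup>+p. ennreal (maxd T (fst p) (snd p)) * ennreal ((fst p)\<^sup>2) \<partial>lborel)"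
    using nn_integral_Mx_W_T[OF T, of "\<lambda>p. ennreal ((fst p)\<^sup>2)"] by simp
  also have "\<dots> = (\<integral>\<^sup>+h. (\<integral>\<^sup>+x. ennreal (maxd T h x) \<partial>lborel) * ennreal (h\<^sup>2) \<partial>lborel)"
    by (simp add: nn_integral_lborel_pair(1) nn_integral_multc)
  also have "\<dots> \<le> (\<integral>\<^sup>+h. ennreal (2 * (gauss T h * h\<^sup>2)) \<partial>lborel)"
  proof (rule nn_integral_mono)
    fix h :: real
    show "(\<integral>\<^sup>+x. ennreal (maxd T h x) \<partial>lborel) * ennreal (h\<^sup>2) \<le> ennreal (2 * (gauss T h * h\<^sup>2))"
    proof (cases "h > 0")
      case True
      then show ?thesis using T
        by (simp add: nn_integral_maxd[OF T True] ennreal_mult'[symmetric] gauss_nonneg mult.assoc)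
    qed (simp add: maxd_def)
  qed
  also have "\<dots> < \<infinity>"
    using integrableD(2)[OF integrable_mult_right[OF int, of 2]] T
    by (simp add: abs_mult gauss_nonneg less_top[symmetric])
  finally show ?thesis by simp
qed

text \<open>The densities describe the depth \<open>h - f t\<close> below the maximum; this
  translates its moments back to \<open>f t\<close>.\<close>

lemma cond_mean_var_eq:
  assumes Q: "\<kappa> v \<in> space (prob_algebra path_space)" and fin: "(\<integral>\<^sup>+f. ennreal (path_bound f) \<partial>\<kappa> v) \<noteq> \<infinity>"
    and t: "t \<in> {0..1}"
  shows "cond_square_integrable \<kappa> v t"
    and "cond_mean \<kappa> v t = h - (\<integral>f. h - f t \<partial>\<kappa> v)"
    and "cond_var \<kappa> v t = (\<integral>f. (h - f t)\<^sup>2 \<partial>\<kappa> v) - (\<integral>f. h - f t \<partial>\<kappa> v)\<^sup>2"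
proof -
  interpret Q: prob_space "\<kappa> v" using Q by (simp add: space_prob_algebra)
  note i = path_moments(1,2)[OF Q fin t]
  show "cond_square_integrable \<kappa> v t" using i by (simp add: cond_square_integrable_def)
  have 1: "(\<integral>f. h - f t \<partial>\<kappa> v) = h - (\<integral>f. f t \<partial>\<kappa> v)"
    using i(1) by (simp add: Q.prob_space)
  then show "cond_mean \<kappa> v t = h - (\<integral>f. h - f t \<partial>\<kappa> v)" by (simp add: cond_mean_def)
  have "(h - x)\<^sup>2 = h\<^sup>2 - 2 * h * x + x\<^sup>2" for x by (simp add: power2_diff)
  then have 2: "(\<integral>f. (h - f t)\<^sup>2 \<partial>\<kappa> v) = h\<^sup>2 - 2 * h * (\<integral>f. f t \<partial>\<kappa> v) + (\<integral>f. (f t)\<^sup>2 \<partial>\<kappa> v)"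
    using i by (simp add: Q.prob_space)
  show "cond_var \<kappa> v t = (\<integral>f. (h - f t)\<^sup>2 \<partial>\<kappa> v) - (\<integral>f. h - f t \<partial>\<kappa> v)\<^sup>2"
    unfolding cond_var_def Q.variance_eq[OF i] 1 2 by (simp add: power2_diff)
qed

section \<open>Moments under a given kernel\<close>

text \<open>A conditioning variable \<open>X\<close> with density \<open>p\<close>, of which the argmax and the maximum are the
  functions \<open>\<Theta>\<close> and \<open>H\<close>.\<close>

locale conditioned = brownian M 1 B for M :: "'a measure" and B +
  fixes X :: "'a \<Rightarrow> 'b::euclidean_space" and \<kappa> :: "'b \<Rightarrow> (real \<Rightarrow> real) measure"
    and p \<Theta> H :: "'b \<Rightarrow> real"
  assumes rcd: "regular_cond_distr M borel X path_space (sample_path B) \<kappa>"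
    and X [measurable]: "X \<in> borel_measurable M"
    and p [measurable]: "p \<in> borel_measurable borel"
    and \<Theta> [measurable]: "\<Theta> \<in> borel_measurable borel" and H [measurable]: "H \<in> borel_measurable borel"
    and law: "distr M borel X = density lborel (\<lambda>x. ennreal (p x))"
    and \<Theta>_X: "\<omega> \<in> space M \<Longrightarrow> \<Theta> (X \<omega>) = argM \<omega>" and H_X: "\<omega> \<in> space M \<Longrightarrow> H (X \<omega>) = Mx \<omega>"
    and pos: "0 < p x \<Longrightarrow> 0 < \<Theta> x \<and> \<Theta> x < 1 \<and> 0 < H x"
    and before: "0 < t \<Longrightarrow> t < 1 \<Longrightarrow> G \<in> borel_measurable borel \<Longrightarrow> A \<in> sets borel \<Longrightarrow>
      (\<integral>\<^sup>+\<omega>. indicator {t<..} (argM \<omega>) * G (Mx \<omega> - B t \<omega>) * indicator A (X \<omega>) \<partial>M)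
      = (\<integral>\<^sup>+x. ennreal (p x) * (indicator {t<..} (\<Theta> x) *
          (\<integral>\<^sup>+y. G y * ennreal (bessel_bridge (t * (\<Theta> x - t) / \<Theta> x) (H x * (\<Theta> x - t) / \<Theta> x) y) \<partial>lborel) * indicator A x) \<partial>lborel)"
begin

lemma Mx_sample_path: "pmax 1 (sample_path B \<omega>) = Mx \<omega>"
  unfolding Mx_def by (rule pmax_cong) (simp add: sample_path_def)

lemma measurable_sample_path: "sample_path B \<in> measurable M path_space"
  unfolding path_space_def
proof (rule measurable_restrict_space2)
  show "sample_path B \<in> space M \<rightarrow> {f. continuous_on {0..1} f}"
  proof
    fix \<omega> assume "\<omega> \<in> space M"
    then have "continuous_on {0..1} (\<lambda>s. B s \<omega>)" by (rule continuous_W)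
    then have "continuous_on {0..1} (sample_path B \<omega>)"
      by (subst continuous_on_cong[OF refl, where g = "\<lambda>s. B s \<omega>"]) (auto simp: sample_path_def)
    then show "sample_path B \<omega> \<in> {f. continuous_on {0..1} f}" by simp
  qed
  show "sample_path B \<in> measurable M (\<Pi>\<^sub>M t\<in>{0..1}. borel)"
    unfolding sample_path_def by (intro measurable_restrict measurable_W)
qed

lemma kernel_prob: "\<kappa> x \<in> space (prob_algebra path_space)"
  using rcd measurable_space[of \<kappa> borel "prob_algebra path_space" x] by (simp add: regular_cond_distr_def)

text \<open>Along the Brownian path the bound is the sum of the squared maxima of the path and of
  its negative, which is again Brownian; both are integrable by the half-normal law.\<close>

lemma AE_path_bound: "AE x in lborel. 0 < p x \<longrightarrow> (\<integral>\<^sup>+f. ennreal (path_bound f) \<partial>\<kappa> x) \<noteq> \<infinity>"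
proof -
  interpret N: brownian M 1 "\<lambda>s \<omega>. - B s \<omega>" by (rule brownian_uminus)
  have pb: "path_bound (sample_path B \<omega>) = (Mx \<omega>)\<^sup>2 + (N.Mx \<omega>)\<^sup>2" for \<omega>
  proof -
    have "pmax 1 (\<lambda>s. - sample_path B \<omega> s) = N.Mx \<omega>"
      unfolding N.Mx_def by (rule pmax_cong) (simp add: sample_path_def)
    then show ?thesis by (simp add: path_bound_def Mx_sample_path)
  qed
  have m: "(\<lambda>z. ennreal (path_bound (snd z))) \<in> borel_measurable ((borel :: 'b measure) \<Otimes>\<^sub>M path_space)"
    by measurable
  have "(\<integral>\<^sup>+\<omega>. ennreal (path_bound (sample_path B \<omega>)) \<partial>M) = (\<integral>\<^sup>+\<omega>. ennreal ((Mx \<omega>)\<^sup>2) + ennreal ((N.Mx \<omega>)\<^sup>2) \<partial>M)"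
    by (simp add: pb)
  also have "\<dots> = (\<integral>\<^sup>+\<omega>. ennreal ((Mx \<omega>)\<^sup>2) \<partial>M) + (\<integral>\<^sup>+\<omega>. ennreal ((N.Mx \<omega>)\<^sup>2) \<partial>M)"
    by (rule nn_integral_add) measurable
  also have "\<dots> \<noteq> \<infinity>"
    using Mx_square_integrable N.Mx_square_integrable by simp
  finally have "(\<integral>\<^sup>+\<omega>. ennreal (path_bound (snd (X \<omega>, sample_path B \<omega>))) \<partial>M) \<noteq> \<infinity>" by simp
  from regular_cond_distr_AE_finite[OF prob_space_axioms rcd X measurable_sample_path m law p this]
  show ?thesis by simp
qed

lemma measurable_kernel_eval:
  assumes "t \<in> {0..1}"
  shows "(\<lambda>f. f t) \<in> borel_measurable (\<kappa> x)"
proof -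
  have "sets (\<kappa> x) = sets path_space" using kernel_prob[of x] by (simp add: space_prob_algebra)
  then show ?thesis using measurable_path_eval[OF assms] measurable_cong_sets by blast
qed

lemma measurable_snd_eval:
  assumes "t \<in> {0..1}"
  shows "(\<lambda>z. snd z t) \<in> borel_measurable ((borel :: 'b measure) \<Otimes>\<^sub>M path_space)"
  using measurable_compose[OF measurable_snd measurable_path_eval[OF assms]] .

text \<open>The integral of the positive part of \<open>f t - H x\<close> is 0 because it is 0 along
  the path. Without this bound the nonnegative integral of \<open>ennreal (H x - f t)\<close>, which
  cuts off negative values, need not be the ordinary mean.\<close>

lemma AE_le_max:
  assumes t: "t \<in> {0..1}"
  shows "AE x in lborel. 0 < p x \<longrightarrow> (AE f in \<kappa> x. f t \<le> H x)"
proof -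
  note [measurable] = measurable_snd_eval[OF t]
  have g: "(\<lambda>z. ennreal (snd z t - H (fst z))) \<in> borel_measurable ((borel :: 'b measure) \<Otimes>\<^sub>M path_space)"
    by measurable
  have "AE x in lborel. 0 < p x \<longrightarrow> x \<in> UNIV \<longrightarrow> (\<integral>\<^sup>+f. ennreal (snd (x, f) t - H (fst (x, f))) \<partial>\<kappa> x) = 0"
  proof (rule regular_cond_distr_AE_eq[OF prob_space_axioms rcd X measurable_sample_path g law p])
    fix A :: "'b set" assume "A \<in> sets borel"
    have "(\<integral>\<^sup>+\<omega>. indicator UNIV (X \<omega>) * ennreal (snd (X \<omega>, sample_path B \<omega>) t - H (fst (X \<omega>, sample_path B \<omega>))) * indicator A (X \<omega>) \<partial>M)
      = (\<integral>\<^sup>+\<omega>. 0 \<partial>M)"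
    proof (rule nn_integral_cong)
      fix \<omega> assume \<omega>: "\<omega> \<in> space M"
      have "sample_path B \<omega> t - H (X \<omega>) \<le> 0"
        using Mx_upper[OF \<omega> t] H_X[OF \<omega>] t by (simp add: sample_path_def)
      then show "indicator UNIV (X \<omega>) * ennreal (snd (X \<omega>, sample_path B \<omega>) t - H (fst (X \<omega>, sample_path B \<omega>))) * indicator A (X \<omega>) = 0"
        by (simp add: ennreal_neg)
    qed
    then show "(\<integral>\<^sup>+\<omega>. indicator UNIV (X \<omega>) * ennreal (snd (X \<omega>, sample_path B \<omega>) t - H (fst (X \<omega>, sample_path B \<omega>))) * indicator A (X \<omega>) \<partial>M)
      = (\<integral>\<^sup>+x. ennreal (p x) * (indicator UNIV x * 0 * indicator A x) \<partial>lborel)" by simp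
  qed simp_all
  then show ?thesis
  proof eventually_elim
    case (elim x)
    show ?case
    proof
      assume "0 < p x"
      then have "(\<integral>\<^sup>+f. ennreal (f t - H x) \<partial>\<kappa> x) = 0" using elim by simp
      moreover have "(\<lambda>f. ennreal (f t - H x)) \<in> borel_measurable (\<kappa> x)"
        using measurable_kernel_eval[OF t, of x] by measurable
      ultimately have "AE f in \<kappa> x. ennreal (f t - H x) = 0" by (simp add: nn_integral_0_iff_AE)
      then show "AE f in \<kappa> x. f t \<le> H x" by eventually_elim (simp add: ennreal_eq_0_iff)
    qed
  qed
qed

lemma AE_before:
  assumes t: "0 < t" "t < 1" and [measurable]: "G \<in> borel_measurable borel"
  shows "AE x in lborel. 0 < p x \<longrightarrow> t < \<Theta> x \<longrightarrow> (\<integral>\<^sup>+f. G (H x - f t) \<partial>\<kappa> x)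
    = (\<integral>\<^sup>+y. G y * ennreal (bessel_bridge (t * (\<Theta> x - t) / \<Theta> x) (H x * (\<Theta> x - t) / \<Theta> x) y) \<partial>lborel)"
proof -
  have t': "t \<in> {0..1}" using t by simp
  note [measurable] = measurable_snd_eval[OF t']
  have g: "(\<lambda>z. G (H (fst z) - snd z t)) \<in> borel_measurable ((borel :: 'b measure) \<Otimes>\<^sub>M path_space)"
    by measurable
  have D: "{x. t < \<Theta> x} \<in> sets borel" by measurable
  have ind: "indicator {x. t < \<Theta> x} x = (indicator {t<..} (\<Theta> x) :: ennreal)" for x
    by (simp add: indicator_def)
  let ?w = "\<lambda>x. \<integral>\<^sup>+y. G y * ennreal (bessel_bridge (t * (\<Theta> x - t) / \<Theta> x) (H x * (\<Theta> x - t) / \<Theta> x) y) \<partial>lborel"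
  have w: "?w \<in> borel_measurable borel" by measurable
  have "AE x in lborel. 0 < p x \<longrightarrow> x \<in> {x. t < \<Theta> x} \<longrightarrow> (\<integral>\<^sup>+f. G (H (fst (x, f)) - snd (x, f) t) \<partial>\<kappa> x) = ?w x"
  proof (rule regular_cond_distr_AE_eq[OF prob_space_axioms rcd X measurable_sample_path g law p w D])
    fix A :: "'b set" assume A: "A \<in> sets borel"
    have "(\<integral>\<^sup>+\<omega>. indicator {x. t < \<Theta> x} (X \<omega>) * G (H (fst (X \<omega>, sample_path B \<omega>)) - snd (X \<omega>, sample_path B \<omega>) t) * indicator A (X \<omega>) \<partial>M)
      = (\<integral>\<^sup>+\<omega>. indicator {t<..} (argM \<omega>) * G (Mx \<omega> - B t \<omega>) * indicator A (X \<omega>) \<partial>M)"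
      using t' by (intro nn_integral_cong) (simp add: ind \<Theta>_X H_X sample_path_def)
    also have "\<dots> = (\<integral>\<^sup>+x. ennreal (p x) * (indicator {t<..} (\<Theta> x) * ?w x * indicator A x) \<partial>lborel)"
      by (rule before[OF t _ A]) measurable
    finally show "(\<integral>\<^sup>+\<omega>. indicator {x. t < \<Theta> x} (X \<omega>) * G (H (fst (X \<omega>, sample_path B \<omega>)) - snd (X \<omega>, sample_path B \<omega>) t) * indicator A (X \<omega>) \<partial>M)
      = (\<integral>\<^sup>+x. ennreal (p x) * (indicator {x. t < \<Theta> x} x * ?w x * indicator A x) \<partial>lborel)"
      unfolding ind .
  qed
  then show ?thesis by simp
qed

lemma AE_rational:
  assumes "\<And>t. 0 < t \<Longrightarrow> t < 1 \<Longrightarrow> AE x in lborel. P t x"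
  shows "AE x in lborel. \<forall>t\<in>\<rat> \<inter> {0<..<1::real}. P t x"
  using assms by (subst AE_ball_countable) (auto simp: countable_rat)

lemma moments_from_nn_integral:
  assumes fin: "(\<integral>\<^sup>+f. ennreal (path_bound f) \<partial>\<kappa> x) \<noteq> \<infinity>"
    and le: "AE f in \<kappa> x. f t \<le> H x" and t: "t \<in> {0..1}"
  shows "(\<integral>\<^sup>+f. ennreal (H x - f t) \<partial>\<kappa> x) = ennreal a \<Longrightarrow> 0 \<le> a \<Longrightarrow> (\<integral>f. H x - f t \<partial>\<kappa> x) = a"
    and "(\<integral>\<^sup>+f. ennreal ((H x - f t)\<^sup>2) \<partial>\<kappa> x) = ennreal b \<Longrightarrow> 0 \<le> b \<Longrightarrow> (\<integral>f. (H x - f t)\<^sup>2 \<partial>\<kappa> x) = b"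
proof -
  note m = measurable_kernel_eval[OF t, of x]
  show "(\<integral>f. H x - f t \<partial>\<kappa> x) = a" if "(\<integral>\<^sup>+f. ennreal (H x - f t) \<partial>\<kappa> x) = ennreal a" "0 \<le> a"
    using that le m by (subst integral_eq_nn_integral) auto
  show "(\<integral>f. (H x - f t)\<^sup>2 \<partial>\<kappa> x) = b" if "(\<integral>\<^sup>+f. ennreal ((H x - f t)\<^sup>2) \<partial>\<kappa> x) = ennreal b" "0 \<le> b"
    using that m by (subst integral_eq_nn_integral) auto
qed

lemma AE_before_max:
  "AE x in lborel. 0 < p x \<longrightarrow> (\<forall>t\<in>{0..1}. cond_square_integrable \<kappa> x t) \<and>
     (\<forall>t\<in>{0..\<Theta> x}. cond_mean \<kappa> x t = H x - sqrt (\<Theta> x) * M1 (1 - t / \<Theta> x) (H x / sqrt (\<Theta> x)) \<and>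
        cond_var \<kappa> x t = \<Theta> x * Vr (1 - t / \<Theta> x) (H x / sqrt (\<Theta> x)))"
proof -
  have "AE x in lborel. \<forall>t\<in>\<rat> \<inter> {0<..<1::real}. 0 < p x \<longrightarrow> (AE f in \<kappa> x. f t \<le> H x)"
    by (rule AE_rational[OF AE_le_max]) simp
  moreover have "AE x in lborel. \<forall>t\<in>\<rat> \<inter> {0<..<1::real}. 0 < p x \<longrightarrow> t < \<Theta> x \<longrightarrow> (\<integral>\<^sup>+f. ennreal (H x - f t) \<partial>\<kappa> x)
    = (\<integral>\<^sup>+y. ennreal y * ennreal (bessel_bridge (t * (\<Theta> x - t) / \<Theta> x) (H x * (\<Theta> x - t) / \<Theta> x) y) \<partial>lborel)"
    by (rule AE_rational[OF AE_before]) simp_all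
  moreover have "AE x in lborel. \<forall>t\<in>\<rat> \<inter> {0<..<1::real}. 0 < p x \<longrightarrow> t < \<Theta> x \<longrightarrow> (\<integral>\<^sup>+f. ennreal ((H x - f t)\<^sup>2) \<partial>\<kappa> x)
    = (\<integral>\<^sup>+y. ennreal (y\<^sup>2) * ennreal (bessel_bridge (t * (\<Theta> x - t) / \<Theta> x) (H x * (\<Theta> x - t) / \<Theta> x) y) \<partial>lborel)"
    by (rule AE_rational[OF AE_before]) simp_all
  \<comment> \<open>From here on \<open>x\<close> is fixed outside one null set, which collects the
    exceptional sets of all rational times.\<close>
  ultimately show ?thesis using AE_path_bound
  proof eventually_elim
    case (elim x)
    show ?case
    proof
      assume px: "0 < p x"
      note fin = elim(4)[rule_format, OF px]
      define \<theta> where "\<theta> = \<Theta> x"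
      define h where "h = H x"
      have \<theta>: "0 < \<theta>" "\<theta> < 1" and h: "0 < h" using pos[OF px] by (auto simp: \<theta>_def h_def)
      note cm = cond_mean_var_eq[where \<kappa> = \<kappa> and v = x, OF kernel_prob fin]
      have r: "(\<integral>f. h - f t \<partial>\<kappa> x) = sqrt \<theta> * M1 (1 - t / \<theta>) (h / sqrt \<theta>) \<and>
        (\<integral>f. (h - f t)\<^sup>2 \<partial>\<kappa> x) = \<theta> * (3 * (1 - t / \<theta>) * (1 - (1 - t / \<theta>)) + (h / sqrt \<theta>)\<^sup>2 * (1 - t / \<theta>)\<^sup>2)"
        if t: "t \<in> \<rat>" "0 < t" "t < \<theta>" for t
      proof -
        have t1: "t \<in> \<rat> \<inter> {0<..<1}" "t \<in> {0..1}" using t \<theta> by auto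
        have vm: "0 < t * (\<theta> - t) / \<theta>" "0 < h * (\<theta> - t) / \<theta>" using t \<theta> h by auto
        note le = elim(1)[rule_format, OF t1(1) px]
        have e1: "(\<integral>\<^sup>+f. ennreal (H x - f t) \<partial>\<kappa> x) = ennreal (bessel_mean (t * (\<theta> - t) / \<theta>) (h * (\<theta> - t) / \<theta>))"
          using elim(2)[rule_format, OF t1(1) px] t(3) nn_integral_bessel_bridge(2)[OF vm] by (simp add: \<theta>_def h_def)
        have e2: "(\<integral>\<^sup>+f. ennreal ((H x - f t)\<^sup>2) \<partial>\<kappa> x) = ennreal ((h * (\<theta> - t) / \<theta>)\<^sup>2 + 3 * (t * (\<theta> - t) / \<theta>))"
          using elim(3)[rule_format, OF t1(1) px] t(3) nn_integral_bessel_bridge(3)[OF vm] by (simp add: \<theta>_def h_def)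
        have n2: "0 \<le> (h * (\<theta> - t) / \<theta>)\<^sup>2 + 3 * (t * (\<theta> - t) / \<theta>)" using vm(1) by (intro add_nonneg_nonneg) auto
        show ?thesis
          unfolding bessel_mean_eq_M1[OF t(2,3) h, symmetric] bessel_second_moment_eq[OF \<theta>(1) h, symmetric]
          using moments_from_nn_integral(1)[OF fin le t1(2) e1 bessel_mean_nonneg[OF vm]]
            moments_from_nn_integral(2)[OF fin le t1(2) e2 n2] by (simp add: h_def)
      qed
      have y: "0 < h / sqrt \<theta>" using h \<theta> by simp
      have sub: "{0..\<theta>} \<subseteq> {0..1}" using \<theta> by simp
      have cs: "continuous_on {0..\<theta>} (\<lambda>t. 1 - t / \<theta>)" using \<theta> by (intro continuous_intros) auto
      have e1: "(\<integral>f. h - f t \<partial>\<kappa> x) = sqrt \<theta> * M1 (1 - t / \<theta>) (h / sqrt \<theta>)" if t: "t \<in> {0..\<theta>}" for t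
      proof (rule continuous_eq_from_rationals[OF \<theta>(1) _ _ _ t])
        show "continuous_on {0..\<theta>} (\<lambda>t. \<integral>f. h - f t \<partial>\<kappa> x)"
          using path_moments(3)[OF kernel_prob fin] sub by (rule continuous_on_subset)
        show "continuous_on {0..\<theta>} (\<lambda>t. sqrt \<theta> * M1 (1 - t / \<theta>) (h / sqrt \<theta>))"
          by (intro continuous_on_mult continuous_on_const continuous_on_compose2[OF continuous_on_M1[OF y] cs])
            (use \<theta> in auto)
        show "(\<integral>f. h - f r \<partial>\<kappa> x) = sqrt \<theta> * M1 (1 - r / \<theta>) (h / sqrt \<theta>)" if "r \<in> \<rat>" "0 < r" "r < \<theta>" for r
          using r[OF that] by simp
      qed
      have e2: "(\<integral>f. (h - f t)\<^sup>2 \<partial>\<kappa> x) = \<theta> * (3 * (1 - t / \<theta>) * (1 - (1 - t / \<theta>)) + (h / sqrt \<theta>)\<^sup>2 * (1 - t / \<theta>)\<^sup>2)"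
        if t: "t \<in> {0..\<theta>}" for t
      proof (rule continuous_eq_from_rationals[OF \<theta>(1) _ _ _ t])
        show "continuous_on {0..\<theta>} (\<lambda>t. \<integral>f. (h - f t)\<^sup>2 \<partial>\<kappa> x)"
          using path_moments(4)[OF kernel_prob fin] sub by (rule continuous_on_subset)
        show "continuous_on {0..\<theta>} (\<lambda>t. \<theta> * (3 * (1 - t / \<theta>) * (1 - (1 - t / \<theta>)) + (h / sqrt \<theta>)\<^sup>2 * (1 - t / \<theta>)\<^sup>2))"
          by (intro continuous_intros) (use \<theta> in auto)
        show "(\<integral>f. (h - f r)\<^sup>2 \<partial>\<kappa> x) = \<theta> * (3 * (1 - r / \<theta>) * (1 - (1 - r / \<theta>)) + (h / sqrt \<theta>)\<^sup>2 * (1 - r / \<theta>)\<^sup>2)"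
          if "r \<in> \<rat>" "0 < r" "r < \<theta>" for r using r[OF that] by simp
      qed
      show "(\<forall>t\<in>{0..1}. cond_square_integrable \<kappa> x t) \<and>
         (\<forall>t\<in>{0..\<Theta> x}. cond_mean \<kappa> x t = H x - sqrt (\<Theta> x) * M1 (1 - t / \<Theta> x) (H x / sqrt (\<Theta> x)) \<and>
            cond_var \<kappa> x t = \<Theta> x * Vr (1 - t / \<Theta> x) (H x / sqrt (\<Theta> x)))"
        unfolding \<theta>_def[symmetric] h_def[symmetric]
      proof (intro conjI ballI)
        show "cond_square_integrable \<kappa> x t" if "t \<in> {0..1}" for t by (rule cm(1)[OF that])
        fix t assume t: "t \<in> {0..\<theta>}"
        then have t1: "t \<in> {0..1}" using sub by blast
        show "cond_mean \<kappa> x t = h - sqrt \<theta> * M1 (1 - t / \<theta>) (h / sqrt \<theta>)"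
          unfolding cm(2)[OF t1, of h] e1[OF t] ..
        show "cond_var \<kappa> x t = \<theta> * Vr (1 - t / \<theta>) (h / sqrt \<theta>)"
          unfolding cm(3)[OF t1, of h] e1[OF t] e2[OF t] using \<theta>
          by (simp add: Vr_def power_mult_distrib right_diff_distrib)
      qed
    qed
  qed
qed

end

section \<open>The integral and the explicit formula\<close>

lemma M1_nonneg:
  assumes "0 < s" "s \<le> 1" "0 < y"
  shows "0 \<le> M1 s y"
  using assms by (auto simp: M1_def intro!: add_nonneg_nonneg mult_nonneg_nonneg erf_nonneg divide_nonneg_nonneg)

lemma borel_measurable_M1: "(\<lambda>y. M1 s y) \<in> borel_measurable borel"
  unfolding M1_def by measurable

lemma set_integral_M1:
  assumes s: "0 < s" "s \<le> 1"
  shows "set_integrable lborel {0<..} (\<lambda>x. x * M1 s x * exp (- x\<^sup>2 / 2))"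
    and "(LBINT x:{0<..}. x * M1 s x * exp (- x\<^sup>2 / 2)) = G11 s"
proof -
  have G: "0 \<le> G11 s" using s by (auto simp: G11_def intro!: mult_nonneg_nonneg add_nonneg_nonneg)
  have nn: "(\<integral>\<^sup>+x. ennreal (x * M1 s x * exp (- x\<^sup>2 / 2)) * indicator {0<..} x \<partial>lborel) = ennreal (G11 s)"
    using nn_integral_M1[of s] nn_integral_M1_1 s by (cases "s = 1") auto
  let ?f = "\<lambda>x. indicator {0<..} x *\<^sub>R (x * M1 s x * exp (- x\<^sup>2 / 2)) :: real"
  have m: "?f \<in> borel_measurable lborel"
    using borel_measurable_M1[of s] unfolding measurable_lborel1 by measurable
  have pos: "0 \<le> ?f x" for x
    using M1_nonneg[OF s, of x] by (auto simp: indicator_def)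
  have "(\<integral>\<^sup>+x. ennreal (?f x) \<partial>lborel) = ennreal (G11 s)"
    unfolding nn[symmetric] by (intro nn_integral_cong) (auto simp: indicator_def)
  then have "has_bochner_integral lborel ?f (G11 s)"
    by (rule has_bochner_integral_nn_integral[OF m AE_I2[OF pos] G])
  then show "set_integrable lborel {0<..} (\<lambda>x. x * M1 s x * exp (- x\<^sup>2 / 2))"
    and "(LBINT x:{0<..}. x * M1 s x * exp (- x\<^sup>2 / 2)) = G11 s"
    unfolding set_integrable_def set_lebesgue_integral_def has_bochner_integral_iff by auto
qed

text \<open>At \<open>t = 0\<close> both sides rest on the values fixed as limits; at
  \<open>t = \<theta>\<close> the error function and the root vanish and \<open>h\<close> remains.
  In between both come from \<open>bessel_mean\<close>.\<close>

lemma pre_max_mean_eq_M1: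
  assumes \<theta>: "0 < \<theta>" and h: "0 < h" and t: "t \<in> {0..\<theta>}"
  shows "h - sqrt \<theta> * M1 (1 - t / \<theta>) (h / sqrt \<theta>) = pre_max_mean \<theta> h t"
proof -
  consider "t = 0" | "t = \<theta>" | "0 < t" "t < \<theta>" using t by fastforce
  then show ?thesis
  proof cases
    case 1
    then show ?thesis using \<theta> by (simp add: M1_def pre_max_mean_def)
  next
    case 2
    then show ?thesis using \<theta> by (simp add: M1_def pre_max_mean_def)
  next
    case 3
    define r where "r = sqrt \<theta>"
    have r: "r > 0" "r * r = \<theta>" using \<theta> by (auto simp: r_def)
    define q where "q = sqrt (\<theta> - t)"
    have q: "q > 0" "q * q = \<theta> - t" using 3 by (auto simp: q_def)
    define k where "k = sqrt t"
    have k: "k > 0" "k * k = t" using 3 by (auto simp: k_def)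
    define v where "v = t * (\<theta> - t) / \<theta>"
    define m where "m = h * (\<theta> - t) / \<theta>"
    have v: "v > 0" using 3 by (simp add: v_def)
    have sv: "sqrt (2 * v) = sqrt 2 * k * q / r"
      unfolding v_def k_def q_def r_def by (simp add: real_sqrt_mult real_sqrt_divide)
    have p: "\<theta> powr (3 / 2) = \<theta> * r"
      using \<theta> powr_add[of \<theta> 1 "1/2"] by (simp add: powr_half_sqrt r_def)
    have c: "m + v / m = r * (t / (h * r) + h * (\<theta> - t) / (\<theta> * r))"
      using 3 \<theta> h r(1) by (simp add: m_def v_def field_simps)
    have a: "m / sqrt (2 * v) = h * q / sqrt (2 * t * \<theta>)"
    proof -
      have "sqrt (2 * t * \<theta>) = sqrt 2 * k * r" unfolding k_def r_def by (simp add: real_sqrt_mult)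
      moreover have "m = h * (q * q) / (r * r)" by (simp add: m_def q(2) r(2))
      ultimately show ?thesis unfolding sv using q(1) r(1) k(1) by simp
    qed
    have e: "m\<^sup>2 / (2 * v) = (\<theta> - t) * h\<^sup>2 / (2 * t * \<theta>)"
    proof -
      have "(h * d / \<theta>)\<^sup>2 / (2 * (t * d / \<theta>)) = d * h\<^sup>2 / (2 * t * \<theta>)" if "d > 0" for d
        using 3 \<theta> that by (simp add: power2_eq_square field_simps)
      then show ?thesis using 3 by (simp add: m_def v_def)
    qed
    have g: "2 * v * gauss v m = sqrt (2 * t * (\<theta> - t)) / sqrt (pi * \<theta>) * exp (- ((\<theta> - t) * h\<^sup>2 / (2 * t * \<theta>)))"
    proof -
      have "2 * v = sqrt (2 * v) * sqrt (2 * v)" using v by simp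
      then have "2 * v / sqrt (2 * pi * v) = sqrt (2 * v) / sqrt pi"
        using v by (simp add: real_sqrt_mult)
      also have "\<dots> = sqrt (2 * t * (\<theta> - t)) / sqrt (pi * \<theta>)"
        unfolding v_def by (simp add: real_sqrt_mult real_sqrt_divide mult_ac)
      finally have c: "2 * v / sqrt (2 * pi * v) = sqrt (2 * t * (\<theta> - t)) / sqrt (pi * \<theta>)" .
      have "2 * v * gauss v m = 2 * v / sqrt (2 * pi * v) * exp (- (m\<^sup>2 / (2 * v)))"
        by (simp add: gauss_def)
      then show ?thesis unfolding c e .
    qed
    have "sqrt \<theta> * M1 (1 - t / \<theta>) (h / sqrt \<theta>) = bessel_mean v m"
      unfolding v_def m_def using 3 h by (intro bessel_mean_eq_M1[symmetric]) auto
    also have "\<dots> = r * (t / (h * r) + h * (\<theta> - t) / (\<theta> * r)) * erf (h * q / sqrt (2 * t * \<theta>))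
       + sqrt (2 * t * (\<theta> - t)) / sqrt (pi * \<theta>) * exp (- ((\<theta> - t) * h\<^sup>2 / (2 * t * \<theta>)))"
      unfolding bessel_mean_def c a g ..
    finally show ?thesis
      using 3 unfolding pre_max_mean_def p r_def[symmetric] q_def[symmetric] by simp
  qed
qed

lemma G11_eq:
  assumes "0 < a" "0 < b"
  shows "sqrt (2 / pi) * (arctan (sqrt (a / b)) + sqrt (a * b) / (a + b)) = G11 (a / (a + b))"
proof -
  define s where "s = a / (a + b)"
  have ab: "a + b > 0" using assms by simp
  have s1: "1 - s = b / (a + b)" using ab by (simp add: s_def field_simps)
  then have "s \<noteq> 1" using assms ab by (metis diff_self divide_eq_0_iff less_irrefl)
  have "s / (1 - s) = a / b" unfolding s1 unfolding s_def using ab by simp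
  moreover have "s * (1 - s) = a * b / (a + b)\<^sup>2" unfolding s1 unfolding s_def by (simp add: power2_eq_square)
  moreover have "sqrt (a * b / (a + b)\<^sup>2) = sqrt (a * b) / (a + b)" using ab by (simp add: real_sqrt_divide)
  ultimately show ?thesis using \<open>s \<noteq> 1\<close> by (simp add: G11_def s_def[symmetric])
qed

section \<open>Kernel moments after the maximum\<close>

context conditioned
begin

text \<open>The law after the maximum is an assumption here and not part of
  \<open>conditioned\<close>: given the endpoint as well, the path after the maximum has a different
  law, so only one of the two conditioning variables satisfies it.\<close>

lemma AE_after:
  assumes after: "\<And>A. A \<in> sets borel \<Longrightarrow>
      (\<integral>\<^sup>+\<omega>. indicator {..t} (argM \<omega>) * G (Mx \<omega> - B t \<omega>) * indicator A (X \<omega>) \<partial>M)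
      = (\<integral>\<^sup>+x. ennreal (p x) * (indicator {..<t} (\<Theta> x) * (\<integral>\<^sup>+y. G y * ennreal (post_density (t - \<Theta> x) (1 - t) y) \<partial>lborel) * indicator A x) \<partial>lborel)"
    and t: "0 < t" "t < 1" and [measurable]: "G \<in> borel_measurable borel"
  shows "AE x in lborel. 0 < p x \<longrightarrow> \<Theta> x < t \<longrightarrow> (\<integral>\<^sup>+f. G (H x - f t) \<partial>\<kappa> x)
    = (\<integral>\<^sup>+y. G y * ennreal (post_density (t - \<Theta> x) (1 - t) y) \<partial>lborel)"
proof -
  have t': "t \<in> {0..1}" using t by simp
  note [measurable] = measurable_snd_eval[OF t']
  have g: "(\<lambda>z. G (H (fst z) - snd z t)) \<in> borel_measurable ((borel :: 'b measure) \<Otimes>\<^sub>M path_space)"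
    by measurable
  have D: "{x. \<Theta> x \<le> t} \<in> sets borel" by measurable
  let ?w = "\<lambda>x. \<integral>\<^sup>+y. G y * ennreal (post_density (t - \<Theta> x) (1 - t) y) \<partial>lborel"
  have w: "?w \<in> borel_measurable borel" by measurable
  \<comment> \<open>The argmax satisfies \<open>\<theta> \<le> t\<close> and the density
    \<open>\<theta> < t\<close>. They differ only at \<open>\<theta> = t\<close>, where
    \<open>post_density\<close> has first argument 0 and vanishes because division by 0 gives
    0.\<close>
  have ind: "indicator {..<t} (\<Theta> x) * ?w x = indicator {x. \<Theta> x \<le> t} x * ?w x" for x
  proof (cases "\<Theta> x = t")
    case True
    then have "post_density (t - \<Theta> x) (1 - t) y = 0" for y by (simp add: post_density_def)
    then show ?thesis by simp
  qed (simp add: indicator_def)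
  have "AE x in lborel. 0 < p x \<longrightarrow> x \<in> {x. \<Theta> x \<le> t} \<longrightarrow> (\<integral>\<^sup>+f. G (H (fst (x, f)) - snd (x, f) t) \<partial>\<kappa> x) = ?w x"
  proof (rule regular_cond_distr_AE_eq[OF prob_space_axioms rcd X measurable_sample_path g law p w D])
    fix A :: "'b set" assume A: "A \<in> sets borel"
    have "(\<integral>\<^sup>+\<omega>. indicator {x. \<Theta> x \<le> t} (X \<omega>) * G (H (fst (X \<omega>, sample_path B \<omega>)) - snd (X \<omega>, sample_path B \<omega>) t) * indicator A (X \<omega>) \<partial>M)
      = (\<integral>\<^sup>+\<omega>. indicator {..t} (argM \<omega>) * G (Mx \<omega> - B t \<omega>) * indicator A (X \<omega>) \<partial>M)"
      using t' by (intro nn_integral_cong) (simp add: \<Theta>_X H_X sample_path_def indicator_def)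
    also have "\<dots> = (\<integral>\<^sup>+x. ennreal (p x) * (indicator {..<t} (\<Theta> x) * ?w x * indicator A x) \<partial>lborel)"
      by (rule after[OF A])
    finally show "(\<integral>\<^sup>+\<omega>. indicator {x. \<Theta> x \<le> t} (X \<omega>) * G (H (fst (X \<omega>, sample_path B \<omega>)) - snd (X \<omega>, sample_path B \<omega>) t) * indicator A (X \<omega>) \<partial>M)
      = (\<integral>\<^sup>+x. ennreal (p x) * (indicator {x. \<Theta> x \<le> t} x * ?w x * indicator A x) \<partial>lborel)"
      unfolding ind .
  qed
  then show ?thesis by eventually_elim simp
qed

lemma AE_after_max:
  assumes after: "\<And>t G A. 0 < t \<Longrightarrow> t < 1 \<Longrightarrow> G \<in> borel_measurable borel \<Longrightarrow> A \<in> sets borel \<Longrightarrow>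
      (\<integral>\<^sup>+\<omega>. indicator {..t} (argM \<omega>) * G (Mx \<omega> - B t \<omega>) * indicator A (X \<omega>) \<partial>M)
      = (\<integral>\<^sup>+x. ennreal (p x) * (indicator {..<t} (\<Theta> x) * (\<integral>\<^sup>+y. G y * ennreal (post_density (t - \<Theta> x) (1 - t) y) \<partial>lborel) * indicator A x) \<partial>lborel)"
  shows "AE x in lborel. 0 < p x \<longrightarrow>
     (\<forall>t\<in>{\<Theta> x..1}. cond_mean \<kappa> x t = H x - sqrt (1 - \<Theta> x) * G11 ((t - \<Theta> x) / (1 - \<Theta> x)) \<and>
        cond_var \<kappa> x t = (1 - \<Theta> x) * (3 * ((t - \<Theta> x) / (1 - \<Theta> x)) - ((t - \<Theta> x) / (1 - \<Theta> x))\<^sup>2)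
          - (1 - \<Theta> x) * (G11 ((t - \<Theta> x) / (1 - \<Theta> x)))\<^sup>2)"
proof -
  have "AE x in lborel. \<forall>t\<in>\<rat> \<inter> {0<..<1::real}. 0 < p x \<longrightarrow> (AE f in \<kappa> x. f t \<le> H x)"
    by (rule AE_rational[OF AE_le_max]) simp
  moreover have "AE x in lborel. \<forall>t\<in>\<rat> \<inter> {0<..<1::real}. 0 < p x \<longrightarrow> \<Theta> x < t \<longrightarrow> (\<integral>\<^sup>+f. ennreal (H x - f t) \<partial>\<kappa> x)
    = (\<integral>\<^sup>+y. ennreal y * ennreal (post_density (t - \<Theta> x) (1 - t) y) \<partial>lborel)"
    by (rule AE_rational, rule AE_after[OF after]) simp_all
  moreover have "AE x in lborel. \<forall>t\<in>\<rat> \<inter> {0<..<1::real}. 0 < p x \<longrightarrow> \<Theta> x < t \<longrightarrow> (\<integral>\<^sup>+f. ennreal ((H x - f t)\<^sup>2) \<partial>\<kappa> x)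
    = (\<integral>\<^sup>+y. ennreal (y\<^sup>2) * ennreal (post_density (t - \<Theta> x) (1 - t) y) \<partial>lborel)"
    by (rule AE_rational, rule AE_after[OF after]) simp_all
  ultimately show ?thesis using AE_path_bound
  proof eventually_elim
    case (elim x)
    show ?case
    proof
      assume px: "0 < p x"
      note fin = elim(4)[rule_format, OF px]
      define \<theta> where "\<theta> = \<Theta> x"
      define h where "h = H x"
      define L where "L = 1 - \<theta>"
      have \<theta>: "0 < \<theta>" "\<theta> < 1" "0 < L" using pos[OF px] by (auto simp: \<theta>_def L_def)
      note cm = cond_mean_var_eq[where \<kappa> = \<kappa> and v = x, OF kernel_prob fin]
      have r: "(\<integral>f. h - f t \<partial>\<kappa> x) = sqrt L * G11 ((t - \<theta>) / L) \<and>
        (\<integral>f. (h - f t)\<^sup>2 \<partial>\<kappa> x) = L * (3 * ((t - \<theta>) / L) - ((t - \<theta>) / L)\<^sup>2)"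
        if t: "t \<in> \<rat>" "\<theta> < t" "t < 1" for t
      proof -
        have t1: "t \<in> \<rat> \<inter> {0<..<1}" "t \<in> {0..1}" using t \<theta> by auto
        have ab: "0 < t - \<theta>" "0 < 1 - t" and L: "t - \<theta> + (1 - t) = L" using t by (auto simp: L_def)
        note le = elim(1)[rule_format, OF t1(1) px]
        have e1: "(\<integral>\<^sup>+f. ennreal (H x - f t) \<partial>\<kappa> x) = ennreal (sqrt L * G11 ((t - \<theta>) / L))"
        proof -
          have g: "sqrt (2 / pi) * (arctan (sqrt ((t - \<theta>) / (1 - t))) + sqrt ((t - \<theta>) * (1 - t)) / L) = G11 ((t - \<theta>) / L)"
            using G11_eq[OF ab] unfolding L .
          have "(\<integral>\<^sup>+f. ennreal (H x - f t) \<partial>\<kappa> x) = (\<integral>\<^sup>+y. ennreal y * ennreal (post_density (t - \<theta>) (1 - t) y) \<partial>lborel)"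
            using elim(2)[rule_format, OF t1(1) px] t(2) by (simp only: \<theta>_def)
          also have "\<dots> = ennreal (sqrt L * G11 ((t - \<theta>) / L))"
            using nn_integral_post_density_1[OF ab] unfolding L g .
          finally show ?thesis .
        qed
        have "0 \<le> G11 ((t - \<theta>) / L)"
          unfolding G11_eq[OF ab, unfolded L, symmetric] using ab \<theta> by (auto intro!: mult_nonneg_nonneg add_nonneg_nonneg divide_nonneg_nonneg)
        then have n1: "0 \<le> sqrt L * G11 ((t - \<theta>) / L)" using \<theta> by simp
        have eq: "(t - \<theta>) * (1 - t) / L + 2 * (t - \<theta>) = L * (3 * ((t - \<theta>) / L) - ((t - \<theta>) / L)\<^sup>2)"
        proof -
          have b: "1 - t = L - (t - \<theta>)" using L by simp
          have "a * (L - a) / L + 2 * a = L * (3 * (a / L) - (a / L)\<^sup>2)" for a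
            using \<theta>(3) by (simp add: field_simps power2_eq_square)
          then show ?thesis unfolding b .
        qed
        have e2: "(\<integral>\<^sup>+f. ennreal ((H x - f t)\<^sup>2) \<partial>\<kappa> x) = ennreal ((t - \<theta>) * (1 - t) / L + 2 * (t - \<theta>))"
          using elim(3)[rule_format, OF t1(1) px] t(2) nn_integral_post_density(2)[OF ab] unfolding L by (simp add: \<theta>_def)
        have n2: "0 \<le> (t - \<theta>) * (1 - t) / L + 2 * (t - \<theta>)" using ab \<theta> by (intro add_nonneg_nonneg) auto
        show ?thesis
          using moments_from_nn_integral(1)[OF fin le t1(2) e1 n1] moments_from_nn_integral(2)[OF fin le t1(2) e2 n2]
          unfolding eq by (simp add: h_def)
      qed
      have sub: "{\<theta>..1} \<subseteq> {0..1}" using \<theta> by simp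
      have cs: "continuous_on {\<theta>..1} (\<lambda>t. (t - \<theta>) / L)" using \<theta> by (intro continuous_intros) auto
      have e1: "(\<integral>f. h - f t \<partial>\<kappa> x) = sqrt L * G11 ((t - \<theta>) / L)" if t: "t \<in> {\<theta>..1}" for t
      proof (rule continuous_eq_from_rationals[OF \<theta>(2) _ _ _ t])
        show "continuous_on {\<theta>..1} (\<lambda>t. \<integral>f. h - f t \<partial>\<kappa> x)"
          using path_moments(3)[OF kernel_prob fin] sub by (rule continuous_on_subset)
        show "continuous_on {\<theta>..1} (\<lambda>t. sqrt L * G11 ((t - \<theta>) / L))"
          by (intro continuous_on_mult continuous_on_const continuous_on_compose2[OF continuous_on_G11 cs])
            (use \<theta> in \<open>auto simp: L_def\<close>)
        show "(\<integral>f. h - f r \<partial>\<kappa> x) = sqrt L * G11 ((r - \<theta>) / L)" if "r \<in> \<rat>" "\<theta> < r" "r < 1" for r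
          using r[OF that] by simp
      qed
      have e2: "(\<integral>f. (h - f t)\<^sup>2 \<partial>\<kappa> x) = L * (3 * ((t - \<theta>) / L) - ((t - \<theta>) / L)\<^sup>2)" if t: "t \<in> {\<theta>..1}" for t
      proof (rule continuous_eq_from_rationals[OF \<theta>(2) _ _ _ t])
        show "continuous_on {\<theta>..1} (\<lambda>t. \<integral>f. (h - f t)\<^sup>2 \<partial>\<kappa> x)"
          using path_moments(4)[OF kernel_prob fin] sub by (rule continuous_on_subset)
        show "continuous_on {\<theta>..1} (\<lambda>t. L * (3 * ((t - \<theta>) / L) - ((t - \<theta>) / L)\<^sup>2))"
          by (intro continuous_intros) (use \<theta> in auto)
        show "(\<integral>f. (h - f r)\<^sup>2 \<partial>\<kappa> x) = L * (3 * ((r - \<theta>) / L) - ((r - \<theta>) / L)\<^sup>2)"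
          if "r \<in> \<rat>" "\<theta> < r" "r < 1" for r using r[OF that] by simp
      qed
      show "\<forall>t\<in>{\<Theta> x..1}. cond_mean \<kappa> x t = H x - sqrt (1 - \<Theta> x) * G11 ((t - \<Theta> x) / (1 - \<Theta> x)) \<and>
        cond_var \<kappa> x t = (1 - \<Theta> x) * (3 * ((t - \<Theta> x) / (1 - \<Theta> x)) - ((t - \<Theta> x) / (1 - \<Theta> x))\<^sup>2)
          - (1 - \<Theta> x) * (G11 ((t - \<Theta> x) / (1 - \<Theta> x)))\<^sup>2"
        unfolding \<theta>_def[symmetric] h_def[symmetric] L_def[symmetric]
      proof
        fix t assume t: "t \<in> {\<theta>..1}"
        then have t1: "t \<in> {0..1}" using sub by blast
        show "cond_mean \<kappa> x t = h - sqrt L * G11 ((t - \<theta>) / L) \<and>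
          cond_var \<kappa> x t = L * (3 * ((t - \<theta>) / L) - ((t - \<theta>) / L)\<^sup>2) - L * (G11 ((t - \<theta>) / L))\<^sup>2"
          unfolding cm(2)[OF t1, of h] cm(3)[OF t1, of h] e1[OF t] e2[OF t] using \<theta>
          by (simp add: power_mult_distrib)
      qed
    qed
  qed
qed

end

section \<open>The two conditioning variables\<close>

lemma nn_integral_mult_multc:
  fixes c :: ennreal
  assumes "F \<in> borel_measurable N" "g \<in> borel_measurable N"
  shows "(\<integral>\<^sup>+y. g y * (F y * c) \<partial>N) = (\<integral>\<^sup>+y. F y * g y \<partial>N) * c"
proof -
  have "(\<integral>\<^sup>+y. g y * (F y * c) \<partial>N) = (\<integral>\<^sup>+y. F y * g y * c \<partial>N)" by (simp only: mult_ac)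
  also have "\<dots> = (\<integral>\<^sup>+y. F y * g y \<partial>N) * c"
    using assms by (intro nn_integral_multc borel_measurable_times_ennreal)
  finally show ?thesis .
qed

locale unit_brownian = brownian M 1 W for M :: "'a measure" and W
begin

text \<open>The bridge density in \<open>law_before_max\<close> does not contain the endpoint, so
  integrating the endpoint out only turns \<open>argd\<close> into \<open>argm\<close> and leaves
  the conditional law as it is.\<close>

lemma conditioned_argM_Mx:
  assumes rcd: "regular_cond_distr M borel (\<lambda>\<omega>. (argM \<omega>, Mx \<omega>)) path_space (sample_path W) \<kappa>"
  shows "conditioned M W (\<lambda>\<omega>. (argM \<omega>, Mx \<omega>)) \<kappa> (\<lambda>x. argm 1 (fst x) (snd x)) fst snd"
proof -
  have law: "distr M borel (\<lambda>\<omega>. (argM \<omega>, Mx \<omega>)) = density lborel (\<lambda>x. ennreal (argm 1 (fst x) (snd x)))"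
  proof (rule measure_eqI)
    fix A :: "(real \<times> real) set" assume "A \<in> sets (distr M borel (\<lambda>\<omega>. (argM \<omega>, Mx \<omega>)))"
    then have A [measurable]: "A \<in> sets borel" by simp
    have "emeasure (distr M borel (\<lambda>\<omega>. (argM \<omega>, Mx \<omega>))) A = (\<integral>\<^sup>+x. indicator A x \<partial>distr M borel (\<lambda>\<omega>. (argM \<omega>, Mx \<omega>)))"
      by simp
    also have "\<dots> = (\<integral>\<^sup>+\<omega>. (\<lambda>q. indicator A (fst q, fst (snd q))) (argM \<omega>, Mx \<omega>, Mx \<omega> - W 1 \<omega>) \<partial>M)"
      by (subst nn_integral_distr) simp_all
    also have "\<dots> = (\<integral>\<^sup>+q. ennreal (argd 1 (fst q) (fst (snd q)) (snd (snd q))) * indicator A (fst q, fst (snd q)) \<partial>lborel)"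
      by (intro nn_integral_argM) simp_all
    also have "\<dots> = (\<integral>\<^sup>+x. ennreal (argm 1 (fst x) (snd x)) * indicator A x \<partial>lborel)"
      by (intro nn_integral_argM_Mx) simp_all
    also have "\<dots> = emeasure (density lborel (\<lambda>x. ennreal (argm 1 (fst x) (snd x)))) A"
      by (rule emeasure_density[symmetric]) simp_all
    finally show "emeasure (distr M borel (\<lambda>\<omega>. (argM \<omega>, Mx \<omega>))) A = emeasure (density lborel (\<lambda>x. ennreal (argm 1 (fst x) (snd x)))) A" .
  qed simp
  show ?thesis
  proof unfold_locales
    show "regular_cond_distr M borel (\<lambda>\<omega>. (argM \<omega>, Mx \<omega>)) path_space (sample_path W) \<kappa>" by fact
    show "distr M borel (\<lambda>\<omega>. (argM \<omega>, Mx \<omega>)) = density lborel (\<lambda>x. ennreal (argm 1 (fst x) (snd x)))" by (rule law)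
    show "0 < fst x \<and> fst x < 1 \<and> 0 < snd x" if "0 < argm 1 (fst x) (snd x)" for x
      using that by (auto simp: argm_def split: if_splits)
    fix t :: real and G :: "real \<Rightarrow> ennreal" and A :: "(real \<times> real) set"
    assume t: "0 < t" "t < 1" and [measurable]: "G \<in> borel_measurable borel" "A \<in> sets borel"
    let ?w = "\<lambda>x. \<integral>\<^sup>+y. G y * ennreal (bessel_bridge (t * (fst x - t) / fst x) (snd x * (fst x - t) / fst x) y) \<partial>lborel"
    have i: "(\<integral>\<^sup>+y. ennreal (bessel_bridge (t * (fst q - t) / fst q) (fst (snd q) * (fst q - t) / fst q) y) * (G y * indicator A (fst q, fst (snd q))) \<partial>lborel)
      = (\<integral>\<^sup>+y. G y * ennreal (bessel_bridge (t * (fst q - t) / fst q) (fst (snd q) * (fst q - t) / fst q) y) \<partial>lborel) * indicator A (fst q, fst (snd q))" for q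
      by (rule nn_integral_mult_multc) measurable
    have "(\<integral>\<^sup>+\<omega>. indicator {t<..} (argM \<omega>) * G (Mx \<omega> - W t \<omega>) * indicator A (argM \<omega>, Mx \<omega>) \<partial>M)
      = (\<integral>\<^sup>+q. ennreal (argd 1 (fst q) (fst (snd q)) (snd (snd q))) * (indicator {t<..} (fst q) *
        (\<integral>\<^sup>+y. ennreal (bessel_bridge (t * (fst q - t) / fst q) (fst (snd q) * (fst q - t) / fst q) y) * (G y * indicator A (fst q, fst (snd q))) \<partial>lborel)) \<partial>lborel)"
      using law_before_max[of t "\<lambda>z. G (fst z) * indicator A (fst (snd z), fst (snd (snd z)))"] t by (simp add: mult.assoc)
    also have "\<dots> = (\<integral>\<^sup>+q. ennreal (argd 1 (fst q) (fst (snd q)) (snd (snd q))) * (\<lambda>x. indicator {t<..} (fst x) * ?w x * indicator A x) (fst q, fst (snd q)) \<partial>lborel)"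
      unfolding i by (simp only: mult_ac fst_conv snd_conv)
    also have "\<dots> = (\<integral>\<^sup>+x. ennreal (argm 1 (fst x) (snd x)) * (indicator {t<..} (fst x) * ?w x * indicator A x) \<partial>lborel)"
      by (intro nn_integral_argM_Mx) simp_all
    finally show "(\<integral>\<^sup>+\<omega>. indicator {t<..} (argM \<omega>) * G (Mx \<omega> - W t \<omega>) * indicator A (argM \<omega>, Mx \<omega>) \<partial>M)
      = (\<integral>\<^sup>+x. ennreal (argm 1 (fst x) (snd x)) * (indicator {t<..} (fst x) * ?w x * indicator A x) \<partial>lborel)"
      .
  qed simp_all
qed

lemma after_argM_Mx:
  assumes t: "0 < t" "t < 1" and [measurable]: "G \<in> borel_measurable borel" "A \<in> sets borel"
  shows "(\<integral>\<^sup>+\<omega>. indicator {..t} (argM \<omega>) * G (Mx \<omega> - W t \<omega>) * indicator A (argM \<omega>, Mx \<omega>) \<partial>M)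
      = (\<integral>\<^sup>+x. ennreal (argm 1 (fst x) (snd x)) * (indicator {..<t} (fst x) * (\<integral>\<^sup>+y. G y * ennreal (post_density (t - fst x) (1 - t) y) \<partial>lborel) * indicator A x) \<partial>lborel)"
proof -
  have "(\<integral>\<^sup>+\<omega>. indicator {..t} (argM \<omega>) * G (Mx \<omega> - W t \<omega>) * indicator A (argM \<omega>, Mx \<omega>) \<partial>M)
    = (\<integral>\<^sup>+q. ennreal (argm 1 (fst q) (snd q)) * (indicator {..<t} (fst q) *
        (\<integral>\<^sup>+y. ennreal (post_density (t - fst q) (1 - t) y) * (G y * indicator A q) \<partial>lborel)) \<partial>lborel)"
    using law_after_max[of t "\<lambda>z. G (fst z) * indicator A (snd z)"] t by (simp add: mult.assoc)
  moreover have "(\<integral>\<^sup>+y. ennreal (post_density (t - fst q) (1 - t) y) * (G y * indicator A q) \<partial>lborel)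
    = (\<integral>\<^sup>+y. G y * ennreal (post_density (t - fst q) (1 - t) y) \<partial>lborel) * indicator A q" for q
    by (rule nn_integral_mult_multc) measurable
  ultimately show ?thesis by (simp only: mult_ac)
qed

text \<open>Now the test set may involve the endpoint, and the bridge density still factors out of
  it; this is the independence of \<open>c\<close>. The coordinates change from
  \<open>x = h - c\<close> to \<open>c\<close> itself.\<close>

lemma conditioned_end_argM_Mx:
  assumes rcd: "regular_cond_distr M borel (\<lambda>\<omega>. (W 1 \<omega>, argM \<omega>, Mx \<omega>)) path_space (sample_path W) \<kappa>"
  shows "conditioned M W (\<lambda>\<omega>. (W 1 \<omega>, argM \<omega>, Mx \<omega>)) \<kappa>
    (\<lambda>x. argd 1 (fst (snd x)) (snd (snd x)) (snd (snd x) - fst x)) (\<lambda>x. fst (snd x)) (\<lambda>x. snd (snd x))"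
proof -
  have [measurable]: "W 1 \<in> borel_measurable M" using measurable_W_T by simp
  have law: "distr M borel (\<lambda>\<omega>. (W 1 \<omega>, argM \<omega>, Mx \<omega>)) = density lborel (\<lambda>x. ennreal (argd 1 (fst (snd x)) (snd (snd x)) (snd (snd x) - fst x)))"
  proof (rule measure_eqI)
    fix A :: "(real \<times> real \<times> real) set" assume "A \<in> sets (distr M borel (\<lambda>\<omega>. (W 1 \<omega>, argM \<omega>, Mx \<omega>)))"
    then have A [measurable]: "A \<in> sets borel" by simp
    have "emeasure (distr M borel (\<lambda>\<omega>. (W 1 \<omega>, argM \<omega>, Mx \<omega>))) A = (\<integral>\<^sup>+x. indicator A x \<partial>distr M borel (\<lambda>\<omega>. (W 1 \<omega>, argM \<omega>, Mx \<omega>)))"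
      by simp
    also have "\<dots> = (\<integral>\<^sup>+\<omega>. (\<lambda>q. indicator A (fst (snd q) - snd (snd q), fst q, fst (snd q))) (argM \<omega>, Mx \<omega>, Mx \<omega> - W 1 \<omega>) \<partial>M)"
      by (subst nn_integral_distr) simp_all
    also have "\<dots> = (\<integral>\<^sup>+q. ennreal (argd 1 (fst q) (fst (snd q)) (snd (snd q))) * indicator A (fst (snd q) - snd (snd q), fst q, fst (snd q)) \<partial>lborel)"
      by (intro nn_integral_argM) simp_all
    also have "\<dots> = (\<integral>\<^sup>+x. ennreal (argd 1 (fst (snd x)) (snd (snd x)) (snd (snd x) - fst x)) * indicator A x \<partial>lborel)"
      by (intro nn_integral_end_argM_Mx) simp_all
    also have "\<dots> = emeasure (density lborel (\<lambda>x. ennreal (argd 1 (fst (snd x)) (snd (snd x)) (snd (snd x) - fst x)))) A"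
      by (rule emeasure_density[symmetric]) simp_all
    finally show "emeasure (distr M borel (\<lambda>\<omega>. (W 1 \<omega>, argM \<omega>, Mx \<omega>))) A
      = emeasure (density lborel (\<lambda>x. ennreal (argd 1 (fst (snd x)) (snd (snd x)) (snd (snd x) - fst x)))) A" .
  qed simp
  show ?thesis
  proof unfold_locales
    show "regular_cond_distr M borel (\<lambda>\<omega>. (W 1 \<omega>, argM \<omega>, Mx \<omega>)) path_space (sample_path W) \<kappa>" by fact
    show "distr M borel (\<lambda>\<omega>. (W 1 \<omega>, argM \<omega>, Mx \<omega>)) = density lborel (\<lambda>x. ennreal (argd 1 (fst (snd x)) (snd (snd x)) (snd (snd x) - fst x)))"
      by (rule law)
    show "0 < fst (snd x) \<and> fst (snd x) < 1 \<and> 0 < snd (snd x)" if "0 < argd 1 (fst (snd x)) (snd (snd x)) (snd (snd x) - fst x)" for x :: "real \<times> real \<times> real"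
      using that by (auto simp: argd_def split: if_splits)
    fix t :: real and G :: "real \<Rightarrow> ennreal" and A :: "(real \<times> real \<times> real) set"
    assume t: "0 < t" "t < 1" and [measurable]: "G \<in> borel_measurable borel" "A \<in> sets borel"
    let ?w = "\<lambda>x. \<integral>\<^sup>+y. G y * ennreal (bessel_bridge (t * (fst (snd x) - t) / fst (snd x)) (snd (snd x) * (fst (snd x) - t) / fst (snd x)) y) \<partial>lborel"
    let ?c = "\<lambda>q. (fst (snd q) - snd (snd q), fst q, fst (snd q)) :: real \<times> real \<times> real"
    have i: "(\<integral>\<^sup>+y. ennreal (bessel_bridge (t * (fst q - t) / fst q) (fst (snd q) * (fst q - t) / fst q) y) * (G y * indicator A (?c q)) \<partial>lborel)
      = (\<integral>\<^sup>+y. G y * ennreal (bessel_bridge (t * (fst q - t) / fst q) (fst (snd q) * (fst q - t) / fst q) y) \<partial>lborel) * indicator A (?c q)" for q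
      by (rule nn_integral_mult_multc) measurable
    have "(\<integral>\<^sup>+\<omega>. indicator {t<..} (argM \<omega>) * G (Mx \<omega> - W t \<omega>) * indicator A (W 1 \<omega>, argM \<omega>, Mx \<omega>) \<partial>M)
      = (\<integral>\<^sup>+q. ennreal (argd 1 (fst q) (fst (snd q)) (snd (snd q))) * (indicator {t<..} (fst q) *
        (\<integral>\<^sup>+y. ennreal (bessel_bridge (t * (fst q - t) / fst q) (fst (snd q) * (fst q - t) / fst q) y) * (G y * indicator A (?c q)) \<partial>lborel)) \<partial>lborel)"
      using law_before_max[of t "\<lambda>z. G (fst z) * indicator A (?c (snd z))"] t by (simp add: mult.assoc)
    also have "\<dots> = (\<integral>\<^sup>+q. ennreal (argd 1 (fst q) (fst (snd q)) (snd (snd q))) * (\<lambda>x. indicator {t<..} (fst (snd x)) * ?w x * indicator A x) (?c q) \<partial>lborel)"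
      unfolding i by (simp only: mult_ac fst_conv snd_conv)
    also have "\<dots> = (\<integral>\<^sup>+x. ennreal (argd 1 (fst (snd x)) (snd (snd x)) (snd (snd x) - fst x)) * (indicator {t<..} (fst (snd x)) * ?w x * indicator A x) \<partial>lborel)"
      by (intro nn_integral_end_argM_Mx) simp_all
    finally show "(\<integral>\<^sup>+\<omega>. indicator {t<..} (argM \<omega>) * G (Mx \<omega> - W t \<omega>) * indicator A (W 1 \<omega>, argM \<omega>, Mx \<omega>) \<partial>M)
      = (\<integral>\<^sup>+x. ennreal (argd 1 (fst (snd x)) (snd (snd x)) (snd (snd x) - fst x)) * (indicator {t<..} (fst (snd x)) * ?w x * indicator A x) \<partial>lborel)"
      .
  qed simp_all
qed

end

text \<open>The kernels \<open>\<kappa>\<close> and \<open>\<kappa>c\<close> are compared at almost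
  every triple, so a null set of pairs has to be lifted to a null set of triples.\<close>

lemma AE_lborel_snd:
  fixes P :: "real \<times> real \<Rightarrow> bool"
  assumes "AE x in lborel. P x"
  shows "AE x in (lborel :: (real \<times> real \<times> real) measure). P (snd x)"
proof -
  obtain N where N: "{x \<in> space lborel. \<not> P x} \<subseteq> N" "emeasure lborel N = 0" "N \<in> sets lborel"
    using AE_E[OF assms] .
  have "UNIV \<times> N \<in> null_sets (lborel \<Otimes>\<^sub>M (lborel :: (real \<times> real) measure) :: (real \<times> real \<times> real) measure)"
  proof (rule null_setsI)
    show "UNIV \<times> N \<in> sets (lborel \<Otimes>\<^sub>M (lborel :: (real \<times> real) measure) :: (real \<times> real \<times> real) measure)"
      using N(3) by (intro pair_measureI) simp_all
    show "emeasure (lborel \<Otimes>\<^sub>M (lborel :: (real \<times> real) measure) :: (real \<times> real \<times> real) measure) (UNIV \<times> N) = 0"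
      using N(2,3) by (subst lborel.emeasure_pair_measure_Times) simp_all
  qed
  then show ?thesis
    unfolding lborel_prod by (rule AE_I') (use N(1) in auto)
qed

section \<open>The combined statement\<close>

theorem theorem5p2:
  fixes M :: "'a measure" and B :: "real \<Rightarrow> 'a \<Rightarrow> real"
    and \<kappa> :: "real \<times> real \<Rightarrow> (real \<Rightarrow> real) measure"
    and \<kappa>c :: "real \<times> real \<times> real \<Rightarrow> (real \<Rightarrow> real) measure"
  assumes "std_brownian_motion M B"
    and "regular_cond_distr M borel
           (\<lambda>\<omega>. (first_argmax (sample_path B \<omega>), path_max (sample_path B \<omega>))) path_space (sample_path B) \<kappa>"
    and "regular_cond_distr M borel
           (\<lambda>\<omega>. (B 1 \<omega>, first_argmax (sample_path B \<omega>), path_max (sample_path B \<omega>))) path_space (sample_path B) \<kappa>c"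
  shows
    "(AE (\<theta>, h) in lborel. 0 < \<theta> \<and> \<theta> < 1 \<and> 0 < h \<longrightarrow>
        (\<forall>t\<in>{0..1}. cond_square_integrable \<kappa> (\<theta>, h) t) \<and>
        (\<forall>t\<in>{\<theta><..1}. let s = (t - \<theta>) / (1 - \<theta>) in
           set_integrable lborel {0<..} (\<lambda>x. x * M1 s x * exp (- x\<^sup>2 / 2)) \<and>
           cond_mean \<kappa> (\<theta>, h) t
             = h - sqrt (1 - \<theta>) * (LBINT x:{0<..}. x * M1 s x * exp (- x\<^sup>2 / 2)) \<and>
           cond_mean \<kappa> (\<theta>, h) t = h - sqrt (1 - \<theta>) * G11 s) \<and>
        (\<forall>t\<in>{0..\<theta>}.
           cond_mean \<kappa> (\<theta>, h) t = h - sqrt \<theta> * M1 (1 - t / \<theta>) (h / sqrt \<theta>) \<and>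
           cond_mean \<kappa> (\<theta>, h) t = pre_max_mean \<theta> h t \<and>
           cond_var \<kappa> (\<theta>, h) t = \<theta> * Vr (1 - t / \<theta>) (h / sqrt \<theta>)) \<and>
        (\<forall>t\<in>{\<theta>..1}. let s = (t - \<theta>) / (1 - \<theta>) in
           cond_var \<kappa> (\<theta>, h) t = (1 - \<theta>) * (3 * s - s\<^sup>2) - (1 - \<theta>) * (G11 s)\<^sup>2))
     \<and> (\<exists>g :: real \<Rightarrow> real \<Rightarrow> real. AE (\<theta>, h) in lborel. 0 < \<theta> \<and> \<theta> < 1 \<and> 0 < h \<longrightarrow>
          (\<forall>t\<in>{\<theta>..1}. cond_mean \<kappa> (\<theta>, h) t - h = g \<theta> t))
     \<and> (AE (c, \<theta>, h) in lborel. 0 < \<theta> \<and> \<theta> < 1 \<and> 0 < h \<and> c < h \<longrightarrow>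
          (\<forall>t\<in>{0..\<theta>}.
             cond_square_integrable \<kappa>c (c, \<theta>, h) t \<and>
             cond_mean \<kappa>c (c, \<theta>, h) t = cond_mean \<kappa> (\<theta>, h) t \<and>
             cond_mean \<kappa>c (c, \<theta>, h) t = h - sqrt \<theta> * M1 (1 - t / \<theta>) (h / sqrt \<theta>) \<and>
             cond_mean \<kappa>c (c, \<theta>, h) t = pre_max_mean \<theta> h t \<and>
             cond_var \<kappa>c (c, \<theta>, h) t = cond_var \<kappa> (\<theta>, h) t \<and>
             cond_var \<kappa>c (c, \<theta>, h) t = \<theta> * Vr (1 - t / \<theta>) (h / sqrt \<theta>)))"
proof -
  interpret B: unit_brownian M B
    unfolding unit_brownian_def by (rule std_brownian_motion_brownian[OF assms(1)])
  have eqs: "first_argmax (sample_path B \<omega>) = B.argM \<omega>" "path_max (sample_path B \<omega>) = B.Mx \<omega>" for \<omega>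
    by (simp_all add: first_argmax_sample_path path_max_sample_path B.argM_def B.Mx_def)
  interpret C: conditioned M B "\<lambda>\<omega>. (B.argM \<omega>, B.Mx \<omega>)" \<kappa> "\<lambda>x. argm 1 (fst x) (snd x)" fst snd
    using assms(2) unfolding eqs by (rule B.conditioned_argM_Mx)
  interpret D: conditioned M B "\<lambda>\<omega>. (B 1 \<omega>, B.argM \<omega>, B.Mx \<omega>)" \<kappa>c
    "\<lambda>x. argd 1 (fst (snd x)) (snd (snd x)) (snd (snd x) - fst x)" "\<lambda>x. fst (snd x)" "\<lambda>x. snd (snd x)"
    using assms(3) unfolding eqs by (rule B.conditioned_end_argM_Mx)
  \<comment> \<open>The densities are positive on the whole stated range, so almost everywhere where
    the density is positive covers almost every value in that range.\<close>
  have pos: "0 < argm 1 \<theta> h" if "0 < \<theta>" "\<theta> < 1" "0 < h" for \<theta> h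
    using that by (simp add: argm_def gauss_pos)
  have posc: "0 < argd 1 \<theta> h (h - c)" if "0 < \<theta>" "\<theta> < 1" "0 < h" "c < h" for \<theta> h c
    using that by (simp add: argd_def gauss_pos)
  note before = C.AE_before_max
  have after: "AE x in lborel. 0 < argm 1 (fst x) (snd x) \<longrightarrow>
     (\<forall>t\<in>{fst x..1}. cond_mean \<kappa> x t = snd x - sqrt (1 - fst x) * G11 ((t - fst x) / (1 - fst x)) \<and>
        cond_var \<kappa> x t = (1 - fst x) * (3 * ((t - fst x) / (1 - fst x)) - ((t - fst x) / (1 - fst x))\<^sup>2)
          - (1 - fst x) * (G11 ((t - fst x) / (1 - fst x)))\<^sup>2)"
    by (rule C.AE_after_max, rule B.after_argM_Mx)
  have 1: "AE (\<theta>, h) in lborel. 0 < \<theta> \<and> \<theta> < 1 \<and> 0 < h \<longrightarrow>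
        (\<forall>t\<in>{0..1}. cond_square_integrable \<kappa> (\<theta>, h) t) \<and>
        (\<forall>t\<in>{\<theta><..1}. let s = (t - \<theta>) / (1 - \<theta>) in
           set_integrable lborel {0<..} (\<lambda>x. x * M1 s x * exp (- x\<^sup>2 / 2)) \<and>
           cond_mean \<kappa> (\<theta>, h) t
             = h - sqrt (1 - \<theta>) * (LBINT x:{0<..}. x * M1 s x * exp (- x\<^sup>2 / 2)) \<and>
           cond_mean \<kappa> (\<theta>, h) t = h - sqrt (1 - \<theta>) * G11 s) \<and>
        (\<forall>t\<in>{0..\<theta>}.
           cond_mean \<kappa> (\<theta>, h) t = h - sqrt \<theta> * M1 (1 - t / \<theta>) (h / sqrt \<theta>) \<and>
           cond_mean \<kappa> (\<theta>, h) t = pre_max_mean \<theta> h t \<and>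
           cond_var \<kappa> (\<theta>, h) t = \<theta> * Vr (1 - t / \<theta>) (h / sqrt \<theta>)) \<and>
        (\<forall>t\<in>{\<theta>..1}. let s = (t - \<theta>) / (1 - \<theta>) in
           cond_var \<kappa> (\<theta>, h) t = (1 - \<theta>) * (3 * s - s\<^sup>2) - (1 - \<theta>) * (G11 s)\<^sup>2)"
    using before after
  proof eventually_elim
    case (elim x)
    obtain \<theta> h where x: "x = (\<theta>, h)" by (cases x)
    show ?case
      unfolding x prod.case
    proof
      assume r: "0 < \<theta> \<and> \<theta> < 1 \<and> 0 < h"
      have px: "0 < argm 1 (fst x) (snd x)" unfolding x using pos r by simp
      note b = elim(1)[rule_format, OF px, unfolded x fst_conv snd_conv]
        and a = elim(2)[rule_format, OF px, unfolded x fst_conv snd_conv]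
      have s: "0 < (t - \<theta>) / (1 - \<theta>) \<and> (t - \<theta>) / (1 - \<theta>) \<le> 1" if "t \<in> {\<theta><..1}" for t
        using that r by auto
      show "(\<forall>t\<in>{0..1}. cond_square_integrable \<kappa> (\<theta>, h) t) \<and>
        (\<forall>t\<in>{\<theta><..1}. let s = (t - \<theta>) / (1 - \<theta>) in
           set_integrable lborel {0<..} (\<lambda>x. x * M1 s x * exp (- x\<^sup>2 / 2)) \<and>
           cond_mean \<kappa> (\<theta>, h) t
             = h - sqrt (1 - \<theta>) * (LBINT x:{0<..}. x * M1 s x * exp (- x\<^sup>2 / 2)) \<and>
           cond_mean \<kappa> (\<theta>, h) t = h - sqrt (1 - \<theta>) * G11 s) \<and>
        (\<forall>t\<in>{0..\<theta>}.
           cond_mean \<kappa> (\<theta>, h) t = h - sqrt \<theta> * M1 (1 - t / \<theta>) (h / sqrt \<theta>) \<and>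
           cond_mean \<kappa> (\<theta>, h) t = pre_max_mean \<theta> h t \<and>
           cond_var \<kappa> (\<theta>, h) t = \<theta> * Vr (1 - t / \<theta>) (h / sqrt \<theta>)) \<and>
        (\<forall>t\<in>{\<theta>..1}. let s = (t - \<theta>) / (1 - \<theta>) in
           cond_var \<kappa> (\<theta>, h) t = (1 - \<theta>) * (3 * s - s\<^sup>2) - (1 - \<theta>) * (G11 s)\<^sup>2)"
        unfolding Let_def
      proof (intro conjI ballI)
        show "cond_square_integrable \<kappa> (\<theta>, h) t" if "t \<in> {0..1}" for t using b that by blast
      next
        fix t assume t: "t \<in> {\<theta><..1}"
        then have t': "t \<in> {\<theta>..1}" by simp
        have s: "0 < (t - \<theta>) / (1 - \<theta>)" "(t - \<theta>) / (1 - \<theta>) \<le> 1" using s[OF t] by auto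
        show "set_integrable lborel {0<..} (\<lambda>x. x * M1 ((t - \<theta>) / (1 - \<theta>)) x * exp (- x\<^sup>2 / 2))"
          by (rule set_integral_M1(1)[OF s])
        show m: "cond_mean \<kappa> (\<theta>, h) t = h - sqrt (1 - \<theta>) * G11 ((t - \<theta>) / (1 - \<theta>))"
          using a t' by blast
        show "cond_mean \<kappa> (\<theta>, h) t = h - sqrt (1 - \<theta>) * (LBINT x:{0<..}. x * M1 ((t - \<theta>) / (1 - \<theta>)) x * exp (- x\<^sup>2 / 2))"
          unfolding set_integral_M1(2)[OF s] by (rule m)
      next
        fix t assume t: "t \<in> {0..\<theta>}"
        show m: "cond_mean \<kappa> (\<theta>, h) t = h - sqrt \<theta> * M1 (1 - t / \<theta>) (h / sqrt \<theta>)" using b t by blast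
        show "cond_mean \<kappa> (\<theta>, h) t = pre_max_mean \<theta> h t"
          unfolding m using r t by (intro pre_max_mean_eq_M1) auto
        show "cond_var \<kappa> (\<theta>, h) t = \<theta> * Vr (1 - t / \<theta>) (h / sqrt \<theta>)" using b t by blast
      next
        fix t assume "t \<in> {\<theta>..1}"
        then show "cond_var \<kappa> (\<theta>, h) t = (1 - \<theta>) * (3 * ((t - \<theta>) / (1 - \<theta>)) - ((t - \<theta>) / (1 - \<theta>))\<^sup>2) - (1 - \<theta>) * (G11 ((t - \<theta>) / (1 - \<theta>)))\<^sup>2"
          using a by blast
      qed
    qed
  qed
  have 2: "AE (\<theta>, h) in lborel. 0 < \<theta> \<and> \<theta> < 1 \<and> 0 < h \<longrightarrow>
          (\<forall>t\<in>{\<theta>..1}. cond_mean \<kappa> (\<theta>, h) t - h = - (sqrt (1 - \<theta>) * G11 ((t - \<theta>) / (1 - \<theta>))))"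
    using after
  proof eventually_elim
    case (elim x)
    obtain \<theta> h where x: "x = (\<theta>, h)" by (cases x)
    show ?case
      unfolding x prod.case
    proof (intro impI ballI)
      fix t assume r: "0 < \<theta> \<and> \<theta> < 1 \<and> 0 < h" and t: "t \<in> {\<theta>..1}"
      have px: "0 < argm 1 (fst x) (snd x)" unfolding x using pos r by simp
      from elim[rule_format, OF px, unfolded x fst_conv snd_conv, OF t]
      show "cond_mean \<kappa> (\<theta>, h) t - h = - (sqrt (1 - \<theta>) * G11 ((t - \<theta>) / (1 - \<theta>)))" by simp
    qed
  qed
  have 3: "AE (c, \<theta>, h) in lborel. 0 < \<theta> \<and> \<theta> < 1 \<and> 0 < h \<and> c < h \<longrightarrow>
          (\<forall>t\<in>{0..\<theta>}.
             cond_square_integrable \<kappa>c (c, \<theta>, h) t \<and>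
             cond_mean \<kappa>c (c, \<theta>, h) t = cond_mean \<kappa> (\<theta>, h) t \<and>
             cond_mean \<kappa>c (c, \<theta>, h) t = h - sqrt \<theta> * M1 (1 - t / \<theta>) (h / sqrt \<theta>) \<and>
             cond_mean \<kappa>c (c, \<theta>, h) t = pre_max_mean \<theta> h t \<and>
             cond_var \<kappa>c (c, \<theta>, h) t = cond_var \<kappa> (\<theta>, h) t \<and>
             cond_var \<kappa>c (c, \<theta>, h) t = \<theta> * Vr (1 - t / \<theta>) (h / sqrt \<theta>))"
    \<comment> \<open>Both kernels satisfy the same formulas, whose right sides do not contain
      \<open>c\<close>; equality of the conditional moments follows from this comparison.\<close>
    using D.AE_before_max AE_lborel_snd[OF before]
  proof eventually_elim
    case (elim x)
    obtain c \<theta> h where x: "x = (c, \<theta>, h)" by (metis prod_cases3)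
    show ?case
      unfolding x prod.case
    proof (intro impI ballI)
      fix t assume r: "0 < \<theta> \<and> \<theta> < 1 \<and> 0 < h \<and> c < h" and t: "t \<in> {0..\<theta>}"
      have t1: "t \<in> {0..1}" using t r by auto
      have px: "0 < argd 1 (fst (snd x)) (snd (snd x)) (snd (snd x) - fst x)" unfolding x using posc r by simp
      have py: "0 < argm 1 (fst (snd x)) (snd (snd x))" unfolding x using pos r by simp
      note d = elim(1)[rule_format, OF px, unfolded x fst_conv snd_conv]
        and b = elim(2)[rule_format, OF py, unfolded x fst_conv snd_conv]
      have i: "cond_square_integrable \<kappa>c (c, \<theta>, h) t" using d t1 by blast
      have m: "cond_mean \<kappa>c (c, \<theta>, h) t = h - sqrt \<theta> * M1 (1 - t / \<theta>) (h / sqrt \<theta>)"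
        "cond_var \<kappa>c (c, \<theta>, h) t = \<theta> * Vr (1 - t / \<theta>) (h / sqrt \<theta>)"
        using d t by blast+
      have m': "cond_mean \<kappa> (\<theta>, h) t = h - sqrt \<theta> * M1 (1 - t / \<theta>) (h / sqrt \<theta>)"
        "cond_var \<kappa> (\<theta>, h) t = \<theta> * Vr (1 - t / \<theta>) (h / sqrt \<theta>)"
        using b t by blast+
      have "h - sqrt \<theta> * M1 (1 - t / \<theta>) (h / sqrt \<theta>) = pre_max_mean \<theta> h t"
        using r t by (intro pre_max_mean_eq_M1) auto
      then show "cond_square_integrable \<kappa>c (c, \<theta>, h) t \<and>
             cond_mean \<kappa>c (c, \<theta>, h) t = cond_mean \<kappa> (\<theta>, h) t \<and>
             cond_mean \<kappa>c (c, \<theta>, h) t = h - sqrt \<theta> * M1 (1 - t / \<theta>) (h / sqrt \<theta>) \<and>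
             cond_mean \<kappa>c (c, \<theta>, h) t = pre_max_mean \<theta> h t \<and>
             cond_var \<kappa>c (c, \<theta>, h) t = cond_var \<kappa> (\<theta>, h) t \<and>
             cond_var \<kappa>c (c, \<theta>, h) t = \<theta> * Vr (1 - t / \<theta>) (h / sqrt \<theta>)"
        unfolding m m' using i by simp
    qed
  qed
  show ?thesis
    \<comment> \<open>The function of \<open>\<theta>\<close> and \<open>t\<close> is read off from
      the mean after the maximum; at \<open>t = \<theta>\<close> it is 0.\<close>
    using 1 2 3 by (intro conjI exI[of _ "\<lambda>\<theta> t. - (sqrt (1 - \<theta>) * G11 ((t - \<theta>) / (1 - \<theta>)))"])
qed

end
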